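(* Let $n\ge 1$, let $\kappa_0,\kappa_1>0$, and for $i=0,1$ let $\mu_i$ be a $\kappa_i$-strongly log-concave probability measure on $\mathbb{R}^n$ (its potential may take the value $+\infty$). Let $(\mu_t)_{t\in[0,1]}$ be the constant-speed quadratic Wasserstein geodesic from $\mu_0$ to $\mu_1$. Then for every $t\in[0,1]$, $$\operatorname{Var}_{\mu_t}(f)\le\left(\frac{1-t}{\sqrt{\kappa_0}}+\frac{t}{\sqrt{\kappa_1}}\right)^2\int|\nabla f|^2\,\mathrm d\mu_t\qquad\text{for every } f\in C_c^\infty(\mathbb{R}^n).$$ Equivalently, $\sqrt{C_P(\mu_t)}\le \frac{1-t}{\sqrt{\kappa_0}}+\frac{t}{\sqrt{\kappa_1}}$.
   Context: A probability measure $\mu$ on $\mathbb{R}^n$ is $\kappa$-strongly log-concave ($\kappa>0$) if $\mathrm d\mu=e^{-V}\,\mathrm dx$ with $V:\mathbb{R}^n\to(-\infty,+\infty]$ proper and lower semicontinuous and $V-\kappa|x|^2/2$ convex ($V$ may take the value $+\infty$; the normalizing constant is absorbed in $V$). $\operatorname{Var}_\mu(f)=\int|f-\int f\,\mathrm d\mu|^2\,\mathrm d\mu$. The Poincaré constant $C_P(\mu)$ is the least $C\in[0,\infty]$ such that $\operatorname{Var}_\mu(f)\le C\int|\nabla f|^2\,\mathrm d\mu$ for every $f\in C_c^\infty(\mathbb{R}^n)$. Geodesic: let $T$ be the Brenier map, i.e. the ($\mu_0$-a.e. unique) optimal transport map from $\mu_0$ to $\mu_1$ for the quadratic cost $|x-y|^2$.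 The constant-speed quadratic Wasserstein geodesic is $\mu_t=(F_t)_\#\mu_0$ with $F_t=(1-t)I+tT$, $t\in[0,1]$, where $I$ is the identity map. *)

theory Defs
  imports "HOL-Probability.Probability"
begin

section \<open>Strongly log-concave measures\<close>

definition lower_semicontinuous :: "('a::topological_space \<Rightarrow> ereal) \<Rightarrow> bool" where
  "lower_semicontinuous V \<longleftrightarrow> (\<forall>x. V x \<le> Liminf (at x) V)"

definition proper_ereal_fun :: "('a \<Rightarrow> ereal) \<Rightarrow> bool" where
  "proper_ereal_fun V \<longleftrightarrow> (\<forall>x. V x \<noteq> -\<infinity>) \<and> (\<exists>x. V x \<noteq> \<infinity>)"

text \<open>Meant for functions with values in \<open>(-\<infinity>, \<infinity>]\<close>, so that the right-hand side
  never contains \<open>\<infinity> + (-\<infinity>)\<close>.\<close>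

definition convex_ereal_fun :: "('a::real_vector \<Rightarrow> ereal) \<Rightarrow> bool" where
  "convex_ereal_fun W \<longleftrightarrow>
     (\<forall>x y. \<forall>u>0. \<forall>v>0. u + v = 1 \<longrightarrow>
        W (u *\<^sub>R x + v *\<^sub>R y) \<le> ereal u * W x + ereal v * W y)"

definition exp_minus :: "ereal \<Rightarrow> ennreal" where
  "exp_minus v = (case v of ereal r \<Rightarrow> ennreal (exp (- r)) | PInfty \<Rightarrow> 0 | MInfty \<Rightarrow> \<infinity>)"

definition strongly_log_concave :: "real \<Rightarrow> 'a::euclidean_space measure \<Rightarrow> bool" where
  "strongly_log_concave \<kappa> \<mu> \<longleftrightarrow>
     \<kappa> > 0 \<and> prob_space \<mu> \<and>
     (\<exists>V. proper_ereal_fun V \<and> lower_semicontinuous V \<and>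
          convex_ereal_fun (\<lambda>x. V x - ereal (\<kappa> * (norm x)\<^sup>2 / 2)) \<and>
          \<mu> = density lborel (\<lambda>x. exp_minus (V x)))"

section \<open>Test functions, variance and the Poincare constant\<close>

text \<open>\<open>Ck k f\<close>: \<open>f\<close> is \<open>k\<close> times continuously differentiable; smooth functions are those
  that are \<open>Ck k\<close> for all \<open>k\<close>.\<close>

fun Ck :: "nat \<Rightarrow> ('a::euclidean_space \<Rightarrow> real) \<Rightarrow> bool" where
  "Ck 0 f \<longleftrightarrow> continuous_on UNIV f"
| "Ck (Suc k) f \<longleftrightarrow>
     (\<forall>x. f differentiable (at x)) \<and>
     (\<forall>b\<in>Basis. Ck k (\<lambda>x. frechet_derivative f (at x) b))"

definition test_functions :: "('a::euclidean_space \<Rightarrow> real) set" where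
  "test_functions = {f. (\<forall>k. Ck k f) \<and> compact (closure {x. f x \<noteq> 0})}"

definition grad :: "('a::euclidean_space \<Rightarrow> real) \<Rightarrow> 'a \<Rightarrow> 'a" where
  "grad f x = (THE D. GDERIV f x :> D)"

lemma grad_eq: "GDERIV f x :> D \<Longrightarrow> grad f x = D"
  unfolding grad_def gderiv_def
  by (rule the_equality) (auto dest: has_derivative_unique simp: fun_eq_iff vector_eq_ldot)

definition poincare_const :: "'a::euclidean_space measure \<Rightarrow> ennreal" where
  "poincare_const \<mu> =
     Inf {C. \<forall>f\<in>test_functions.
            ennreal (prob_space.variance \<mu> f)
              \<le> C * ennreal (\<integral>x. (norm (grad f x))\<^sup>2 \<partial>\<mu>)}"

text \<open>The infimum is attained, i.e. it is the least constant, as soon as it is finite. If it is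
  infinite, the inequality need not hold with \<open>C = \<infinity>\<close>, because \<open>\<infinity> * 0 = 0\<close> in
  \<^typ>\<open>ennreal\<close>.\<close>

lemma poincare_const_attained:
  assumes "poincare_const \<mu> < \<infinity>" and "f \<in> test_functions"
  shows "ennreal (prob_space.variance \<mu> f)
           \<le> poincare_const \<mu> * ennreal (\<integral>x. (norm (grad f x))\<^sup>2 \<partial>\<mu>)"
proof -
  define S where "S = {C. \<forall>f\<in>test_functions. ennreal (prob_space.variance \<mu> f)
    \<le> C * ennreal (\<integral>x. (norm (grad f x))\<^sup>2 \<partial>\<mu>)}"
  define v e where "v = ennreal (prob_space.variance \<mu> f)"
    and "e = ennreal (\<integral>x. (norm (grad f x))\<^sup>2 \<partial>\<mu>)"
  have S: "v \<le> C * e" if "C \<in> S" for C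
    using that assms(2) by (auto simp: S_def v_def e_def)
  have P: "poincare_const \<mu> = Inf S"
    by (simp add: poincare_const_def S_def)
  then obtain C0 where C0: "C0 \<in> S"
    using assms(1) by (auto simp: Inf_less_iff)
  have "v \<le> Inf S * e"
  proof (cases "e = 0")
    case True
    then show ?thesis using S[OF C0] by simp
  next
    case False
    then have "v / e \<le> Inf S"
      using S by (intro Inf_greatest divide_le_posI_ennreal) (auto simp: zero_less_iff_neq_zero mult.commute)
    then have "v / e * e \<le> Inf S * e"
      by (rule mult_right_mono) simp
    moreover have "v / e * e = v"
      using False by (simp add: ennreal_divide_times ennreal_mult_divide_eq e_def)
    ultimately show ?thesis by simp
  qed
  then show ?thesis by (simp add: P v_def e_def)
qed

section \<open>Optimal transport for the quadratic cost\<close>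

definition couplings :: "'a::euclidean_space measure \<Rightarrow> 'a measure \<Rightarrow> ('a \<times> 'a) measure set" where
  "couplings \<mu> \<nu> = {\<pi>. sets \<pi> = sets (borel \<Otimes>\<^sub>M borel) \<and> distr \<pi> borel fst = \<mu> \<and> distr \<pi> borel snd = \<nu>}"

text \<open>The square of the quadratic Wasserstein distance.\<close>

definition W2_squared :: "'a::euclidean_space measure \<Rightarrow> 'a measure \<Rightarrow> ennreal" where
  "W2_squared \<mu> \<nu> = (INF \<pi>\<in>couplings \<mu> \<nu>. \<integral>\<^sup>+(x, y). ennreal ((norm (x - y))\<^sup>2) \<partial>\<pi>)"

definition optimal_transport_map ::
    "'a::euclidean_space measure \<Rightarrow> 'a measure \<Rightarrow> ('a \<Rightarrow> 'a) \<Rightarrow> bool" where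
  "optimal_transport_map \<mu> \<nu> T \<longleftrightarrow>
     T \<in> borel \<rightarrow>\<^sub>M borel \<and> distr \<mu> borel T = \<nu> \<and>
     (\<integral>\<^sup>+x. ennreal ((norm (x - T x))\<^sup>2) \<partial>\<mu>) = W2_squared \<mu> \<nu>"

text \<open>The optimal map is only unique up to null sets, which does not affect the push-forward.\<close>

definition wasserstein_geodesic ::
    "'a::euclidean_space measure \<Rightarrow> 'a measure \<Rightarrow> (real \<Rightarrow> 'a measure) \<Rightarrow> bool" where
  "wasserstein_geodesic \<mu>0 \<mu>1 \<mu> \<longleftrightarrow>
     (\<exists>T. optimal_transport_map \<mu>0 \<mu>1 T \<and>
          (\<forall>t\<in>{0..1}. \<mu> t = distr \<mu>0 borel (\<lambda>x. (1 - t) *\<^sub>R x + t *\<^sub>R T x)))"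

end

theory Submission
  imports Defs "HOL-Library.Diagonal_Subsequence"
begin

text \<open>
  The optimal maps are obtained by minimising the dual Kantorovich functional, and no regularity
  of them is used. Let \<open>T\<close> be the optimal map from \<open>\<mu>0\<close> to \<open>\<mu>1\<close>, and
  perturb the optimal coupling by the density \<open>1 + \<epsilon> g\<close>, where \<open>g\<close> is the centred test function
  evaluated at the interpolated point; this perturbs the marginals to \<open>\<nu>0\<close> and \<open>\<nu>1\<close>. The variance is the
  rate at which the mean of the test function changes, and this change is split by passing through
  the optimal maps \<open>\<mu>0 \<rightarrow> \<nu>1\<close> and \<open>\<nu>1 \<rightarrow> \<mu>0\<close>, so that only one marginal moves at a time.
  Each displacement is controlled by a Talagrand inequality for two optimal maps with the same source
  \<open>\<sigma>\<close>: if \<open>\<mu>\<close> is \<open>\<kappa>\<close>-strongly log-concave, then \<open>\<kappa>/2 \<integral>|T1 - T0|\<^sup>2 d\<sigma>\<close> is at most the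
  entropy of \<open>\<nu>\<close> relative to \<open>\<mu>\<close>, where \<open>T0\<close> and \<open>T1\<close> transport \<open>\<sigma>\<close> to \<open>\<mu>\<close> and \<open>\<nu>\<close>. It is proved for
  discrete sources, where the Prekopa-Leindler inequality makes the exponential integrals over
  Laguerre cells log-concave in the weights, and passes to the limit because a convex function
  has almost everywhere only one subgradient.\<close>

section \<open>Prekopa-Leindler inequality\<close>

text \<open>Differentiating the optimal map along a path of marginals would require regularity
  theory for the Monge-Ampere equation. Two optimal maps with a common source can instead be
  compared through their difference alone. Reweighting the coupling keeps it optimal for its new
  marginals, and these have the same relative entropy, at most \<epsilon>^2 var / 2 to leading
  order. The entropy inequality then gives displacements of L2 norm at most \<epsilon> sqrt (var /
  \<kappa>1) at the target end and \<epsilon> sqrt (var / \<kappa>0) at the source end, and the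
  interpolated point moves by t, respectively 1 - t, times these. Cauchy-Schwarz against the
  gradient gives, to leading order, \<epsilon> var <= \<epsilon> ((1 - t) / sqrt \<kappa>0 + t /
  sqrt \<kappa>1) sqrt var |grad f|, and dividing by \<epsilon> sqrt var leaves the square root of
  the claim. So the leading coefficients in the entropy expansion and in the transport inequality
  have to be exact, while the Taylor remainder of the test function may be crude.\<close>

lemma emeasure_lborel_le_length:
  fixes I :: "real set"
  assumes "I \<in> sets borel" "\<And>z. z \<in> I \<Longrightarrow> a \<le> z \<and> z \<le> b" "a \<le> b"
  shows "emeasure lborel I \<le> ennreal (b - a)"
proof -
  have "emeasure lborel I \<le> emeasure lborel {a..b}"
    using assms by (intro emeasure_mono) auto
  then show ?thesis using assms by simp
qed

lemma emeasure_lborel_translate: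
  fixes A :: "'a::euclidean_space set"
  assumes "A \<in> sets borel"
  shows "emeasure lborel ((\<lambda>x. c + x) ` A) = emeasure lborel A" "(\<lambda>x. c + x) ` A \<in> sets borel"
proof -
  have im: "(\<lambda>x. c + x) ` A = (\<lambda>x. - c + x) -` A"
    by (auto simp: image_iff) (metis add.commute add_uminus_conv_diff diff_add_cancel)
  have m: "(\<lambda>x. - c + x) -` A \<inter> space borel \<in> sets borel"
    using assms by (intro measurable_sets[of _ borel borel]) auto
  then show "(\<lambda>x. c + x) ` A \<in> sets borel" using im by simp
  have "emeasure lborel A = emeasure (distr lborel borel ((+) (-c))) A"
    by (simp add: lborel_distr_plus)
  also have "\<dots> = emeasure lborel ((\<lambda>x. - c + x) -` A)"
    using assms by (subst emeasure_distr) auto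
  finally show "emeasure lborel ((\<lambda>x. c + x) ` A) = emeasure lborel A" using im by simp
qed

text \<open>Take \<open>a\<close> in \<open>A\<close> within e/2 of its supremum and
  \<open>b\<close> in \<open>B\<close> within e/2 of its infimum. The translates of \<open>A\<close>
  by \<open>b\<close> and of \<open>B\<close> by \<open>a\<close> both lie in \<open>C\<close>, and
  they can meet only within distance e/2 of \<open>a + b\<close>, so the overlap counted twice has
  length at most e.\<close>

lemma brunn_minkowski_real_bounded:
  fixes A B C :: "real set"
  assumes [measurable]: "A \<in> sets borel" "B \<in> sets borel" "C \<in> sets borel"
    and ne: "A \<noteq> {}" "B \<noteq> {}" and bd: "bdd_above A" "bdd_below B"
    and sub: "\<And>a b. a \<in> A \<Longrightarrow> b \<in> B \<Longrightarrow> a + b \<in> C"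
  shows "emeasure lborel A + emeasure lborel B \<le> emeasure lborel C"
proof (rule ennreal_le_epsilon)
  fix e :: real assume e: "0 < e"
  obtain a where a: "a \<in> A" "a > Sup A - e/2"
    by (rule less_cSupE[of "Sup A - e/2" A]) (use e ne in auto)
  have "Inf B < Inf B + e/2" using e by simp
  then obtain b where b: "b \<in> B" "b < Inf B + e/2"
    using cInf_lessD[OF ne(2)] by blast
  let ?A = "(\<lambda>x. b + x) ` A" and ?B = "(\<lambda>x. a + x) ` B"
  note [measurable] = emeasure_lborel_translate(2)[OF assms(1), of b] emeasure_lborel_translate(2)[OF assms(2), of a]
  have "emeasure lborel A + emeasure lborel B = emeasure lborel ?A + emeasure lborel ?B"
    by (simp add: emeasure_lborel_translate)
  also have "\<dots> = emeasure lborel (?A \<union> ?B) + emeasure lborel (?A \<inter> ?B)"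
    by (rule emeasure_Un_Int) auto
  also have "emeasure lborel (?A \<union> ?B) \<le> emeasure lborel C"
    using sub a b by (intro emeasure_mono) (auto, metis add.commute)
  also have "emeasure lborel (?A \<inter> ?B) \<le> ennreal ((a + b + e/2) - (a + b - e/2))"
  proof (rule emeasure_lborel_le_length)
    fix z assume "z \<in> ?A \<inter> ?B"
    then obtain x y where x: "x \<in> A" "z = b + x" and y: "y \<in> B" "z = a + y" by auto
    have "x \<le> Sup A" "Inf B \<le> y" using x y bd by (auto intro: cSup_upper cInf_lower)
    then show "a + b - e/2 \<le> z \<and> z \<le> a + b + e/2" using x y a b by auto
  qed (use e in auto)
  finally show "emeasure lborel A + emeasure lborel B \<le> emeasure lborel C + ennreal e"
    by (simp add: add_mono)
qed

text \<open>Exhaustion by bounded intervals. Only large n count: both truncated sets have to be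
  nonempty, which the points \<open>a0\<close> and \<open>b0\<close> guarantee for n >= N.\<close>

lemma brunn_minkowski_real:
  fixes A B C :: "real set"
  assumes [measurable]: "A \<in> sets borel" "B \<in> sets borel" "C \<in> sets borel"
    and ne: "A \<noteq> {}" "B \<noteq> {}"
    and sub: "\<And>a b. a \<in> A \<Longrightarrow> b \<in> B \<Longrightarrow> a + b \<in> C"
  shows "emeasure lborel A + emeasure lborel B \<le> emeasure lborel C"
proof -
  obtain a0 b0 where ab: "a0 \<in> A" "b0 \<in> B" using ne by auto
  let ?A = "\<lambda>n. A \<inter> {-real n..real n}" and ?B = "\<lambda>n. B \<inter> {-real n..real n}"
  have un: "(\<Union>n. A \<inter> {-real n..real n}) = A" for A :: "real set"
  proof -
    have "\<exists>n. x \<in> {-real n..real n}" for x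
    proof -
      obtain n where "\<bar>x\<bar> \<le> real n" using real_arch_simple by blast
      then show ?thesis by (intro exI[of _ n]) auto
    qed
    then show ?thesis by blast
  qed
  have lim: "(\<lambda>n. emeasure lborel (A \<inter> {-real n..real n})) \<longlonglongrightarrow> emeasure lborel A"
    if "A \<in> sets borel" for A :: "real set"
  proof -
    have "(\<lambda>n. emeasure lborel (A \<inter> {-real n..real n})) \<longlonglongrightarrow> emeasure lborel (\<Union>n. A \<inter> {-real n..real n})"
      using that by (intro Lim_emeasure_incseq) (auto simp: incseq_def)
    then show ?thesis unfolding un .
  qed
  have "(\<lambda>n. emeasure lborel (?A n) + emeasure lborel (?B n)) \<longlonglongrightarrow> emeasure lborel A + emeasure lborel B"
    by (intro tendsto_add lim) auto
  moreover have "\<forall>\<^sub>F n in sequentially. emeasure lborel (?A n) + emeasure lborel (?B n) \<le> emeasure lborel C"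
  proof -
    obtain N where N: "\<bar>a0\<bar> + \<bar>b0\<bar> \<le> real N" using real_arch_simple by blast
    have "emeasure lborel (?A n) + emeasure lborel (?B n) \<le> emeasure lborel C" if "n \<ge> N" for n
    proof (rule brunn_minkowski_real_bounded)
      have "real N \<le> real n" using that by simp
      then have "a0 \<in> ?A n" "b0 \<in> ?B n" using ab N by auto
      then show "?A n \<noteq> {}" "?B n \<noteq> {}" by blast+
      show "bdd_above (?A n)" "bdd_below (?B n)" by (auto intro!: bdd_aboveI[of _ "real n"] bdd_belowI[of _ "- real n"])
    qed (use sub in auto)
    then show ?thesis by (auto simp: eventually_sequentially)
  qed
  ultimately show ?thesis by (rule tendsto_upperbound) simp
qed

text \<open>Tonelli for the region under the graph: \<open>f x\<close> is the length of the set of t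
  >= 0 below it, also when \<open>f x\<close> is infinite.\<close>

lemma nn_integral_layer_cake:
  fixes f :: "'a \<Rightarrow> ennreal"
  assumes [measurable]: "f \<in> borel_measurable M" and "sigma_finite_measure M"
  shows "(\<integral>\<^sup>+x. f x \<partial>M) = (\<integral>\<^sup>+t. emeasure M {x\<in>space M. ennreal t < f x} * indicator {0..} t \<partial>lborel)"
proof -
  interpret sigma_finite_measure M by fact
  interpret P: pair_sigma_finite M lborel ..
  have f: "f x = (\<integral>\<^sup>+t. indicator {t. 0 \<le> t \<and> ennreal t < f x} t \<partial>lborel)" for x
  proof (cases "f x")
    case (real r)
    then have "{t. 0 \<le> t \<and> ennreal t < f x} = {0..<r}"
      by (auto simp: ennreal_less_iff)
    then show ?thesis using real by (simp add: nn_integral_indicator)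
  next
    case top
    then have "{t. 0 \<le> t \<and> ennreal t < f x} = {0..}" by auto
    moreover have "emeasure lborel {0::real..} = \<infinity>"
    proof -
      have "ennreal (real n) \<le> emeasure lborel {0::real..}" for n
      proof -
        have "emeasure lborel {0..real n} \<le> emeasure lborel {0::real..}" by (intro emeasure_mono) auto
        then show ?thesis by simp
      qed
      moreover have "\<exists>n. r < ennreal (real n)" if "r \<noteq> top" for r
        using that ennreal_Ex_less_of_nat[of r] by (auto simp: less_top ennreal_of_nat_eq_real_of_nat)
      ultimately show ?thesis
        by (metis infinity_ennreal_def leD)
    qed
    ultimately show ?thesis using top by (simp add: nn_integral_indicator)
  qed
  have "(\<integral>\<^sup>+x. f x \<partial>M) = (\<integral>\<^sup>+x. (\<integral>\<^sup>+t. indicator {t. 0 \<le> t \<and> ennreal t < f x} t \<partial>lborel) \<partial>M)"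
    using f by simp
  also have "\<dots> = (\<integral>\<^sup>+t. (\<integral>\<^sup>+x. indicator {t. 0 \<le> t \<and> ennreal t < f x} t \<partial>M) \<partial>lborel)"
    by (rule P.Fubini'[symmetric]) measurable
  also have "\<dots> = (\<integral>\<^sup>+t. emeasure M {x\<in>space M. ennreal t < f x} * indicator {0..} t \<partial>lborel)"
  proof (rule nn_integral_cong)
    fix t :: real
    have "(\<integral>\<^sup>+x. indicator {t. 0 \<le> t \<and> ennreal t < f x} t \<partial>M)
       = (\<integral>\<^sup>+x. indicator {x\<in>space M. ennreal t < f x} x * indicator {0..} t \<partial>M)"
      by (intro nn_integral_cong) (auto split: split_indicator)
    also have "\<dots> = emeasure M {x\<in>space M. ennreal t < f x} * indicator {0..} t"
      by (subst nn_integral_multc) (auto simp: nn_integral_indicator)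
    finally show "(\<integral>\<^sup>+x. indicator {t. 0 \<le> t \<and> ennreal t < f x} t \<partial>M) = emeasure M {x\<in>space M. ennreal t < f x} * indicator {0..} t" .
  qed
  finally show ?thesis .
qed


text \<open>The arithmetic-geometric mean inequality. It turns the additive estimate for level sets
  into the multiplicative one for integrals.\<close>

lemma ennreal_mult_le_mean_square:
  fixes p q k :: ennreal
  assumes "p + q \<le> 2 * k"
  shows "p * q \<le> k\<^sup>2"
proof (cases "k = top")
  case True
  then show ?thesis by (simp add: power2_eq_square ennreal_top_mult)
next
  case False
  then obtain k' where k: "k = ennreal k'" "k' \<ge> 0" by (cases k) auto
  have "p + q \<noteq> top"
    using assms k by (metis ennreal_mult_eq_top_iff ennreal_neq_top ennreal_numeral neq_top_trans)
  then obtain p' q' where pq: "p = ennreal p'" "p' \<ge> 0" "q = ennreal q'" "q' \<ge> 0"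
    by (cases p; cases q) auto
  have "ennreal (p' + q') \<le> ennreal (2 * k')"
    using assms pq k by (simp add: ennreal_mult)
  then have le: "p' + q' \<le> 2 * k'" using k by (subst (asm) ennreal_le_iff) auto
  have "0 \<le> (p' - q')\<^sup>2" by simp
  moreover have "(p' + q')\<^sup>2 \<le> (2 * k')\<^sup>2" using le pq by (intro power_mono) auto
  ultimately have "p' * q' \<le> k'\<^sup>2" by (simp add: power2_eq_square algebra_simps)
  then show ?thesis using pq k by (simp add: ennreal_mult[symmetric] ennreal_power)
qed

lemma ennreal_mult_less_mono:
  fixes a b x y :: ennreal
  assumes "a < x" "b < y"
  shows "a * b < x * y"
proof (cases "a = 0")
  case True
  then show ?thesis using assms by (simp add: ennreal_zero_less_mult_iff)
     (metis gr_zeroI not_less_zero)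
next
  case False
  then have "a * b < a * y"
    using assms by (intro ennreal_mult_strict_left_mono) (auto simp: zero_less_iff_neq_zero less_top[symmetric])
  also have "\<dots> \<le> x * y" using assms by (intro mult_right_mono) auto
  finally show ?thesis .
qed

text \<open>Dividing f and g by their suprema F and G makes both superlevel sets nonempty for every
  t < 1, as Brunn-Minkowski demands; boundedness keeps F and G finite. The midpoints of these two
  sets lie in the superlevel set of \<open>h / sqrt (F * G)\<close>, and integrating over t gives
  the inequality.\<close>

lemma prekopa_leindler_real_bounded:
  fixes f g h :: "real \<Rightarrow> ennreal"
  assumes [measurable]: "f \<in> borel_measurable borel" "g \<in> borel_measurable borel" "h \<in> borel_measurable borel"
    and le: "\<And>x y. f x * g y \<le> (h ((x + y) / 2))\<^sup>2"
    and bd: "\<And>x. f x \<le> ennreal K" "\<And>x. g x \<le> ennreal K"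
  shows "(\<integral>\<^sup>+x. f x \<partial>lborel) * (\<integral>\<^sup>+x. g x \<partial>lborel) \<le> (\<integral>\<^sup>+x. h x \<partial>lborel)\<^sup>2"
proof -
  define F where "F = (SUP x. f x)"
  define G where "G = (SUP x. g x)"
  have "F \<le> ennreal K" "G \<le> ennreal K" unfolding F_def G_def using bd by (auto intro: SUP_least)
  then have fin: "F \<noteq> top" "G \<noteq> top" using ennreal_neq_top neq_top_trans by blast+
  have fF: "f x \<le> F" "g x \<le> G" for x unfolding F_def G_def by (auto intro: SUP_upper)
  show ?thesis
  proof (cases "F = 0 \<or> G = 0")
    case True
    then have "(\<forall>x. f x = 0) \<or> (\<forall>x. g x = 0)" using fF by (metis le_zero_eq)
    then show ?thesis by auto
  next
    case False
    obtain F' where F': "F = ennreal F'" "F' > 0"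
      using False fin by (cases F) (auto simp: ennreal_eq_0_iff not_le)
    obtain G' where G': "G = ennreal G'" "G' > 0"
      using False fin by (cases G) (auto simp: ennreal_eq_0_iff not_le)
    define s where "s = sqrt (F' * G')"
    have s: "s > 0" "s * s = F' * G'" using F' G' by (auto simp: s_def)
    have lvl: "emeasure lborel {x. ennreal t < f x / F} + emeasure lborel {x. ennreal t < g x / G}
        \<le> 2 * emeasure lborel {x. ennreal t < h x / ennreal s}" if "0 \<le> t" for t
    proof (cases "t < 1")
      case False
      have "f x / F \<le> 1" "g x / G \<le> 1" for x
        using fF[of x] F' G' by (auto intro!: divide_le_posI_ennreal)
      then have "{x. ennreal t < f x / F} = {}" "{x. ennreal t < g x / G} = {}"
        using False by (auto simp: not_less intro: order_trans[of _ 1])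
      then show ?thesis by simp
    next
      case True
      let ?A = "{x. ennreal t < f x / F}" and ?B = "{x. ennreal t < g x / G}"
      let ?C = "{x. ennreal t < h x / ennreal s}"
      have lessdiv: "ennreal t < a / ennreal r \<longleftrightarrow> ennreal (t * r) < a" if "r > 0" for a r
      proof (cases a)
        case (real a')
        then show ?thesis using that \<open>0 \<le> t\<close>
          by (simp add: divide_ennreal ennreal_less_iff pos_less_divide_eq)
      next
        case top
        then show ?thesis using that by (simp add: ennreal_top_divide)
      qed
      have "ennreal (t * F') < F" "ennreal (t * G') < G"
        using F' G' True \<open>0 \<le> t\<close> by (auto simp: ennreal_less_iff)
      then obtain x0 y0 where "ennreal (t * F') < f x0" "ennreal (t * G') < g y0"
        unfolding F_def G_def less_SUP_iff by auto
      then have ne: "?A \<noteq> {}" "?B \<noteq> {}" using F' G' lessdiv by auto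
      \<comment> \<open>The hypothesis evaluates h at midpoints, so the sum of the two sets lands in
        the dilate of \<open>?C\<close> by 2, whose measure is twice that of
        \<open>?C\<close>.\<close>
      have sub: "x + y \<in> (\<lambda>z. z / 2) -` ?C" if "x \<in> ?A" "y \<in> ?B" for x y
      proof -
        have fx: "ennreal (t * F') < f x" "ennreal (t * G') < g y"
          using that F' G' lessdiv by auto
        have "(ennreal (t * s))\<^sup>2 = ennreal ((t * s) * (t * s))"
          using s \<open>0 \<le> t\<close> by (simp add: ennreal_power power2_eq_square ennreal_mult)
        also have "(t * s) * (t * s) = (t * F') * (t * G')"
          using s(2) by (simp add: algebra_simps)
        also have "ennreal \<dots> = ennreal (t * F') * ennreal (t * G')"
          using F' G' \<open>0 \<le> t\<close> by (simp add: ennreal_mult)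
        also have "\<dots> < f x * g y"
          using fx by (rule ennreal_mult_less_mono)
        also have "\<dots> \<le> (h ((x + y) / 2))\<^sup>2" by (rule le)
        finally have "ennreal (t * s) < h ((x + y) / 2)"
          by (meson not_less power_mono zero_le)
        then show ?thesis using s lessdiv by simp
      qed
      have "emeasure lborel ?A + emeasure lborel ?B \<le> emeasure lborel ((\<lambda>z. z / 2) -` ?C)"
      proof (rule brunn_minkowski_real)
        have "(\<lambda>z. z / 2) -` ?C = {z. ennreal t < h (z / 2) / ennreal s}" by auto
        also have "\<dots> \<in> sets borel" by measurable
        finally show "(\<lambda>z. z / 2) -` ?C \<in> sets borel" .
      qed (use ne sub in auto)
      also have "\<dots> = 2 * emeasure lborel ?C"
      proof -
        have "emeasure lborel ((\<lambda>z. z / 2) -` ?C) = emeasure (distr lborel borel (\<lambda>z::real. (1/2) * z)) ?C"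
          by (subst emeasure_distr) (auto simp: vimage_def)
        also have "distr lborel borel (\<lambda>z::real. (1/2) * z) = density lborel (\<lambda>_. ennreal 2)"
          by (subst lborel_distr_mult) auto
        also have "emeasure \<dots> ?C = 2 * emeasure lborel ?C"
          by (subst emeasure_density) (auto simp: nn_integral_cmult)
        finally show ?thesis .
      qed
      finally show ?thesis .
    qed
    have sf: "sigma_finite_measure (lborel :: real measure)" ..
    define p q k where "p = (\<integral>\<^sup>+x. f x \<partial>lborel) / F" and "q = (\<integral>\<^sup>+x. g x \<partial>lborel) / G"
      and "k = (\<integral>\<^sup>+x. h x \<partial>lborel) / ennreal s"
    have "p + q = (\<integral>\<^sup>+t. emeasure lborel {x. ennreal t < f x / F} * indicator {0..} t \<partial>lborel)
      + (\<integral>\<^sup>+t. emeasure lborel {x. ennreal t < g x / G} * indicator {0..} t \<partial>lborel)"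
      unfolding p_def q_def
      by (subst (1 2) nn_integral_divide[symmetric], simp, simp)
         (subst (1 2) nn_integral_layer_cake[OF _ sf], auto)
    also have "\<dots> = (\<integral>\<^sup>+t. emeasure lborel {x. ennreal t < f x / F} * indicator {0..} t
        + emeasure lborel {x. ennreal t < g x / G} * indicator {0..} t \<partial>lborel)"
      by (rule nn_integral_add[symmetric]) measurable
    also have "\<dots> \<le> (\<integral>\<^sup>+t. 2 * (emeasure lborel {x. ennreal t < h x / ennreal s} * indicator {0..} t) \<partial>lborel)"
      by (intro nn_integral_mono) (use lvl in \<open>auto split: split_indicator\<close>)
    also have "\<dots> = 2 * (\<integral>\<^sup>+t. emeasure lborel {x. ennreal t < h x / ennreal s} * indicator {0..} t \<partial>lborel)"
      by (rule nn_integral_cmult) measurable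
    also have "(\<integral>\<^sup>+t. emeasure lborel {x. ennreal t < h x / ennreal s} * indicator {0..} t \<partial>lborel) = k"
      unfolding k_def
      by (subst nn_integral_divide[symmetric], simp)
         (subst nn_integral_layer_cake[OF _ sf], auto)
    finally have "p * q \<le> k\<^sup>2" by (rule ennreal_mult_le_mean_square)
    then have "(F * G) * (p * q) \<le> (F * G) * k\<^sup>2" by (rule mult_left_mono) simp
    moreover have "F * p = (\<integral>\<^sup>+x. f x \<partial>lborel)" "G * q = (\<integral>\<^sup>+x. g x \<partial>lborel)"
      "ennreal s * k = (\<integral>\<^sup>+x. h x \<partial>lborel)"
      unfolding p_def q_def k_def using False fin s
      by (auto simp: ennreal_times_divide mult_divide_eq_ennreal mult.commute[of F] mult.commute[of G] mult.commute[of "ennreal s"])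
    moreover have "F * G = (ennreal s)\<^sup>2"
      using F' G' s by (simp add: power2_eq_square ennreal_mult[symmetric])
    moreover have "(F * G) * (p * q) = (F * p) * (G * q)" by (simp add: mult_ac)
    moreover have "(ennreal s)\<^sup>2 * k\<^sup>2 = (ennreal s * k)\<^sup>2" by (simp add: power_mult_distrib)
    ultimately show ?thesis by simp
  qed
qed

lemma nn_integral_min_SUP:
  fixes f :: "'a \<Rightarrow> ennreal"
  assumes [measurable]: "f \<in> borel_measurable M"
  shows "(\<integral>\<^sup>+x. f x \<partial>M) = (SUP n. \<integral>\<^sup>+x. min (f x) (of_nat n) \<partial>M)"
proof -
  have "(SUP n. min (f x) (of_nat n)) = f x" for x
  proof -
    have "(SUP n. inf (f x) (of_nat n)) = inf (f x) (SUP n. of_nat n)"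
      by (rule inf_SUP[symmetric])
    then show ?thesis by (simp add: ennreal_SUP_of_nat_eq_top inf_min)
  qed
  then have "(\<integral>\<^sup>+x. f x \<partial>M) = (\<integral>\<^sup>+x. (SUP n. min (f x) (of_nat n)) \<partial>M)" by simp
  also have "\<dots> = (SUP n. \<integral>\<^sup>+x. min (f x) (of_nat n) \<partial>M)"
  proof (rule nn_integral_monotone_convergence_SUP)
    show "incseq (\<lambda>n x. min (f x) (of_nat n))"
      by (auto simp: incseq_def le_fun_def simp del: min.bounded_iff intro!: min.mono)
  qed measurable
  finally show ?thesis .
qed

text \<open>Truncating f and g at separate levels n and m leaves h untouched, and the two suprema
  can then be taken one after the other.\<close>

lemma prekopa_leindler_real:
  fixes f g h :: "real \<Rightarrow> ennreal"
  assumes [measurable]: "f \<in> borel_measurable borel" "g \<in> borel_measurable borel" "h \<in> borel_measurable borel"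
    and le: "\<And>x y. f x * g y \<le> (h ((x + y) / 2))\<^sup>2"
  shows "(\<integral>\<^sup>+x. f x \<partial>lborel) * (\<integral>\<^sup>+x. g x \<partial>lborel) \<le> (\<integral>\<^sup>+x. h x \<partial>lborel)\<^sup>2"
proof -
  have "(\<integral>\<^sup>+x. min (f x) (of_nat n) \<partial>lborel) * (\<integral>\<^sup>+x. min (g x) (of_nat m) \<partial>lborel) \<le> (\<integral>\<^sup>+x. h x \<partial>lborel)\<^sup>2"
    for n m
  proof (rule prekopa_leindler_real_bounded[where K="real (max n m)"])
    fix x y
    have "min (f x) (of_nat n) * min (g y) (of_nat m) \<le> f x * g y"
      by (intro mult_mono) auto
    then show "min (f x) (of_nat n) * min (g y) (of_nat m) \<le> (h ((x + y) / 2))\<^sup>2"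
      using le order_trans by blast
    have "min a (of_nat k :: ennreal) \<le> of_nat (max n m)" if "k \<le> max n m" for a k
    proof -
      have "(of_nat k :: ennreal) \<le> of_nat (max n m)" using that by (simp only: of_nat_le_iff)
      then show ?thesis by (meson min.cobounded2 order_trans)
    qed
    then show "min (f x) (of_nat n) \<le> ennreal (real (max n m))" "min (g x) (of_nat m) \<le> ennreal (real (max n m))"
      by (simp_all only: ennreal_of_nat_eq_real_of_nat[symmetric] max.cobounded1 max.cobounded2)
  qed measurable
  then show ?thesis
    by (subst (1 2) nn_integral_min_SUP)
       (auto simp: SUP_mult_left_ennreal SUP_mult_right_ennreal intro!: SUP_least)
qed

text \<open>Induction on the coordinates. The one-dimensional inequality in coordinate j, with the
  other coordinates frozen at x, at y and at their midpoint, says that the partial integrals over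
  coordinate j satisfy the midpoint hypothesis again.\<close>

lemma prekopa_leindler_PiM:
  fixes f g h :: "('i \<Rightarrow> real) \<Rightarrow> ennreal"
  assumes "finite I"
    and "f \<in> borel_measurable (\<Pi>\<^sub>M i\<in>I. lborel)" "g \<in> borel_measurable (\<Pi>\<^sub>M i\<in>I. lborel)"
      "h \<in> borel_measurable (\<Pi>\<^sub>M i\<in>I. lborel)"
    and "\<And>x y. x \<in> space (\<Pi>\<^sub>M i\<in>I. lborel :: real measure) \<Longrightarrow> y \<in> space (\<Pi>\<^sub>M i\<in>I. lborel :: real measure)
      \<Longrightarrow> f x * g y \<le> (h (\<lambda>i\<in>I. (x i + y i) / 2))\<^sup>2"
  shows "(\<integral>\<^sup>+x. f x \<partial>(\<Pi>\<^sub>M i\<in>I. lborel)) * (\<integral>\<^sup>+x. g x \<partial>(\<Pi>\<^sub>M i\<in>I. lborel))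
    \<le> (\<integral>\<^sup>+x. h x \<partial>(\<Pi>\<^sub>M i\<in>I. lborel))\<^sup>2"
  using assms
proof (induction I arbitrary: f g h rule: finite_induct)
  case empty
  then show ?case by (simp add: PiM_empty nn_integral_count_space_finite power2_eq_square)
next
  case (insert j I)
  interpret product_sigma_finite "\<lambda>_. lborel :: real measure" ..
  let ?P = "\<lambda>I. (\<Pi>\<^sub>M i\<in>I. lborel :: real measure)"
  note [measurable] = insert.prems(1-3)
  have m: "(\<lambda>y. k (x(j := y))) \<in> borel_measurable borel"
    if "k \<in> borel_measurable (?P (insert j I))" "x \<in> space (?P I)" for k :: "_ \<Rightarrow> ennreal" and x
  proof -
    have "(\<lambda>y. x(j := y)) \<in> lborel \<rightarrow>\<^sub>M ?P (insert j I)"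
      using that(2) by (intro measurable_fun_upd[where J=I]) auto
    from measurable_compose[OF this that(1)] show ?thesis by simp
  qed
  have m2: "(\<lambda>x. \<integral>\<^sup>+y. k (x(j := y)) \<partial>lborel) \<in> borel_measurable (?P I)"
    if [measurable]: "k \<in> borel_measurable (?P (insert j I))" for k :: "_ \<Rightarrow> ennreal"
  proof -
    have "(\<lambda>(x, y). k (x(j := y))) \<in> borel_measurable (?P I \<Otimes>\<^sub>M lborel)"
      using measurable_compose[OF measurable_add_dim that] by (simp add: case_prod_beta')
    then show ?thesis by (intro lborel.borel_measurable_nn_integral) simp
  qed
  have eq: "(\<integral>\<^sup>+x. k x \<partial>?P (insert j I)) = (\<integral>\<^sup>+x. (\<integral>\<^sup>+y. k (x(j := y)) \<partial>lborel) \<partial>?P I)"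
    if "k \<in> borel_measurable (?P (insert j I))" for k :: "_ \<Rightarrow> ennreal"
    using insert.hyps that by (rule product_nn_integral_insert)
  show ?case
    unfolding eq[OF insert.prems(1)] eq[OF insert.prems(2)] eq[OF insert.prems(3)]
  proof (rule insert.IH)
    fix x y assume x: "x \<in> space (?P I)" and y: "y \<in> space (?P I)"
    let ?z = "\<lambda>i\<in>I. (x i + y i) / 2"
    have z: "?z \<in> space (?P I)" by (auto simp: space_PiM)
    show "(\<integral>\<^sup>+t. f (x(j := t)) \<partial>lborel) * (\<integral>\<^sup>+t. g (y(j := t)) \<partial>lborel)
      \<le> (\<integral>\<^sup>+t. h (?z(j := t)) \<partial>lborel)\<^sup>2"
    proof (rule prekopa_leindler_real)
      fix s t
      have "f (x(j := s)) * g (y(j := t)) \<le> (h (\<lambda>i\<in>insert j I. ((x(j := s)) i + (y(j := t)) i) / 2))\<^sup>2"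
        using x y by (intro insert.prems(4)) (auto simp: space_PiM PiE_iff extensional_def)
      also have "(\<lambda>i\<in>insert j I. ((x(j := s)) i + (y(j := t)) i) / 2) = ?z(j := (s + t) / 2)"
        using insert.hyps(2) by (auto simp: fun_eq_iff)
      finally show "f (x(j := s)) * g (y(j := t)) \<le> (h (?z(j := (s + t) / 2)))\<^sup>2" .
    qed (use m x y z insert.prems(1-3) in auto)
  qed (rule m2, fact)+
qed

theorem prekopa_leindler:
  fixes f g h :: "'a::euclidean_space \<Rightarrow> ennreal"
  assumes [measurable]: "f \<in> borel_measurable borel" "g \<in> borel_measurable borel" "h \<in> borel_measurable borel"
    and le: "\<And>x y. f x * g y \<le> (h ((1/2) *\<^sub>R (x + y)))\<^sup>2"
  shows "(\<integral>\<^sup>+x. f x \<partial>lborel) * (\<integral>\<^sup>+x. g x \<partial>lborel) \<le> (\<integral>\<^sup>+x. h x \<partial>lborel)\<^sup>2"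
proof -
  let ?P = "\<Pi>\<^sub>M b\<in>(Basis::'a set). lborel :: real measure"
  let ?e = "\<lambda>u. \<Sum>b\<in>(Basis::'a set). u b *\<^sub>R b"
  have eq: "(\<integral>\<^sup>+x. k x \<partial>lborel) = (\<integral>\<^sup>+u. k (?e u) \<partial>?P)" if "k \<in> borel_measurable borel" for k :: "'a \<Rightarrow> ennreal"
    unfolding lborel_eq[where 'a='a] using that by (subst nn_integral_distr) auto
  have [measurable]: "?e \<in> ?P \<rightarrow>\<^sub>M borel" by measurable
  show ?thesis
    unfolding eq[OF assms(1)] eq[OF assms(2)] eq[OF assms(3)]
  proof (rule prekopa_leindler_PiM)
    fix u v :: "'a \<Rightarrow> real"
    have "?e (\<lambda>i\<in>Basis. (u i + v i) / 2) = (1/2) *\<^sub>R (?e u + ?e v)"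
      by (simp add: scaleR_add_left sum.distrib scaleR_add_right scaleR_right.sum add_divide_distrib)
    then show "f (?e u) * g (?e v) \<le> (h (?e (\<lambda>i\<in>Basis. (u i + v i) / 2)))\<^sup>2"
      using le[of "?e u" "?e v"] by (simp only:)
  qed simp_all
qed

section \<open>Convex functions are differentiable almost everywhere\<close>

text \<open>Prolong the segment from y to z beyond z by the length r to a point w, which stays in
  the doubled ball. With d the distance of y and z, the point z is a convex combination of y and w
  with weight d / (d + r) <= d / r on w, and f w - f y <= 2 B.\<close>

lemma convex_on_ball_lipschitz:
  fixes f :: "'a::real_normed_vector \<Rightarrow> real"
  assumes f: "convex_on (ball x (2 * r)) f" and r: "r > 0"
    and B: "\<And>y. y \<in> ball x (2 * r) \<Longrightarrow> \<bar>f y\<bar> \<le> B"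
    and y: "y \<in> ball x r" and z: "z \<in> ball x r"
  shows "\<bar>f y - f z\<bar> \<le> 2 * B / r * norm (y - z)"
proof -
  have main: "f z - f y \<le> 2 * B / r * norm (y - z)" if y: "y \<in> ball x r" and z: "z \<in> ball x r" for y z
  proof (cases "y = z")
    case False
    define d where "d = norm (z - y)"
    have d: "d > 0" using False by (simp add: d_def)
    define w where "w = z + (r / d) *\<^sub>R (z - y)"
    have "norm (w - z) = r" using d r by (simp add: w_def d_def)
    then have "dist x w < 2 * r"
      using z dist_triangle[of x w z] by (simp add: dist_norm norm_minus_commute)
    then have w: "w \<in> ball x (2 * r)" by simp
    have y2: "y \<in> ball x (2 * r)" using y r by simp
    define t where "t = d / (d + r)"
    have t: "0 \<le> t" "t \<le> 1" using d r by (auto simp: t_def)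
    have zz: "z = (1 - t) *\<^sub>R y + t *\<^sub>R w"
    proof -
      have td: "t * (r / d) = 1 - t" using d r by (simp add: t_def field_simps)
      have "(1 - t) *\<^sub>R y + t *\<^sub>R w = (1 - t) *\<^sub>R y + t *\<^sub>R z + (t * (r / d)) *\<^sub>R (z - y)"
        by (simp add: w_def scaleR_add_right)
      then show ?thesis unfolding td by (simp add: algebra_simps)
    qed
    have "f z \<le> (1 - t) * f y + t * f w"
      using convex_onD[OF f t(1,2) y2 w] zz by simp
    then have "f z - f y \<le> t * (f w - f y)" by (simp add: algebra_simps)
    also have "\<dots> \<le> t * (2 * B)" using B[OF w] B[OF y2] t by (intro mult_left_mono) auto
    also have "\<dots> \<le> (d / r) * (2 * B)"
      using d r B[OF w] by (intro mult_right_mono) (auto simp: t_def field_simps)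
    finally show ?thesis by (simp add: d_def norm_minus_commute mult.commute)
  qed simp
  show ?thesis using main[OF y z] main[OF z y] by (simp add: norm_minus_commute abs_le_iff)
qed

lemma convex_on_eq_on:
  assumes "convex_on S f" "\<And>x. x \<in> S \<Longrightarrow> g x = f x"
  shows "convex_on S g"
proof (rule convex_onI)
  show "convex S" using assms(1) by (rule convex_on_imp_convex)
  fix t x y assume t: "0 < t" "t < (1::real)" and xy: "x \<in> S" "y \<in> S"
  then have "(1 - t) *\<^sub>R x + t *\<^sub>R y \<in> S"
    using \<open>convex S\<close> by (intro convexD_alt) auto
  then show "g ((1 - t) *\<^sub>R x + t *\<^sub>R y) \<le> (1 - t) * g x + t * g y"
    using convex_onD[OF assms(1), of t x y] t xy assms(2) by simp
qed

text \<open>Both slopes are compared with the slope of the chord from p to s.\<close>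

lemma convex_on_slope_mono:
  fixes u :: "real \<Rightarrow> real"
  assumes "convex_on I u" "p \<in> I" "q \<in> I" "r \<in> I" "s \<in> I" "p < q" "q \<le> r" "r < s"
  shows "(u q - u p) / (q - p) \<le> (u s - u r) / (s - r)"
proof -
  have "(u p - u q) / (p - q) \<le> (u p - u s) / (p - s)"
    using assms by (intro convex_on_slope_le(1)[of I]) auto
  also have "\<dots> \<le> (u r - u s) / (r - s)"
    using assms by (intro convex_on_slope_le(2)[of I]) auto
  finally show ?thesis using minus_divide_divide[of "u q - u p" "q - p"] minus_divide_divide[of "u s - u r" "s - r"] by simp
qed

text \<open>Each summand is a forward slope minus a backward slope at \<open>k * d\<close>. Since 2
  h <= d, the forward slope at \<open>k * d\<close> is at most the backward slope at the next grid
  point, so the sum telescopes as an inequality and only the last forward and the first backward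
  slope survive.\<close>

lemma convex_on_second_difference_sum:
  fixes u :: "real \<Rightarrow> real"
  assumes u: "convex_on I u" and h: "0 < h" "2 * h \<le> d"
    and I: "{0..real m * d + h} \<subseteq> I" and m: "m > 0"
  shows "(\<Sum>k=1..m. (u (real k * d + h) + u (real k * d - h) - 2 * u (real k * d)) / h)
    \<le> (u (real m * d + h) - u (real m * d)) / h - (u d - u (d - h)) / h"
  using m I
proof (induction m rule: nat_induct_non_zero)
  case 1
  then show ?case by (simp add: add_divide_distrib diff_divide_distrib)
next
  case (Suc m)
  have d: "d > 0" using h by simp
  have sub: "{0..real m * d + h} \<subseteq> {0..real (Suc m) * d + h}"
    using d by (auto simp: algebra_simps)
  have md: "real m * d \<ge> d" using Suc.hyps d by simp
  have "real (Suc m) * d = real m * d + d" by (simp add: algebra_simps)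
  then have mem: "s \<in> I" if "0 \<le> s" "s \<le> real m * d + d + h" for s
    using Suc.prems that by auto
  have hd: "h \<le> d" using h by simp
  have "(u (real m * d + h) - u (real m * d)) / ((real m * d + h) - real m * d)
      \<le> (u (real (Suc m) * d) - u (real (Suc m) * d - h)) / (real (Suc m) * d - (real (Suc m) * d - h))"
  proof (intro convex_on_slope_mono[OF u])
    have "real (Suc m) * d = real m * d + d" by (simp add: algebra_simps)
    then show "real m * d \<in> I" "real m * d + h \<in> I" "real (Suc m) * d - h \<in> I" "real (Suc m) * d \<in> I"
      "real m * d < real m * d + h" "real m * d + h \<le> real (Suc m) * d - h" "real (Suc m) * d - h < real (Suc m) * d"
      by (auto intro!: mem) (use hd h d md in linarith)+
  qed
  then have "(u (real m * d + h) - u (real m * d)) / h \<le> (u (real (Suc m) * d) - u (real (Suc m) * d - h)) / h"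
    by simp
  moreover have "(\<Sum>k=1..m. (u (real k * d + h) + u (real k * d - h) - 2 * u (real k * d)) / h)
    \<le> (u (real m * d + h) - u (real m * d)) / h - (u d - u (d - h)) / h"
    using Suc.IH order_trans[OF sub Suc.prems] by blast
  ultimately show ?case by (simp add: diff_divide_distrib add_divide_distrib)
qed

text \<open>The division is by h and not by its square: this is the forward minus the backward
  slope, which for convex f tends to the jump of the one-sided derivatives in direction e.\<close>

definition second_diff :: "('a::real_vector \<Rightarrow> real) \<Rightarrow> 'a \<Rightarrow> real \<Rightarrow> 'a \<Rightarrow> real" where
  "second_diff f e h x = (f (x + h *\<^sub>R e) + f (x - h *\<^sub>R e) - 2 * f x) / h"

lemma convex_on_line:
  fixes f :: "'a::real_vector \<Rightarrow> real"
  assumes f: "convex_on U f"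
  shows "convex_on {s. x + s *\<^sub>R e \<in> U} (\<lambda>s. f (x + s *\<^sub>R e))"
proof (rule convex_onI)
  have eq: "x + ((1 - t) *\<^sub>R p + t *\<^sub>R q) *\<^sub>R e = (1 - t) *\<^sub>R (x + p *\<^sub>R e) + t *\<^sub>R (x + q *\<^sub>R e)" for t p q :: real
    by (simp add: algebra_simps)
  show "f (x + ((1 - t) *\<^sub>R p + t *\<^sub>R q) *\<^sub>R e) \<le> (1 - t) * f (x + p *\<^sub>R e) + t * f (x + q *\<^sub>R e)"
    if "0 < t" "t < 1" "p \<in> {s. x + s *\<^sub>R e \<in> U}" "q \<in> {s. x + s *\<^sub>R e \<in> U}" for t p q
    unfolding eq using that by (intro convex_onD[OF f]) auto
  have "convex U" using f by (rule convex_on_imp_convex)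
  show "convex {s. x + s *\<^sub>R e \<in> U}"
    unfolding convex_alt
  proof safe
    fix p q t :: real assume "x + p *\<^sub>R e \<in> U" "x + q *\<^sub>R e \<in> U" "0 \<le> t" "t \<le> 1"
    then show "x + ((1 - t) *\<^sub>R p + t *\<^sub>R q) *\<^sub>R e \<in> U"
      unfolding eq using \<open>convex U\<close> by (intro convexD_alt) auto
  qed
qed

text \<open>As the step shrinks, forward slopes decrease and backward slopes increase, and backward
  slopes stay below forward ones. The last two conclusions make the forward slopes converge.\<close>

lemma second_diff_mono:
  fixes f :: "'a::real_vector \<Rightarrow> real"
  assumes f: "convex_on U f" and h: "0 < h" "h \<le> k"
    and U: "\<And>s. \<bar>s\<bar> \<le> k \<Longrightarrow> x + s *\<^sub>R e \<in> U"
  shows "second_diff f e h x \<le> second_diff f e k x" "0 \<le> second_diff f e h x"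
    "(f (x + h *\<^sub>R e) - f x) / h \<le> (f (x + k *\<^sub>R e) - f x) / k"
    "(f x - f (x - k *\<^sub>R e)) / k \<le> (f (x + h *\<^sub>R e) - f x) / h"
proof -
  let ?u = "\<lambda>s. f (x + s *\<^sub>R e)" and ?I = "{s. x + s *\<^sub>R e \<in> U}"
  note u = convex_on_line[OF f, of x e]
  have I: "s \<in> ?I" if "\<bar>s\<bar> \<le> k" for s using U that by auto
  have r: "(?u h - ?u 0) / h \<le> (?u k - ?u 0) / k"
  proof (cases "h = k")
    case False
    then show ?thesis using convex_on_slope_le(1)[OF u I I, of 0 k h] h
      by (simp add: diff_divide_distrib)
  qed simp
  have l: "(?u 0 - ?u (-k)) / k \<le> (?u 0 - ?u (-h)) / h"
  proof (cases "h = k")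
    case False
    then show ?thesis using convex_on_slope_le(2)[OF u I I, of "-k" 0 "-h"] h
      by (simp add: diff_divide_distrib)
  qed simp
  have m: "(?u 0 - ?u (-h)) / (0 - (-h)) \<le> (?u h - ?u 0) / (h - 0)"
    by (rule convex_on_slope_mono[OF u I I I I]) (use h in auto)
  show "second_diff f e h x \<le> second_diff f e k x" "0 \<le> second_diff f e h x"
    "(f (x + h *\<^sub>R e) - f x) / h \<le> (f (x + k *\<^sub>R e) - f x) / k"
    "(f x - f (x - k *\<^sub>R e)) / k \<le> (f (x + h *\<^sub>R e) - f x) / h"
    using r l m h by (simp_all add: second_diff_def add_divide_distrib diff_divide_distrib)
qed

text \<open>By translation invariance, m copies of the integral equal the integral of the sum over m
  translates along e with spacing r / m. On each line that sum telescopes to at most twice a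
  Lipschitz constant, whatever m is. Hence the mean jump of the derivative over the ball is of order
  1 / m.\<close>

lemma second_diff_integral_bound:
  fixes f :: "'a::euclidean_space \<Rightarrow> real"
  assumes f: "convex_on (ball x0 (8 * r)) f" and r: "r > 0" and e: "norm e = 1"
    and B: "\<And>y. y \<in> ball x0 (8 * r) \<Longrightarrow> \<bar>f y\<bar> \<le> B"
    and [measurable]: "f \<in> borel_measurable borel"
    and m: "m > 0" and h: "0 < h" "2 * h \<le> r / real m"
  shows "of_nat m * (\<integral>\<^sup>+x. ennreal (second_diff f e h x) * indicator (ball x0 r) x \<partial>lborel)
    \<le> ennreal (B / r) * emeasure lborel (ball x0 (2 * r))"
proof -
  define d where "d = r / real m"
  \<comment> \<open>The Lipschitz constant \<open>2 * B / (4 * r)\<close> of f on the ball of radius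
    4 r, which contains everything reached from the ball of radius 2 r by shifts of length at most 2
    r along e.\<close>
  define L where "L = B / (2 * r)"
  have d: "d > 0" "real m * d = r" "2 * h \<le> d" using r m h by (auto simp: d_def)
  have [measurable]: "ball x0 r \<in> sets borel" by simp
  have [measurable]: "second_diff f e h \<in> borel_measurable borel"
    unfolding second_diff_def[abs_def] by measurable
  have lip: "\<bar>f y - f z\<bar> \<le> L * norm (y - z)" if "y \<in> ball x0 (4*r)" "z \<in> ball x0 (4*r)" for y z
    using convex_on_ball_lipschitz[of x0 "4*r" f B y z] f r B that by (simp add: L_def)
  have dm: "d \<le> r" using r m by (simp add: d_def field_simps)
  have pos: "real k * d \<le> r" if "k \<le> m" for k
    using that d by (metis mult_right_mono of_nat_le_iff less_imp_le)
  have inb: "x + s *\<^sub>R e \<in> ball x0 (4*r)" if "x \<in> ball x0 (2*r)" "\<bar>s\<bar> \<le> 2 * r" for x s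
    using that e dist_triangle[of x0 "x + s *\<^sub>R e" x] by (simp add: dist_norm)
  have D0: "0 \<le> second_diff f e h x" if "x \<in> ball x0 (3*r)" for x
  proof (rule second_diff_mono(2)[OF f h(1) order_refl])
    fix s assume "\<bar>s\<bar> \<le> h"
    then show "x + s *\<^sub>R e \<in> ball x0 (8*r)"
      using that e dist_triangle[of x0 "x + s *\<^sub>R e" x] d dm by (simp add: dist_norm)
  qed
  have sumD: "(\<Sum>k=1..m. second_diff f e h (x + (real k * d) *\<^sub>R e)) \<le> 2 * L"
    if x: "x \<in> ball x0 (2*r)" for x
  proof -
    let ?u = "\<lambda>s. f (x + s *\<^sub>R e)"
    have cv: "convex_on {s. x + s *\<^sub>R e \<in> ball x0 (8 * r)} ?u" by (rule convex_on_line[OF f])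
    have "{0..real m * d + h} \<subseteq> {s. x + s *\<^sub>R e \<in> ball x0 (8 * r)}"
    proof safe
      fix s assume "s \<in> {0..real m * d + h}"
      then have "\<bar>s\<bar> \<le> 2 * r" using d dm by auto
      from inb[OF x this] show "x + s *\<^sub>R e \<in> ball x0 (8*r)" using r by auto
    qed
    from convex_on_second_difference_sum[OF cv h(1) d(3) this m]
    have "(\<Sum>k=1..m. second_diff f e h (x + (real k * d) *\<^sub>R e))
      \<le> (?u (r + h) - ?u r) / h - (?u d - ?u (d - h)) / h"
      unfolding d(2) second_diff_def by (simp only: scaleR_left_distrib scaleR_left_diff_distrib add.assoc add_diff_eq)
    also have "\<dots> \<le> L + L"
    proof -
      have b: "\<bar>?u s - ?u t\<bar> \<le> L * \<bar>s - t\<bar>" if "\<bar>s\<bar> \<le> 2*r" "\<bar>t\<bar> \<le> 2*r" for s t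
      proof -
        have "norm ((x + s *\<^sub>R e) - (x + t *\<^sub>R e)) = \<bar>s - t\<bar>"
          using e by (simp add: scaleR_left_diff_distrib[symmetric])
        then show ?thesis using lip[OF inb[OF x that(1)] inb[OF x that(2)]] by simp
      qed
      have "\<bar>?u (r+h) - ?u r\<bar> \<le> L * h" "\<bar>?u d - ?u (d - h)\<bar> \<le> L * h"
        using b[of "r+h" r] b[of d "d-h"] h d dm r by auto
      then have "(?u (r + h) - ?u r) / h \<le> L" "- L \<le> (?u d - ?u (d - h)) / h"
        using h by (simp_all add: field_simps abs_le_iff)
      then show ?thesis by linarith
    qed
    finally show ?thesis by simp
  qed
  let ?g = "\<lambda>x. ennreal (second_diff f e h x) * indicator (ball x0 r) x"
  have tr: "(\<integral>\<^sup>+x. ?g x \<partial>lborel) = (\<integral>\<^sup>+x. ?g (x + c) \<partial>lborel)" for c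
  proof -
    have "(\<integral>\<^sup>+x. ?g x \<partial>lborel) = (\<integral>\<^sup>+x. ?g x \<partial>(distr lborel borel ((+) c)))"
      by (simp add: lborel_distr_plus)
    also have "\<dots> = (\<integral>\<^sup>+x. ?g (c + x) \<partial>lborel)" by (rule nn_integral_distr) measurable
    finally show ?thesis by (simp only: add.commute)
  qed
  have "of_nat m * (\<integral>\<^sup>+x. ?g x \<partial>lborel) = (\<Sum>k=1..m. \<integral>\<^sup>+x. ?g x \<partial>lborel)" by simp
  also have "\<dots> = (\<Sum>k=1..m. \<integral>\<^sup>+x. ?g (x + (real k * d) *\<^sub>R e) \<partial>lborel)"
    using tr by (intro sum.cong refl)
  also have "\<dots> = (\<integral>\<^sup>+x. (\<Sum>k=1..m. ?g (x + (real k * d) *\<^sub>R e)) \<partial>lborel)"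
    by (rule nn_integral_sum[symmetric]) measurable
  also have "\<dots> \<le> (\<integral>\<^sup>+x. ennreal (2 * L) * indicator (ball x0 (2*r)) x \<partial>lborel)"
  proof (rule nn_integral_mono)
    fix x :: 'a
    show "(\<Sum>k=1..m. ?g (x + (real k * d) *\<^sub>R e)) \<le> ennreal (2 * L) * indicator (ball x0 (2*r)) x"
    proof (cases "x \<in> ball x0 (2*r)")
      case True
      have in3: "x + (real k * d) *\<^sub>R e \<in> ball x0 (3*r)" if "k \<le> m" for k
        using True pos[OF that] d e dist_triangle[of x0 "x + (real k * d) *\<^sub>R e" x] by (simp add: dist_norm)
      have "(\<Sum>k=1..m. ?g (x + (real k * d) *\<^sub>R e)) \<le> (\<Sum>k=1..m. ennreal (second_diff f e h (x + (real k * d) *\<^sub>R e)))"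
        by (intro sum_mono) (auto split: split_indicator)
      also have "\<dots> = ennreal (\<Sum>k=1..m. second_diff f e h (x + (real k * d) *\<^sub>R e))"
        using D0 in3 by (intro sum_ennreal) auto
      also have "\<dots> \<le> ennreal (2 * L)" by (intro ennreal_leI sumD True)
      finally show ?thesis using True by simp
    next
      case False
      have "x + (real k * d) *\<^sub>R e \<notin> ball x0 r" if "k \<le> m" for k
        using False pos[OF that] d e dist_triangle[of x0 x "x + (real k * d) *\<^sub>R e"] by (simp add: dist_norm)
      then have "(\<Sum>k=1..m. ?g (x + (real k * d) *\<^sub>R e)) = 0" by (intro sum.neutral) auto
      then show ?thesis by simp
    qed
  qed
  also have "\<dots> = ennreal (B / r) * emeasure lborel (ball x0 (2 * r))"
    by (simp add: nn_integral_cmult_indicator L_def)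
  finally show ?thesis .
qed


text \<open>The infimum over n of the second differences has integral at most C / (n + 1) for every
  n, hence vanishes almost everywhere on the ball. One good step h for each \<eta> is enough later
  on, because second differences are monotone in the step.\<close>

lemma convex_AE_second_diff_local:
  fixes f :: "'a::euclidean_space \<Rightarrow> real"
  assumes U: "open U" "convex_on U f" and e: "norm e = 1" and x0: "x0 \<in> U"
  obtains r where "r > 0" "AE x in lborel. x \<in> ball x0 r \<longrightarrow>
    (\<forall>\<eta>>0. \<exists>h>0. (\<forall>s. \<bar>s\<bar> \<le> h \<longrightarrow> x + s *\<^sub>R e \<in> U) \<and> second_diff f e h x < \<eta>)"
proof -
  obtain R where R: "R > 0" "cball x0 R \<subseteq> U" using U(1) x0 open_contains_cball by blast
  define r where "r = R / 8"
  have r: "r > 0" "8 * r = R" using R by (auto simp: r_def)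
  have cont: "continuous_on U f" using U by (rule convex_on_continuous)
  have "compact (f ` cball x0 R)"
    using cont R by (intro compact_continuous_image) (auto intro: continuous_on_subset)
  then obtain B where B: "\<And>y. y \<in> cball x0 R \<Longrightarrow> \<bar>f y\<bar> \<le> B"
    using compact_imp_bounded by (force simp: bounded_iff)
  \<comment> \<open>Cutting f off outside the ball gives a Borel function on the whole space, and
    all points that enter the second differences stay inside the ball.\<close>
  define F where "F = (\<lambda>x. indicator (ball x0 R) x *\<^sub>R f x)"
  have [measurable]: "F \<in> borel_measurable borel"
    unfolding F_def
    by (intro borel_measurable_continuous_on_indicator continuous_on_subset[OF cont]) (use R in auto)
  have "convex_on (ball x0 R) f"
    using U(2) R by (rule_tac convex_on_subset) auto
  then have cF: "convex_on (ball x0 (8 * r)) F"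
    unfolding r(2) by (rule convex_on_eq_on) (simp add: F_def)
  \<comment> \<open>Chosen such that \<open>2 * h n\<close> is r / (n + 1), so that the integral
    bound applies with m = n + 1.\<close>
  define h where "h n = r / (2 * real (Suc n))" for n
  have h: "h n > 0" "2 * h n \<le> r / real (Suc n)" for n using r by (auto simp: h_def field_simps)
  have hr: "h n \<le> r" for n using r by (simp add: h_def field_simps)
  let ?J = "\<lambda>n x. ennreal (second_diff F e (h n) x) * indicator (ball x0 r) x"
  have [measurable]: "second_diff F e (h n) \<in> borel_measurable borel" for n
    unfolding second_diff_def[abs_def] by measurable
  have [measurable]: "ball x0 r \<in> sets borel" by simp
  define C where "C = ennreal (B / r) * emeasure lborel (ball x0 (2 * r))"
  have C: "C < top"
    unfolding C_def using emeasure_bounded_finite[OF bounded_ball, of x0 "2 * r"]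
    by (simp add: ennreal_mult_less_top)
  let ?i = "\<integral>\<^sup>+x. (INF n. ?J n x) \<partial>lborel"
  have J: "of_nat (Suc n) * ?i \<le> C" for n
  proof -
    have "of_nat (Suc n) * ?i \<le> of_nat (Suc n) * (\<integral>\<^sup>+x. ?J n x \<partial>lborel)"
      by (intro mult_left_mono nn_integral_mono INF_lower) auto
    also have "\<dots> \<le> C"
      unfolding C_def
    proof (rule second_diff_integral_bound[OF cF r(1) e])
      show "\<bar>F y\<bar> \<le> B" if "y \<in> ball x0 (8*r)" for y
        using that B r by (auto simp: F_def less_imp_le)
    qed (use h in auto)
    finally show ?thesis .
  qed
  have "?i = 0"
  proof (rule ccontr)
    assume "?i \<noteq> 0"
    moreover have "?i < top" using J[of 0] C by (simp add: le_less_trans)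
    ultimately obtain i where i: "?i = ennreal i" "i > 0"
      by (cases ?i) (auto simp: ennreal_eq_0_iff not_le)
    obtain c where c: "C = ennreal c" "c \<ge> 0" using C by (cases C) auto
    obtain n where "c < real n * i" using reals_Archimedean3[OF i(2)] by blast
    moreover have "real n * i \<le> real (Suc n) * i" using i by simp
    moreover have "real (Suc n) * i \<le> c"
    proof -
      have "ennreal (real (Suc n) * i) \<le> ennreal c"
        using J[of n] i c by (simp add: ennreal_mult ennreal_of_nat_eq_real_of_nat del: of_nat_Suc)
      then show ?thesis using c by (subst (asm) ennreal_le_iff) auto
    qed
    ultimately show False by linarith
  qed
  then have "AE x in lborel. (INF n. ?J n x) = 0"
    by (subst (asm) nn_integral_0_iff_AE) auto
  then have "AE x in lborel. x \<in> ball x0 r \<longrightarrow>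
    (\<forall>\<eta>>0. \<exists>h>0. (\<forall>s. \<bar>s\<bar> \<le> h \<longrightarrow> x + s *\<^sub>R e \<in> U) \<and> second_diff f e h x < \<eta>)"
  proof (eventually_elim, intro impI allI)
    fix x and \<eta> :: real assume x: "x \<in> ball x0 r" and \<eta>: "\<eta> > 0" and "(INF n. ?J n x) = 0"
    then have "(INF n. ?J n x) < ennreal \<eta>" by simp
    then obtain n where "?J n x < ennreal \<eta>" by (auto simp: INF_less_iff)
    then have sm: "second_diff F e (h n) x < \<eta>"
      using x \<eta> by (simp add: ennreal_less_iff ennreal_lessI) (meson ennreal_leI not_less)
    have in_b: "x + s *\<^sub>R e \<in> ball x0 R" if "\<bar>s\<bar> \<le> h n" for s
      using that x e hr[of n] r dist_triangle[of x0 "x + s *\<^sub>R e" x] by (simp add: dist_norm)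
    have "x \<in> ball x0 R" "x + h n *\<^sub>R e \<in> ball x0 R" "x - h n *\<^sub>R e \<in> ball x0 R"
      using in_b[of 0] in_b[of "h n"] in_b[of "- h n"] h[of n] by auto
    then have "second_diff F e (h n) x = second_diff f e (h n) x"
      by (simp add: second_diff_def F_def)
    then show "\<exists>h>0. (\<forall>s. \<bar>s\<bar> \<le> h \<longrightarrow> x + s *\<^sub>R e \<in> U) \<and> second_diff f e h x < \<eta>"
      using sm h[of n] in_b R by (intro exI[of _ "h n"]) (auto dest!: in_b)
  qed
  with r(1) show ?thesis by (rule that)
qed

text \<open>By Lindelof countably many of the balls cover U, so their exceptional sets together are
  still null.\<close>

lemma AE_lborel_local:
  fixes U :: "'a::euclidean_space set"
  assumes "\<And>x. x \<in> U \<Longrightarrow> \<exists>r>0. AE y in lborel. y \<in> ball x r \<longrightarrow> P y"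
  shows "AE y in lborel. y \<in> U \<longrightarrow> P y"
proof -
  obtain r where r: "\<And>x. x \<in> U \<Longrightarrow> r x > 0" "\<And>x. x \<in> U \<Longrightarrow> AE y in lborel. y \<in> ball x (r x) \<longrightarrow> P y"
    using assms by metis
  let ?F = "(\<lambda>x. ball x (r x)) ` U"
  obtain F' where F': "F' \<subseteq> ?F" "countable F'" "\<Union>F' = \<Union>?F"
    by (rule Lindelof[of ?F]) auto
  have "AE y in lborel. \<forall>S\<in>F'. y \<in> S \<longrightarrow> P y"
    using F' r by (subst AE_ball_countable) auto
  then show ?thesis
  proof eventually_elim
    case (elim y)
    show ?case
    proof
      assume "y \<in> U"
      then have "y \<in> \<Union>?F" using r by (auto intro!: bexI[of _ y])
      then show "P y" using F' elim by auto
    qed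
  qed
qed

lemma convex_AE_second_diff:
  fixes f :: "'a::euclidean_space \<Rightarrow> real"
  assumes U: "open U" "convex_on U f" and e: "norm e = 1"
  shows "AE x in lborel. x \<in> U \<longrightarrow>
    (\<forall>\<eta>>0. \<exists>h>0. (\<forall>s. \<bar>s\<bar> \<le> h \<longrightarrow> x + s *\<^sub>R e \<in> U) \<and> second_diff f e h x < \<eta>)"
proof (rule AE_lborel_local)
  fix x0 assume "x0 \<in> U"
  from convex_AE_second_diff_local[OF assms this]
  obtain r where "r > 0" "AE x in lborel. x \<in> ball x0 r \<longrightarrow>
    (\<forall>\<eta>>0. \<exists>h>0. (\<forall>s. \<bar>s\<bar> \<le> h \<longrightarrow> x + s *\<^sub>R e \<in> U) \<and> second_diff f e h x < \<eta>)" .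
  then show "\<exists>r>0. AE x in lborel. x \<in> ball x0 r \<longrightarrow>
    (\<forall>\<eta>>0. \<exists>h>0. (\<forall>s. \<bar>s\<bar> \<le> h \<longrightarrow> x + s *\<^sub>R e \<in> U) \<and> second_diff f e h x < \<eta>)"
    by (intro exI conjI)
qed

text \<open>Only the upper half of differentiability, with x interior to U. For a convex function
  the lower half is supplied by subgradients, and the upper half forces every approximate
  subgradient at x to be close to v.\<close>

definition supergradient_at :: "'a::euclidean_space set \<Rightarrow> ('a \<Rightarrow> real) \<Rightarrow> 'a \<Rightarrow> 'a \<Rightarrow> bool" where
  "supergradient_at U f x v \<longleftrightarrow>
     (\<forall>\<eta>>0. \<exists>\<delta>>0. \<forall>h. norm h \<le> \<delta> \<longrightarrow> x + h \<in> U \<and> f (x + h) \<le> f x + h \<bullet> v + \<eta> * norm h)"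

text \<open>Here g is the right derivative, a limit of decreasing forward slopes, and for s > 0 the
  estimate is just this convergence. For s < 0 the small second difference carries it to the other
  side, since the forward slope at -s is at least g. The limit is written with F so that a total
  Borel extension of f makes g measurable in x.\<close>

lemma convex_directional:
  fixes f :: "'a::euclidean_space \<Rightarrow> real"
  assumes U: "open U" "convex_on U f" and x: "x \<in> U"
    and small: "\<And>\<eta>. \<eta> > 0 \<Longrightarrow> \<exists>h>0. (\<forall>s. \<bar>s\<bar> \<le> h \<longrightarrow> x + s *\<^sub>R e \<in> U) \<and> second_diff f e h x < \<eta>"
    and F: "\<And>y. y \<in> U \<Longrightarrow> F y = f y"
    and g: "g = lim (\<lambda>n. (F (x + (1 / real (Suc n)) *\<^sub>R e) - F x) * real (Suc n))"
    and \<eta>: "\<eta> > 0"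
  shows "\<exists>\<delta>>0. \<forall>s. \<bar>s\<bar> \<le> \<delta> \<longrightarrow> x + s *\<^sub>R e \<in> U \<and> f (x + s *\<^sub>R e) \<le> f x + s * g + \<eta> * \<bar>s\<bar>"
proof -
  obtain h0 where h0: "h0 > 0" "\<And>s. \<bar>s\<bar> \<le> h0 \<Longrightarrow> x + s *\<^sub>R e \<in> U" "second_diff f e h0 x < \<eta>"
    using small[OF \<eta>] by blast
  obtain N where N: "1 / real (Suc N) < h0" using h0(1) nat_approx_posE by blast
  let ?q = "\<lambda>h. (f (x + h *\<^sub>R e) - f x) / h"
  let ?S = "\<lambda>n. (F (x + (1 / real (Suc n)) *\<^sub>R e) - F x) * real (Suc n)"
  have Nn: "1 / real (Suc (n + N)) \<le> 1 / real (Suc N)" for n by (simp add: frac_le)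
  have SF: "?S (n + N) = ?q (1 / real (Suc (n + N)))" for n
  proof -
    have "x + (1 / real (Suc (n + N))) *\<^sub>R e \<in> U" using h0(2) N Nn[of n] by simp
    then show ?thesis using F x by simp
  qed
  have qmono: "?q h \<le> ?q k" if "0 < h" "h \<le> k" "k \<le> h0" for h k
    using second_diff_mono(3)[OF U(2) that(1,2), of x e] h0(2) that by auto
  have qlow: "(f x - f (x - h0 *\<^sub>R e)) / h0 \<le> ?q h" if "0 < h" "h \<le> h0" for h
    using second_diff_mono(4)[OF U(2) that(1,2), of x e] h0(2) that by auto
  have dec: "decseq (\<lambda>n. ?S (n + N))"
    unfolding SF decseq_def
  proof (intro allI impI)
    fix m n :: nat assume "m \<le> n"
    then show "?q (1 / real (Suc (n + N))) \<le> ?q (1 / real (Suc (m + N)))"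
      using N Nn[of m] by (intro qmono frac_le) auto
  qed
  have "(f x - f (x - h0 *\<^sub>R e)) / h0 \<le> ?S (n + N)" for n
    unfolding SF by (rule qlow) (use N Nn[of n] in auto)
  then obtain L where L: "(\<lambda>n. ?S (n + N)) \<longlonglongrightarrow> L" "\<And>n. L \<le> ?S (n + N)"
    by (rule_tac decseq_convergent[OF dec, of "(f x - f (x - h0 *\<^sub>R e)) / h0"]) auto
  have "?S \<longlonglongrightarrow> L" using L(1) by (rule LIMSEQ_offset)
  then have gL: "g = L" unfolding g by (rule limI)
  obtain n where n: "?S (n + N) < L + \<eta>"
    using order_tendstoD(2)[OF L(1), of "L + \<eta>"] \<eta> by (auto simp: eventually_sequentially)
  define \<delta> where "\<delta> = 1 / real (Suc (n + N))"
  have \<delta>: "\<delta> > 0" "\<delta> \<le> h0" using N Nn[of n] by (auto simp: \<delta>_def)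
  have glow: "g \<le> ?q s" if s0: "0 < s" "s \<le> h0" for s
  proof -
    obtain k where k: "1 / real (Suc k) < s" by (rule nat_approx_posE[OF s0(1)])
    have "1 / real (Suc (k + N)) \<le> 1 / real (Suc k)" by (intro frac_le) auto
    then have "1 / real (Suc (k + N)) \<le> s" using k by linarith
    then have "?S (k + N) \<le> ?q s" unfolding SF by (rule qmono[rotated]) (use s0 in auto)
    then show ?thesis using L(2)[of k] gL by linarith
  qed
  show ?thesis
  proof (intro exI[of _ \<delta>] conjI allI impI)
    fix s assume s: "\<bar>s\<bar> \<le> \<delta>"
    then show "x + s *\<^sub>R e \<in> U" using h0 \<delta> by auto
    have pos: "f (x + t *\<^sub>R e) \<le> f x + t * g + \<eta> * t" if t: "0 < t" "t \<le> \<delta>" for t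
    proof -
      have "?q t \<le> ?q \<delta>" using t \<delta> by (intro qmono) auto
      also have "\<dots> \<le> g + \<eta>" using n SF[of n] gL by (simp add: \<delta>_def)
      finally show ?thesis using t by (simp add: field_simps)
    qed
    have neg: "f (x - t *\<^sub>R e) \<le> f x - t * g + \<eta> * t" if t: "0 < t" "t \<le> \<delta>" for t
    proof -
      have "second_diff f e t x \<le> second_diff f e h0 x"
        using t \<delta> h0 by (intro second_diff_mono(1)[OF U(2)]) auto
      then have "second_diff f e t x \<le> \<eta>" using h0 by linarith
      then have "f (x + t *\<^sub>R e) + f (x - t *\<^sub>R e) - 2 * f x \<le> \<eta> * t"
        using t by (simp add: second_diff_def field_simps)
      moreover have "t * g \<le> f (x + t *\<^sub>R e) - f x"
        using glow[of t] t \<delta> by (simp add: field_simps)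
      ultimately show ?thesis by linarith
    qed
    consider "s = 0" | "s > 0" | "s < 0" by linarith
    then show "f (x + s *\<^sub>R e) \<le> f x + s * g + \<eta> * \<bar>s\<bar>"
      by cases (use pos[of s] neg[of "-s"] s in auto)
  qed (use \<delta> in auto)
qed

text \<open>Coordinate directions suffice: with n the dimension, x + h is the average of the n
  points obtained from x by moving n times one coordinate of h, and Jensen bounds f (x + h) by the
  average of the coordinate estimates. Convexity thus yields exactly the upper bound that
  \<open>supergradient_at\<close> asks for.\<close>

theorem convex_AE_gradient:
  fixes f :: "'a::euclidean_space \<Rightarrow> real"
  assumes U: "open U" "convex_on U f"
  obtains T where "T \<in> borel_measurable borel" "AE x in lborel. x \<in> U \<longrightarrow> supergradient_at U f x (T x)"
proof -
  define F where "F = (\<lambda>x. indicator U x *\<^sub>R f x)"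
  have [measurable]: "F \<in> borel_measurable borel"
    unfolding F_def using U convex_on_continuous[OF U]
    by (intro borel_measurable_continuous_on_indicator) auto
  have F: "F y = f y" if "y \<in> U" for y using that by (simp add: F_def)
  define G where "G b x = lim (\<lambda>n. (F (x + (1 / real (Suc n)) *\<^sub>R b) - F x) * real (Suc n))" for b x :: 'a
  have [measurable]: "G b \<in> borel_measurable borel" for b
    unfolding G_def[abs_def] by (intro borel_measurable_lim_metric) measurable
  define T where "T x = (\<Sum>b\<in>Basis. G b x *\<^sub>R b)" for x :: 'a
  have Tb: "T x \<bullet> b = G b x" if "b \<in> Basis" for x b
    using that by (simp add: T_def inner_sum_left_Basis)
  have "AE x in lborel. \<forall>b\<in>(Basis::'a set). x \<in> U \<longrightarrow>
    (\<forall>\<eta>>0. \<exists>h>0. (\<forall>s. \<bar>s\<bar> \<le> h \<longrightarrow> x + s *\<^sub>R b \<in> U) \<and> second_diff f b h x < \<eta>)"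
    by (subst AE_ball_countable) (auto intro!: convex_AE_second_diff U countable_finite)
  then have "AE x in lborel. x \<in> U \<longrightarrow> supergradient_at U f x (T x)"
  proof (eventually_elim, intro impI)
    fix x assume x: "x \<in> U" and good: "\<forall>b\<in>(Basis::'a set). x \<in> U \<longrightarrow>
      (\<forall>\<eta>>0. \<exists>h>0. (\<forall>s. \<bar>s\<bar> \<le> h \<longrightarrow> x + s *\<^sub>R b \<in> U) \<and> second_diff f b h x < \<eta>)"
    let ?n = "real DIM('a)"
    have n: "?n > 0" by simp
    show "supergradient_at U f x (T x)"
      unfolding supergradient_at_def
    proof (intro allI impI)
      fix \<eta> :: real assume \<eta>: "\<eta> > 0"
      have "\<exists>\<delta>>0. \<forall>s. \<bar>s\<bar> \<le> \<delta> \<longrightarrow> x + s *\<^sub>R b \<in> U \<and> f (x + s *\<^sub>R b) \<le> f x + s * G b x + (\<eta> / ?n) * \<bar>s\<bar>"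
        if b: "b \<in> Basis" for b
        by (rule convex_directional[OF U x _ F G_def]) (use good b x \<eta> n in auto)
      then obtain \<delta> where \<delta>: "\<And>b. b \<in> Basis \<Longrightarrow> \<delta> b > 0"
        "\<And>b s. b \<in> Basis \<Longrightarrow> \<bar>s\<bar> \<le> \<delta> b \<Longrightarrow> x + s *\<^sub>R b \<in> U \<and> f (x + s *\<^sub>R b) \<le> f x + s * G b x + (\<eta> / ?n) * \<bar>s\<bar>"
        by metis
      \<comment> \<open>Dividing by the dimension compensates its appearance as a factor in the
        points \<open>y b\<close>, which keeps each of them within the range of its coordinate
        estimate.\<close>
      define d where "d = Min (\<delta> ` Basis) / ?n"
      have d: "d > 0" unfolding d_def using \<delta>(1) n by (intro divide_pos_pos) auto
      have db: "?n * d \<le> \<delta> b" if "b \<in> Basis" for b using that by (auto simp: d_def)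
      show "\<exists>\<delta>>0. \<forall>h. norm h \<le> \<delta> \<longrightarrow> x + h \<in> U \<and> f (x + h) \<le> f x + h \<bullet> T x + \<eta> * norm h"
      proof (intro exI[of _ d] conjI allI impI d)
        fix h :: 'a assume h: "norm h \<le> d"
        define y where "y b = x + (?n * (h \<bullet> b)) *\<^sub>R b" for b
        have hb: "\<bar>h \<bullet> b\<bar> \<le> norm h" if "b \<in> Basis" for b using that by (rule Basis_le_norm)
        have s: "\<bar>?n * (h \<bullet> b)\<bar> \<le> \<delta> b" if "b \<in> Basis" for b
          using hb[OF that] h db[OF that] n
          by (simp add: abs_mult) (metis mult_left_mono order_trans of_nat_0_le_iff)
        have y: "y b \<in> U" "f (y b) \<le> f x + (?n * (h \<bullet> b)) * G b x + (\<eta> / ?n) * \<bar>?n * (h \<bullet> b)\<bar>" if "b \<in> Basis" for b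
          unfolding y_def using \<delta>(2)[OF that s[OF that]] by auto
        have xh: "(\<Sum>b\<in>Basis. (1 / ?n) *\<^sub>R y b) = x + h"
        proof -
          have "(\<Sum>b\<in>Basis. (1 / ?n) *\<^sub>R y b) = (\<Sum>b\<in>Basis. (1 / ?n) *\<^sub>R x + (h \<bullet> b) *\<^sub>R b)"
            using n by (intro sum.cong) (auto simp: y_def scaleR_add_right)
          also have "\<dots> = x + h" by (simp add: sum.distrib euclidean_representation sum_constant_scaleR)
          finally show ?thesis .
        qed
        have cU: "convex U" using U(2) by (rule convex_on_imp_convex)
        have "(\<Sum>b\<in>Basis. (1 / ?n) *\<^sub>R y b) \<in> U"
          using y cU by (intro convex_sum) auto
        then show "x + h \<in> U" using xh by simp
        have "f (x + h) \<le> (\<Sum>b\<in>Basis. (1 / ?n) * f (y b))"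
          unfolding xh[symmetric] using y by (intro convex_on_sum[OF _ _ U(2)]) auto
        also have "\<dots> \<le> (\<Sum>b\<in>Basis. (1 / ?n) * (f x + (?n * (h \<bullet> b)) * G b x + (\<eta> / ?n) * \<bar>?n * (h \<bullet> b)\<bar>))"
          using y n by (intro sum_mono mult_left_mono) auto
        also have "\<dots> \<le> (\<Sum>b\<in>Basis. (1 / ?n) * f x + (h \<bullet> b) * (T x \<bullet> b) + (\<eta> / ?n) * norm h)"
        proof (intro sum_mono)
          fix b :: 'a assume b: "b \<in> Basis"
          have "(1 / ?n) * ((\<eta> / ?n) * \<bar>?n * (h \<bullet> b)\<bar>) = (\<eta> / ?n) * \<bar>h \<bullet> b\<bar>"
            using n by (simp add: abs_mult)
          also have "\<dots> \<le> (\<eta> / ?n) * norm h" using hb[OF b] \<eta> by (intro mult_left_mono) auto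
          finally show "(1 / ?n) * (f x + (?n * (h \<bullet> b)) * G b x + (\<eta> / ?n) * \<bar>?n * (h \<bullet> b)\<bar>)
            \<le> (1 / ?n) * f x + (h \<bullet> b) * (T x \<bullet> b) + (\<eta> / ?n) * norm h"
            using n Tb[OF b] by (simp add: distrib_left)
        qed
        also have "\<dots> = f x + h \<bullet> T x + \<eta> * norm h"
          by (simp add: sum.distrib euclidean_inner[of h "T x"])
        finally show "f (x + h) \<le> f x + h \<bullet> T x + \<eta> * norm h" .
      qed
    qed
  qed
  moreover have "T \<in> borel_measurable borel" unfolding T_def[abs_def] by measurable
  ultimately show ?thesis by (rule that[rotated])
qed

section \<open>Optimal transport maps\<close>

text \<open>Nonnegative convex functions with common local upper bounds are uniformly locally
  Lipschitz. A diagonal subsequence converges on a countable dense set, and the Lipschitz bounds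
  carry the Cauchy property to every point of U.\<close>

lemma convex_on_nonneg_locally_bounded_imp_convergent_subseq:
  fixes \<psi> :: "nat \<Rightarrow> 'a::euclidean_space \<Rightarrow> real"
  assumes conv: "\<And>n. convex_on U (\<psi> n)"
    and nonneg: "\<And>n x. x \<in> U \<Longrightarrow> 0 \<le> \<psi> n x"
    and bd: "\<And>x. x \<in> U \<Longrightarrow> \<exists>r>0. \<exists>B. ball x (2 * r) \<subseteq> U \<and> (\<forall>n. \<forall>y\<in>ball x (2 * r). \<psi> n y \<le> B)"
  obtains k \<phi> where "strict_mono k" "\<And>x. x \<in> U \<Longrightarrow> (\<lambda>n. \<psi> (k n) x) \<longlonglongrightarrow> \<phi> x"
    "convex_on U \<phi>" "\<And>x. x \<in> U \<Longrightarrow> 0 \<le> \<phi> x"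
proof (cases "U = {}")
  case True
  then show ?thesis using that[of id "\<lambda>_. 0"] by (auto simp: strict_mono_def convex_on_def)
next
  case False
  obtain D :: "'a set" where D: "countable D" "\<And>Y. open Y \<Longrightarrow> Y \<noteq> {} \<Longrightarrow> \<exists>d\<in>D. d \<in> Y"
    using countable_dense_setE by blast
  have "open U"
    unfolding open_contains_ball by (metis bd mult_pos_pos zero_less_numeral)
  then have DU: "D \<inter> U \<noteq> {}" "countable (D \<inter> U)" using D False by auto
  then obtain q :: "nat \<Rightarrow> 'a" where q: "range q = D \<inter> U" by (metis range_from_nat_into)
  let ?P = "\<lambda>n. \<lambda>s. convergent (\<lambda>k. \<psi> (s k) (q n))"
  interpret nat: subseqs ?P
  proof
    fix n :: nat and s :: "nat \<Rightarrow> nat" assume s: "strict_mono s"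
    have "q n \<in> U" using q by auto
    from bd[OF this] obtain r B where "r > 0" "\<forall>k. \<forall>y\<in>ball (q n) (2 * r). \<psi> k y \<le> B" by blast
    then have "\<psi> (s k) (q n) \<in> {0..B}" for k using nonneg \<open>q n \<in> U\<close> by auto
    then obtain l r where "strict_mono (r :: nat \<Rightarrow> nat)" "((\<lambda>k. \<psi> (s k) (q n)) \<circ> r) \<longlonglongrightarrow> l"
      using compact_Icc[of 0 B] unfolding compact_def by metis
    then show "\<exists>r. strict_mono r \<and> convergent (\<lambda>k. \<psi> ((s \<circ> r) k) (q n))"
      by (auto simp: convergent_def comp_def)
  qed
  define k where "k = nat.diagseq"
  have k: "strict_mono k" unfolding k_def by (rule nat.subseq_diagseq)
  have cvq: "convergent (\<lambda>j. \<psi> (k j) (q n))" for n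
  proof -
    \<comment> \<open>The diagonal sequence is a subsequence of the n-th one only from index
      \<open>Suc n\<close> on, hence the shift.\<close>
    have "?P n (k \<circ> ((+) (Suc n)))"
      unfolding k_def
    proof (rule nat.diagseq_holds)
      fix r s :: "nat \<Rightarrow> nat" and n assume "strict_mono r" "?P n s"
      then show "?P n (s \<circ> r)"
        using convergent_subseq_convergent[of "\<lambda>k. \<psi> (s k) (q n)" r] by (simp add: comp_def)
    qed
    then obtain L where "(\<lambda>j. \<psi> (k (j + Suc n)) (q n)) \<longlonglongrightarrow> L"
      by (auto simp: convergent_def comp_def add.commute)
    then have "(\<lambda>j. \<psi> (k j) (q n)) \<longlonglongrightarrow> L" by (rule LIMSEQ_offset)
    then show ?thesis by (auto simp: convergent_def)
  qed
  have cv: "convergent (\<lambda>j. \<psi> (k j) x)" if x: "x \<in> U" for x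
  proof -
    from bd[OF x] obtain r B where r: "r > 0" "ball x (2 * r) \<subseteq> U"
      and B: "\<And>n y. y \<in> ball x (2 * r) \<Longrightarrow> \<psi> n y \<le> B" by blast
    have lip: "\<bar>\<psi> n y - \<psi> n x\<bar> \<le> 2 * B / r * norm (y - x)" if "y \<in> ball x r" for n y
    proof (rule convex_on_ball_lipschitz[of x r])
      show "convex_on (ball x (2 * r)) (\<psi> n)" using conv r by (auto intro: convex_on_subset)
      show "\<bar>\<psi> n y\<bar> \<le> B" if "y \<in> ball x (2*r)" for y
        using B[OF that] nonneg[of y n] r that by auto
    qed (use that r in auto)
    have B0: "B \<ge> 0" using B[of x 0] nonneg[OF x, of 0] r by auto
    have "Cauchy (\<lambda>j. \<psi> (k j) x)"
    proof (rule metric_CauchyI)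
      fix e :: real assume e: "e > 0"
      \<comment> \<open>B + 1 instead of B keeps the denominator positive when B = 0.\<close>
      define \<delta> where "\<delta> = min r (e * r / (6 * (B + 1)))"
      have \<delta>: "\<delta> > 0" "\<delta> \<le> r" using e r B0 by (auto simp: \<delta>_def)
      have "x \<in> ball x \<delta> \<inter> U" using \<delta> x by simp
      then have "ball x \<delta> \<inter> U \<noteq> {}" by blast
      then obtain d where "d \<in> D" "d \<in> ball x \<delta> \<inter> U"
        using D(2)[of "ball x \<delta> \<inter> U"] \<open>open U\<close> by auto
      then obtain n where n: "d = q n" "d \<in> ball x \<delta>" using q by (metis IntD1 IntD2 IntI imageE)
      have small: "\<bar>\<psi> j d - \<psi> j x\<bar> \<le> e / 3" for j
      proof -
        have "\<bar>\<psi> j d - \<psi> j x\<bar> \<le> 2 * B / r * norm (d - x)" using n \<delta> by (intro lip) auto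
        also have "\<dots> \<le> 2 * B / r * (e * r / (6 * (B + 1)))"
          using n r B0 by (intro mult_left_mono) (auto simp: \<delta>_def dist_norm norm_minus_commute)
        also have "\<dots> = (e / 3) * (B / (B + 1))" using r B0 by (simp add: field_simps)
        also have "\<dots> \<le> (e / 3) * 1" using B0 e by (intro mult_left_mono) auto
        finally show ?thesis by simp
      qed
      have "Cauchy (\<lambda>j. \<psi> (k j) d)" using cvq[of n] n by (simp add: convergent_Cauchy)
      then obtain M where M: "\<And>m j. m \<ge> M \<Longrightarrow> j \<ge> M \<Longrightarrow> dist (\<psi> (k m) d) (\<psi> (k j) d) < e / 3"
        using e by (metis metric_CauchyD zero_less_divide_iff zero_less_numeral)
      show "\<exists>M. \<forall>m\<ge>M. \<forall>n\<ge>M. dist (\<psi> (k m) x) (\<psi> (k n) x) < e"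
      proof (intro exI[of _ M] allI impI)
        fix m j assume "M \<le> m" "M \<le> j"
        then show "dist (\<psi> (k m) x) (\<psi> (k j) x) < e"
          using M[of m j] small[of "k m"] small[of "k j"] unfolding dist_real_def by linarith
      qed
    qed
    then show ?thesis by (simp add: Cauchy_convergent_iff)
  qed
  define \<phi> where "\<phi> x = lim (\<lambda>j. \<psi> (k j) x)" for x
  have lim: "(\<lambda>n. \<psi> (k n) x) \<longlonglongrightarrow> \<phi> x" if "x \<in> U" for x
    unfolding \<phi>_def using cv[OF that] by (simp add: convergent_LIMSEQ_iff)
  have cU: "convex U" using conv by (rule convex_on_imp_convex)
  have "convex_on U \<phi>"
  proof (rule convex_onI)
    fix t x y assume t: "0 < t" "t < (1::real)" and xy: "x \<in> U" "y \<in> U"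
    have z: "(1 - t) *\<^sub>R x + t *\<^sub>R y \<in> U" using t xy cU by (intro convexD_alt) auto
    show "\<phi> ((1 - t) *\<^sub>R x + t *\<^sub>R y) \<le> (1 - t) * \<phi> x + t * \<phi> y"
    proof (rule LIMSEQ_le[OF lim[OF z]])
      show "(\<lambda>n. (1 - t) * \<psi> (k n) x + t * \<psi> (k n) y) \<longlonglongrightarrow> (1 - t) * \<phi> x + t * \<phi> y"
        using xy by (intro tendsto_intros lim) auto
      show "\<exists>N. \<forall>n\<ge>N. \<psi> (k n) ((1 - t) *\<^sub>R x + t *\<^sub>R y) \<le> (1 - t) * \<psi> (k n) x + t * \<psi> (k n) y"
        using t xy by (auto intro!: convex_onD[OF conv])
    qed
  qed (rule cU)
  moreover have "0 \<le> \<phi> x" if "x \<in> U" for x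
    using lim[OF that] by (rule LIMSEQ_le_const) (use nonneg that in auto)
  ultimately show ?thesis by (intro that[OF k lim])
qed

text \<open>The lower bound on the density is local in U, so it may degenerate at the boundary. It
  turns L1 bounds with respect to \<open>\<sigma>\<close> into local bounds for convex functions,
  which gives compactness of potentials. Having a density at all transfers what holds
  Lebesgue-almost everywhere on U.\<close>

definition nice_source :: "'a::euclidean_space measure \<Rightarrow> 'a set \<Rightarrow> bool" where
  "nice_source \<sigma> U \<longleftrightarrow> prob_space \<sigma> \<and> open U \<and> convex U \<and> U \<noteq> {} \<and> (AE x in \<sigma>. x \<in> U) \<and>
     integrable \<sigma> (\<lambda>x. (norm x)\<^sup>2) \<and>
     (\<exists>d\<in>borel_measurable borel. \<sigma> = density lborel d \<and>
       (\<forall>x\<in>U. \<exists>r>0. \<exists>c>0. ball x r \<subseteq> U \<and> (\<forall>y\<in>ball x r. ennreal c \<le> d y)))"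

lemma nice_source_sets: "nice_source \<sigma> U \<Longrightarrow> sets \<sigma> = sets borel"
  by (auto simp: nice_source_def)

lemma nice_source_AE:
  assumes "nice_source \<sigma> U" "AE x in lborel. x \<in> U \<longrightarrow> P x"
  shows "AE x in \<sigma>. P x"
proof -
  obtain d where d: "d \<in> borel_measurable borel" "\<sigma> = density lborel d"
    using assms(1) by (auto simp: nice_source_def)
  have "AE x in \<sigma>. x \<in> U \<longrightarrow> P x"
    unfolding d(2) using d(1) assms(2) by (subst AE_density) auto
  moreover have "AE x in \<sigma>. x \<in> U" using assms(1) by (simp add: nice_source_def)
  ultimately show ?thesis by eventually_elim auto
qed

text \<open>Integrate \<psi> y <= (\<psi> (y + v) + \<psi> (y - v)) / 2 over v in the ball. F is a
  Borel function that represents \<psi> on U.\<close>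

lemma convex_nonneg_mean_bound:
  fixes \<psi> :: "'a::euclidean_space \<Rightarrow> real"
  assumes conv: "convex_on U \<psi>" and nonneg: "\<And>x. x \<in> U \<Longrightarrow> 0 \<le> \<psi> x"
    and [measurable]: "F \<in> borel_measurable borel" and F: "\<And>x. x \<in> U \<Longrightarrow> F x = ennreal (\<psi> x)"
    and sub: "ball y r \<subseteq> U" and r: "r > 0"
  shows "ennreal (\<psi> y) * emeasure lborel (ball (0::'a) r) \<le> (\<integral>\<^sup>+x. F x * indicator (ball y r) x \<partial>lborel)"
    (is "_ \<le> ?I")
proof -
  have [measurable]: "ball y r \<in> sets borel" "ball (0::'a) r \<in> sets borel" by auto
  let ?G = "\<lambda>x. F x * indicator (ball y r) x"
  have 1: "?I = (\<integral>\<^sup>+v. ?G (y + v) \<partial>lborel)"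
  proof -
    have "?I = (\<integral>\<^sup>+x. ?G x \<partial>(distr lborel borel ((+) y)))" by (simp add: lborel_distr_plus)
    also have "\<dots> = (\<integral>\<^sup>+v. ?G (y + v) \<partial>lborel)" by (rule nn_integral_distr) measurable
    finally show ?thesis .
  qed
  have 2: "?I = (\<integral>\<^sup>+v. ?G (y - v) \<partial>lborel)"
  proof -
    have "(\<integral>\<^sup>+v. ?G (y + v) \<partial>lborel) = (\<integral>\<^sup>+v. ?G (y + v) \<partial>(distr lborel borel uminus))"
    proof -
      have "distr lborel borel (uminus :: 'a \<Rightarrow> 'a) = lborel"
        using lborel_affine[of "-1" "0 :: 'a"] by (simp add: density_1)
      then show ?thesis by simp
    qed
    also have "\<dots> = (\<integral>\<^sup>+v. ?G (y + - v) \<partial>lborel)" by (rule nn_integral_distr) measurable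
    finally show ?thesis using 1 by simp
  qed
  have "2 * (ennreal (\<psi> y) * emeasure lborel (ball (0::'a) r))
      = (\<integral>\<^sup>+v. (2 * ennreal (\<psi> y)) * indicator (ball (0::'a) r) v \<partial>lborel)"
    by (subst nn_integral_cmult_indicator) (auto simp: mult.assoc)
  also have "\<dots> \<le> (\<integral>\<^sup>+v. ?G (y + v) + ?G (y - v) \<partial>lborel)"
  proof (rule nn_integral_mono)
    fix v :: 'a
    show "(2 * ennreal (\<psi> y)) * indicator (ball 0 r) v \<le> ?G (y + v) + ?G (y - v)"
    proof (cases "v \<in> ball 0 r")
      case True
      then have b: "y + v \<in> ball y r" "y - v \<in> ball y r" by (auto simp: dist_norm)
      then have U: "y + v \<in> U" "y - v \<in> U" "y \<in> U" using sub r by auto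
      have "y = (1 - 1/2) *\<^sub>R (y + v) + (1/2) *\<^sub>R (y - v)"
        by (simp add: algebra_simps scaleR_add_left[symmetric])
      then have "\<psi> y \<le> (1 - 1/2) * \<psi> (y + v) + (1/2) * \<psi> (y - v)"
        using convex_onD[OF conv, of "1/2" "y + v" "y - v"] U by simp
      then have "2 * \<psi> y \<le> \<psi> (y + v) + \<psi> (y - v)" by simp
      then have "ennreal (2 * \<psi> y) \<le> ennreal (\<psi> (y + v)) + ennreal (\<psi> (y - v))"
        using nonneg U by (simp add: ennreal_plus[symmetric] ennreal_leI del: ennreal_plus)
      then show ?thesis using True b F U nonneg by (simp add: ennreal_mult)
    qed simp
  qed
  also have "\<dots> = ?I + ?I" using 1 2 by (subst nn_integral_add) auto
  finally have "2 * (ennreal (\<psi> y) * emeasure lborel (ball (0::'a) r)) \<le> 2 * ?I" by (simp add: mult_2)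
  then show ?thesis by (subst (asm) ennreal_mult_le_mult_iff) auto
qed

text \<open>The mean over a ball around y is controlled by the integral against
  \<open>\<sigma>\<close> through the lower bound c of the density, which gives the constant
  \<open>1 / (c * v)\<close>. Radius and K are chosen before \<psi> and C, so the bound is uniform
  along a minimising sequence.\<close>

lemma nice_source_convex_bound:
  assumes nice: "nice_source \<sigma> U" and x: "x \<in> U"
  shows "\<exists>r>0. \<exists>K. ball x (2 * r) \<subseteq> U \<and> (\<forall>\<psi> C. convex_on U \<psi> \<longrightarrow> (\<forall>x\<in>U. 0 \<le> \<psi> x) \<longrightarrow>
    (\<integral>\<^sup>+x. ennreal (\<psi> x) * indicator U x \<partial>\<sigma>) \<le> ennreal C \<longrightarrow> 0 \<le> C \<longrightarrow> (\<forall>y\<in>ball x (2 * r). \<psi> y \<le> K * C))"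
proof -
  obtain d where [measurable]: "d \<in> borel_measurable borel" and d: "\<sigma> = density lborel d"
    "\<And>x. x\<in>U \<Longrightarrow> \<exists>r>0. \<exists>c>0. ball x r \<subseteq> U \<and> (\<forall>y\<in>ball x r. ennreal c \<le> d y)"
    using nice by (auto simp: nice_source_def)
  have U: "open U" using nice by (simp add: nice_source_def)
  then have [measurable]: "U \<in> sets borel" by simp
  obtain R c where R: "R > 0" "c > 0" "ball x R \<subseteq> U" "\<And>y. y\<in>ball x R \<Longrightarrow> ennreal c \<le> d y"
    using d(2)[OF x] by blast
  define r where "r = R / 4"
  have r: "r > 0" using R by (simp add: r_def)
  define v where "v = measure lborel (ball (0::'a) (2 * r))"
  have v: "emeasure lborel (ball (0::'a) (2*r)) = ennreal v" "v > 0"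
    using r content_ball_pos[of "2*r" "0::'a"] emeasure_bounded_finite[OF bounded_ball, of "0::'a" "2*r"]
    by (auto simp: v_def emeasure_eq_ennreal_measure)
  show ?thesis
  proof (rule exI[of _ r], intro exI[of _ "1 / (c * v)"] conjI allI impI ballI)
    show "ball x (2 * r) \<subseteq> U" using R by (auto simp: r_def)
    fix \<psi> :: "'a \<Rightarrow> real" and C y
    assume conv: "convex_on U \<psi>" and "\<forall>x\<in>U. 0 \<le> \<psi> x"
      and C: "(\<integral>\<^sup>+x. ennreal (\<psi> x) * indicator U x \<partial>\<sigma>) \<le> ennreal C" "0 \<le> C" and y: "y \<in> ball x (2 * r)"
    then have nonneg: "\<And>x. x \<in> U \<Longrightarrow> 0 \<le> \<psi> x" by blast
    have bsub: "ball y (2 * r) \<subseteq> ball x R"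
    proof
      fix z assume "z \<in> ball y (2*r)"
      then show "z \<in> ball x R" using y dist_triangle[of x z y] by (simp add: r_def)
    qed
    define F where "F = (\<lambda>x. ennreal (indicator U x *\<^sub>R \<psi> x))"
    have m: "(\<lambda>x. indicator U x *\<^sub>R \<psi> x) \<in> borel_measurable borel"
      using convex_on_continuous[OF U conv] U by (intro borel_measurable_continuous_on_indicator) auto
    then have Fm[measurable]: "F \<in> borel_measurable borel" unfolding F_def by measurable
    have [measurable]: "ball y (2 * r) \<in> sets borel" by simp
    have FU: "ennreal (\<psi> x) * indicator U x = F x" for x by (auto simp: F_def split: split_indicator)
    have "ennreal (\<psi> y) * ennreal v \<le> (\<integral>\<^sup>+x. F x * indicator (ball y (2*r)) x \<partial>lborel)"
      unfolding v(1)[symmetric] by (rule convex_nonneg_mean_bound[OF conv nonneg]) (insert r bsub R, (rule Fm | simp add: FU[symmetric] | blast)+)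
    then have "ennreal c * (ennreal (\<psi> y) * ennreal v) \<le> ennreal c * (\<integral>\<^sup>+x. F x * indicator (ball y (2*r)) x \<partial>lborel)"
      by (rule mult_left_mono) simp
    also have "\<dots> = (\<integral>\<^sup>+x. ennreal c * (F x * indicator (ball y (2*r)) x) \<partial>lborel)"
      by (rule nn_integral_cmult[symmetric]) measurable
    also have "\<dots> \<le> (\<integral>\<^sup>+x. d x * F x \<partial>lborel)"
      using R(4) bsub by (intro nn_integral_mono) (auto split: split_indicator intro!: mult_right_mono)
    also have "\<dots> = (\<integral>\<^sup>+x. ennreal (\<psi> x) * indicator U x \<partial>\<sigma>)"
      unfolding d(1) FU by (rule nn_integral_density[symmetric]) measurable
    also have "\<dots> \<le> ennreal C" by (rule C)
    finally have fin: "ennreal c * (ennreal (\<psi> y) * ennreal v) \<le> ennreal C" .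
    have "y \<in> ball y (2 * r)" using r by simp
    then have "y \<in> U" using bsub R(3) by blast
    then have "ennreal (c * (\<psi> y * v)) \<le> ennreal C"
      using fin R v nonneg[of y] by (simp add: ennreal_mult)
    then have "c * (\<psi> y * v) \<le> C" using C by (subst (asm) ennreal_le_iff) auto
    then show "\<psi> y \<le> 1 / (c * v) * C" using R v by (simp add: field_simps)
  qed (rule r)
qed

text \<open>Superlevel sets are unions of open sets, so an uncountable index set does no
  harm.\<close>

lemma borel_measurable_SUP_continuous:
  fixes g :: "'i \<Rightarrow> 'a::topological_space \<Rightarrow> 'b::{complete_linorder, linorder_topology, second_countable_topology}"
  assumes "\<And>i. i \<in> I \<Longrightarrow> continuous_on UNIV (g i)"
  shows "(\<lambda>y. SUP i\<in>I. g i y) \<in> borel_measurable borel"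
proof (rule borel_measurableI_greater)
  fix t
  have "{y \<in> space borel. t < (SUP i\<in>I. g i y)} = (\<Union>i\<in>I. g i -` {t<..})"
    by (auto simp: less_SUP_iff)
  also have "open \<dots>"
    using assms by (intro open_UN ballI open_vimage) auto
  finally show "{y \<in> space borel. t < (SUP i\<in>I. g i y)} \<in> sets borel" by (simp add: borel_open)
qed

text \<open>Outer regularity extends the inequality from open sets to Borel sets. As both masses are
  one, the inequality for the complement is the reverse inequality.\<close>

lemma distr_eqI_open:
  fixes \<mu> \<tau> :: "'a::{second_countable_topology, complete_space} measure"
  assumes p: "prob_space \<mu>" "prob_space \<tau>" and s: "sets \<mu> = sets borel" "sets \<tau> = sets borel"
    and le: "\<And>O'. open O' \<Longrightarrow> emeasure \<mu> O' \<le> emeasure \<tau> O'"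
  shows "\<mu> = \<tau>"
proof -
  interpret M: prob_space \<mu> by fact
  interpret T: prob_space \<tau> by fact
  have sp: "space \<mu> = UNIV" "space \<tau> = UNIV" using sets_eq_imp_space_eq[OF s(1)] sets_eq_imp_space_eq[OF s(2)] by simp_all
  have le': "emeasure \<mu> A \<le> emeasure \<tau> A" if "A \<in> sets borel" for A
  proof -
    have "emeasure \<mu> A \<le> (INF U \<in> {U. A \<subseteq> U \<and> open U}. emeasure \<tau> U)"
    proof (rule INF_greatest)
      fix U assume U: "U \<in> {U. A \<subseteq> U \<and> open U}"
      then have "emeasure \<mu> A \<le> emeasure \<mu> U" using s by (intro emeasure_mono) auto
      also have "\<dots> \<le> emeasure \<tau> U" using U by (intro le) auto
      finally show "emeasure \<mu> A \<le> emeasure \<tau> U" .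
    qed
    also have "\<dots> = emeasure \<tau> A"
      using that s by (intro outer_regular[symmetric]) auto
    finally show ?thesis .
  qed
  show ?thesis
  proof (rule measure_eqI)
    fix A assume "A \<in> sets \<mu>"
    then have A: "A \<in> sets borel" using s by simp
    then have cA: "- A \<in> sets borel" by (rule borel_comp)
    have "measure \<mu> A \<le> measure \<tau> A"
      using le'[OF A] by (simp add: M.emeasure_eq_measure T.emeasure_eq_measure)
    moreover have "measure \<mu> (- A) \<le> measure \<tau> (- A)"
      using le'[OF cA] by (simp add: M.emeasure_eq_measure T.emeasure_eq_measure)
    moreover have "measure \<mu> (- A) = 1 - measure \<mu> A" "measure \<tau> (- A) = 1 - measure \<tau> A"
      using M.prob_compl[of A] T.prob_compl[of A] A s sp by (auto simp: Compl_eq_Diff_UNIV)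
    ultimately show "emeasure \<mu> A = emeasure \<tau> A"
      by (simp add: M.emeasure_eq_measure T.emeasure_eq_measure)
  qed (use s in simp)
qed

text \<open>Insert x' = x + h with h of length \<delta> pointing along w - v. The approximate
  subgradient inequality and the upper bound from \<open>supergradient_at\<close> then give
  \<open>\<delta> * norm (w - v) \<le> \<eta> * \<delta> + e\<close>.\<close>

lemma supergradient_near:
  assumes sg: "supergradient_at U f x v" and \<eta>: "\<eta> > 0"
  obtains \<delta> where "\<delta> > 0"
    "\<And>e w. (\<And>x'. x' \<in> U \<Longrightarrow> f x + (x' - x) \<bullet> w - e \<le> f x') \<Longrightarrow> norm (w - v) \<le> \<eta> + e / \<delta>"
proof -
  obtain \<delta> where \<delta>: "\<delta> > 0" "\<And>h. norm h \<le> \<delta> \<Longrightarrow> x + h \<in> U \<and> f (x + h) \<le> f x + h \<bullet> v + \<eta> * norm h"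
    using sg \<eta> unfolding supergradient_at_def by blast
  show ?thesis
  proof (rule that[OF \<delta>(1)])
    fix e w assume le: "\<And>x'. x' \<in> U \<Longrightarrow> f x + (x' - x) \<bullet> w - e \<le> f x'"
    have "x \<in> U" using \<delta>(2)[of 0] \<delta>(1) by simp
    then have e: "e \<ge> 0" using le[of x] by simp
    show "norm (w - v) \<le> \<eta> + e / \<delta>"
    proof (cases "w = v")
      case True
      then show ?thesis using \<eta> e \<delta> by simp
    next
      case False
      define h where "h = (\<delta> / norm (w - v)) *\<^sub>R (w - v)"
      have nh: "norm h = \<delta>" using False \<delta>(1) by (simp add: h_def)
      have "f x + h \<bullet> w - e \<le> f (x + h)" using le[of "x + h"] \<delta>(2)[of h] nh by simp
      also have "\<dots> \<le> f x + h \<bullet> v + \<eta> * \<delta>" using \<delta>(2)[of h] nh by simp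
      finally have "h \<bullet> (w - v) \<le> \<eta> * \<delta> + e" by (simp add: inner_diff_right)
      moreover have "h \<bullet> (w - v) = \<delta> * norm (w - v)"
        using False by (simp add: h_def power2_norm_eq_inner[symmetric] power2_eq_square)
      ultimately have "\<delta> * norm (w - v) \<le> \<eta> * \<delta> + e" by simp
      then show ?thesis using \<delta>(1) by (simp add: field_simps)
    qed
  qed
qed

text \<open>This stability replaces regularity of the maps: slopes of affine functions that support
  f at x up to defects tending to 0 must converge to v.\<close>

lemma supergradient_limit:
  assumes sg: "supergradient_at U f x v" and e: "e \<longlonglongrightarrow> 0"
    and le: "\<And>n x'. x' \<in> U \<Longrightarrow> f x + (x' - x) \<bullet> w n - e n \<le> f x'"
  shows "w \<longlonglongrightarrow> v"
proof (rule LIMSEQ_I)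
  fix r :: real assume r: "r > 0"
  obtain \<delta> where \<delta>: "\<delta> > 0"
    "\<And>e w. (\<And>x'. x' \<in> U \<Longrightarrow> f x + (x' - x) \<bullet> w - e \<le> f x') \<Longrightarrow> norm (w - v) \<le> r / 2 + e / \<delta>"
    using supergradient_near[OF sg, of "r/2"] r by auto
  have "(\<lambda>n. r / 2 + e n / \<delta>) \<longlonglongrightarrow> r / 2 + 0 / \<delta>" by (intro tendsto_intros e) (use \<delta> in auto)
  then have "\<forall>\<^sub>F n in sequentially. r / 2 + e n / \<delta> < r" by (rule order_tendstoD) (use r in auto)
  then obtain N where "\<And>n. n \<ge> N \<Longrightarrow> r / 2 + e n / \<delta> < r" by (auto simp: eventually_sequentially)
  then show "\<exists>no. \<forall>n\<ge>no. norm (w n - v) < r"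
    using \<delta>(2)[OF le] by (meson le_less_trans)
qed

lemma integrable_norm_of_square:
  fixes \<sigma> :: "'a::euclidean_space measure"
  assumes "prob_space \<sigma>" "sets \<sigma> = sets borel" "integrable \<sigma> (\<lambda>x. (norm x)\<^sup>2)"
  shows "integrable \<sigma> (\<lambda>x. norm x)" "integrable \<sigma> (\<lambda>x. x)" "integrable \<sigma> (\<lambda>x. x \<bullet> v)"
proof -
  interpret prob_space \<sigma> by fact
  have [measurable_cong]: "sets \<sigma> = sets borel" by fact
  have "norm x \<le> 1 + (norm x)\<^sup>2" for x :: 'a
  proof -
    have "0 \<le> (norm x - 1/2)\<^sup>2" by simp
    then show ?thesis by (simp add: power2_eq_square algebra_simps)
  qed
  then have le: "AE x in \<sigma>. norm (norm x) \<le> norm (1 + (norm x)\<^sup>2)" by simp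
  show 1: "integrable \<sigma> (\<lambda>x. norm x)"
    by (rule Bochner_Integration.integrable_bound[OF _ _ le]) (use assms(3) in auto)
  show 2: "integrable \<sigma> (\<lambda>x. x)"
    by (rule Bochner_Integration.integrable_bound[OF 1]) auto
  show "integrable \<sigma> (\<lambda>x. x \<bullet> v)" using 2 by simp
qed

text \<open>The normalised Kantorovich problem: with \<open>m\<close> the barycentre of the target and \<open>x\<^sub>0\<close> a point
  of \<open>U\<close>, replacing \<open>x \<bullet> y\<close> by \<open>(x - x\<^sub>0) \<bullet> (y - m)\<close> makes the conjugate of a potential nonnegative.\<close>

locale kantorovich =
  fixes \<sigma> \<tau> :: "'a::euclidean_space measure" and U :: "'a set" and x0 m :: 'a
  assumes nice: "nice_source \<sigma> U" and x0: "x0 \<in> U"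
    and prob_\<tau>: "prob_space \<tau>" and sets_\<tau>: "sets \<tau> = sets borel"
    and mom_\<tau>: "integrable \<tau> (\<lambda>x. (norm x)\<^sup>2)" and m_def: "m = (\<integral>y. y \<partial>\<tau>)"
begin

lemma prob_\<sigma>: "prob_space \<sigma>" and U: "open U" "convex U" "AE x in \<sigma>. x \<in> U"
  and sets_\<sigma>: "sets \<sigma> = sets borel" and mom_\<sigma>: "integrable \<sigma> (\<lambda>x. (norm x)\<^sup>2)"
  using nice nice_source_sets[OF nice] by (simp_all add: nice_source_def)

sublocale S: prob_space \<sigma> by (rule prob_\<sigma>)
sublocale T: prob_space \<tau> by (rule prob_\<tau>)

lemmas [measurable_cong] = sets_\<sigma> sets_\<tau>

lemma U_borel[measurable]: "U \<in> sets borel" using U(1) by simp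

definition K :: "'a \<Rightarrow> 'a \<Rightarrow> real" where "K x y = (x - x0) \<bullet> (y - m)"
text \<open>The Legendre transform of \<psi> for the pairing \<open>K\<close>, shifted by
  \<open>\<psi> x0\<close>. The term at \<open>x0\<close> is zero, so truncating negative terms in
  \<open>ennreal\<close> does not change the supremum, which may be infinite.\<close>

definition conjugate :: "('a \<Rightarrow> real) \<Rightarrow> 'a \<Rightarrow> ennreal" where
  "conjugate \<psi> y = (SUP x\<in>U. ennreal (K x y - \<psi> x + \<psi> x0))"
text \<open>Extension by zero, because \<psi> is arbitrary off U and may fail to be measurable
  there.\<close>

definition on_U :: "('a \<Rightarrow> real) \<Rightarrow> 'a \<Rightarrow> real" where "on_U \<psi> x = indicator U x *\<^sub>R \<psi> x"
definition adm :: "('a \<Rightarrow> real) set" where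
  "adm = {\<psi>. convex_on U \<psi> \<and> (\<forall>x\<in>U. 0 \<le> \<psi> x) \<and> integrable \<sigma> (on_U \<psi>) \<and> (\<integral>\<^sup>+y. conjugate \<psi> y \<partial>\<tau>) < top}"
text \<open>The dual Kantorovich functional. The last term undoes the shift in
  \<open>conjugate\<close> and makes \<open>J\<close> invariant under adding constants to
  \<psi>.\<close>

definition J :: "('a \<Rightarrow> real) \<Rightarrow> real" where
  "J \<psi> = (\<integral>x. on_U \<psi> x \<partial>\<sigma>) + enn2real (\<integral>\<^sup>+y. conjugate \<psi> y \<partial>\<tau>) - \<psi> x0"

lemma conjugate_measurable[measurable]: "conjugate \<psi> \<in> borel_measurable borel"
  unfolding conjugate_def[abs_def] K_def
  by (intro borel_measurable_SUP_continuous continuous_on_ennreal continuous_intros)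

lemma on_U_measurable: "convex_on U \<psi> \<Longrightarrow> on_U \<psi> \<in> borel_measurable borel"
  unfolding on_U_def[abs_def] using convex_on_continuous U
  by (intro borel_measurable_continuous_on_indicator) auto

lemma on_U_in[simp]: "x \<in> U \<Longrightarrow> on_U \<psi> x = \<psi> x" by (simp add: on_U_def)

lemma K_integrable: "integrable \<tau> (\<lambda>y. K x y)" and K_integral: "(\<integral>y. K x y \<partial>\<tau>) = 0"
proof -
  note i = integrable_norm_of_square[OF prob_\<tau> sets_\<tau> mom_\<tau>]
  have K: "K x y = y \<bullet> (x - x0) - m \<bullet> (x - x0)" for y by (simp add: K_def inner_commute inner_diff_right)
  show "integrable \<tau> (\<lambda>y. K x y)" unfolding K using i(3)[of "x - x0"] by simp
  have "(\<integral>y. K x y \<partial>\<tau>) = (\<integral>y. y \<bullet> (x - x0) \<partial>\<tau>) - m \<bullet> (x - x0)"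
    unfolding K using i(3)[of "x - x0"] by (subst Bochner_Integration.integral_diff) (auto simp: T.prob_space)
  also have "(\<integral>y. y \<bullet> (x - x0) \<partial>\<tau>) = m \<bullet> (x - x0)"
    unfolding m_def using i(2) by (rule integral_inner_left)
  finally show "(\<integral>y. K x y \<partial>\<tau>) = 0" by simp
qed

text \<open>The conjugate dominates its term at x, and \<open>K x\<close> has mean zero because m is
  the barycentre of \<open>\<tau>\<close>.\<close>

lemma conjugate_lower:
  assumes "(\<integral>\<^sup>+y. conjugate \<psi> y \<partial>\<tau>) < top" and x: "x \<in> U"
  shows "\<psi> x0 - \<psi> x \<le> enn2real (\<integral>\<^sup>+y. conjugate \<psi> y \<partial>\<tau>)"
proof -
  let ?f = "\<lambda>y. K x y - \<psi> x + \<psi> x0"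
  have i: "integrable \<tau> ?f" using K_integrable by simp
  have "(\<integral>y. ?f y \<partial>\<tau>) = \<psi> x0 - \<psi> x"
    using K_integrable K_integral by (simp add: T.prob_space)
  moreover have "(\<integral>y. ?f y \<partial>\<tau>) \<le> (\<integral>y. max 0 (?f y) \<partial>\<tau>)"
    using i by (intro integral_mono) auto
  moreover have "(\<integral>y. max 0 (?f y) \<partial>\<tau>) = enn2real (\<integral>\<^sup>+y. ennreal (max 0 (?f y)) \<partial>\<tau>)"
    using i by (intro integral_eq_nn_integral) auto
  moreover have "enn2real (\<integral>\<^sup>+y. ennreal (max 0 (?f y)) \<partial>\<tau>) \<le> enn2real (\<integral>\<^sup>+y. conjugate \<psi> y \<partial>\<tau>)"
  proof (rule enn2real_mono)
    show "(\<integral>\<^sup>+y. ennreal (max 0 (?f y)) \<partial>\<tau>) \<le> (\<integral>\<^sup>+y. conjugate \<psi> y \<partial>\<tau>)"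
    proof (rule nn_integral_mono)
      fix y
      have "ennreal (max 0 (?f y)) = ennreal (?f y)" by (simp add: max_def ennreal_neg)
      also have "\<dots> \<le> conjugate \<psi> y" unfolding conjugate_def using x by (rule SUP_upper)
      finally show "ennreal (max 0 (?f y)) \<le> conjugate \<psi> y" .
    qed
  qed fact
  ultimately show ?thesis by linarith
qed

lemma integral_on_U_shift:
  assumes "integrable \<sigma> (on_U \<psi>)"
  shows "integrable \<sigma> (on_U (\<lambda>x. \<psi> x - c))" "(\<integral>x. on_U (\<lambda>x. \<psi> x - c) x \<partial>\<sigma>) = (\<integral>x. on_U \<psi> x \<partial>\<sigma>) - c"
proof -
  have eq: "on_U (\<lambda>x. \<psi> x - c) = (\<lambda>x. on_U \<psi> x - c * indicator U x)"
    by (auto simp: on_U_def algebra_simps)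
  have c: "integrable \<sigma> (\<lambda>x. c * indicator U x :: real)"
    by (intro integrable_mult_right S.integrable_const_bound[of _ 1]) auto
  have "(\<integral>x. c * indicator U x \<partial>\<sigma>) = c"
  proof -
    have "AE x in \<sigma>. c * indicator U x = c" using U(3) by eventually_elim simp
    then have "(\<integral>x. c * indicator U x \<partial>\<sigma>) = (\<integral>x. c \<partial>\<sigma>)"
      by (intro integral_cong_AE) auto
    then show ?thesis by (simp add: S.prob_space)
  qed
  then show "integrable \<sigma> (on_U (\<lambda>x. \<psi> x - c))" "(\<integral>x. on_U (\<lambda>x. \<psi> x - c) x \<partial>\<sigma>) = (\<integral>x. on_U \<psi> x \<partial>\<sigma>) - c"
    unfolding eq using assms c by auto
qed

lemma adm_shift:
  assumes \<psi>: "\<psi> \<in> adm" and c: "\<And>x. x \<in> U \<Longrightarrow> c \<le> \<psi> x"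
  shows "(\<lambda>x. \<psi> x - c) \<in> adm" "J (\<lambda>x. \<psi> x - c) = J \<psi>"
proof -
  have cj: "conjugate (\<lambda>x. \<psi> x - c) = conjugate \<psi>" by (simp add: conjugate_def[abs_def] algebra_simps)
  have i: "integrable \<sigma> (on_U \<psi>)" using \<psi> by (simp add: adm_def)
  have "convex_on U (\<lambda>x. \<psi> x + (- c))"
    using \<psi> U(2) by (intro convex_on_add) (auto simp: adm_def convex_on_const)
  then show "(\<lambda>x. \<psi> x - c) \<in> adm"
    using \<psi> c integral_on_U_shift[OF i] by (auto simp: adm_def cj)
  show "J (\<lambda>x. \<psi> x - c) = J \<psi>"
    using integral_on_U_shift[OF i] by (simp add: J_def cj)
qed

lemma J_lower: "\<psi> \<in> adm \<Longrightarrow> x \<in> U \<Longrightarrow> (\<integral>x. on_U \<psi> x \<partial>\<sigma>) - \<psi> x \<le> J \<psi>"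
  using conjugate_lower[of \<psi> x] by (auto simp: J_def adm_def)

text \<open>After subtracting the infimum of \<psi>, \<open>J_lower\<close> at points that nearly
  attain it bounds the integral of the new potential by \<open>J \<psi>\<close>. So a minimising
  sequence can be taken bounded in L1.\<close>

lemma adm_normalised:
  assumes \<psi>: "\<psi> \<in> adm"
  obtains \<psi>' where "\<psi>' \<in> adm" "J \<psi>' = J \<psi>" "(\<integral>x. on_U \<psi>' x \<partial>\<sigma>) \<le> J \<psi>" "0 \<le> J \<psi>"
proof -
  define c where "c = (INF x\<in>U. \<psi> x)"
  have bb: "bdd_below (\<psi> ` U)" using \<psi> by (auto simp: adm_def intro!: bdd_belowI[of _ 0])
  have c: "c \<le> \<psi> x" if "x \<in> U" for x unfolding c_def using bb that by (rule cINF_lower)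
  define \<psi>' where "\<psi>' = (\<lambda>x. \<psi> x - c)"
  have a: "\<psi>' \<in> adm" "J \<psi>' = J \<psi>" unfolding \<psi>'_def by (rule adm_shift[OF \<psi> c]; simp)+
  have le: "(\<integral>x. on_U \<psi>' x \<partial>\<sigma>) \<le> J \<psi>"
  proof (rule field_le_epsilon)
    fix e :: real assume "e > 0"
    then have "c < c + e" by simp
    then obtain x where x: "x \<in> U" "\<psi> x < c + e"
      unfolding c_def using x0 bb by (subst (asm) cINF_less_iff) auto
    then show "(\<integral>x. on_U \<psi>' x \<partial>\<sigma>) \<le> J \<psi> + e"
      using J_lower[OF a(1) x(1)] a(2) by (simp add: \<psi>'_def)
  qed
  have "0 \<le> (\<integral>x. on_U \<psi>' x \<partial>\<sigma>)"
    using a(1) by (intro integral_nonneg_AE) (auto simp: adm_def on_U_def split: split_indicator)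
  then show ?thesis using a le by (intro that[of \<psi>']) auto
qed

text \<open>Completing the square shows that the conjugate of the quadratic grows at most
  quadratically, so finite second moments suffice.\<close>

lemma adm_nonempty: "(\<lambda>x. (norm x)\<^sup>2 / 2) \<in> adm"
proof -
  let ?\<psi> = "\<lambda>x::'a. (norm x)\<^sup>2 / 2"
  have cv: "convex_on U ?\<psi>"
  proof (rule convex_onI)
    fix t :: real and x y :: 'a assume t: "0 < t" "t < 1"
    have "(1 - t) * ((norm x)\<^sup>2 / 2) + t * ((norm y)\<^sup>2 / 2) - (norm ((1 - t) *\<^sub>R x + t *\<^sub>R y))\<^sup>2 / 2
      = t * (1 - t) * (norm (x - y))\<^sup>2 / 2"
      unfolding power2_norm_eq_inner inner_simps
      by (simp add: inner_commute[of y x] algebra_simps add_divide_distrib diff_divide_distrib)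
    moreover have "0 \<le> t * (1 - t) * (norm (x - y))\<^sup>2 / 2" using t by simp
    ultimately show "(norm ((1 - t) *\<^sub>R x + t *\<^sub>R y))\<^sup>2 / 2 \<le> (1 - t) * ((norm x)\<^sup>2 / 2) + t * ((norm y)\<^sup>2 / 2)"
      by linarith
  qed (rule U(2))
  have "integrable \<sigma> (on_U ?\<psi>)"
    by (rule Bochner_Integration.integrable_bound[OF mom_\<sigma>])
       (use on_U_measurable[OF cv] in \<open>auto simp: on_U_def split: split_indicator\<close>)
  moreover have "(\<integral>\<^sup>+y. conjugate ?\<psi> y \<partial>\<tau>) < top"
  proof -
    let ?B = "\<lambda>y. (norm y)\<^sup>2 + ((norm m)\<^sup>2 + norm x0 * norm m + (norm x0)\<^sup>2) + norm x0 * norm y"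
    have le: "conjugate ?\<psi> y \<le> ennreal (?B y)" for y
      unfolding conjugate_def
    proof (intro SUP_least ennreal_leI)
      fix x
      have "0 \<le> (norm (x - (y - m)))\<^sup>2 / 2" by simp
      also have "\<dots> = (norm x)\<^sup>2 / 2 - x \<bullet> (y - m) + (norm (y - m))\<^sup>2 / 2"
        by (simp add: power2_norm_eq_inner inner_simps inner_commute field_simps)
      finally have 1: "x \<bullet> (y - m) - (norm x)\<^sup>2 / 2 \<le> (norm (y - m))\<^sup>2 / 2" by simp
      have 2: "(norm (y - m))\<^sup>2 / 2 \<le> (norm y)\<^sup>2 + (norm m)\<^sup>2"
      proof -
        have "0 \<le> (norm (y + m))\<^sup>2" by simp
        then show ?thesis by (simp add: power2_norm_eq_inner inner_simps inner_commute algebra_simps)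
      qed
      have 3: "- (x0 \<bullet> (y - m)) \<le> norm x0 * norm y + norm x0 * norm m"
      proof -
        have "- (x0 \<bullet> (y - m)) \<le> norm x0 * norm (y - m)"
          using Cauchy_Schwarz_ineq2[of x0 "y - m"] by linarith
        also have "\<dots> \<le> norm x0 * (norm y + norm m)" by (intro mult_left_mono norm_triangle_ineq4) auto
        finally show ?thesis by (simp add: algebra_simps)
      qed
      have 4: "(norm x0)\<^sup>2 / 2 \<le> (norm x0)\<^sup>2" by simp
      show "K x y - (norm x)\<^sup>2 / 2 + (norm x0)\<^sup>2 / 2 \<le> ?B y"
        using 1 2 3 4 unfolding K_def inner_diff_left by linarith
    qed
    have i: "integrable \<tau> ?B"
      using mom_\<tau> integrable_norm_of_square(1)[OF prob_\<tau> sets_\<tau> mom_\<tau>] by simp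
    have "(\<integral>\<^sup>+y. conjugate ?\<psi> y \<partial>\<tau>) \<le> (\<integral>\<^sup>+y. ennreal (?B y) \<partial>\<tau>)" using le by (rule nn_integral_mono)
    also have "\<dots> < top" using i by (subst nn_integral_eq_integral) auto
    finally show ?thesis .
  qed
  ultimately show ?thesis using cv by (simp add: adm_def)
qed

end

section \<open>Existence of a minimiser of the dual problem\<close>

context kantorovich
begin

text \<open>The direct method: a normalised minimising sequence is bounded in L1, hence locally
  bounded, hence has a subsequence converging pointwise on U. Fatou gives lower semicontinuity of
  both integrals in \<open>J\<close>.\<close>

lemma minimiser_exists:
  obtains \<phi> where "\<phi> \<in> adm" "\<And>\<psi>. \<psi> \<in> adm \<Longrightarrow> J \<phi> \<le> J \<psi>"
proof -
  define m0 where "m0 = Inf (J ` adm)"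
  have bb: "bdd_below (J ` adm)"
    by (rule bdd_belowI[of _ 0]) (auto elim: adm_normalised)
  have m0: "m0 \<le> J \<psi>" if "\<psi> \<in> adm" for \<psi>
    unfolding m0_def using that bb by (auto intro: cINF_lower)
  have m0_nonneg: "0 \<le> m0"
    unfolding m0_def using adm_nonempty by (intro cInf_greatest) (auto elim: adm_normalised)
  have "\<exists>\<psi>. \<psi> \<in> adm \<and> J \<psi> < m0 + 1 / real (Suc n) \<and> (\<integral>x. on_U \<psi> x \<partial>\<sigma>) \<le> J \<psi>" for n
  proof -
    have "Inf (J ` adm) < m0 + 1 / real (Suc n)" by (simp add: m0_def)
    then obtain \<psi> where "\<psi> \<in> adm" "J \<psi> < m0 + 1 / real (Suc n)"
      using adm_nonempty bb by (subst (asm) cInf_less_iff) auto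
    then show ?thesis using adm_normalised[of \<psi>] by metis
  qed
  then obtain s where s: "\<And>n. s n \<in> adm" "\<And>n. J (s n) < m0 + 1 / real (Suc n)"
    "\<And>n. (\<integral>x. on_U (s n) x \<partial>\<sigma>) \<le> J (s n)" by metis
  define C where "C = m0 + 1"
  have C: "0 \<le> C" using m0_nonneg by (simp add: C_def)
  have conv: "convex_on U (s n)" and nonneg: "\<And>x. x \<in> U \<Longrightarrow> 0 \<le> s n x"
    and int: "integrable \<sigma> (on_U (s n))" and cfin: "(\<integral>\<^sup>+y. conjugate (s n) y \<partial>\<tau>) < top" for n
    using s(1)[of n] by (auto simp: adm_def)
  have sC: "(\<integral>x. on_U (s n) x \<partial>\<sigma>) \<le> C" for n
  proof -
    have "1 / real (Suc n) \<le> 1" by simp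
    then show ?thesis using s(2,3)[of n] unfolding C_def by linarith
  qed
  have on_U_nonneg: "0 \<le> on_U (s n) x" for n x
    using nonneg by (simp add: on_U_def split: split_indicator)
  have eq: "(\<integral>\<^sup>+x. ennreal (on_U (s n) x) \<partial>\<sigma>) = ennreal (\<integral>x. on_U (s n) x \<partial>\<sigma>)" for n
    using int on_U_nonneg by (intro nn_integral_eq_integral) auto
  have bd: "\<exists>r>0. \<exists>B. ball x (2 * r) \<subseteq> U \<and> (\<forall>n. \<forall>y\<in>ball x (2 * r). s n y \<le> B)" if xU: "x \<in> U" for x
  proof -
    obtain r R where r: "r > 0" "ball x (2 * r) \<subseteq> U"
      "\<forall>\<psi> C. convex_on U \<psi> \<longrightarrow> (\<forall>x\<in>U. 0 \<le> \<psi> x) \<longrightarrow>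
      (\<integral>\<^sup>+x. ennreal (\<psi> x) * indicator U x \<partial>\<sigma>) \<le> ennreal C \<longrightarrow> 0 \<le> C \<longrightarrow> (\<forall>y\<in>ball x (2 * r). \<psi> y \<le> R * C)"
      using nice_source_convex_bound[OF nice xU] by (elim exE conjE) (rule that)
    have "(\<integral>\<^sup>+x. ennreal (s n x) * indicator U x \<partial>\<sigma>) = (\<integral>\<^sup>+x. ennreal (on_U (s n) x) \<partial>\<sigma>)" for n
      by (intro nn_integral_cong) (auto simp: on_U_def split: split_indicator)
    then have "(\<integral>\<^sup>+x. ennreal (s n x) * indicator U x \<partial>\<sigma>) \<le> ennreal C" for n
      using sC by (simp add: eq ennreal_leI)
    then have "s n y \<le> R * C" if "y \<in> ball x (2 * r)" for n y
      using r(3)[THEN spec, THEN spec, THEN mp, THEN mp, THEN mp, THEN mp, OF conv _ _ C] nonneg that by blast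
    then show ?thesis using r(1,2) by blast
  qed
  have "\<exists>k \<phi>. strict_mono k \<and> (\<forall>x\<in>U. (\<lambda>n. s (k n) x) \<longlonglongrightarrow> \<phi> x) \<and> convex_on U \<phi> \<and> (\<forall>x\<in>U. 0 \<le> \<phi> x)"
    by (rule convex_on_nonneg_locally_bounded_imp_convergent_subseq[OF conv nonneg bd]) blast+
  then obtain k \<phi> where k1: "strict_mono k" "\<forall>x\<in>U. (\<lambda>n. s (k n) x) \<longlonglongrightarrow> \<phi> x"
    "convex_on U \<phi>" "\<forall>x\<in>U. 0 \<le> \<phi> x" by (elim exE conjE)
  note k = k1(1) k1(2)[rule_format] k1(3) k1(4)[rule_format]
  have "(\<integral>x. on_U (s (k n)) x \<partial>\<sigma>) \<in> {0..C}" for n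
    using sC on_U_nonneg by (auto intro!: integral_nonneg_AE)
  \<comment> \<open>Along a second subsequence the first integrals converge to some a. The integrals
    of the conjugates then converge to \<open>m0 - a + \<phi> x0\<close>, and the two separate Fatou
    bounds add up to \<open>m0\<close>.\<close>
  then obtain a l where l: "strict_mono (l :: nat \<Rightarrow> nat)" "((\<lambda>n. \<integral>x. on_U (s (k n)) x \<partial>\<sigma>) \<circ> l) \<longlonglongrightarrow> a"
    using compact_Icc[of 0 C] unfolding compact_def by metis
  define t where "t n = s (k (l n))" for n
  define p where "p n = enn2real (\<integral>\<^sup>+y. conjugate (t n) y \<partial>\<tau>)" for n
  have t: "(\<lambda>n. t n x) \<longlonglongrightarrow> \<phi> x" if "x \<in> U" for x
    using LIMSEQ_subseq_LIMSEQ[OF k(2)[OF that] l(1)] by (simp add: t_def comp_def)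
  have a: "(\<lambda>n. \<integral>x. on_U (t n) x \<partial>\<sigma>) \<longlonglongrightarrow> a" using l(2) by (simp add: t_def comp_def)
  have Jt: "(\<lambda>n. J (t n)) \<longlonglongrightarrow> m0"
  proof (rule real_tendsto_sandwich)
    show "\<forall>\<^sub>F n in sequentially. m0 \<le> J (t n)" using m0 s(1) by (simp add: t_def)
    show "\<forall>\<^sub>F n in sequentially. J (t n) \<le> m0 + 1 / real (Suc n)"
    proof (intro always_eventually allI)
      fix n
      have "n \<le> k (l n)"
        using strict_mono_imp_increasing[OF k(1), of "l n"] strict_mono_imp_increasing[OF l(1), of n] by simp
      then have "1 / real (Suc (k (l n))) \<le> 1 / real (Suc n)" by (intro frac_le) auto
      then show "J (t n) \<le> m0 + 1 / real (Suc n)" using s(2)[of "k (l n)"] by (simp add: t_def)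
    qed
    show "(\<lambda>n. m0 + 1 / real (Suc n)) \<longlonglongrightarrow> m0"
      using tendsto_add[OF tendsto_const LIMSEQ_inverse_real_of_nat, of m0] by (simp add: inverse_eq_divide)
  qed simp
  have p: "p \<longlonglongrightarrow> m0 - a + \<phi> x0"
  proof -
    have "p = (\<lambda>n. J (t n) - (\<integral>x. on_U (t n) x \<partial>\<sigma>) + t n x0)" by (simp add: p_def J_def fun_eq_iff)
    then show ?thesis using Jt a t[OF x0] by (auto intro!: tendsto_intros)
  qed
  have [measurable]: "on_U \<phi> \<in> borel_measurable borel" "on_U (t n) \<in> borel_measurable borel" for n
    using on_U_measurable k(3) conv by (auto simp: t_def)
  have 1: "(\<integral>\<^sup>+x. ennreal (on_U \<phi> x) \<partial>\<sigma>) \<le> ennreal a"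
  proof -
    have "(\<integral>\<^sup>+x. ennreal (on_U \<phi> x) \<partial>\<sigma>) = (\<integral>\<^sup>+x. liminf (\<lambda>n. ennreal (on_U (t n) x)) \<partial>\<sigma>)"
    proof (intro nn_integral_cong)
      fix x
      have "(\<lambda>n. on_U (t n) x) \<longlonglongrightarrow> on_U \<phi> x"
        using t[of x] by (cases "x \<in> U") (auto simp: on_U_def)
      then have "(\<lambda>n. ennreal (on_U (t n) x)) \<longlonglongrightarrow> ennreal (on_U \<phi> x)" by (rule tendsto_ennrealI)
      then show "ennreal (on_U \<phi> x) = liminf (\<lambda>n. ennreal (on_U (t n) x))"
        by (simp add: lim_imp_Liminf)
    qed
    also have "\<dots> \<le> liminf (\<lambda>n. \<integral>\<^sup>+x. ennreal (on_U (t n) x) \<partial>\<sigma>)"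
      by (rule nn_integral_liminf) measurable
    also have "\<dots> = liminf (\<lambda>n. ennreal (\<integral>x. on_U (t n) x \<partial>\<sigma>))" by (simp add: t_def eq)
    also have "\<dots> = ennreal a" using tendsto_ennrealI[OF a] by (simp add: lim_imp_Liminf)
    finally show ?thesis .
  qed
  have 2: "(\<integral>\<^sup>+y. conjugate \<phi> y \<partial>\<tau>) \<le> ennreal (m0 - a + \<phi> x0)"
  proof -
    have "(\<integral>\<^sup>+y. conjugate \<phi> y \<partial>\<tau>) \<le> (\<integral>\<^sup>+y. liminf (\<lambda>n. conjugate (t n) y) \<partial>\<tau>)"
    proof (rule nn_integral_mono)
      fix y
      show "conjugate \<phi> y \<le> liminf (\<lambda>n. conjugate (t n) y)"
        unfolding conjugate_def[of \<phi>]
      proof (rule SUP_least)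
        fix x assume x: "x \<in> U"
        have "(\<lambda>n. ennreal (K x y - t n x + t n x0)) \<longlonglongrightarrow> ennreal (K x y - \<phi> x + \<phi> x0)"
          using t[OF x] t[OF x0] by (intro tendsto_ennrealI tendsto_intros)
        then have "ennreal (K x y - \<phi> x + \<phi> x0) = liminf (\<lambda>n. ennreal (K x y - t n x + t n x0))"
          by (simp add: lim_imp_Liminf)
        also have "\<dots> \<le> liminf (\<lambda>n. conjugate (t n) y)"
          unfolding conjugate_def using x by (intro Liminf_mono always_eventually allI SUP_upper)
        finally show "ennreal (K x y - \<phi> x + \<phi> x0) \<le> liminf (\<lambda>n. conjugate (t n) y)" .
      qed
    qed
    also have "\<dots> \<le> liminf (\<lambda>n. \<integral>\<^sup>+y. conjugate (t n) y \<partial>\<tau>)"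
      by (rule nn_integral_liminf) measurable
    also have "\<dots> = liminf (\<lambda>n. ennreal (p n))"
      using cfin by (simp add: p_def t_def)
    also have "\<dots> = ennreal (m0 - a + \<phi> x0)" using tendsto_ennrealI[OF p] by (simp add: lim_imp_Liminf)
    finally show ?thesis .
  qed
  have a0: "0 \<le> a"
    by (rule LIMSEQ_le_const[OF a]) (auto simp: t_def on_U_nonneg intro!: integral_nonneg_AE)
  have p0: "0 \<le> m0 - a + \<phi> x0" by (rule LIMSEQ_le_const[OF p]) (auto simp: p_def)
  have \<phi>0: "0 \<le> on_U \<phi> x" for x using k(4) by (simp add: on_U_def split: split_indicator)
  have i\<phi>: "integrable \<sigma> (on_U \<phi>)"
    using 1 \<phi>0 by (intro integrableI_nonneg) (auto intro: le_less_trans)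
  have adm: "\<phi> \<in> adm" using k(3,4) i\<phi> 2 by (auto simp: adm_def intro: le_less_trans)
  have "(\<integral>x. on_U \<phi> x \<partial>\<sigma>) \<le> a"
    using 1 a0 \<phi>0 i\<phi> by (subst (asm) nn_integral_eq_integral) auto
  moreover have "enn2real (\<integral>\<^sup>+y. conjugate \<phi> y \<partial>\<tau>) \<le> m0 - a + \<phi> x0"
    using enn2real_mono[OF 2] p0 by simp
  ultimately have "J \<phi> \<le> m0" by (simp add: J_def)
  then show ?thesis using adm m0 by (intro that[of \<phi>]) (auto intro: order_trans)
qed

end

text \<open>The potentials a and b satisfy the duality inequality on U and W, with equality along
  the graph of T. W leaves out the points where the conjugate is infinite. The supergradient clause
  says that a has only one subgradient at x, which is what gives uniqueness and stability of
  T.\<close>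

definition brenier_pair ::
    "'a::euclidean_space measure \<Rightarrow> 'a measure \<Rightarrow> 'a set \<Rightarrow> ('a \<Rightarrow> real) \<Rightarrow> 'a set \<Rightarrow> ('a \<Rightarrow> real) \<Rightarrow> ('a \<Rightarrow> 'a) \<Rightarrow> bool" where
  "brenier_pair \<sigma> \<tau> U a W b T \<longleftrightarrow>
     (AE y in \<tau>. y \<in> W) \<and> (\<forall>x\<in>U. \<forall>y\<in>W. x \<bullet> y \<le> a x + b y) \<and> integrable \<sigma> a \<and> integrable \<tau> b \<and>
     T \<in> borel_measurable borel \<and> distr \<sigma> borel T = \<tau> \<and>
     (AE x in \<sigma>. x \<in> U \<and> T x \<in> W \<and> a x + b (T x) = x \<bullet> T x \<and> supergradient_at U a x (T x))"

lemma convex_on_SUP_affine: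
  fixes g :: "'i \<Rightarrow> 'a::real_vector \<Rightarrow> real"
  assumes U: "convex U" and W: "W \<noteq> {}"
    and aff: "\<And>w t x y. w \<in> W \<Longrightarrow> g w ((1 - t) *\<^sub>R x + t *\<^sub>R y) = (1 - t) * g w x + t * g w y"
    and bdd: "\<And>x. x \<in> U \<Longrightarrow> bdd_above ((\<lambda>w. g w x) ` W)"
  shows "convex_on U (\<lambda>x. SUP w\<in>W. g w x)"
proof (rule convex_onI)
  fix t :: real and x y assume t: "0 < t" "t < 1" and xy: "x \<in> U" "y \<in> U"
  show "(SUP w\<in>W. g w ((1 - t) *\<^sub>R x + t *\<^sub>R y)) \<le> (1 - t) * (SUP w\<in>W. g w x) + t * (SUP w\<in>W. g w y)"
  proof (rule cSUP_least[OF W])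
    fix w assume w: "w \<in> W"
    have "g w x \<le> (SUP w\<in>W. g w x)" "g w y \<le> (SUP w\<in>W. g w y)"
      using w xy bdd by (auto intro: cSUP_upper)
    then show "g w ((1 - t) *\<^sub>R x + t *\<^sub>R y) \<le> (1 - t) * (SUP w\<in>W. g w x) + t * (SUP w\<in>W. g w y)"
      unfolding aff[OF w] using t by (intro add_mono mult_left_mono) auto
  qed
qed (rule U)

section \<open>From the minimiser to the transport map\<close>

context kantorovich
begin

lemma K_affine: "K ((1 - t) *\<^sub>R x + t *\<^sub>R z) y = (1 - t) * K x y + t * K z y"
  by (simp add: K_def inner_simps algebra_simps)

lemma K_diff: "K x' y = K x y + (x' - x) \<bullet> (y - m)"
  by (simp_all add: K_def inner_simps algebra_simps)

text \<open>Let b be the conjugate of the minimiser and a the conjugate of b. Raising b by t on an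
  open set O' lowers a to \<open>A t O'\<close>, and minimality bounds the loss in the integral of a
  by t times the mass of O'. Where S x lies in O', this loss occurs at rate at least 1 as t tends to
  0, so by Fatou the law of S is at most \<open>\<tau>\<close> on open sets.\<close>

lemma brenier_pair_exists: "\<exists>a W b T. brenier_pair \<sigma> \<tau> U a W b T"
proof -
  obtain \<phi> where \<phi>: "\<phi> \<in> adm" and min: "\<And>\<psi>. \<psi> \<in> adm \<Longrightarrow> J \<phi> \<le> J \<psi>"
    using minimiser_exists by blast
  have \<phi>0: "\<And>x. x \<in> U \<Longrightarrow> 0 \<le> \<phi> x" and i\<phi>: "integrable \<sigma> (on_U \<phi>)"
    and fin: "(\<integral>\<^sup>+y. conjugate \<phi> y \<partial>\<tau>) < top" using \<phi> by (auto simp: adm_def)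
  have ind: "0 \<le> t * indicator O' y" "t * indicator O' y \<le> t" if "t \<ge> 0" for t :: real and O' :: "'a set" and y
    using that by (auto simp: indicator_def)
  define W where "W = {y. conjugate \<phi> y < top}"
  define b where "b y = enn2real (conjugate \<phi> y)" for y
  have bm[measurable]: "b \<in> borel_measurable borel" unfolding b_def[abs_def] by measurable
  have W_AE: "AE y in \<tau>. y \<in> W"
    using fin nn_integral_PInf_AE[of "conjugate \<phi>" \<tau>] by (auto simp: W_def less_top elim!: eventually_mono)
  have eb: "conjugate \<phi> y = ennreal (b y)" if "y \<in> W" for y using that by (simp add: b_def W_def)
  have b0: "0 \<le> b y" for y by (simp add: b_def)
  have ib: "integrable \<tau> b" and Ib: "(\<integral>\<^sup>+y. conjugate \<phi> y \<partial>\<tau>) = ennreal (\<integral>y. b y \<partial>\<tau>)"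
  proof -
    have e: "(\<integral>\<^sup>+y. conjugate \<phi> y \<partial>\<tau>) = (\<integral>\<^sup>+y. ennreal (b y) \<partial>\<tau>)"
      using W_AE by (intro nn_integral_cong_AE) (auto simp: eb elim!: eventually_mono)
    then show "integrable \<tau> b" using fin b0 by (intro integrableI_nonneg) auto
    then show "(\<integral>\<^sup>+y. conjugate \<phi> y \<partial>\<tau>) = ennreal (\<integral>y. b y \<partial>\<tau>)"
      unfolding e using b0 by (intro nn_integral_eq_integral) auto
  qed
  have Kb: "K x y - \<phi> x + \<phi> x0 \<le> b y" if "x \<in> U" "y \<in> W" for x y
  proof -
    have "ennreal (K x y - \<phi> x + \<phi> x0) \<le> ennreal (b y)"
      unfolding eb[OF that(2), symmetric] conjugate_def using that(1) by (rule SUP_upper)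
    then show ?thesis using b0 by (subst (asm) ennreal_le_iff) auto
  qed
  have b_least: "y \<in> W \<and> b y \<le> c" if "0 \<le> c" "\<And>x. x \<in> U \<Longrightarrow> K x y - \<phi> x + \<phi> x0 \<le> c" for y c
  proof -
    have le: "conjugate \<phi> y \<le> ennreal c"
      unfolding conjugate_def using that(2) by (intro SUP_least ennreal_leI)
    then have "y \<in> W" using le_less_trans[OF le ennreal_less_top] by (simp add: W_def)
    moreover have "b y \<le> c" using enn2real_mono[OF le] that(1) by (simp add: b_def)
    ultimately show ?thesis ..
  qed
  \<comment> \<open>At y = m the pairing vanishes, which puts m into W with
    \<open>b m \<le> \<phi> x0\<close>. Hence W is nonempty and a is nonnegative.\<close>
  have m: "m \<in> W" "b m \<le> \<phi> x0"
    using b_least[of "\<phi> x0" m] \<phi>0[OF x0] \<phi>0 by (auto simp: K_def)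
  define A where "A t O' x = (SUP y\<in>W. K x y - b y - t * indicator O' y + \<phi> x0)" for t :: real and O' :: "'a set" and x
  have bddA: "bdd_above ((\<lambda>y. K x y - b y - t * indicator O' y + \<phi> x0) ` W)" if "x \<in> U" "t \<ge> 0" for t O' x
  proof (rule bdd_aboveI2)
    fix y assume "y \<in> W"
    then show "K x y - b y - t * indicator O' y + \<phi> x0 \<le> \<phi> x"
      using Kb[OF that(1), of y] ind(1)[OF that(2), of O' y] by linarith
  qed
  define a where "a = A 0 {}"
  have a_def': "a x = (SUP y\<in>W. K x y - b y + \<phi> x0)" for x by (simp add: a_def A_def)
  have aK: "K x y - b y + \<phi> x0 \<le> a x" if "x \<in> U" "y \<in> W" for x y
    unfolding a_def' using bddA[OF that(1), of 0 "{}"] that(2) by (intro cSUP_upper) auto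
  have AK: "K x y - b y - t * indicator O' y + \<phi> x0 \<le> A t O' x" if "x \<in> U" "y \<in> W" "t \<ge> 0" for x y t O'
    unfolding A_def using that(2) by (intro cSUP_upper bddA that)
  have ex_near: "\<exists>y\<in>W. A t O' x - e < K x y - b y - t * indicator O' y + \<phi> x0" if "x \<in> U" "t \<ge> 0" "e > 0" for x t O' e
    using less_cSUP_iff[of W "\<lambda>y. K x y - b y - t * indicator O' y + \<phi> x0" "A t O' x - e"] that bddA m
    by (auto simp: A_def)
  have A_conv: "convex_on U (A t O')" if "t \<ge> 0" for t O'
    unfolding A_def[abs_def]
  proof (rule convex_on_SUP_affine)
    show "K ((1 - s) *\<^sub>R x + s *\<^sub>R z) y - b y - t * indicator O' y + \<phi> x0 =
      (1 - s) * (K x y - b y - t * indicator O' y + \<phi> x0) + s * (K z y - b y - t * indicator O' y + \<phi> x0)" for s x z y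
      unfolding K_affine by (simp add: algebra_simps)
  qed (use U m bddA that in auto)
  have a_le: "a x \<le> \<phi> x" if "x \<in> U" for x
    unfolding a_def'
  proof (rule cSUP_least)
    fix y assume "y \<in> W"
    then show "K x y - b y + \<phi> x0 \<le> \<phi> x" using Kb[OF that, of y] by linarith
  qed (use m in auto)
  have a0: "0 \<le> a x" if "x \<in> U" for x
    using aK[OF that m(1)] m(2) by (simp add: K_def)
  have A_le: "A t O' x \<le> a x" if "x \<in> U" "t \<ge> 0" for t O' x
    unfolding A_def
  proof (rule cSUP_least)
    fix y assume "y \<in> W"
    then show "K x y - b y - t * indicator O' y + \<phi> x0 \<le> a x"
      using aK[OF that(1), of y] ind(1)[OF that(2), of O' y] by linarith
  qed (use m in auto)
  have A_ge: "a x - t \<le> A t O' x" if "x \<in> U" "t \<ge> 0" for t O' x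
  proof -
    have "a x \<le> A t O' x + t"
      unfolding a_def'
    proof (rule cSUP_least)
      fix y assume "y \<in> W"
      then show "K x y - b y + \<phi> x0 \<le> A t O' x + t"
        using AK[OF that(1) _ that(2), of y O'] ind(2)[OF that(2), of O' y] by linarith
    qed (use m in auto)
    then show ?thesis by simp
  qed
  have iA: "integrable \<sigma> (on_U (A t O'))" if "t \<ge> 0" for t O'
  proof (rule Bochner_Integration.integrable_bound[of \<sigma> "\<lambda>x. on_U \<phi> x + t"])
    show "AE x in \<sigma>. norm (on_U (A t O') x) \<le> norm (on_U \<phi> x + t)"
    proof (intro AE_I2)
      fix x
      show "norm (on_U (A t O') x) \<le> norm (on_U \<phi> x + t)"
        using A_le[OF _ that, of x O'] A_ge[OF _ that, of x O'] a0[of x] a_le[of x] \<phi>0[of x] that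
        by (cases "x \<in> U") (auto simp: on_U_def abs_le_iff)
    qed
  qed (use on_U_measurable[OF A_conv[OF that]] i\<phi> in auto)
  have ia: "integrable \<sigma> (on_U a)" unfolding a_def by (rule iA) simp
  have pert: "(\<integral>x. on_U a x \<partial>\<sigma>) - (\<integral>x. on_U (A t O') x \<partial>\<sigma>) \<le> t * measure \<tau> O'"
    if t: "t > 0" and O': "open O'" for t O'
  proof -
    \<comment> \<open>The competitor is \<open>A t O'\<close> raised by t: the former is only known
      to be at least -t, whereas \<open>adm\<close> asks for nonnegative functions.\<close>
    define \<psi> where "\<psi> x = A t O' x - (- t)" for x
    have \<psi>cv: "convex_on U \<psi>"
    proof -
      have "convex_on U (\<lambda>x. A t O' x + t)"
        using A_conv[of t O'] U(2) t by (intro convex_on_add) (auto simp: convex_on_const)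
      then show ?thesis by (simp add: \<psi>_def[abs_def])
    qed
    have \<psi>0: "0 \<le> \<psi> x" if "x \<in> U" for x using A_ge[OF that, of t O'] a0[OF that] t by (simp add: \<psi>_def)
    note sh = integral_on_U_shift[OF iA[of t O'], of "- t"]
    have [measurable]: "O' \<in> sets borel" using O' by simp
    let ?B = "\<lambda>y. b y + t * indicator O' y - \<phi> x0 + A t O' x0"
    have iO: "integrable \<tau> (\<lambda>y. t * indicator O' y :: real)"
      by (intro integrable_mult_right T.integrable_const_bound[of _ 1]) auto
    have B0: "0 \<le> ?B y" if "y \<in> W" for y
      using AK[OF x0 that, of t O'] t by (simp add: K_def)
    have cle: "conjugate \<psi> y \<le> ennreal (?B y)" if "y \<in> W" for y
      unfolding conjugate_def
    proof (intro SUP_least ennreal_leI)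
      fix x assume "x \<in> U"
      then show "K x y - \<psi> x + \<psi> x0 \<le> ?B y"
        using AK[OF _ that, of x t O'] t by (simp add: \<psi>_def)
    qed
    have IB: "(\<integral>y. ?B y \<partial>\<tau>) = (\<integral>y. b y \<partial>\<tau>) + t * measure \<tau> O' - \<phi> x0 + A t O' x0"
      using ib iO by (simp add: T.prob_space)
    have cI: "(\<integral>\<^sup>+y. conjugate \<psi> y \<partial>\<tau>) \<le> ennreal (\<integral>y. ?B y \<partial>\<tau>)"
    proof -
      have "(\<integral>\<^sup>+y. conjugate \<psi> y \<partial>\<tau>) \<le> (\<integral>\<^sup>+y. ennreal (?B y) \<partial>\<tau>)"
        using W_AE by (intro nn_integral_mono_AE) (auto intro: cle elim!: eventually_mono)
      also have "\<dots> = ennreal (\<integral>y. ?B y \<partial>\<tau>)"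
        using ib iO W_AE B0 by (intro nn_integral_eq_integral) (auto elim!: eventually_mono)
      finally show ?thesis .
    qed
    have IB0: "0 \<le> (\<integral>y. ?B y \<partial>\<tau>)"
      using W_AE B0 by (intro integral_nonneg_AE) (auto elim!: eventually_mono)
    have "\<psi> \<in> adm"
      using \<psi>cv \<psi>0 sh(1) t le_less_trans[OF cI ennreal_less_top] by (simp add: adm_def \<psi>_def[abs_def])
    then have "J \<phi> \<le> J \<psi>" by (rule min)
    also have "J \<psi> \<le> ((\<integral>x. on_U (A t O') x \<partial>\<sigma>) + t) + (\<integral>y. ?B y \<partial>\<tau>) - (A t O' x0 + t)"
      using enn2real_mono[OF cI] IB0 sh(2) t by (simp add: J_def \<psi>_def[abs_def])
    also have "J \<phi> = (\<integral>x. on_U \<phi> x \<partial>\<sigma>) + (\<integral>y. b y \<partial>\<tau>) - \<phi> x0"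
      using b0 by (simp add: J_def Ib integral_nonneg_AE)
    finally have "(\<integral>x. on_U \<phi> x \<partial>\<sigma>) \<le> (\<integral>x. on_U (A t O') x \<partial>\<sigma>) + t * measure \<tau> O'"
      unfolding IB by simp
    moreover have "(\<integral>x. on_U a x \<partial>\<sigma>) \<le> (\<integral>x. on_U \<phi> x \<partial>\<sigma>)"
      using a_le by (intro integral_mono ia i\<phi>) (auto simp: on_U_def split: split_indicator)
    ultimately show ?thesis by linarith
  qed
  have acv: "convex_on U a" unfolding a_def by (rule A_conv) simp
  obtain T where Tm[measurable]: "T \<in> borel_measurable borel"
    and T: "AE x in lborel. x \<in> U \<longrightarrow> supergradient_at U a x (T x)"
    by (rule convex_AE_gradient[OF U(1) acv])
  define S where "S x = T x + m" for x
  have [measurable]: "S \<in> borel_measurable borel" unfolding S_def[abs_def] by measurable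
  have sg: "AE x in \<sigma>. supergradient_at U a x (T x)" by (rule nice_source_AE[OF nice T])
  have slope: "a x + (x' - x) \<bullet> (y - m) - (a x - (K x y - b y + \<phi> x0)) \<le> a x'"
    if "x' \<in> U" "y \<in> W" for x x' y
    using aK[OF that] by (simp add: K_diff[of x' y x])
  \<comment> \<open>Near-maximisers \<open>y n\<close> of the supremum defining \<open>a x\<close>
    have slopes that are approximate subgradients, so they converge to \<open>S x\<close>. Each term
    of the conjugate is continuous in y, so the bounds on them pass to the limit: \<open>S x\<close>
    lies in W and attains the supremum.\<close>
  have contact: "S x \<in> W \<and> a x = K x (S x) - b (S x) + \<phi> x0"
    if x: "x \<in> U" and sgx: "supergradient_at U a x (T x)" for x
  proof -
    have "\<exists>y\<in>W. a x - 1 / real (Suc n) < K x y - b y + \<phi> x0" for n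
      using ex_near[OF x, of 0 "1 / real (Suc n)" "{}"] by (simp add: a_def)
    then obtain y where y: "\<And>n. y n \<in> W" "\<And>n. a x - 1 / real (Suc n) < K x (y n) - b (y n) + \<phi> x0" by metis
    have e0: "(\<lambda>n. 1 / real (Suc n)) \<longlonglongrightarrow> 0" using LIMSEQ_inverse_real_of_nat by (simp add: inverse_eq_divide)
    have "(\<lambda>n. y n - m) \<longlonglongrightarrow> T x"
      by (rule supergradient_limit[OF sgx e0]) (use slope[OF _ y(1), of _ x] y(2) in \<open>smt (verit)\<close>)
    then have ylim: "y \<longlonglongrightarrow> S x"
      using tendsto_add[of "\<lambda>n. y n - m" "T x" sequentially "\<lambda>_. m" m] by (simp add: S_def)
    have lsc: "K x' (S x) - \<phi> x' + \<phi> x0 \<le> K x (S x) + \<phi> x0 - a x" if x': "x' \<in> U" for x'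
    proof (rule LIMSEQ_le)
      show "(\<lambda>n. K x' (y n) - \<phi> x' + \<phi> x0) \<longlonglongrightarrow> K x' (S x) - \<phi> x' + \<phi> x0"
        unfolding K_def by (intro tendsto_intros ylim)
      have "(\<lambda>n. K x (y n) + \<phi> x0 - a x + 1 / real (Suc n)) \<longlonglongrightarrow> K x (S x) + \<phi> x0 - a x + 0"
        unfolding K_def by (intro tendsto_intros ylim e0)
      then show "(\<lambda>n. K x (y n) + \<phi> x0 - a x + 1 / real (Suc n)) \<longlonglongrightarrow> K x (S x) + \<phi> x0 - a x" by simp
      show "\<exists>N. \<forall>n\<ge>N. K x' (y n) - \<phi> x' + \<phi> x0 \<le> K x (y n) + \<phi> x0 - a x + 1 / real (Suc n)"
        using Kb[OF x' y(1)] y(2) by (intro exI[of _ 0] allI impI) (smt (verit))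
    qed
    have "0 \<le> K x (S x) + \<phi> x0 - a x"
      using lsc[OF x0] by (simp add: K_def)
    then have "S x \<in> W \<and> b (S x) \<le> K x (S x) + \<phi> x0 - a x" using lsc by (rule b_least)
    moreover from this have "K x (S x) - b (S x) + \<phi> x0 \<le> a x" using aK[OF x] by blast
    ultimately show ?thesis by auto
  qed
  have push: "emeasure \<sigma> (S -` O') \<le> emeasure \<tau> O'" if O': "open O'" for O'
  proof -
    have [measurable]: "O' \<in> sets borel" using O' by simp
    define t where "t n = 1 / real (Suc n)" for n
    have t: "t n > 0" for n by (simp add: t_def)
    have t0: "t \<longlonglongrightarrow> 0" unfolding t_def using LIMSEQ_inverse_real_of_nat by (simp add: inverse_eq_divide)
    define D where "D n x = (on_U a x - on_U (A (t n) O') x) / t n" for n x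
    have [measurable]: "D n \<in> borel_measurable borel" for n
      unfolding D_def[abs_def] using on_U_measurable[OF acv] on_U_measurable[OF A_conv, of "t n" O'] t[of n]
      by simp
    have D0: "0 \<le> D n x" for n x
      using A_le[of x "t n" O'] t[of n] by (cases "x \<in> U") (auto simp: D_def on_U_def)
    have lim: "indicator (S -` O') x \<le> liminf (\<lambda>n. ennreal (D n x))"
      if x: "x \<in> U" and sgx: "supergradient_at U a x (T x)" for x
    proof (cases "S x \<in> O'")
      case True
      \<comment> \<open>The tolerance is the square of \<open>t n\<close>, so that it still vanishes
        after the division by \<open>t n\<close> in D.\<close>
      have "\<exists>y\<in>W. A (t n) O' x - (t n)\<^sup>2 < K x y - b y - t n * indicator O' y + \<phi> x0" for n
        using t[of n] by (intro ex_near x) auto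
      then obtain y where y: "\<And>n. y n \<in> W"
        "\<And>n. A (t n) O' x - (t n)\<^sup>2 < K x (y n) - b (y n) - t n * indicator O' (y n) + \<phi> x0" by metis
      have gap: "a x - (K x (y n) - b (y n) + \<phi> x0) \<le> t n + (t n)\<^sup>2" for n
        using y(2)[of n] A_ge[OF x, of "t n" O'] t[of n] ind(1)[of "t n" O' "y n"] by linarith
      have "(\<lambda>n. t n + (t n)\<^sup>2) \<longlonglongrightarrow> 0 + 0\<^sup>2" by (intro tendsto_intros t0)
      then have e0: "(\<lambda>n. t n + (t n)\<^sup>2) \<longlonglongrightarrow> 0" by simp
      have "(\<lambda>n. y n - m) \<longlonglongrightarrow> T x"
        by (rule supergradient_limit[OF sgx e0]) (use slope[OF _ y(1), of _ x] gap in \<open>smt (verit)\<close>)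
      then have "y \<longlonglongrightarrow> S x"
        using tendsto_add[of "\<lambda>n. y n - m" "T x" sequentially "\<lambda>_. m" m] by (simp add: S_def)
      then have ev: "\<forall>\<^sub>F n in sequentially. y n \<in> O'"
        using O' True by (rule topological_tendstoD)
      have ev2: "\<forall>\<^sub>F n in sequentially. 1 - t n \<le> D n x"
        using ev
      proof eventually_elim
        case (elim n)
        have "A (t n) O' x - (t n)\<^sup>2 < a x - t n"
          using y(2)[of n] aK[OF x y(1)[of n]] elim by simp
        then have "t n * (1 - t n) \<le> a x - A (t n) O' x" by (simp add: power2_eq_square algebra_simps)
        then show ?case using x t[of n] by (simp add: D_def field_simps)
      qed
      have "(\<lambda>n. ennreal (1 - t n)) \<longlonglongrightarrow> ennreal (1 - 0)" by (intro tendsto_intros t0)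
      then have "1 = liminf (\<lambda>n. ennreal (1 - t n))" by (simp add: lim_imp_Liminf)
      also have "\<dots> \<le> liminf (\<lambda>n. ennreal (D n x))"
        using ev2 by (intro Liminf_mono) (auto intro: ennreal_leI elim!: eventually_mono)
      finally show ?thesis using True by simp
    qed simp
    have "emeasure \<sigma> (S -` O') = (\<integral>\<^sup>+x. indicator (S -` O') x \<partial>\<sigma>)"
      using measurable_sets_borel[of S borel O'] by (subst nn_integral_indicator) auto
    also have "\<dots> \<le> (\<integral>\<^sup>+x. liminf (\<lambda>n. ennreal (D n x)) \<partial>\<sigma>)"
      using U(3) sg by (intro nn_integral_mono_AE) (auto intro: lim elim!: eventually_elim2)
    also have "\<dots> \<le> liminf (\<lambda>n. \<integral>\<^sup>+x. ennreal (D n x) \<partial>\<sigma>)"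
      by (rule nn_integral_liminf) measurable
    also have "\<dots> \<le> liminf (\<lambda>n. emeasure \<tau> O')"
    proof (intro Liminf_mono always_eventually allI)
      fix n
      have iD: "integrable \<sigma> (D n)"
        unfolding D_def[abs_def] using ia iA[of "t n" O'] t[of n] by simp
      have "(\<integral>\<^sup>+x. ennreal (D n x) \<partial>\<sigma>) = ennreal (\<integral>x. D n x \<partial>\<sigma>)"
        using iD D0 by (intro nn_integral_eq_integral) auto
      also have "(\<integral>x. D n x \<partial>\<sigma>) = ((\<integral>x. on_U a x \<partial>\<sigma>) - (\<integral>x. on_U (A (t n) O') x \<partial>\<sigma>)) / t n"
        unfolding D_def using ia iA[of "t n" O'] t[of n] by simp
      also have "\<dots> \<le> measure \<tau> O'"
        using pert[OF t O', of n] t[of n] by (simp add: field_simps)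
      finally show "(\<integral>\<^sup>+x. ennreal (D n x) \<partial>\<sigma>) \<le> emeasure \<tau> O'"
        by (simp add: T.emeasure_eq_measure ennreal_leI)
    qed
    finally show ?thesis by (simp add: Liminf_const)
  qed
  have distr: "distr \<sigma> borel S = \<tau>"
  proof (rule distr_eqI_open)
    show "prob_space (distr \<sigma> borel S)" by (rule S.prob_space_distr) simp
    fix O' :: "'a set" assume O': "open O'"
    have "emeasure (distr \<sigma> borel S) O' = emeasure \<sigma> (S -` O' \<inter> space \<sigma>)"
      using O' by (intro emeasure_distr) auto
    also have "S -` O' \<inter> space \<sigma> = S -` O'" using sets_eq_imp_space_eq[OF sets_\<sigma>] by simp
    finally show "emeasure (distr \<sigma> borel S) O' \<le> emeasure \<tau> O'" using push[OF O'] by simp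
  qed (use prob_\<tau> sets_\<tau> in auto)
  \<comment> \<open>The inner product differs from \<open>K x y\<close> by terms in x alone and in y
    alone; they are moved into the potentials to undo the normalisation.\<close>
  define a' where "a' x = on_U a x + (x \<bullet> m - \<phi> x0 - x0 \<bullet> m)" for x
  define b' where "b' y = b y + y \<bullet> x0" for y
  have Kxy: "x \<bullet> y = K x y + x \<bullet> m + y \<bullet> x0 - x0 \<bullet> m" for x y
    by (simp add: K_def inner_simps inner_commute algebra_simps)
  have "brenier_pair \<sigma> \<tau> U a' W b' S"
    unfolding brenier_pair_def
  proof (intro conjI ballI)
    show "x \<bullet> y \<le> a' x + b' y" if "x \<in> U" "y \<in> W" for x y
      using aK[OF that] that Kxy[of x y] by (simp add: a'_def b'_def)
    show "integrable \<sigma> a'"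
      unfolding a'_def[abs_def] using ia integrable_norm_of_square(3)[OF prob_\<sigma> sets_\<sigma> mom_\<sigma>, of m] by simp
    show "integrable \<tau> b'"
      unfolding b'_def[abs_def] using ib integrable_norm_of_square(3)[OF prob_\<tau> sets_\<tau> mom_\<tau>, of x0] by simp
    show "AE x in \<sigma>. x \<in> U \<and> S x \<in> W \<and> a' x + b' (S x) = x \<bullet> S x \<and> supergradient_at U a' x (S x)"
      using U(3) sg
    proof eventually_elim
      case (elim x)
      have "supergradient_at U a' x (S x)"
        unfolding supergradient_at_def
      proof (intro allI impI)
        fix \<eta> :: real assume "\<eta> > 0"
        then obtain \<delta> where \<delta>: "\<delta> > 0" "\<And>h. norm h \<le> \<delta> \<Longrightarrow> x + h \<in> U \<and> a (x + h) \<le> a x + h \<bullet> T x + \<eta> * norm h"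
          using elim(2) unfolding supergradient_at_def by blast
        then show "\<exists>\<delta>>0. \<forall>h. norm h \<le> \<delta> \<longrightarrow> x + h \<in> U \<and> a' (x + h) \<le> a' x + h \<bullet> S x + \<eta> * norm h"
        proof (intro exI[of _ \<delta>] conjI allI impI)
          fix h :: 'a assume "norm h \<le> \<delta>"
          then have h: "x + h \<in> U" "a (x + h) \<le> a x + h \<bullet> T x + \<eta> * norm h" using \<delta>(2) by auto
          show "x + h \<in> U" by (rule h)
          show "a' (x + h) \<le> a' x + h \<bullet> S x + \<eta> * norm h"
            using h(2) unfolding a'_def on_U_in[OF h(1)] on_U_in[OF elim(1)] S_def inner_add_left inner_add_right
            by linarith
        qed
      qed
      moreover have "a' x + b' (S x) = x \<bullet> S x"
        using contact[OF elim] Kxy[of x "S x"] unfolding a'_def b'_def on_U_in[OF elim(1)] by linarith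
      ultimately show ?case using contact[OF elim] elim(1) by blast
    qed
  qed (use W_AE distr in auto)
  then show ?thesis by blast
qed

end

theorem brenier_exists:
  fixes \<sigma> \<tau> :: "'a::euclidean_space measure"
  assumes "nice_source \<sigma> U" "prob_space \<tau>" "sets \<tau> = sets borel" "integrable \<tau> (\<lambda>x. (norm x)\<^sup>2)"
  shows "\<exists>a W b T. brenier_pair \<sigma> \<tau> U a W b T"
proof -
  obtain x0 where "x0 \<in> U" using assms(1) by (auto simp: nice_source_def)
  then have "kantorovich \<sigma> \<tau> U x0 (\<integral>y. y \<partial>\<tau>)"
    using assms by (intro kantorovich.intro) simp_all
  then show ?thesis by (rule kantorovich.brenier_pair_exists)
qed

section \<open>Entropy inequality for Laguerre cells\<close>

text \<open>Strong log-concavity in midpoint form, squared to avoid roots. The constant \<kappa> / 4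
  makes it an equality for the density exp (- \<kappa> |x|^2 / 2) up to normalisation.\<close>

definition slc_density :: "real \<Rightarrow> ('a::euclidean_space \<Rightarrow> ennreal) \<Rightarrow> bool" where
  "slc_density \<kappa> d \<longleftrightarrow> d \<in> borel_measurable borel \<and>
     (\<forall>y z. d y * d z * ennreal (exp (\<kappa> * (norm (y - z))\<^sup>2 / 4)) \<le> (d ((1/2) *\<^sub>R (y + z)))\<^sup>2)"

lemma AE_lborel_not_hyperplane:
  fixes v :: "'a::euclidean_space"
  assumes "v \<noteq> 0"
  shows "AE y in lborel. v \<bullet> y \<noteq> c"
proof -
  have "negligible {y. v \<bullet> y = c}" using assms by (intro negligible_hyperplane) auto
  then have "{y. v \<bullet> y = c} \<in> null_sets lebesgue" by (simp add: negligible_iff_null_sets)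
  moreover have "closed {y. v \<bullet> y = c}" by (rule closed_hyperplane)
  ultimately have "{y. v \<bullet> y = c} \<in> null_sets lborel"
    by (auto simp: null_sets_def)
  then show ?thesis by (intro AE_I'[of "{y. v \<bullet> y = c}"]) auto
qed

text \<open>From ln u <= u - 1 at u = b / a. Integrated, it is the Gibbs inequality for masses that
  need not be normalised.\<close>

lemma xlogx_tangent:
  fixes a b :: real
  assumes "a > 0" "b > 0"
  shows "a * ln a \<ge> a * ln b + a - b"
proof -
  have "ln (b / a) \<le> b / a - 1" using assms by (intro ln_le_minus_one) auto
  then have "a * (ln b - ln a) \<le> a * (b / a - 1)" using assms by (intro mult_left_mono) (auto simp: ln_div)
  then show ?thesis using assms by (simp add: algebra_simps)
qed

text \<open>A bound independent of the step s, for dominated convergence of difference quotients of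
  exponentials.\<close>

lemma exp_difference_quotient_bound:
  fixes u :: real
  assumes "s > 0" "s \<le> 1"
  shows "\<bar>(exp (s * u) - 1) / s\<bar> \<le> exp (2 * \<bar>u\<bar>)"
proof -
  have 1: "\<bar>exp v - 1\<bar> \<le> \<bar>v\<bar> * exp \<bar>v\<bar>" for v :: real
  proof (cases "v \<ge> 0")
    case True
    have "1 - v \<le> exp (- v)" using exp_ge_add_one_self[of "- v"] by simp
    then have "(1 - v) * exp v \<le> exp (- v) * exp v" by (intro mult_right_mono) auto
    then show ?thesis using True by (simp add: exp_minus algebra_simps)
  next
    case False
    have "1 - exp v \<le> - v" using exp_ge_add_one_self[of v] by linarith
    also have "- v \<le> - v * exp (- v)" using False mult_left_mono[of 1 "exp (- v)" "- v"] by simp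
    finally show ?thesis using False by simp
  qed
  have "\<bar>exp (s * u) - 1\<bar> \<le> (s * \<bar>u\<bar>) * exp (s * \<bar>u\<bar>)"
    using 1[of "s * u"] assms by (simp add: abs_mult)
  also have "\<dots> \<le> (s * \<bar>u\<bar>) * exp \<bar>u\<bar>" using assms by (intro mult_left_mono) (auto intro: mult_left_le_one_le)
  also have "\<dots> \<le> s * (exp \<bar>u\<bar> * exp \<bar>u\<bar>)"
  proof -
    have "\<bar>u\<bar> \<le> exp \<bar>u\<bar>" using exp_ge_add_one_self[of "\<bar>u\<bar>"] by linarith
    then show ?thesis using assms by (simp add: mult.assoc mult_left_mono mult_right_mono)
  qed
  also have "exp \<bar>u\<bar> * exp \<bar>u\<bar> = exp (2 * \<bar>u\<bar>)" by (simp add: exp_add[symmetric])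
  finally show ?thesis using assms by (simp add: abs_divide field_simps)
qed

section \<open>Exponential integrals over Laguerre cells\<close>

locale laguerre =
  fixes \<mu> :: "'a::euclidean_space measure" and d and \<kappa> :: real and X :: "'a set"
  assumes prob: "prob_space \<mu>" and \<mu>: "\<mu> = density lborel d" and slc: "slc_density \<kappa> d"
    and \<kappa>: "\<kappa> > 0" and exp_mom: "\<And>L. integrable \<mu> (\<lambda>y. exp (L * norm y))"
    and X: "finite X" "X \<noteq> {}"
begin

sublocale prob_space \<mu> by (rule prob)

lemma d_measurable[measurable]: "d \<in> borel_measurable borel" using slc by (simp add: slc_density_def)

lemma sets_\<mu>[measurable_cong]: "sets \<mu> = sets borel" by (simp add: \<mu>)

text \<open>In semidiscrete transport onto the finite set X, this is the region sent to x when w is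
  the dual potential on X. Distinct cells overlap only in hyperplanes.\<close>

definition cell :: "('a \<Rightarrow> real) \<Rightarrow> 'a \<Rightarrow> 'a set" where
  "cell w x = {y. \<forall>x'\<in>X. x' \<bullet> y - w x' \<le> x \<bullet> y - w x}"

lemma cell_measurable[measurable]: "cell w x \<in> sets borel"
proof -
  have "cell w x = (\<Inter>x'\<in>X. {y. x' \<bullet> y - w x' \<le> x \<bullet> y - w x})" by (auto simp: cell_def)
  also have "closed \<dots>" by (intro closed_INT ballI closed_Collect_le continuous_intros)
  finally show ?thesis by simp
qed

lemma AE_generic_lborel: "AE y in lborel. \<forall>x\<in>X. \<forall>x'\<in>X. x \<noteq> x' \<longrightarrow> x \<bullet> y - w x \<noteq> x' \<bullet> y - w x'"
proof -
  have "AE y in lborel. x \<noteq> x' \<longrightarrow> x \<bullet> y - w x \<noteq> x' \<bullet> y - w x'" for x x'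
  proof (cases "x = x'")
    case False
    then have "AE y in lborel. (x - x') \<bullet> y \<noteq> w x - w x'" by (intro AE_lborel_not_hyperplane) auto
    then show ?thesis by eventually_elim (auto simp: inner_diff_left)
  qed auto
  then show ?thesis
    using X by (simp add: AE_ball_countable countable_finite)
qed

lemma AE_generic: "AE y in \<mu>. \<forall>x\<in>X. \<forall>x'\<in>X. x \<noteq> x' \<longrightarrow> x \<bullet> y - w x \<noteq> x' \<bullet> y - w x'"
  using AE_generic_lborel[of w] unfolding \<mu> by (subst AE_density) (auto elim!: eventually_mono)

lemma unique_cell:
  assumes "\<forall>x\<in>X. \<forall>x'\<in>X. x \<noteq> x' \<longrightarrow> x \<bullet> y - w x \<noteq> x' \<bullet> y - w x'"
  obtains z where "z \<in> X" "\<And>x. x \<in> X \<Longrightarrow> x \<noteq> z \<Longrightarrow> x \<bullet> y - w x < z \<bullet> y - w z"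
    "\<And>x. x \<in> X \<Longrightarrow> y \<in> cell w x \<longleftrightarrow> x = z"
proof -
  define M where "M = Max ((\<lambda>x. x \<bullet> y - w x) ` X)"
  have "M \<in> (\<lambda>x. x \<bullet> y - w x) ` X" unfolding M_def using X by (intro Max_in) auto
  then obtain z where z: "z \<in> X" "M = z \<bullet> y - w z" by auto
  have le: "x \<bullet> y - w x \<le> z \<bullet> y - w z" if "x \<in> X" for x
    unfolding z(2)[symmetric] M_def using that X by (intro Max_ge) auto
  have less: "x \<bullet> y - w x < z \<bullet> y - w z" if "x \<in> X" "x \<noteq> z" for x
    using le[OF that(1)] assms that z(1) by force
  have "y \<in> cell w x \<longleftrightarrow> x = z" if "x \<in> X" for x
    using le less[OF that] z(1) by (force simp: cell_def)
  with z(1) less show ?thesis by (rule that)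
qed

text \<open>The quantifier over g stands inside, so that one z describes all sums over cells at y at
  once.\<close>

lemma sum_cell:
  assumes "\<forall>x\<in>X. \<forall>x'\<in>X. x \<noteq> x' \<longrightarrow> x \<bullet> y - w x \<noteq> x' \<bullet> y - w x'"
  shows "\<exists>z\<in>X. \<forall>g::'a \<Rightarrow> real. (\<Sum>x\<in>X. indicator (cell w x) y * g x) = g z"
proof -
  obtain z where z: "z \<in> X" "\<And>x. x \<in> X \<Longrightarrow> y \<in> cell w x \<longleftrightarrow> x = z"
    using unique_cell[OF assms] by metis
  have "(\<Sum>x\<in>X. indicator (cell w x) y * g x) = g z" for g :: "'a \<Rightarrow> real"
  proof -
    have "(\<Sum>x\<in>X. indicator (cell w x) y * g x) = (\<Sum>x\<in>X. if x = z then g x else 0)"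
      using z(2) by (intro sum.cong) (auto simp: indicator_def)
    then show ?thesis using z(1) X by simp
  qed
  then show ?thesis using z(1) by blast
qed

text \<open>The defining inequalities are affine jointly in the point and the weights. This is what
  lets Prekopa-Leindler act on cells with different weights.\<close>

lemma cell_mid:
  assumes "y \<in> cell w x" "z \<in> cell w' x"
  shows "(1/2) *\<^sub>R (y + z) \<in> cell (\<lambda>x. (w x + w' x) / 2) x"
  unfolding cell_def
proof safe
  fix x' assume "x' \<in> X"
  then have "x' \<bullet> y - w x' \<le> x \<bullet> y - w x" "x' \<bullet> z - w' x' \<le> x \<bullet> z - w' x"
    using assms by (auto simp: cell_def)
  then show "x' \<bullet> ((1/2) *\<^sub>R (y + z)) - (w x' + w' x') / 2 \<le> x \<bullet> ((1/2) *\<^sub>R (y + z)) - (w x + w' x) / 2"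
    by (simp add: inner_add_right field_simps)
qed

text \<open>The Laplace transform of \<open>\<mu>\<close> restricted to a cell; at l = 0 it is the
  mass of the cell.\<close>

definition Z :: "'a \<Rightarrow> ('a \<Rightarrow> real) \<Rightarrow> 'a \<Rightarrow> real" where
  "Z l w x = (\<integral>y. indicator (cell w x) y * exp (l \<bullet> y) \<partial>\<mu>)"

lemma exp_integrable: "integrable \<mu> (\<lambda>y. exp (l \<bullet> y))"
proof (rule Bochner_Integration.integrable_bound[OF exp_mom[of "norm l"]])
  show "AE y in \<mu>. norm (exp (l \<bullet> y)) \<le> norm (exp (norm l * norm y))"
    using Cauchy_Schwarz_ineq2 by (auto simp: abs_le_iff intro!: AE_I2)
qed simp

lemma cell_exp_integrable: "integrable \<mu> (\<lambda>y. indicator (cell w x) y * exp (l \<bullet> y))"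
  using integrable_mult_indicator[of "cell w x" \<mu> "\<lambda>y. exp (l \<bullet> y)"] exp_integrable by simp

lemma cell_integrable: "integrable \<mu> (\<lambda>y. indicator (cell w x) y :: real)"
  using cell_exp_integrable[of w x 0] by simp

lemma Z_nn: "ennreal (Z l w x * c) = (\<integral>\<^sup>+y. ennreal (indicator (cell w x) y * exp (l \<bullet> y) * c) * d y \<partial>lborel)"
  if "c \<ge> 0"
proof -
  have "ennreal (Z l w x * c) = (\<integral>\<^sup>+y. ennreal (indicator (cell w x) y * exp (l \<bullet> y) * c) \<partial>\<mu>)"
    unfolding Z_def using cell_exp_integrable[of w x l] that
    by (subst nn_integral_eq_integral) auto
  also have "\<dots> = (\<integral>\<^sup>+y. d y * ennreal (indicator (cell w x) y * exp (l \<bullet> y) * c) \<partial>lborel)"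
    unfolding \<mu> by (rule nn_integral_density) measurable
  finally show ?thesis by (simp add: mult.commute)
qed

text \<open>The reciprocal of the Laplace transform of the centred Gaussian with covariance 1 /
  \<kappa> times the identity. This factor compensates the log-convexity of \<open>Z\<close> in
  l.\<close>

definition G :: "'a \<Rightarrow> real" where "G l = exp (- (norm l)\<^sup>2 / (2 * \<kappa>))"

lemma Z_nonneg: "0 \<le> Z l w x" unfolding Z_def by (intro integral_nonneg_AE) auto

text \<open>The product of \<open>Z\<close> and \<open>G\<close> is midpoint log-concave jointly in
  l and w. The exponentials produce the cross term (l - l') . (y - z) / 2, the factors
  \<open>G\<close> contribute - |l - l'|^2 / (4 \<kappa>), and strong log-concavity allows \<kappa>
  |y - z|^2 / 4, so the balance is a perfect square.\<close>

lemma Z_midpoint: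
  "(Z l w x * G l) * (Z l' w' x * G l')
    \<le> (Z ((1/2) *\<^sub>R (l + l')) (\<lambda>x. (w x + w' x) / 2) x * G ((1/2) *\<^sub>R (l + l')))\<^sup>2"
proof -
  let ?l = "(1/2) *\<^sub>R (l + l')" and ?w = "\<lambda>x. (w x + w' x) / 2"
  let ?f = "\<lambda>l w y. ennreal (indicator (cell w x) y * exp (l \<bullet> y) * G l) * d y"
  have G0: "0 \<le> G l" for l by (simp add: G_def)
  have m[measurable]: "?f l w \<in> borel_measurable borel" for l w by measurable
  have "(\<integral>\<^sup>+y. ?f l w y \<partial>lborel) * (\<integral>\<^sup>+y. ?f l' w' y \<partial>lborel) \<le> (\<integral>\<^sup>+y. ?f ?l ?w y \<partial>lborel)\<^sup>2"
  proof (rule prekopa_leindler)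
    fix y z
    show "?f l w y * ?f l' w' z \<le> (?f ?l ?w ((1/2) *\<^sub>R (y + z)))\<^sup>2"
    proof (cases "y \<in> cell w x \<and> z \<in> cell w' x")
      case True
      let ?e = "exp (l \<bullet> y) * G l * (exp (l' \<bullet> z) * G l')"
      let ?m = "exp (?l \<bullet> ((1/2) *\<^sub>R (y + z))) * G ?l"
      have le: "?e \<le> ?m\<^sup>2 * exp (\<kappa> * (norm (y - z))\<^sup>2 / 4)"
      proof -
        have "0 \<le> (norm (sqrt \<kappa> *\<^sub>R (y - z) - (1 / sqrt \<kappa>) *\<^sub>R (l - l')))\<^sup>2" by simp
        also have "\<dots> = \<kappa> * ((y - z) \<bullet> (y - z)) - 2 * ((y - z) \<bullet> (l - l')) + ((l - l') \<bullet> (l - l')) / \<kappa>"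
        proof -
          have s: "sqrt \<kappa> * sqrt \<kappa> = \<kappa>" "sqrt \<kappa> \<noteq> 0" using \<kappa> by auto
          have "(norm (sqrt \<kappa> *\<^sub>R (y - z) - (1 / sqrt \<kappa>) *\<^sub>R (l - l')))\<^sup>2 =
            (sqrt \<kappa> * sqrt \<kappa>) * ((y - z) \<bullet> (y - z)) - 2 * (sqrt \<kappa> * (1 / sqrt \<kappa>)) * ((y - z) \<bullet> (l - l'))
            + (1 / sqrt \<kappa> * (1 / sqrt \<kappa>)) * ((l - l') \<bullet> (l - l'))"
            unfolding power2_norm_eq_inner
            by (simp only: inner_diff_left[of "sqrt \<kappa> *\<^sub>R _"] inner_diff_right[of _ "sqrt \<kappa> *\<^sub>R _"]
               inner_scaleR_left inner_scaleR_right inner_commute[of "l - l'" "y - z"]) algebra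
          then show ?thesis using s by simp
        qed
        finally have "l \<bullet> y + - (norm l)\<^sup>2 / (2 * \<kappa>) + (l' \<bullet> z + - (norm l')\<^sup>2 / (2 * \<kappa>))
          \<le> 2 * (?l \<bullet> ((1/2) *\<^sub>R (y + z)) + - (norm ?l)\<^sup>2 / (2 * \<kappa>)) + \<kappa> * (norm (y - z))\<^sup>2 / 4"
        proof -
          define q where "q = 1 / (2 * \<kappa>)"
          have q: "c / (2 * \<kappa>) = q * c" "c / \<kappa> = 2 * (q * c)" for c by (auto simp: q_def)
          assume "0 \<le> \<kappa> * ((y - z) \<bullet> (y - z)) - 2 * ((y - z) \<bullet> (l - l')) + ((l - l') \<bullet> (l - l')) / \<kappa>"
          then show ?thesis
            unfolding power2_norm_eq_inner q
            by (simp add: inner_simps inner_commute algebra_simps add_divide_distrib diff_divide_distrib)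
        qed
        then show ?thesis
          by (simp add: G_def exp_add[symmetric] power2_eq_square add_ac)
      qed
      have "?f l w y * ?f l' w' z = ennreal ?e * (d y * d z)"
        using True G0 by (simp add: ennreal_mult mult_ac)
      also have "\<dots> \<le> ennreal (?m\<^sup>2 * exp (\<kappa> * (norm (y - z))\<^sup>2 / 4)) * (d y * d z)"
        by (intro mult_right_mono ennreal_leI le) auto
      also have "\<dots> = ennreal (?m\<^sup>2) * (d y * d z * ennreal (exp (\<kappa> * (norm (y - z))\<^sup>2 / 4)))"
        by (simp add: ennreal_mult mult_ac)
      also have "\<dots> \<le> ennreal (?m\<^sup>2) * (d ((1/2) *\<^sub>R (y + z)))\<^sup>2"
        using slc by (intro mult_left_mono) (auto simp: slc_density_def)
      also have "\<dots> = (?f ?l ?w ((1/2) *\<^sub>R (y + z)))\<^sup>2"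
        using cell_mid[of y w x z w'] True G0 by (simp add: power_mult_distrib ennreal_power)
      finally show ?thesis .
    qed auto
  qed (rule m)+
  then have "ennreal (Z l w x * G l) * ennreal (Z l' w' x * G l') \<le> (ennreal (Z ?l ?w x * G ?l))\<^sup>2"
    by (simp add: Z_nn[OF G0])
  moreover have "ennreal a * ennreal b \<le> (ennreal c)\<^sup>2 \<Longrightarrow> a * b \<le> c\<^sup>2" if "0 \<le> a" "0 \<le> b" "0 \<le> c" for a b c
    using that by (simp add: ennreal_mult[symmetric] ennreal_power ennreal_le_iff)
  ultimately show ?thesis using Z_nonneg G0 by simp
qed


text \<open>The slope of a concave function from its starting point grows as the step shrinks.
  Repeated midpoints between (0, w0) and (l, w1) give this at dyadic steps from midpoint
  log-concavity alone, and each midpoint inherits the positivity that the logarithm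
  requires.\<close>

lemma Z_dyadic:
  assumes pos0: "Z 0 w0 x > 0" and pos1: "Z l w1 x > 0"
  defines "lk \<equiv> \<lambda>k. (1 / 2 ^ k) *\<^sub>R l" and "wk \<equiv> \<lambda>k x. w0 x + (w1 x - w0 x) / 2 ^ k"
  shows "Z (lk k) (wk k) x > 0 \<and>
    ln (Z l w1 x * G l) - ln (Z 0 w0 x) \<le> 2 ^ k * (ln (Z (lk k) (wk k) x * G (lk k)) - ln (Z 0 w0 x))"
proof (induction k)
  case 0
  have "wk 0 = w1" by (auto simp: wk_def)
  then show ?case using pos1 by (simp add: lk_def)
next
  case (Suc k)
  have Gp: "G l > 0" for l by (simp add: G_def)
  have lmid: "(1/2) *\<^sub>R (0 + lk k) = lk (Suc k)" by (simp add: lk_def)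
  have wmid: "(\<lambda>x. (w0 x + wk k x) / 2) = wk (Suc k)" by (auto simp: wk_def field_simps)
  let ?q = "\<lambda>k. Z (lk k) (wk k) x * G (lk k)"
  have mid: "Z 0 w0 x * ?q k \<le> (?q (Suc k))\<^sup>2"
    using Z_midpoint[of 0 w0 x "lk k" "wk k"] unfolding lmid wmid by (simp add: G_def)
  have qk: "?q k > 0" using Suc Gp by simp
  then have "(?q (Suc k))\<^sup>2 > 0" using mid pos0 by (metis less_le_trans mult_pos_pos)
  then have "Z (lk (Suc k)) (wk (Suc k)) x \<noteq> 0" by auto
  then have pos: "Z (lk (Suc k)) (wk (Suc k)) x > 0" using Z_nonneg by (simp add: less_le)
  then have q': "?q (Suc k) > 0" using Gp by simp
  have "ln (Z 0 w0 x * ?q k) \<le> ln ((?q (Suc k))\<^sup>2)"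
    using mid pos0 qk q' by (subst ln_le_cancel_iff) auto
  then have "ln (?q k) - ln (Z 0 w0 x) \<le> 2 * (ln (?q (Suc k)) - ln (Z 0 w0 x))"
    using pos0 qk q' by (simp add: ln_mult_pos ln_realpow)
  then have "2 ^ k * (ln (?q k) - ln (Z 0 w0 x)) \<le> 2 ^ k * (2 * (ln (?q (Suc k)) - ln (Z 0 w0 x)))"
    by (intro mult_left_mono) auto
  moreover have "2 ^ k * (2 * (ln (?q (Suc k)) - ln (Z 0 w0 x))) = 2 ^ Suc k * (ln (?q (Suc k)) - ln (Z 0 w0 x))"
    by (simp only: power_Suc mult_ac)
  ultimately show ?case using Suc pos by linarith
qed

text \<open>By concavity the left side is at most the derivative at (0, w0) towards (l, w1).
  Weighting the logarithms by the cell masses turns it into the derivative of the sum of the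
  \<open>Z\<close>. For l = 0 this sum is 1 for all weights, so the motion of the cells contributes
  nothing and only the derivative in l remains.\<close>

lemma log_partition_bound:
  assumes pos0: "\<And>x. x \<in> X \<Longrightarrow> Z 0 w0 x > 0" and pos1: "\<And>x. x \<in> X \<Longrightarrow> Z (l x) w1 x > 0"
  shows "(\<Sum>x\<in>X. Z 0 w0 x * (ln (Z (l x) w1 x * G (l x)) - ln (Z 0 w0 x)))
    \<le> (\<integral>y. (\<Sum>x\<in>X. indicator (cell w0 x) y * (l x \<bullet> y)) \<partial>\<mu>)"
proof -
  define lk where "lk k x = (1 / 2 ^ k) *\<^sub>R l x" for k :: nat and x
  define wk where "wk k x = w0 x + (w1 x - w0 x) / 2 ^ k" for k :: nat and x
  define g where "g k y = (\<Sum>x\<in>X. indicator (cell (wk k) x) y * (2 ^ k * (exp (lk k x \<bullet> y) - 1)))" for k y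
  let ?L = "\<Sum>x\<in>X. Z 0 w0 x * (ln (Z (l x) w1 x * G (l x)) - ln (Z 0 w0 x))"
  have sumZ0: "(\<Sum>x\<in>X. Z 0 w x) = 1" for w
  proof -
    have "(\<Sum>x\<in>X. Z 0 w x) = (\<integral>y. (\<Sum>x\<in>X. indicator (cell w x) y) \<partial>\<mu>)"
      unfolding Z_def using cell_integrable by (subst Bochner_Integration.integral_sum) auto
    also have "\<dots> = (\<integral>y. 1 \<partial>\<mu>)"
    proof (rule integral_cong_AE)
      show "AE y in \<mu>. (\<Sum>x\<in>X. indicator (cell w x) y) = (1::real)"
        using AE_generic[of w]
      proof eventually_elim
        case (elim y)
        from sum_cell[OF this] obtain z where "\<forall>g::'a \<Rightarrow> real. (\<Sum>x\<in>X. indicator (cell w x) y * g x) = g z" by blast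
        from this[rule_format, of "\<lambda>_. 1"] show ?case by simp
      qed
    qed auto
    finally show ?thesis by (simp add: prob_space)
  qed
  have step: "?L \<le> (\<integral>y. g k y \<partial>\<mu>)" for k
  proof -
    let ?q = "\<lambda>x. Z (lk k x) (wk k) x * G (lk k x)"
    have dy: "Z (lk k x) (wk k) x > 0" "ln (Z (l x) w1 x * G (l x)) - ln (Z 0 w0 x) \<le> 2 ^ k * (ln (?q x) - ln (Z 0 w0 x))"
      if "x \<in> X" for x
      using Z_dyadic[OF pos0[OF that] pos1[OF that], of k] by (simp_all add: lk_def wk_def[abs_def])
    have Gp: "G l > 0" "G l \<le> 1" for l using \<kappa> by (auto simp: G_def)
    have "?L \<le> (\<Sum>x\<in>X. 2 ^ k * (Z (lk k x) (wk k) x - Z 0 w0 x))"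
    proof (rule sum_mono)
      fix x assume x: "x \<in> X"
      have "Z 0 w0 x * (ln (Z (l x) w1 x * G (l x)) - ln (Z 0 w0 x)) \<le> Z 0 w0 x * (2 ^ k * (ln (?q x) - ln (Z 0 w0 x)))"
        using dy(2)[OF x] pos0[OF x] by (intro mult_left_mono) auto
      also have "\<dots> = 2 ^ k * (Z 0 w0 x * (ln (?q x) - ln (Z 0 w0 x)))" by (simp add: mult_ac)
      \<comment> \<open>The tangent inequality replaces the logarithms by the difference of the
        values; afterwards \<open>G\<close> is dropped because it is at most 1.\<close>
      also have "\<dots> \<le> 2 ^ k * (?q x - Z 0 w0 x)"
        using xlogx_tangent[of "Z 0 w0 x" "?q x"] pos0[OF x] dy(1)[OF x] Gp
        by (intro mult_left_mono) (auto simp: algebra_simps)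
      also have "\<dots> \<le> 2 ^ k * (Z (lk k x) (wk k) x - Z 0 w0 x)"
        using dy(1)[OF x] Gp[of "lk k x"] by (intro mult_left_mono diff_right_mono mult_left_le) auto
      finally show "Z 0 w0 x * (ln (Z (l x) w1 x * G (l x)) - ln (Z 0 w0 x)) \<le> 2 ^ k * (Z (lk k x) (wk k) x - Z 0 w0 x)" .
    qed
    also have "\<dots> = 2 ^ k * ((\<Sum>x\<in>X. Z (lk k x) (wk k) x) - (\<Sum>x\<in>X. Z 0 w0 x))"
      by (simp only: sum_distrib_left[symmetric] sum_subtractf)
    \<comment> \<open>Both partitions have total mass one, so the masses for \<open>w0\<close> may
      be exchanged for those of \<open>wk k\<close>. Each summand then compares two integrands on
      the same cell.\<close>
    also have "(\<Sum>x\<in>X. Z 0 w0 x) = (\<Sum>x\<in>X. Z 0 (wk k) x)" by (simp add: sumZ0)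
    also have "2 ^ k * ((\<Sum>x\<in>X. Z (lk k x) (wk k) x) - (\<Sum>x\<in>X. Z 0 (wk k) x))
      = (\<Sum>x\<in>X. 2 ^ k * (Z (lk k x) (wk k) x - Z 0 (wk k) x))"
      by (simp only: sum_distrib_left[symmetric] sum_subtractf)
    also have "\<dots> = (\<Sum>x\<in>X. \<integral>y. indicator (cell (wk k) x) y * (2 ^ k * (exp (lk k x \<bullet> y) - 1)) \<partial>\<mu>)"
    proof (rule sum.cong[OF refl])
      fix x
      have "(\<integral>y. indicator (cell (wk k) x) y * (2 ^ k * (exp (lk k x \<bullet> y) - 1)) \<partial>\<mu>)
        = (\<integral>y. 2 ^ k * (indicator (cell (wk k) x) y * exp (lk k x \<bullet> y) - indicator (cell (wk k) x) y * exp (0 \<bullet> y)) \<partial>\<mu>)"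
        by (intro Bochner_Integration.integral_cong) (auto simp: algebra_simps)
      also have "\<dots> = 2 ^ k * (Z (lk k x) (wk k) x - Z 0 (wk k) x)"
        unfolding Z_def using cell_exp_integrable[of "wk k" x] by (subst integral_mult_right_zero) (subst Bochner_Integration.integral_diff, auto intro: cell_integrable)
      finally show "2 ^ k * (Z (lk k x) (wk k) x - Z 0 (wk k) x)
        = (\<integral>y. indicator (cell (wk k) x) y * (2 ^ k * (exp (lk k x \<bullet> y) - 1)) \<partial>\<mu>)" by simp
    qed
    also have "\<dots> = (\<integral>y. g k y \<partial>\<mu>)"
      unfolding g_def
    proof (rule Bochner_Integration.integral_sum[symmetric])
      fix x
      have "integrable \<mu> (\<lambda>y. 2 ^ k * (indicator (cell (wk k) x) y * exp (lk k x \<bullet> y) - indicator (cell (wk k) x) y * exp (0 \<bullet> y)))"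
        by (intro integrable_mult_right Bochner_Integration.integrable_diff cell_exp_integrable)
      then show "integrable \<mu> (\<lambda>y. indicator (cell (wk k) x) y * (2 ^ k * (exp (lk k x \<bullet> y) - 1)))"
        by (simp add: algebra_simps)
    qed
    finally show ?thesis .
  qed
  have "(\<lambda>k. \<integral>y. g k y \<partial>\<mu>) \<longlonglongrightarrow> (\<integral>y. (\<Sum>x\<in>X. indicator (cell w0 x) y * (l x \<bullet> y)) \<partial>\<mu>)"
  proof (rule integral_dominated_convergence[where w="\<lambda>y. \<Sum>x\<in>X. exp ((2 * norm (l x)) * norm y)"])
    show "integrable \<mu> (\<lambda>y. \<Sum>x\<in>X. exp ((2 * norm (l x)) * norm y))" using exp_mom by auto
    show "AE y in \<mu>. norm (g k y) \<le> (\<Sum>x\<in>X. exp ((2 * norm (l x)) * norm y))" for k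
    proof (intro AE_I2)
      fix y
      have "norm (g k y) \<le> (\<Sum>x\<in>X. norm (indicator (cell (wk k) x) y * (2 ^ k * (exp (lk k x \<bullet> y) - 1))))"
        unfolding g_def by (rule norm_sum)
      also have "\<dots> \<le> (\<Sum>x\<in>X. exp ((2 * norm (l x)) * norm y))"
      proof (rule sum_mono)
        fix x
        have "norm (indicator (cell (wk k) x) y * (2 ^ k * (exp (lk k x \<bullet> y) - 1)))
          \<le> \<bar>(exp ((1 / 2 ^ k) * (l x \<bullet> y)) - 1) / (1 / 2 ^ k)\<bar>"
          by (auto simp: lk_def abs_mult mult.commute split: split_indicator)
        also have "\<dots> \<le> exp (2 * \<bar>l x \<bullet> y\<bar>)" by (rule exp_difference_quotient_bound) auto
        also have "\<dots> \<le> exp ((2 * norm (l x)) * norm y)" using Cauchy_Schwarz_ineq2[of "l x" y] by simp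
        finally show "norm (indicator (cell (wk k) x) y * (2 ^ k * (exp (lk k x \<bullet> y) - 1))) \<le> exp ((2 * norm (l x)) * norm y)" .
      qed
      finally show "norm (g k y) \<le> (\<Sum>x\<in>X. exp ((2 * norm (l x)) * norm y))" .
    qed
    show "AE y in \<mu>. (\<lambda>k. g k y) \<longlonglongrightarrow> (\<Sum>x\<in>X. indicator (cell w0 x) y * (l x \<bullet> y))"
      using AE_generic[of w0]
    proof eventually_elim
      case (elim y)
      from unique_cell[OF this] obtain z where z: "z \<in> X" "\<And>x. x \<in> X \<Longrightarrow> x \<noteq> z \<Longrightarrow> x \<bullet> y - w0 x < z \<bullet> y - w0 z"
        "\<And>x. x \<in> X \<Longrightarrow> y \<in> cell w0 x \<longleftrightarrow> x = z" by blast
      have p2: "(\<lambda>k. 1 / 2 ^ k :: real) \<longlonglongrightarrow> 0"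
        using LIMSEQ_power_zero[of "1/2 :: real"] by (simp add: power_divide)
      have wlim: "(\<lambda>k. x \<bullet> y - wk k x) \<longlonglongrightarrow> x \<bullet> y - w0 x" for x
      proof -
        have "(\<lambda>k. x \<bullet> y - (w0 x + (w1 x - w0 x) * (1 / 2 ^ k))) \<longlonglongrightarrow> x \<bullet> y - (w0 x + (w1 x - w0 x) * 0)"
          by (intro tendsto_intros p2)
        then show ?thesis by (simp add: wk_def)
      qed
      \<comment> \<open>Away from ties the maximiser z for \<open>w0\<close> is strict, so it
        remains the maximiser for all weights close to \<open>w0\<close>.\<close>
      have "\<forall>\<^sub>F k in sequentially. \<forall>x\<in>X. x \<noteq> z \<longrightarrow> x \<bullet> y - wk k x < z \<bullet> y - wk k z"
      proof (rule eventually_ball_finite[OF X(1)], rule ballI)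
        fix x assume x: "x \<in> X"
        show "\<forall>\<^sub>F k in sequentially. x \<noteq> z \<longrightarrow> x \<bullet> y - wk k x < z \<bullet> y - wk k z"
        proof (cases "x = z")
          case False
          have "(\<lambda>k. (z \<bullet> y - wk k z) - (x \<bullet> y - wk k x)) \<longlonglongrightarrow> (z \<bullet> y - w0 z) - (x \<bullet> y - w0 x)"
            by (intro tendsto_diff wlim)
          then have "\<forall>\<^sub>F k in sequentially. 0 < (z \<bullet> y - wk k z) - (x \<bullet> y - wk k x)"
            by (rule order_tendstoD) (use z(2)[OF x False] in simp)
          then show ?thesis by eventually_elim simp
        qed simp
      qed
      then have "\<forall>\<^sub>F k in sequentially. 2 ^ k * (exp (lk k z \<bullet> y) - 1) = g k y"
      proof eventually_elim
        case (elim k)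
        have "y \<in> cell (wk k) x \<longleftrightarrow> x = z" if "x \<in> X" for x
          using elim z(1) that by (force simp: cell_def)
        then have "g k y = (\<Sum>x\<in>X. if x = z then 2 ^ k * (exp (lk k x \<bullet> y) - 1) else 0)"
          unfolding g_def by (intro sum.cong) (auto simp: indicator_def)
        then show ?case using z(1) X by simp
      qed
      moreover have "(\<lambda>k. 2 ^ k * (exp (lk k z \<bullet> y) - 1)) \<longlonglongrightarrow> l z \<bullet> y"
      proof -
        have "((\<lambda>s. exp (s * (l z \<bullet> y))) has_real_derivative exp (0 * (l z \<bullet> y)) * (l z \<bullet> y)) (at 0)"
          by (auto intro!: derivative_eq_intros)
        then have "((\<lambda>s. (exp (s * (l z \<bullet> y)) - 1) / s) \<longlongrightarrow> l z \<bullet> y) (at 0)"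
          by (simp add: has_field_derivative_iff)
        moreover have "filterlim (\<lambda>k. 1 / 2 ^ k :: real) (at 0) sequentially"
          using p2 by (auto simp: filterlim_at)
        ultimately have "(\<lambda>k. (exp ((1 / 2 ^ k) * (l z \<bullet> y)) - 1) / (1 / 2 ^ k)) \<longlonglongrightarrow> l z \<bullet> y"
          by (rule filterlim_compose)
        then show ?thesis by (simp add: lk_def mult.commute)
      qed
      ultimately have "(\<lambda>k. g k y) \<longlonglongrightarrow> l z \<bullet> y" by (rule Lim_transform_eventually[rotated])
      moreover have "(\<Sum>x\<in>X. indicator (cell w0 x) y * (l x \<bullet> y)) = l z \<bullet> y"
      proof -
        have "(\<Sum>x\<in>X. indicator (cell w0 x) y * (l x \<bullet> y)) = (\<Sum>x\<in>X. if x = z then l x \<bullet> y else 0)"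
          using z(3) by (intro sum.cong) (auto simp: indicator_def)
        then show ?thesis using z(1) X by simp
      qed
      ultimately show ?case by simp
    qed
  qed (auto simp: g_def[abs_def])
  then show ?thesis by (rule LIMSEQ_le_const) (use step in auto)
qed

text \<open>For any tilts l, \<open>log_partition_bound\<close> bounds the \<sigma>-weighted sum of
  ln \<open>Z\<close> from above through the barycentres A, and the Gibbs inequality for
  \<open>\<rho>\<close> bounds it from below through B and the entropy. What remains is the sum of l
  . (B - A) - \<sigma> |l|^2 / (2 \<kappa>), which is then maximised over l.\<close>

lemma semidiscrete_talagrand:
  assumes \<rho>[measurable]: "\<rho> \<in> borel_measurable borel" and c: "0 < c" "\<And>y. c \<le> \<rho> y" "\<And>y. \<rho> y \<le> C"
    and \<sigma>: "\<And>x. x \<in> X \<Longrightarrow> 0 < \<sigma> x"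
    and mass0: "\<And>x. x \<in> X \<Longrightarrow> (\<integral>y. indicator (cell w0 x) y \<partial>\<mu>) = \<sigma> x"
    and mass1: "\<And>x. x \<in> X \<Longrightarrow> (\<integral>y. indicator (cell w1 x) y * \<rho> y \<partial>\<mu>) = \<sigma> x"
  defines "A \<equiv> \<lambda>x. (\<integral>y. indicator (cell w0 x) y *\<^sub>R y \<partial>\<mu>)"
    and "B \<equiv> \<lambda>x. (\<integral>y. (indicator (cell w1 x) y * \<rho> y) *\<^sub>R y \<partial>\<mu>)"
  shows "\<kappa> / 2 * (\<Sum>x\<in>X. (norm (B x - A x))\<^sup>2 / \<sigma> x) \<le> (\<integral>y. \<rho> y * ln (\<rho> y) \<partial>\<mu>)"
proof -
  \<comment> \<open>The maximiser of the quadratic expression l . (B - A) - \<sigma> |l|^2 / (2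
    \<kappa>).\<close>
  define l where "l x = (\<kappa> / \<sigma> x) *\<^sub>R (B x - A x)" for x
  have \<rho>pos: "\<rho> y > 0" for y using c by (meson less_le_trans)
  have i_id: "integrable \<mu> (\<lambda>y. y)"
  proof (rule Bochner_Integration.integrable_bound[OF exp_mom[of 1]])
    show "AE y in \<mu>. norm y \<le> norm (exp (1 * norm y))"
    proof (intro AE_I2)
      fix y :: 'a
      have "norm y \<le> exp (norm y)" using exp_ge_add_one_self[of "norm y"] by linarith
      then show "norm y \<le> norm (exp (1 * norm y))" by simp
    qed
  qed simp
  have bounded: "integrable \<mu> (\<lambda>y. h y *\<^sub>R f y)" if "integrable \<mu> f" "h \<in> borel_measurable borel" "\<And>y. \<bar>h y\<bar> \<le> D"
    for f :: "'a \<Rightarrow> 'b::{banach,second_countable_topology}" and h :: "'a \<Rightarrow> real" and D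
  proof (rule Bochner_Integration.integrable_bound[of \<mu> "\<lambda>y. D * norm (f y)"])
    show "AE y in \<mu>. norm (h y *\<^sub>R f y) \<le> norm (D * norm (f y))"
    proof (intro AE_I2)
      fix y
      have "\<bar>h y\<bar> * norm (f y) \<le> D * norm (f y)" using that(3)[of y] by (intro mult_right_mono) auto
      then show "norm (h y *\<^sub>R f y) \<le> norm (D * norm (f y))" by simp
    qed
  qed (use that in auto)
  have ia: "integrable \<mu> (\<lambda>y. indicator (cell w0 x) y *\<^sub>R y)" for x
    by (rule bounded[OF i_id, of _ 1]) (auto simp: indicator_def)
  have \<rho>C: "\<bar>indicator S y * \<rho> y\<bar> \<le> C" for S y
    using c(1) c(2,3)[of y] by (auto simp: indicator_def)
  have ib: "integrable \<mu> (\<lambda>y. (indicator (cell w1 x) y * \<rho> y) *\<^sub>R y)" for x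
    by (rule bounded[OF i_id _ \<rho>C]) auto
  have ib1: "integrable \<mu> (\<lambda>y. indicator (cell w1 x) y * \<rho> y)" for x
    using bounded[of "\<lambda>_. 1::real" "\<lambda>y. indicator (cell w1 x) y * \<rho> y" C, OF _ _ \<rho>C] by simp
  have Z0: "Z 0 w0 x = \<sigma> x" if "x \<in> X" for x using mass0[OF that] by (simp add: Z_def)
  \<comment> \<open>A cell with vanishing exponential integral would be null for
    \<open>\<mu>\<close>, contradicting its positive mass under the density
    \<open>\<rho>\<close>.\<close>
  have Z1: "Z (l x) w1 x > 0" if x: "x \<in> X" for x
  proof (rule ccontr)
    assume "\<not> Z (l x) w1 x > 0"
    then have "Z (l x) w1 x = 0" using Z_nonneg[of "l x" w1 x] by simp
    then have "AE y in \<mu>. indicator (cell w1 x) y * exp (l x \<bullet> y) = 0"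
      unfolding Z_def using cell_exp_integrable by (subst (asm) integral_nonneg_eq_0_iff_AE) auto
    then have "AE y in \<mu>. indicator (cell w1 x) y * \<rho> y = 0" by eventually_elim auto
    then have "(\<integral>y. indicator (cell w1 x) y * \<rho> y \<partial>\<mu>) = 0" by (rule integral_eq_zero_AE)
    then show False using mass1[OF x] \<sigma>[OF x] by simp
  qed
  have upper: "(\<Sum>x\<in>X. \<sigma> x * (ln (Z (l x) w1 x * G (l x)) - ln (\<sigma> x))) \<le> (\<Sum>x\<in>X. l x \<bullet> A x)"
  proof -
    have "(\<Sum>x\<in>X. \<sigma> x * (ln (Z (l x) w1 x * G (l x)) - ln (\<sigma> x)))
      = (\<Sum>x\<in>X. Z 0 w0 x * (ln (Z (l x) w1 x * G (l x)) - ln (Z 0 w0 x)))"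
      by (intro sum.cong) (auto simp: Z0)
    also have "\<dots> \<le> (\<integral>y. (\<Sum>x\<in>X. indicator (cell w0 x) y * (l x \<bullet> y)) \<partial>\<mu>)"
      by (rule log_partition_bound) (use Z0 \<sigma> Z1 in auto)
    also have "\<dots> = (\<integral>y. (\<Sum>x\<in>X. l x \<bullet> (indicator (cell w0 x) y *\<^sub>R y)) \<partial>\<mu>)" by simp
    also have "\<dots> = (\<Sum>x\<in>X. \<integral>y. l x \<bullet> (indicator (cell w0 x) y *\<^sub>R y) \<partial>\<mu>)"
      using ia by (intro Bochner_Integration.integral_sum integrable_inner_right) auto
    also have "\<dots> = (\<Sum>x\<in>X. l x \<bullet> A x)"
      unfolding A_def using ia by (intro sum.cong refl integral_inner_right) auto
    finally show ?thesis .
  qed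
  define k where "k x = ln (Z (l x) w1 x) - ln (\<sigma> x)" for x
  have gibbs: "(\<Sum>x\<in>X. l x \<bullet> B x - \<sigma> x * k x) \<le> (\<integral>y. \<rho> y * ln (\<rho> y) \<partial>\<mu>)"
  proof -
    \<comment> \<open>The comparison density on the cell of x is the exponential tilt, scaled to
      have the same mass \<open>\<sigma> x\<close> as \<open>\<rho>\<close>. The last two terms
      therefore cancel after integration.\<close>
    let ?h = "\<lambda>x y. l x \<bullet> ((indicator (cell w1 x) y * \<rho> y) *\<^sub>R y) - k x * (indicator (cell w1 x) y * \<rho> y)
      + (indicator (cell w1 x) y * \<rho> y) - (\<sigma> x / Z (l x) w1 x) * (indicator (cell w1 x) y * exp (l x \<bullet> y))"
    have ih: "integrable \<mu> (?h x)" for x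
      using ib ib1 cell_exp_integrable
      by (intro Bochner_Integration.integrable_add Bochner_Integration.integrable_diff integrable_mult_right integrable_inner_right) auto
    have int_h: "(\<integral>y. ?h x y \<partial>\<mu>) = l x \<bullet> B x - \<sigma> x * k x" if x: "x \<in> X" for x
    proof -
      have "(\<integral>y. ?h x y \<partial>\<mu>) = l x \<bullet> B x - k x * \<sigma> x + \<sigma> x - (\<sigma> x / Z (l x) w1 x) * Z (l x) w1 x"
      proof -
        have split: "(\<integral>y. f1 y - f2 y + f3 y - f4 y \<partial>\<mu>) = (\<integral>y. f1 y \<partial>\<mu>) - (\<integral>y. f2 y \<partial>\<mu>) + (\<integral>y. f3 y \<partial>\<mu>) - (\<integral>y. f4 y \<partial>\<mu>)"
          if "integrable \<mu> f1" "integrable \<mu> f2" "integrable \<mu> f3" "integrable \<mu> f4" for f1 f2 f3 f4 :: "'a \<Rightarrow> real"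
          using that by simp
        show ?thesis
          by (subst split) (use ib[of x] ib1[of x] cell_exp_integrable[of w1 x "l x"] in
            \<open>simp_all only: integrable_mult_right integrable_inner_right integral_inner_right integral_mult_right_zero B_def mass1[OF x] Z_def[symmetric]\<close>)
      qed
      then show ?thesis using Z1[OF x] by (simp add: mult.commute)
    qed
    have "(\<Sum>x\<in>X. l x \<bullet> B x - \<sigma> x * k x) = (\<integral>y. (\<Sum>x\<in>X. ?h x y) \<partial>\<mu>)"
      using int_h ih by (subst Bochner_Integration.integral_sum) auto
    also have "\<dots> \<le> (\<integral>y. \<rho> y * ln (\<rho> y) \<partial>\<mu>)"
    proof (rule integral_mono_AE)
      show "integrable \<mu> (\<lambda>y. \<Sum>x\<in>X. ?h x y)" using ih by auto
      have "integrable \<mu> (\<lambda>y. (\<rho> y * ln (\<rho> y)) *\<^sub>R (1::real))"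
      proof (rule bounded)
        fix y
        have "\<bar>ln (\<rho> y)\<bar> \<le> \<bar>ln c\<bar> + \<bar>ln C\<bar>"
        proof -
          have "ln c \<le> ln (\<rho> y)" "ln (\<rho> y) \<le> ln C" using c(1) c(2,3)[of y] by (auto simp: ln_mono)
          then show ?thesis by linarith
        qed
        then have "\<bar>\<rho> y\<bar> * \<bar>ln (\<rho> y)\<bar> \<le> C * (\<bar>ln c\<bar> + \<bar>ln C\<bar>)"
          using c(1) c(2,3)[of y] by (intro mult_mono) auto
        then show "\<bar>\<rho> y * ln (\<rho> y)\<bar> \<le> C * (\<bar>ln c\<bar> + \<bar>ln C\<bar>)" by (simp add: abs_mult)
      qed auto
      then show "integrable \<mu> (\<lambda>y. \<rho> y * ln (\<rho> y))" by simp
      show "AE y in \<mu>. (\<Sum>x\<in>X. ?h x y) \<le> \<rho> y * ln (\<rho> y)"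
        using AE_generic[of w1]
      proof eventually_elim
        case (elim y)
        from sum_cell[OF this] obtain z where z: "z \<in> X" "\<forall>g::'a \<Rightarrow> real. (\<Sum>x\<in>X. indicator (cell w1 x) y * g x) = g z" by blast
        have "(\<Sum>x\<in>X. ?h x y) = (\<Sum>x\<in>X. indicator (cell w1 x) y *
          (\<rho> y * (l x \<bullet> y) - k x * \<rho> y + \<rho> y - (\<sigma> x / Z (l x) w1 x) * exp (l x \<bullet> y)))"
          by (intro sum.cong) (auto simp: algebra_simps)
        also have "\<dots> = \<rho> y * (l z \<bullet> y) - k z * \<rho> y + \<rho> y - (\<sigma> z / Z (l z) w1 z) * exp (l z \<bullet> y)"
          by (rule z(2)[rule_format])
        also have "\<dots> = \<rho> y * ln ((\<sigma> z / Z (l z) w1 z) * exp (l z \<bullet> y)) + \<rho> y - (\<sigma> z / Z (l z) w1 z) * exp (l z \<bullet> y)"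
          using Z1[OF z(1)] \<sigma>[OF z(1)] by (simp add: k_def ln_mult_pos ln_div) (simp add: algebra_simps)
        also have "\<dots> \<le> \<rho> y * ln (\<rho> y)"
          using xlogx_tangent[OF \<rho>pos[of y], of "(\<sigma> z / Z (l z) w1 z) * exp (l z \<bullet> y)"] Z1[OF z(1)] \<sigma>[OF z(1)] by simp
        finally show ?case .
      qed
    qed
    finally show ?thesis .
  qed
  have "(\<Sum>x\<in>X. \<sigma> x * (ln (Z (l x) w1 x * G (l x)) - ln (\<sigma> x))) = (\<Sum>x\<in>X. \<sigma> x * k x - \<sigma> x * ((norm (l x))\<^sup>2 / (2 * \<kappa>)))"
  proof (rule sum.cong[OF refl])
    fix x assume x: "x \<in> X"
    have "ln (Z (l x) w1 x * G (l x)) = ln (Z (l x) w1 x) - (norm (l x))\<^sup>2 / (2 * \<kappa>)"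
      using Z1[OF x] by (simp add: ln_mult_pos G_def)
    then have "ln (Z (l x) w1 x * G (l x)) - ln (\<sigma> x) = k x - (norm (l x))\<^sup>2 / (2 * \<kappa>)"
      by (simp add: k_def)
    then show "\<sigma> x * (ln (Z (l x) w1 x * G (l x)) - ln (\<sigma> x)) = \<sigma> x * k x - \<sigma> x * ((norm (l x))\<^sup>2 / (2 * \<kappa>))"
      by (simp only: right_diff_distrib)
  qed
  then have "(\<Sum>x\<in>X. l x \<bullet> (B x - A x) - \<sigma> x * ((norm (l x))\<^sup>2 / (2 * \<kappa>))) \<le> (\<integral>y. \<rho> y * ln (\<rho> y) \<partial>\<mu>)"
    using gibbs upper by (simp add: sum_subtractf inner_diff_right)
  moreover have "(\<Sum>x\<in>X. l x \<bullet> (B x - A x) - \<sigma> x * ((norm (l x))\<^sup>2 / (2 * \<kappa>))) = \<kappa> / 2 * (\<Sum>x\<in>X. (norm (B x - A x))\<^sup>2 / \<sigma> x)"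
    unfolding sum_distrib_left
  proof (rule sum.cong[OF refl])
    fix x assume x: "x \<in> X"
    define N where "N = (B x - A x) \<bullet> (B x - A x)"
    have e1: "l x \<bullet> (B x - A x) = \<kappa> / \<sigma> x * N" by (simp add: l_def N_def)
    have e2: "(norm (l x))\<^sup>2 = (\<kappa> / \<sigma> x)\<^sup>2 * N"
      unfolding power2_norm_eq_inner by (simp add: l_def N_def power2_eq_square)
    have e3: "(norm (B x - A x))\<^sup>2 = N" by (simp add: N_def power2_norm_eq_inner)
    show "l x \<bullet> (B x - A x) - \<sigma> x * ((norm (l x))\<^sup>2 / (2 * \<kappa>)) = \<kappa> / 2 * ((norm (B x - A x))\<^sup>2 / \<sigma> x)"
      unfolding e1 e2 e3 using \<sigma>[OF x] \<kappa> by (simp add: power2_eq_square field_simps)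
  qed
  ultimately show ?thesis by simp
qed

end

section \<open>Cauchy-Schwarz inequalities\<close>

lemma integral_Cauchy_Schwarz:
  fixes f g :: "'a \<Rightarrow> real"
  assumes [measurable]: "f \<in> borel_measurable M" "g \<in> borel_measurable M"
    and f2: "integrable M (\<lambda>x. (f x)\<^sup>2)" and g2: "integrable M (\<lambda>x. (g x)\<^sup>2)"
  shows "integrable M (\<lambda>x. f x * g x)"
    and "(\<integral>x. f x * g x \<partial>M) \<le> sqrt (\<integral>x. (f x)\<^sup>2 \<partial>M) * sqrt (\<integral>x. (g x)\<^sup>2 \<partial>M)"
proof -
  have le: "\<bar>f x * g x\<bar> \<le> (f x)\<^sup>2 + (g x)\<^sup>2" for x
  proof -
    have "0 \<le> (\<bar>f x\<bar> - \<bar>g x\<bar>)\<^sup>2" "0 \<le> \<bar>f x\<bar> * \<bar>g x\<bar>" by auto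
    then show ?thesis unfolding power2_diff abs_mult power2_abs mult.assoc by linarith
  qed
  show i: "integrable M (\<lambda>x. f x * g x)"
    by (rule Bochner_Integration.integrable_bound[OF Bochner_Integration.integrable_add[OF f2 g2]])
       (use le in \<open>auto intro!: AE_I2\<close>)
  have ia: "integrable M (\<lambda>x. \<bar>f x\<bar> * \<bar>g x\<bar>)" using i by (simp add: abs_mult[symmetric] integrable_abs)
  have "(\<integral>\<^sup>+x. ennreal \<bar>f x\<bar> * ennreal \<bar>g x\<bar> \<partial>M)\<^sup>2 \<le>
    (\<integral>\<^sup>+x. (ennreal \<bar>f x\<bar>)\<^sup>2 \<partial>M) * (\<integral>\<^sup>+x. (ennreal \<bar>g x\<bar>)\<^sup>2 \<partial>M)"
    by (rule Cauchy_Schwarz_nn_integral) auto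
  also have "(\<integral>\<^sup>+x. (ennreal \<bar>f x\<bar>)\<^sup>2 \<partial>M) = ennreal (\<integral>x. (f x)\<^sup>2 \<partial>M)"
    using f2 by (subst nn_integral_eq_integral[symmetric]) (auto simp: ennreal_power)
  also have "(\<integral>\<^sup>+x. (ennreal \<bar>g x\<bar>)\<^sup>2 \<partial>M) = ennreal (\<integral>x. (g x)\<^sup>2 \<partial>M)"
    using g2 by (subst nn_integral_eq_integral[symmetric]) (auto simp: ennreal_power)
  also have "(\<integral>\<^sup>+x. ennreal \<bar>f x\<bar> * ennreal \<bar>g x\<bar> \<partial>M) = ennreal (\<integral>x. \<bar>f x\<bar> * \<bar>g x\<bar> \<partial>M)"
    using ia by (subst nn_integral_eq_integral[symmetric]) (auto simp: ennreal_mult)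
  finally have "ennreal ((\<integral>x. \<bar>f x\<bar> * \<bar>g x\<bar> \<partial>M)\<^sup>2) \<le> ennreal ((\<integral>x. (f x)\<^sup>2 \<partial>M) * (\<integral>x. (g x)\<^sup>2 \<partial>M))"
    by (simp add: ennreal_power ennreal_mult)
  then have "(\<integral>x. \<bar>f x\<bar> * \<bar>g x\<bar> \<partial>M)\<^sup>2 \<le> (\<integral>x. (f x)\<^sup>2 \<partial>M) * (\<integral>x. (g x)\<^sup>2 \<partial>M)"
    by (subst (asm) ennreal_le_iff) auto
  then have "(\<integral>x. \<bar>f x\<bar> * \<bar>g x\<bar> \<partial>M) \<le> sqrt (\<integral>x. (f x)\<^sup>2 \<partial>M) * sqrt (\<integral>x. (g x)\<^sup>2 \<partial>M)"
    unfolding real_sqrt_mult[symmetric] by (rule real_le_rsqrt)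
  moreover have "(\<integral>x. f x * g x \<partial>M) \<le> (\<integral>x. \<bar>f x\<bar> * \<bar>g x\<bar> \<partial>M)"
    using i ia by (intro integral_mono) (auto simp: abs_mult[symmetric])
  ultimately show "(\<integral>x. f x * g x \<partial>M) \<le> sqrt (\<integral>x. (f x)\<^sup>2 \<partial>M) * sqrt (\<integral>x. (g x)\<^sup>2 \<partial>M)" by linarith
qed

lemma integral_inner_Cauchy_Schwarz:
  fixes f g :: "'a \<Rightarrow> 'b::euclidean_space"
  assumes [measurable]: "f \<in> borel_measurable M" "g \<in> borel_measurable M"
    and f2: "integrable M (\<lambda>x. (norm (f x))\<^sup>2)" and g2: "integrable M (\<lambda>x. (norm (g x))\<^sup>2)"
  shows "integrable M (\<lambda>x. f x \<bullet> g x)"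
    and "\<bar>\<integral>x. f x \<bullet> g x \<partial>M\<bar> \<le> sqrt (\<integral>x. (norm (f x))\<^sup>2 \<partial>M) * sqrt (\<integral>x. (norm (g x))\<^sup>2 \<partial>M)"
proof -
  note cs = integral_Cauchy_Schwarz[of "\<lambda>x. norm (f x)" M "\<lambda>x. norm (g x)", OF _ _ f2 g2]
  have i: "integrable M (\<lambda>x. norm (f x) * norm (g x))" by (rule cs(1)) auto
  show j: "integrable M (\<lambda>x. f x \<bullet> g x)"
    by (rule Bochner_Integration.integrable_bound[OF i]) (auto intro!: AE_I2 Cauchy_Schwarz_ineq2)
  have "\<bar>\<integral>x. f x \<bullet> g x \<partial>M\<bar> \<le> (\<integral>x. \<bar>f x \<bullet> g x\<bar> \<partial>M)" by (rule integral_abs_bound)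
  also have "\<dots> \<le> (\<integral>x. norm (f x) * norm (g x) \<partial>M)"
    using i j by (intro integral_mono) (auto intro: Cauchy_Schwarz_ineq2)
  also have "\<dots> \<le> sqrt (\<integral>x. (norm (f x))\<^sup>2 \<partial>M) * sqrt (\<integral>x. (norm (g x))\<^sup>2 \<partial>M)" by (rule cs(2)) auto
  finally show "\<bar>\<integral>x. f x \<bullet> g x \<partial>M\<bar> \<le> sqrt (\<integral>x. (norm (f x))\<^sup>2 \<partial>M) * sqrt (\<integral>x. (norm (g x))\<^sup>2 \<partial>M)" .
qed

text \<open>The map r rounds the source to finitely many atoms, so discrete data become step
  functions on the original source and can be compared there with the actual maps. Atoms need
  positive mass because barycentres are formed by dividing by it.\<close>

locale laguerre_base = laguerre +
  fixes \<sigma> :: "'a measure" and r :: "'a \<Rightarrow> 'a"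
  assumes prob_\<sigma>: "prob_space \<sigma>" and sets_\<sigma>: "sets \<sigma> = sets borel"
    and mom_\<sigma>: "integrable \<sigma> (\<lambda>x. (norm x)\<^sup>2)"
    and r_measurable[measurable]: "r \<in> borel_measurable borel" and rX: "\<And>x. r x \<in> X"
    and s_pos: "\<And>z. z \<in> X \<Longrightarrow> 0 < measure \<sigma> (r -` {z})"
begin

sublocale S: prob_space \<sigma> by (rule prob_\<sigma>)

lemmas sets_\<sigma>'[measurable_cong] = sets_\<sigma>

lemma space_\<sigma>[simp]: "space \<sigma> = UNIV" using sets_eq_imp_space_eq[OF sets_\<sigma>] by simp

definition s :: "'a \<Rightarrow> real" where "s z = measure \<sigma> (r -` {z})"

lemma fibre_measurable[measurable]: "r -` {z} \<in> sets borel"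
  using measurable_sets_borel[OF r_measurable, of "{z}"] by simp

text \<open>As r has finitely many values, its composition with any h, measurable or not, is a step
  function.\<close>

lemma compose_r: "h (r x) = (\<Sum>z\<in>X. indicator (r -` {z}) x *\<^sub>R h z)" for h :: "'a \<Rightarrow> 'b::real_vector"
proof -
  have "(\<Sum>z\<in>X. indicator (r -` {z}) x *\<^sub>R h z) = (\<Sum>z\<in>X. if z = r x then h z else 0)"
    by (intro sum.cong) (auto simp: indicator_def)
  then show ?thesis using rX X by simp
qed

lemma compose_r_measurable[measurable]: "(\<lambda>x. h (r x)) \<in> borel_measurable borel"
  for h :: "'a \<Rightarrow> 'b::{second_countable_topology, real_normed_vector}"
  unfolding compose_r[of h] by measurable

lemma compose_r_integrable: "integrable \<sigma> (\<lambda>x. h (r x))"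
  and compose_r_integral: "(\<integral>x. h (r x) \<partial>\<sigma>) = (\<Sum>z\<in>X. s z *\<^sub>R h z)"
  for h :: "'a \<Rightarrow> 'b::{second_countable_topology, banach}"
proof -
  have i: "integrable \<sigma> (\<lambda>x. indicator (r -` {z}) x *\<^sub>R h z)" for z
    by (intro integrable_scaleR_left S.integrable_const_bound[of _ 1]) auto
  then show "integrable \<sigma> (\<lambda>x. h (r x))" unfolding compose_r[of h] by simp
  have "(\<integral>x. h (r x) \<partial>\<sigma>) = (\<Sum>z\<in>X. \<integral>x. indicator (r -` {z}) x *\<^sub>R h z \<partial>\<sigma>)"
    unfolding compose_r[of h] using i by (rule Bochner_Integration.integral_sum)
  also have "\<dots> = (\<Sum>z\<in>X. s z *\<^sub>R h z)"
    unfolding s_def by (subst integral_scaleR_left) (auto intro!: S.integrable_const_bound[of _ 1])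
  finally show "(\<integral>x. h (r x) \<partial>\<sigma>) = (\<Sum>z\<in>X. s z *\<^sub>R h z)" .
qed

lemma AE_cell_partition:
  assumes "nice_source \<tau> V"
  shows "AE y in \<tau>. \<exists>z\<in>X. \<forall>g::'a \<Rightarrow> real. (\<Sum>x\<in>X. indicator (cell w x) y * g x) = g z"
  by (rule nice_source_AE[OF assms]) (use AE_generic_lborel[of w] sum_cell in \<open>auto elim!: eventually_mono\<close>)

text \<open>Transport \<open>\<tau>\<close>, which has a density, backwards onto the image of
  \<open>\<sigma>\<close> under r. The potential on the atoms provides the weights, and almost every
  y lies in exactly the cell of its image. The second claim is weak duality for the coupling (r, T),
  since the sum over cells is the dual value.\<close>

lemma brenier_cells:
  assumes nice: "nice_source \<tau> V"
  obtains w where "\<And>z. z \<in> X \<Longrightarrow> measure \<tau> (cell w z) = s z"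
    "\<And>T. T \<in> borel_measurable borel \<Longrightarrow> distr \<sigma> borel T = \<tau> \<Longrightarrow>
      (\<integral>x. r x \<bullet> T x \<partial>\<sigma>) \<le> (\<Sum>z\<in>X. z \<bullet> (\<integral>y. indicator (cell w z) y *\<^sub>R y \<partial>\<tau>))"
proof -
  have p\<tau>: "prob_space \<tau>" and m\<tau>: "integrable \<tau> (\<lambda>x. (norm x)\<^sup>2)" using nice by (auto simp: nice_source_def)
  have s\<tau>[measurable_cong]: "sets \<tau> = sets borel" using nice by (rule nice_source_sets)
  interpret T: prob_space \<tau> by fact
  have i\<tau>: "integrable \<tau> (\<lambda>y. y)" using integrable_norm_of_square(2)[OF p\<tau> s\<tau> m\<tau>] .
  define \<pi> where "\<pi> = distr \<sigma> borel r"
  have "integrable \<pi> (\<lambda>x. (norm x)\<^sup>2)"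
    unfolding \<pi>_def by (subst integrable_distr_eq) (auto intro: compose_r_integrable[of "\<lambda>x. (norm x)\<^sup>2"])
  then obtain a W b G where BP: "brenier_pair \<tau> \<pi> V a W b G"
    using brenier_exists[OF nice, of \<pi>] S.prob_space_distr[of r borel] by (auto simp: \<pi>_def)
  have WAE: "AE y in \<pi>. y \<in> W" and ineq: "\<And>x y. x \<in> V \<Longrightarrow> y \<in> W \<Longrightarrow> x \<bullet> y \<le> a x + b y"
    and ia: "integrable \<tau> a" and ib: "integrable \<pi> b" and Gm[measurable]: "G \<in> borel_measurable borel"
    and dG: "distr \<tau> borel G = \<pi>" and eq: "AE x in \<tau>. x \<in> V \<and> G x \<in> W \<and> a x + b (G x) = x \<bullet> G x"
    using BP by (auto simp: brenier_pair_def elim!: eventually_mono)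
  \<comment> \<open>An atom of positive mass cannot lie outside the set W of full measure.\<close>
  have XW: "z \<in> W" if z: "z \<in> X" for z
  proof (rule ccontr)
    assume nz: "z \<notin> W"
    have "AE x in \<sigma>. r x \<in> W" using WAE unfolding \<pi>_def by (rule AE_distrD[rotated]) simp
    then have "AE x in \<sigma>. x \<notin> r -` {z}" using nz by (auto elim!: eventually_mono)
    then have "measure \<sigma> (r -` {z}) = 0"
      by (subst (asm) AE_iff_measurable[where N="r -` {z}"]) (auto simp: S.emeasure_eq_measure)
    then show False using s_pos[OF z] by simp
  qed
  have [measurable]: "X \<in> sets borel" using X by (simp add: finite_imp_closed)
  have "AE y in \<pi>. y \<in> X" unfolding \<pi>_def using rX X by (subst AE_distr_iff) auto
  then have GX: "AE y in \<tau>. G y \<in> X" unfolding dG[symmetric] by (rule AE_distrD[rotated]) simp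
  have gen: "AE y in \<tau>. \<forall>x\<in>X. \<forall>x'\<in>X. x \<noteq> x' \<longrightarrow> x \<bullet> y - b x \<noteq> x' \<bullet> y - b x'"
    by (rule nice_source_AE[OF nice]) (use AE_generic_lborel[of b] in \<open>auto elim!: eventually_mono\<close>)
  have cellG: "AE y in \<tau>. \<forall>z\<in>X. y \<in> cell b z \<longleftrightarrow> z = G y"
    using gen GX eq
  proof eventually_elim
    case (elim y)
    obtain z where z: "z \<in> X" "\<And>x. x \<in> X \<Longrightarrow> y \<in> cell b x \<longleftrightarrow> x = z"
      using unique_cell[OF elim(1)] by metis
    have "y \<in> cell b (G y)"
      unfolding cell_def
    proof safe
      fix x' assume "x' \<in> X"
      then have "y \<bullet> x' \<le> a y + b x'" using elim(3) XW by (intro ineq) auto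
      then show "x' \<bullet> y - b x' \<le> G y \<bullet> y - b (G y)" using elim(3) by (simp add: inner_commute)
    qed
    then have "G y = z" using z(2)[OF elim(2)] by simp
    then show ?case using z by blast
  qed
  have bm[measurable]: "b \<in> borel_measurable borel" using borel_measurable_integrable[OF ib] by (simp add: \<pi>_def)
  have am[measurable]: "a \<in> borel_measurable borel" using borel_measurable_integrable[OF ia] by simp
  have meas: "measure \<tau> (cell b z) = s z" if z: "z \<in> X" for z
  proof -
    have [measurable]: "G -` {z} \<in> sets borel" using measurable_sets_borel[OF Gm, of "{z}"] by simp
    have "measure \<tau> (cell b z) = measure \<tau> (G -` {z})"
      using cellG z by (intro T.finite_measure_eq_AE) (auto elim!: eventually_mono)
    also have "\<dots> = measure (distr \<tau> borel G) {z}"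
      using sets_eq_imp_space_eq[OF s\<tau>] by (subst measure_distr) auto
    also have "\<dots> = measure (distr \<sigma> borel r) {z}" by (simp add: dG \<pi>_def)
    also have "\<dots> = s z" by (subst measure_distr) (auto simp: s_def)
    finally show ?thesis .
  qed
  have bnd: "(\<integral>x. r x \<bullet> T x \<partial>\<sigma>) \<le> (\<Sum>z\<in>X. z \<bullet> (\<integral>y. indicator (cell b z) y *\<^sub>R y \<partial>\<tau>))"
    if Tm[measurable]: "T \<in> borel_measurable borel" and dT: "distr \<sigma> borel T = \<tau>" for T
  proof -
    have iaT: "integrable \<sigma> (\<lambda>x. a (T x))"
      using ia unfolding dT[symmetric] by (subst (asm) integrable_distr_eq) auto
    have ic: "integrable \<tau> (\<lambda>y. indicator (cell b z) y *\<^sub>R y)" for z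
      using i\<tau> by (intro integrable_mult_indicator) auto
    have "(\<Sum>z\<in>X. z \<bullet> (\<integral>y. indicator (cell b z) y *\<^sub>R y \<partial>\<tau>)) = (\<Sum>z\<in>X. \<integral>y. z \<bullet> (indicator (cell b z) y *\<^sub>R y) \<partial>\<tau>)"
      using ic by (intro sum.cong refl integral_inner_right[symmetric]) auto
    also have "\<dots> = (\<integral>y. (\<Sum>z\<in>X. z \<bullet> (indicator (cell b z) y *\<^sub>R y)) \<partial>\<tau>)"
      using ic by (intro Bochner_Integration.integral_sum[symmetric] integrable_inner_right) auto
    also have "\<dots> = (\<integral>y. a y + b (G y) \<partial>\<tau>)"
    proof (rule integral_cong_AE)
      show "AE y in \<tau>. (\<Sum>z\<in>X. z \<bullet> (indicator (cell b z) y *\<^sub>R y)) = a y + b (G y)"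
        using cellG GX eq
      proof eventually_elim
        case (elim y)
        have "(\<Sum>z\<in>X. z \<bullet> (indicator (cell b z) y *\<^sub>R y)) = (\<Sum>z\<in>X. if z = G y then z \<bullet> y else 0)"
          using elim(1) by (intro sum.cong) (auto simp: indicator_def)
        then show ?case using elim X by (simp add: inner_commute)
      qed
    qed auto
    also have "\<dots> = (\<integral>y. a y \<partial>\<tau>) + (\<integral>y. b (G y) \<partial>\<tau>)"
    proof (rule Bochner_Integration.integral_add[OF ia])
      show "integrable \<tau> (\<lambda>y. b (G y))"
        using ib unfolding dG[symmetric] by (subst (asm) integrable_distr_eq) auto
    qed
    also have "(\<integral>y. b (G y) \<partial>\<tau>) = (\<integral>x. b x \<partial>\<pi>)"
      unfolding dG[symmetric] by (rule integral_distr[symmetric]) auto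
    also have "\<dots> = (\<integral>x. b (r x) \<partial>\<sigma>)" unfolding \<pi>_def by (rule integral_distr) auto
    also have "(\<integral>y. a y \<partial>\<tau>) = (\<integral>x. a (T x) \<partial>\<sigma>)" unfolding dT[symmetric] by (rule integral_distr) auto
    also have "(\<integral>x. a (T x) \<partial>\<sigma>) + (\<integral>x. b (r x) \<partial>\<sigma>) = (\<integral>x. a (T x) + b (r x) \<partial>\<sigma>)"
      using iaT compose_r_integrable[of b] by simp
    finally have E: "(\<Sum>z\<in>X. z \<bullet> (\<integral>y. indicator (cell b z) y *\<^sub>R y \<partial>\<tau>)) = (\<integral>x. a (T x) + b (r x) \<partial>\<sigma>)" .
    have iT2: "integrable \<sigma> (\<lambda>x. (norm (T x))\<^sup>2)"
      using m\<tau> unfolding dT[symmetric] by (intro integrable_distr[of T \<sigma> borel "\<lambda>x. (norm x)\<^sup>2"]) auto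
    have VAE: "AE x in \<sigma>. T x \<in> V"
    proof -
      have "AE y in \<tau>. y \<in> V" using eq by eventually_elim simp
      then show ?thesis unfolding dT[symmetric] by (rule AE_distrD[rotated]) simp
    qed
    show ?thesis
      unfolding E
    proof (rule integral_mono_AE)
      show "integrable \<sigma> (\<lambda>x. r x \<bullet> T x)"
        using iT2 compose_r_integrable[of "\<lambda>x. (norm x)\<^sup>2"] by (intro integral_inner_Cauchy_Schwarz) auto
      show "integrable \<sigma> (\<lambda>x. a (T x) + b (r x))" using iaT compose_r_integrable[of b] by simp
      show "AE x in \<sigma>. r x \<bullet> T x \<le> a (T x) + b (r x)"
        using VAE by eventually_elim (use ineq XW rX in \<open>simp add: inner_commute\<close>)
    qed
  qed
  show ?thesis using meas bnd by (rule that)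
qed

text \<open>Averaging the duality inequality over the cell of z gives an affine minorant of a with
  slope the barycentre \<open>Ab z\<close>, so \<open>Ab (r x)\<close> is a subgradient at x up to
  the gap e. By duality for T and the optimality in \<open>opt\<close>, the integral of e is at most
  that of (x - r x) . (T x - Ab (r x)). Cauchy-Schwarz for the two parts gives the factor 2.\<close>

lemma barycentre_defect:
  assumes nice: "nice_source \<tau> V" and BP: "brenier_pair \<sigma> \<tau> U a W b T"
    and mass: "\<And>z. z \<in> X \<Longrightarrow> measure \<tau> (cell w z) = s z"
    and opt: "(\<integral>x. r x \<bullet> T x \<partial>\<sigma>) \<le> (\<Sum>z\<in>X. z \<bullet> (\<integral>y. indicator (cell w z) y *\<^sub>R y \<partial>\<tau>))"
  defines "Ab \<equiv> \<lambda>z. (1 / s z) *\<^sub>R (\<integral>y. indicator (cell w z) y *\<^sub>R y \<partial>\<tau>)"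
  shows "\<exists>e. integrable \<sigma> e \<and> (AE x in \<sigma>. 0 \<le> e x \<and> (\<forall>x'\<in>U. a x + (x' - x) \<bullet> Ab (r x) - e x \<le> a x')) \<and>
    (\<integral>x. e x \<partial>\<sigma>) \<le> 2 * sqrt (\<integral>x. (norm (x - r x))\<^sup>2 \<partial>\<sigma>) * sqrt (\<integral>y. (norm y)\<^sup>2 \<partial>\<tau>)"
proof -
  have p\<tau>: "prob_space \<tau>" and m\<tau>: "integrable \<tau> (\<lambda>x. (norm x)\<^sup>2)" using nice by (auto simp: nice_source_def)
  have s\<tau>[measurable_cong]: "sets \<tau> = sets borel" using nice by (rule nice_source_sets)
  interpret T: prob_space \<tau> by fact
  have i\<tau>: "integrable \<tau> (\<lambda>y. y)" using integrable_norm_of_square(2)[OF p\<tau> s\<tau> m\<tau>] .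
  have WAE: "AE y in \<tau>. y \<in> W" and ineq: "\<And>x y. x \<in> U \<Longrightarrow> y \<in> W \<Longrightarrow> x \<bullet> y \<le> a x + b y"
    and ia: "integrable \<sigma> a" and ib: "integrable \<tau> b" and Tm[measurable]: "T \<in> borel_measurable borel"
    and dT: "distr \<sigma> borel T = \<tau>" and eq: "AE x in \<sigma>. x \<in> U \<and> a x + b (T x) = x \<bullet> T x"
    using BP by (auto simp: brenier_pair_def elim!: eventually_mono)
  have bm[measurable]: "b \<in> borel_measurable borel" using borel_measurable_integrable[OF ib] by simp
  have am[measurable]: "a \<in> borel_measurable borel" using borel_measurable_integrable[OF ia] by simp
  have sp: "0 < s z" if "z \<in> X" for z using s_pos[OF that] by (simp add: s_def)
  let ?A = "\<lambda>z. \<integral>y. indicator (cell w z) y *\<^sub>R y \<partial>\<tau>"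
  define Bb where "Bb z = (1 / s z) * (\<integral>y. indicator (cell w z) y * b y \<partial>\<tau>)" for z
  have icy: "integrable \<tau> (\<lambda>y. indicator (cell w z) y *\<^sub>R y)" for z
    using i\<tau> by (intro integrable_mult_indicator) auto
  have icb: "integrable \<tau> (\<lambda>y. indicator (cell w z) y * b y)" for z
    using integrable_mult_indicator[of "cell w z" \<tau> b] ib by simp
  have ic1: "integrable \<tau> (\<lambda>y. indicator (cell w z) y :: real)" for z
    by (intro T.integrable_const_bound[of _ 1]) auto
  have ic2: "integrable \<tau> (\<lambda>y. indicator (cell w z) y * (norm y)\<^sup>2)" for z
    using integrable_mult_indicator[of "cell w z" \<tau> "\<lambda>y. (norm y)\<^sup>2"] m\<tau> by simp
  have mass': "(\<integral>y. indicator (cell w z) y \<partial>\<tau>) = s z" if "z \<in> X" for z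
    using mass[OF that] by simp
  have low: "x' \<bullet> Ab z - Bb z \<le> a x'" if z: "z \<in> X" and x': "x' \<in> U" for x' z
  proof -
    have "x' \<bullet> ?A z = (\<integral>y. x' \<bullet> (indicator (cell w z) y *\<^sub>R y) \<partial>\<tau>)"
      using icy by (intro integral_inner_right[symmetric]) auto
    also have "\<dots> \<le> (\<integral>y. a x' * indicator (cell w z) y + indicator (cell w z) y * b y \<partial>\<tau>)"
    proof (rule integral_mono_AE)
      show "integrable \<tau> (\<lambda>y. x' \<bullet> (indicator (cell w z) y *\<^sub>R y))" using icy by (rule integrable_inner_right)
      show "AE y in \<tau>. x' \<bullet> (indicator (cell w z) y *\<^sub>R y) \<le> a x' * indicator (cell w z) y + indicator (cell w z) y * b y"
        using WAE by eventually_elim (use ineq[OF x'] in \<open>auto simp: indicator_def\<close>)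
    qed (use icy icb ic1 in auto)
    also have "\<dots> = a x' * s z + (\<integral>y. indicator (cell w z) y * b y \<partial>\<tau>)"
      using icb ic1 mass[OF z] by (subst Bochner_Integration.integral_add) auto
    finally have le: "x' \<bullet> ?A z \<le> a x' * s z + (\<integral>y. indicator (cell w z) y * b y \<partial>\<tau>)" .
    have "x' \<bullet> Ab z - Bb z = (x' \<bullet> ?A z - (\<integral>y. indicator (cell w z) y * b y \<partial>\<tau>)) / s z"
      by (simp add: Ab_def Bb_def diff_divide_distrib)
    also have "\<dots> \<le> a x'" using le sp[OF z] by (simp add: pos_divide_le_eq)
    finally show ?thesis .
  qed
  define e where "e x = a x + Bb (r x) - x \<bullet> Ab (r x)" for x
  have iT2: "integrable \<sigma> (\<lambda>x. (norm (T x))\<^sup>2)"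
    using m\<tau> unfolding dT[symmetric] by (intro integrable_distr[of T \<sigma> borel "\<lambda>x. (norm x)\<^sup>2"]) auto
  have IT2: "(\<integral>x. (norm (T x))\<^sup>2 \<partial>\<sigma>) = (\<integral>y. (norm y)\<^sup>2 \<partial>\<tau>)"
    unfolding dT[symmetric] by (intro integral_distr[symmetric]) auto
  have iA2: "integrable \<sigma> (\<lambda>x. (norm (Ab (r x)))\<^sup>2)" by (rule compose_r_integrable)
  have ixA: "integrable \<sigma> (\<lambda>x. x \<bullet> Ab (r x))"
    using mom_\<sigma> iA2 by (intro integral_inner_Cauchy_Schwarz) auto
  have ir2: "integrable \<sigma> (\<lambda>x. (norm (r x))\<^sup>2)" by (rule compose_r_integrable)
  have ixr2: "integrable \<sigma> (\<lambda>x. (norm (x - r x))\<^sup>2)"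
  proof (rule Bochner_Integration.integrable_bound[of \<sigma> "\<lambda>x. 2 * (norm x)\<^sup>2 + 2 * (norm (r x))\<^sup>2"])
    show "AE x in \<sigma>. norm ((norm (x - r x))\<^sup>2) \<le> norm (2 * (norm x)\<^sup>2 + 2 * (norm (r x))\<^sup>2)"
    proof (intro AE_I2)
      fix x
      have "0 \<le> (norm (x + r x))\<^sup>2" by simp
      then have "(norm (x - r x))\<^sup>2 \<le> 2 * (norm x)\<^sup>2 + 2 * (norm (r x))\<^sup>2"
        unfolding power2_norm_eq_inner by (simp add: inner_simps inner_commute)
      then show "norm ((norm (x - r x))\<^sup>2) \<le> norm (2 * (norm x)\<^sup>2 + 2 * (norm (r x))\<^sup>2)" by simp
    qed
  qed (use mom_\<sigma> ir2 in auto)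
  have ie: "integrable \<sigma> e"
    unfolding e_def[abs_def] using ia ixA compose_r_integrable[of Bb] by simp
  have part: "AE y in \<tau>. \<exists>z\<in>X. \<forall>g::'a \<Rightarrow> real. (\<Sum>x\<in>X. indicator (cell w x) y * g x) = g z"
    by (rule AE_cell_partition[OF nice])
  have IB: "(\<integral>x. Bb (r x) \<partial>\<sigma>) = (\<integral>y. b y \<partial>\<tau>)"
  proof -
    have "(\<integral>x. Bb (r x) \<partial>\<sigma>) = (\<Sum>z\<in>X. \<integral>y. indicator (cell w z) y * b y \<partial>\<tau>)"
      unfolding compose_r_integral using sp by (intro sum.cong) (auto simp: Bb_def dest!: sp)
    also have "\<dots> = (\<integral>y. (\<Sum>z\<in>X. indicator (cell w z) y * b y) \<partial>\<tau>)"
      using icb by (intro Bochner_Integration.integral_sum[symmetric]) auto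
    also have "\<dots> = (\<integral>y. b y \<partial>\<tau>)"
    proof (rule integral_cong_AE)
      show "AE y in \<tau>. (\<Sum>z\<in>X. indicator (cell w z) y * b y) = b y"
        using part
      proof eventually_elim
        case (elim y)
        then obtain z where z: "\<forall>g::'a \<Rightarrow> real. (\<Sum>x\<in>X. indicator (cell w x) y * g x) = g z" by blast
        from z[rule_format, of "\<lambda>_. b y"] show ?case .
      qed
    qed (use icb ib in auto)
    finally show ?thesis .
  qed
  \<comment> \<open>Jensen on each cell, obtained by expanding the nonnegative variance around
    \<open>Ab z\<close>.\<close>
  have IA2: "(\<integral>x. (norm (Ab (r x)))\<^sup>2 \<partial>\<sigma>) \<le> (\<integral>y. (norm y)\<^sup>2 \<partial>\<tau>)"
  proof -
    have "(\<integral>x. (norm (Ab (r x)))\<^sup>2 \<partial>\<sigma>) = (\<Sum>z\<in>X. s z * (norm (Ab z))\<^sup>2)"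
      using compose_r_integral[of "\<lambda>z. (norm (Ab z))\<^sup>2"] by simp
    also have "\<dots> \<le> (\<Sum>z\<in>X. \<integral>y. indicator (cell w z) y * (norm y)\<^sup>2 \<partial>\<tau>)"
    proof (rule sum_mono)
      fix z assume z: "z \<in> X"
      have A: "?A z = s z *\<^sub>R Ab z" using sp[OF z] by (simp add: Ab_def)
      have "0 \<le> (\<integral>y. indicator (cell w z) y * (norm (y - Ab z))\<^sup>2 \<partial>\<tau>)"
        by (intro integral_nonneg_AE) auto
      also have "\<dots> = (\<integral>y. indicator (cell w z) y * (norm y)\<^sup>2 - 2 * (Ab z \<bullet> (indicator (cell w z) y *\<^sub>R y))
        + (norm (Ab z))\<^sup>2 * indicator (cell w z) y \<partial>\<tau>)"
        by (intro Bochner_Integration.integral_cong) (auto simp: power2_norm_eq_inner inner_simps inner_commute algebra_simps)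
      also have "\<dots> = (\<integral>y. indicator (cell w z) y * (norm y)\<^sup>2 \<partial>\<tau>) - 2 * (Ab z \<bullet> ?A z) + (norm (Ab z))\<^sup>2 * s z"
      proof -
        have split: "(\<integral>y. f1 y - f2 y + f3 y \<partial>\<tau>) = (\<integral>y. f1 y \<partial>\<tau>) - (\<integral>y. f2 y \<partial>\<tau>) + (\<integral>y. f3 y \<partial>\<tau>)"
          if "integrable \<tau> f1" "integrable \<tau> f2" "integrable \<tau> f3" for f1 f2 f3 :: "'a \<Rightarrow> real"
          using that by simp
        show ?thesis
          by (subst split) (use icy[of z] ic1[of z] ic2[of z] in
            \<open>simp_all only: integrable_mult_right integrable_inner_right integral_inner_right integral_mult_right_zero mass'[OF z]\<close>)
      qed
      also have "Ab z \<bullet> ?A z = s z * (norm (Ab z))\<^sup>2" by (simp add: A power2_norm_eq_inner)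
      finally show "s z * (norm (Ab z))\<^sup>2 \<le> (\<integral>y. indicator (cell w z) y * (norm y)\<^sup>2 \<partial>\<tau>)"
        by (simp add: mult.commute)
    qed
    also have "\<dots> = (\<integral>y. (\<Sum>z\<in>X. indicator (cell w z) y * (norm y)\<^sup>2) \<partial>\<tau>)"
      using ic2 by (intro Bochner_Integration.integral_sum[symmetric]) auto
    also have "\<dots> = (\<integral>y. (norm y)\<^sup>2 \<partial>\<tau>)"
    proof (rule integral_cong_AE)
      show "AE y in \<tau>. (\<Sum>z\<in>X. indicator (cell w z) y * (norm y)\<^sup>2) = (norm y)\<^sup>2"
        using part
      proof eventually_elim
        case (elim y)
        then obtain z where z: "\<forall>g::'a \<Rightarrow> real. (\<Sum>x\<in>X. indicator (cell w x) y * g x) = g z" by blast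
        from z[rule_format, of "\<lambda>_. (norm y)\<^sup>2"] show ?case .
      qed
    qed auto
    finally show ?thesis .
  qed
  have IrA: "(\<integral>x. r x \<bullet> T x \<partial>\<sigma>) \<le> (\<integral>x. r x \<bullet> Ab (r x) \<partial>\<sigma>)"
  proof -
    have "(\<integral>x. r x \<bullet> Ab (r x) \<partial>\<sigma>) = (\<Sum>z\<in>X. s z * (z \<bullet> Ab z))"
      using compose_r_integral[of "\<lambda>z. z \<bullet> Ab z"] by simp
    also have "\<dots> = (\<Sum>z\<in>X. z \<bullet> ?A z)"
      by (intro sum.cong) (auto simp: Ab_def dest!: sp)
    finally show ?thesis using opt by simp
  qed
  have IxT: "(\<integral>x. a x \<partial>\<sigma>) + (\<integral>y. b y \<partial>\<tau>) = (\<integral>x. x \<bullet> T x \<partial>\<sigma>)"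
  proof -
    have ibT: "integrable \<sigma> (\<lambda>x. b (T x))"
      using ib unfolding dT[symmetric] by (intro integrable_distr[of T \<sigma> borel]) auto
    have "(\<integral>y. b y \<partial>\<tau>) = (\<integral>x. b (T x) \<partial>\<sigma>)" unfolding dT[symmetric] by (rule integral_distr) auto
    then have "(\<integral>x. a x \<partial>\<sigma>) + (\<integral>y. b y \<partial>\<tau>) = (\<integral>x. a x + b (T x) \<partial>\<sigma>)" using ia ibT by simp
    also have "\<dots> = (\<integral>x. x \<bullet> T x \<partial>\<sigma>)"
      using eq by (intro integral_cong_AE) (auto elim!: eventually_mono)
    finally show ?thesis .
  qed
  have i1: "integrable \<sigma> (\<lambda>x. (x - r x) \<bullet> T x)" and b1: "\<bar>\<integral>x. (x - r x) \<bullet> T x \<partial>\<sigma>\<bar>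
      \<le> sqrt (\<integral>x. (norm (x - r x))\<^sup>2 \<partial>\<sigma>) * sqrt (\<integral>x. (norm (T x))\<^sup>2 \<partial>\<sigma>)"
    using integral_inner_Cauchy_Schwarz[of "\<lambda>x. x - r x" \<sigma> T] ixr2 iT2 by auto
  have i2: "integrable \<sigma> (\<lambda>x. (x - r x) \<bullet> Ab (r x))" and b2: "\<bar>\<integral>x. (x - r x) \<bullet> Ab (r x) \<partial>\<sigma>\<bar>
      \<le> sqrt (\<integral>x. (norm (x - r x))\<^sup>2 \<partial>\<sigma>) * sqrt (\<integral>x. (norm (Ab (r x)))\<^sup>2 \<partial>\<sigma>)"
    using integral_inner_Cauchy_Schwarz[of "\<lambda>x. x - r x" \<sigma> "\<lambda>x. Ab (r x)"] ixr2 iA2 by auto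
  have irT: "integrable \<sigma> (\<lambda>x. r x \<bullet> T x)" and irA: "integrable \<sigma> (\<lambda>x. r x \<bullet> Ab (r x))"
    using ir2 iT2 iA2 by (auto intro!: integral_inner_Cauchy_Schwarz)
  have "(\<integral>x. x \<bullet> T x \<partial>\<sigma>) = (\<integral>x. (x - r x) \<bullet> T x \<partial>\<sigma>) + (\<integral>x. r x \<bullet> T x \<partial>\<sigma>)"
    using i1 irT by (subst Bochner_Integration.integral_add[symmetric]) (auto simp: inner_diff_left)
  moreover have "(\<integral>x. x \<bullet> Ab (r x) \<partial>\<sigma>) = (\<integral>x. (x - r x) \<bullet> Ab (r x) \<partial>\<sigma>) + (\<integral>x. r x \<bullet> Ab (r x) \<partial>\<sigma>)"
    using i2 irA by (subst Bochner_Integration.integral_add[symmetric]) (auto simp: inner_diff_left)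
  moreover have "(\<integral>x. e x \<partial>\<sigma>) = (\<integral>x. a x \<partial>\<sigma>) + (\<integral>y. b y \<partial>\<tau>) - (\<integral>x. x \<bullet> Ab (r x) \<partial>\<sigma>)"
    unfolding e_def using ia ixA compose_r_integrable[of Bb] IB by simp
  ultimately have "(\<integral>x. e x \<partial>\<sigma>) \<le> (\<integral>x. (x - r x) \<bullet> T x \<partial>\<sigma>) - (\<integral>x. (x - r x) \<bullet> Ab (r x) \<partial>\<sigma>)"
    using IxT IrA by linarith
  also have "\<dots> \<le> sqrt (\<integral>x. (norm (x - r x))\<^sup>2 \<partial>\<sigma>) * sqrt (\<integral>y. (norm y)\<^sup>2 \<partial>\<tau>)
      + sqrt (\<integral>x. (norm (x - r x))\<^sup>2 \<partial>\<sigma>) * sqrt (\<integral>y. (norm y)\<^sup>2 \<partial>\<tau>)"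
  proof -
    have "sqrt (\<integral>x. (norm (x - r x))\<^sup>2 \<partial>\<sigma>) * sqrt (\<integral>x. (norm (Ab (r x)))\<^sup>2 \<partial>\<sigma>)
      \<le> sqrt (\<integral>x. (norm (x - r x))\<^sup>2 \<partial>\<sigma>) * sqrt (\<integral>y. (norm y)\<^sup>2 \<partial>\<tau>)"
      using IA2 by (intro mult_left_mono) auto
    then show ?thesis using b1 b2 unfolding IT2 by linarith
  qed
  finally have Ie: "(\<integral>x. e x \<partial>\<sigma>) \<le> 2 * sqrt (\<integral>x. (norm (x - r x))\<^sup>2 \<partial>\<sigma>) * sqrt (\<integral>y. (norm y)\<^sup>2 \<partial>\<tau>)"
    by (simp only: mult_2 distrib_right)
  have "AE x in \<sigma>. 0 \<le> e x \<and> (\<forall>x'\<in>U. a x + (x' - x) \<bullet> Ab (r x) - e x \<le> a x')"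
    using eq
  proof eventually_elim
    case (elim x)
    have "0 \<le> e x" using low[OF rX, of x x] elim by (simp add: e_def)
    moreover have "a x + (x' - x) \<bullet> Ab (r x) - e x \<le> a x'" if "x' \<in> U" for x'
      using low[OF rX that, of x] by (simp add: e_def inner_diff_left)
    ultimately show ?case by blast
  qed
  with ie Ie show ?thesis by blast
qed

end

section \<open>A transport-entropy inequality with a common base measure\<close>

text \<open>Used twice, with source \<open>\<mu>0\<close> for the targets \<open>\<mu>1\<close>,
  \<open>\<nu>1\<close> and with source \<open>\<nu>1\<close> for the targets \<open>\<mu>0\<close>,
  \<open>\<nu>0\<close>. The two-sided bounds on \<open>\<rho>\<close> make the entropy integrand
  bounded.\<close>

locale base_pair =
  fixes \<sigma> \<mu> \<nu> :: "'a::euclidean_space measure" and U V :: "'a set" and d and \<kappa> c C :: real and \<rho> :: "'a \<Rightarrow> real"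
    and a0 b0 a1 b1 :: "'a \<Rightarrow> real" and W0 W1 :: "'a set" and T0 T1 :: "'a \<Rightarrow> 'a"
  assumes prob_\<sigma>: "prob_space \<sigma>" and sets_\<sigma>: "sets \<sigma> = sets borel" and mom_\<sigma>: "integrable \<sigma> (\<lambda>x. (norm x)\<^sup>2)"
    and \<mu>: "\<mu> = density lborel d" and slc: "slc_density \<kappa> d" and \<kappa>: "\<kappa> > 0"
    and exp_mom: "\<And>L. integrable \<mu> (\<lambda>y. exp (L * norm y))"
    and \<rho>[measurable]: "\<rho> \<in> borel_measurable borel" and c: "0 < c" "\<And>y. c \<le> \<rho> y" "\<And>y. \<rho> y \<le> C"
    and \<nu>: "\<nu> = density \<mu> (\<lambda>y. ennreal (\<rho> y))"
    and nice_\<mu>: "nice_source \<mu> V" and nice_\<nu>: "nice_source \<nu> V"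
    and B0: "brenier_pair \<sigma> \<mu> U a0 W0 b0 T0" and B1: "brenier_pair \<sigma> \<nu> U a1 W1 b1 T1"
begin

definition H :: real where "H = (\<integral>y. \<rho> y * ln (\<rho> y) \<partial>\<mu>)"
definition M0 :: real where "M0 = sqrt (\<integral>y. (norm y)\<^sup>2 \<partial>\<mu>)"
definition M1 :: real where "M1 = sqrt (\<integral>y. (norm y)\<^sup>2 \<partial>\<nu>)"

text \<open>The weighted sum in the discrete inequality is the squared L2 distance of two step
  functions on the source. The defects certify that these are nearly subgradients of
  \<open>a0\<close> and \<open>a1\<close>, with a total error governed by the distance of r from the
  identity.\<close>

lemma base_step:
  assumes r: "r \<in> borel_measurable borel" and rX: "\<And>x. r x \<in> X" and X: "finite X"
    and s_pos: "\<And>z. z \<in> X \<Longrightarrow> 0 < measure \<sigma> (r -` {z})"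
  shows "\<exists>A B e0 e1. A \<in> borel_measurable borel \<and> B \<in> borel_measurable borel \<and>
    integrable \<sigma> (\<lambda>x. (norm (B x - A x))\<^sup>2) \<and> \<kappa> / 2 * (\<integral>x. (norm (B x - A x))\<^sup>2 \<partial>\<sigma>) \<le> H \<and>
    integrable \<sigma> e0 \<and> integrable \<sigma> e1 \<and>
    (AE x in \<sigma>. 0 \<le> e0 x \<and> (\<forall>x'\<in>U. a0 x + (x' - x) \<bullet> A x - e0 x \<le> a0 x')) \<and>
    (AE x in \<sigma>. 0 \<le> e1 x \<and> (\<forall>x'\<in>U. a1 x + (x' - x) \<bullet> B x - e1 x \<le> a1 x')) \<and>
    (\<integral>x. e0 x + e1 x \<partial>\<sigma>) \<le> 2 * sqrt (\<integral>x. (norm (x - r x))\<^sup>2 \<partial>\<sigma>) * (M0 + M1)"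
proof -
  have pm: "prob_space \<mu>" using nice_\<mu> by (simp add: nice_source_def)
  have Xne: "X \<noteq> {}" using rX by blast
  interpret laguerre_base \<mu> d \<kappa> X \<sigma> r
    by (intro laguerre_base.intro laguerre.intro laguerre_base_axioms.intro)
       (assumption | rule pm \<mu> slc \<kappa> exp_mom X Xne rX prob_\<sigma> sets_\<sigma> mom_\<sigma> r s_pos)+
  have sets_\<nu>: "sets \<nu> = sets borel" using nice_\<nu> by (rule nice_source_sets)
  obtain w0 where w0: "\<And>z. z \<in> X \<Longrightarrow> measure \<mu> (cell w0 z) = s z"
    "\<And>T. T \<in> borel_measurable borel \<Longrightarrow> distr \<sigma> borel T = \<mu> \<Longrightarrow>
      (\<integral>x. r x \<bullet> T x \<partial>\<sigma>) \<le> (\<Sum>z\<in>X. z \<bullet> (\<integral>y. indicator (cell w0 z) y *\<^sub>R y \<partial>\<mu>))"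
    using brenier_cells[OF nice_\<mu>] by blast
  obtain w1 where w1: "\<And>z. z \<in> X \<Longrightarrow> measure \<nu> (cell w1 z) = s z"
    "\<And>T. T \<in> borel_measurable borel \<Longrightarrow> distr \<sigma> borel T = \<nu> \<Longrightarrow>
      (\<integral>x. r x \<bullet> T x \<partial>\<sigma>) \<le> (\<Sum>z\<in>X. z \<bullet> (\<integral>y. indicator (cell w1 z) y *\<^sub>R y \<partial>\<nu>))"
    using brenier_cells[OF nice_\<nu>] by blast
  have T: "T0 \<in> borel_measurable borel" "distr \<sigma> borel T0 = \<mu>" "T1 \<in> borel_measurable borel" "distr \<sigma> borel T1 = \<nu>"
    using B0 B1 by (auto simp: brenier_pair_def)
  define A where "A z = (\<integral>y. indicator (cell w0 z) y *\<^sub>R y \<partial>\<mu>)" for z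
  define B where "B z = (\<integral>y. indicator (cell w1 z) y *\<^sub>R y \<partial>\<nu>)" for z
  define Ab where "Ab z = (1 / s z) *\<^sub>R A z" for z
  define Bb where "Bb z = (1 / s z) *\<^sub>R B z" for z
  obtain e0 where e0: "integrable \<sigma> e0"
    "AE x in \<sigma>. 0 \<le> e0 x \<and> (\<forall>x'\<in>U. a0 x + (x' - x) \<bullet> Ab (r x) - e0 x \<le> a0 x')"
    "(\<integral>x. e0 x \<partial>\<sigma>) \<le> 2 * sqrt (\<integral>x. (norm (x - r x))\<^sup>2 \<partial>\<sigma>) * M0"
    using barycentre_defect[OF nice_\<mu> B0 w0(1) w0(2)[OF T(1,2)]] unfolding Ab_def A_def M0_def by blast
  obtain e1 where e1: "integrable \<sigma> e1"
    "AE x in \<sigma>. 0 \<le> e1 x \<and> (\<forall>x'\<in>U. a1 x + (x' - x) \<bullet> Bb (r x) - e1 x \<le> a1 x')"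
    "(\<integral>x. e1 x \<partial>\<sigma>) \<le> 2 * sqrt (\<integral>x. (norm (x - r x))\<^sup>2 \<partial>\<sigma>) * M1"
    using barycentre_defect[OF nice_\<nu> B1 w1(1) w1(2)[OF T(3,4)]] unfolding Bb_def B_def M1_def by blast
  have sp: "0 < s z" if "z \<in> X" for z using s_pos[OF that] by (simp add: s_def)
  have \<rho>0: "0 \<le> \<rho> y" for y using c(1) c(2)[of y] by linarith
  have B': "B z = (\<integral>y. (indicator (cell w1 z) y * \<rho> y) *\<^sub>R y \<partial>\<mu>)" for z
  proof -
    have "B z = (\<integral>y. \<rho> y *\<^sub>R (indicator (cell w1 z) y *\<^sub>R y) \<partial>\<mu>)"
      unfolding B_def \<nu> using \<rho>0 by (intro integral_density) auto
    then show ?thesis by (simp add: mult.commute)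
  qed
  have "\<kappa> / 2 * (\<Sum>x\<in>X. (norm (B x - A x))\<^sup>2 / s x) \<le> H"
    unfolding H_def B' A_def
  proof (rule semidiscrete_talagrand[OF \<rho> c sp])
    show "(\<integral>y. indicator (cell w0 x) y \<partial>\<mu>) = s x" if "x \<in> X" for x
      using w0(1)[OF that] by simp
    show "(\<integral>y. indicator (cell w1 x) y * \<rho> y \<partial>\<mu>) = s x" if "x \<in> X" for x
    proof -
      have "s x = (\<integral>y. indicator (cell w1 x) y \<partial>\<nu>)" using w1(1)[OF that] sets_\<nu> by simp
      also have "\<dots> = (\<integral>y. \<rho> y *\<^sub>R indicator (cell w1 x) y \<partial>\<mu>)"
        unfolding \<nu> using \<rho>0 by (intro integral_density) auto
      finally show ?thesis by (simp add: mult.commute)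
    qed
  qed
  also have "(\<Sum>x\<in>X. (norm (B x - A x))\<^sup>2 / s x) = (\<integral>x. (norm (Bb (r x) - Ab (r x)))\<^sup>2 \<partial>\<sigma>)"
  proof -
    have "(\<integral>x. (norm (Bb (r x) - Ab (r x)))\<^sup>2 \<partial>\<sigma>) = (\<Sum>z\<in>X. s z * (norm (Bb z - Ab z))\<^sup>2)"
      using compose_r_integral[of "\<lambda>z. (norm (Bb z - Ab z))\<^sup>2"] by simp
    also have "\<dots> = (\<Sum>x\<in>X. (norm (B x - A x))\<^sup>2 / s x)"
    proof (rule sum.cong[OF refl])
      fix z assume z: "z \<in> X"
      have "Bb z - Ab z = (1 / s z) *\<^sub>R (B z - A z)" by (simp add: Bb_def Ab_def scaleR_diff_right)
      then have "norm (Bb z - Ab z) = norm (B z - A z) / s z" using sp[OF z] by simp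
      then show "s z * (norm (Bb z - Ab z))\<^sup>2 = (norm (B z - A z))\<^sup>2 / s z"
        using sp[OF z] by (simp add: power_divide power2_eq_square)
    qed
    finally show ?thesis by simp
  qed
  finally have 1: "\<kappa> / 2 * (\<integral>x. (norm (Bb (r x) - Ab (r x)))\<^sup>2 \<partial>\<sigma>) \<le> H" .
  have 2: "(\<integral>x. e0 x + e1 x \<partial>\<sigma>) \<le> 2 * sqrt (\<integral>x. (norm (x - r x))\<^sup>2 \<partial>\<sigma>) * (M0 + M1)"
    using e0(1,3) e1(1,3) by (simp add: distrib_left)
  have 3: "integrable \<sigma> (\<lambda>x. (norm (Bb (r x) - Ab (r x)))\<^sup>2)" by (rule compose_r_integrable)
  show ?thesis
    by (rule exI[of _ "\<lambda>x. Ab (r x)"], rule exI[of _ "\<lambda>x. Bb (r x)"], rule exI[of _ e0], rule exI[of _ e1])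
       (intro conjI compose_r_measurable e0 e1 1 2 3)
qed

text \<open>Simple functions approximate the identity with norm at most twice that of x, so 9 |x|^2
  dominates the squared error.\<close>

lemma simple_approximation:
  obtains r X where "\<And>i. r i \<in> borel_measurable borel" "\<And>i x. r i x \<in> X i" "\<And>i. finite (X i)"
    "\<And>i z. z \<in> X i \<Longrightarrow> 0 < measure \<sigma> (r i -` {z})"
    "(\<lambda>i. \<integral>x. (norm (x - r i x))\<^sup>2 \<partial>\<sigma>) \<longlonglongrightarrow> 0"
proof -
  interpret S: prob_space \<sigma> by (rule prob_\<sigma>)
  have [measurable_cong]: "sets \<sigma> = sets borel" by (rule sets_\<sigma>)
  obtain F where F: "\<And>i. simple_function (borel :: 'a measure) (F i)" "\<And>x. (\<lambda>i. F i x) \<longlonglongrightarrow> x"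
    "\<And>i x. norm (F i x) \<le> 2 * norm x"
    using borel_measurable_implies_sequence_metric[of "\<lambda>x::'a. x" borel 0] by (auto simp: dist_norm)
  have Fm[measurable]: "F i \<in> borel_measurable borel" for i using F(1) by (rule borel_measurable_simple_function)
  have fin: "finite (range (F i))" for i using F(1)[of i] by (simp add: simple_function_def)
  have fm[measurable]: "F i -` {z} \<in> sets borel" for i z using measurable_sets_borel[OF Fm, of "{z}"] by simp
  define X where "X i = {z \<in> range (F i). 0 < measure \<sigma> (F i -` {z})}" for i
  have Xfin: "finite (X i)" for i using fin[of i] by (simp add: X_def)
  have FX: "AE x in \<sigma>. F i x \<in> X i" for i
  proof -
    have "AE x in \<sigma>. \<forall>z\<in>range (F i) - X i. x \<notin> F i -` {z}"
    proof (subst AE_ball_countable)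
      show "countable (range (F i) - X i)" using fin by (intro countable_finite) auto
      show "\<forall>z\<in>range (F i) - X i. AE x in \<sigma>. x \<notin> F i -` {z}"
      proof
        fix z assume "z \<in> range (F i) - X i"
        then have "measure \<sigma> (F i -` {z}) = 0" by (auto simp: X_def not_less measure_le_0_iff)
        then have "F i -` {z} \<in> null_sets \<sigma>" by (auto simp: null_sets_def S.emeasure_eq_measure)
        then show "AE x in \<sigma>. x \<notin> F i -` {z}" by (rule AE_not_in)
      qed
    qed
    then show ?thesis by eventually_elim auto
  qed
  have Xne: "X i \<noteq> {}" for i
  proof
    assume "X i = {}"
    then have "AE x in \<sigma>. False" using FX[of i] by simp
    then show False using S.AE_False by simp
  qed
  \<comment> \<open>Values taken with probability zero are redirected to some atom of positive mass,
    which alters the map only on a null set.\<close>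
  define r where "r i x = (if F i x \<in> X i then F i x else (SOME z. z \<in> X i))" for i x
  have Xm[measurable]: "X i \<in> sets borel" for i using Xfin by (simp add: finite_imp_closed)
  have rm[measurable]: "r i \<in> borel_measurable borel" for i unfolding r_def[abs_def] by measurable
  have rX: "r i x \<in> X i" for i x using someI_ex[of "\<lambda>z. z \<in> X i"] Xne[of i] by (auto simp: r_def)
  have rF: "AE x in \<sigma>. r i x = F i x" for i using FX[of i] by eventually_elim (simp add: r_def)
  have pos: "0 < measure \<sigma> (r i -` {z})" if "z \<in> X i" for i z
  proof -
    have "r i -` {z} \<in> sets borel" using measurable_sets_borel[OF rm, of "{z}"] by simp
    then have "measure \<sigma> (r i -` {z}) = measure \<sigma> (F i -` {z})"
      using rF[of i] by (intro S.finite_measure_eq_AE) (auto elim!: eventually_mono)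
    then show ?thesis using that by (simp add: X_def)
  qed
  have "(\<lambda>i. \<integral>x. (norm (x - F i x))\<^sup>2 \<partial>\<sigma>) \<longlonglongrightarrow> (\<integral>x. 0 \<partial>\<sigma>)"
  proof (rule integral_dominated_convergence[where w="\<lambda>x. 9 * (norm x)\<^sup>2"])
    show "AE x in \<sigma>. (\<lambda>i. (norm (x - F i x))\<^sup>2) \<longlonglongrightarrow> 0"
    proof (intro AE_I2)
      fix x
      have "(\<lambda>i. (norm (x - F i x))\<^sup>2) \<longlonglongrightarrow> (norm (x - x))\<^sup>2" by (intro tendsto_intros F(2))
      then show "(\<lambda>i. (norm (x - F i x))\<^sup>2) \<longlonglongrightarrow> 0" by simp
    qed
    show "AE x in \<sigma>. norm ((norm (x - F i x))\<^sup>2) \<le> 9 * (norm x)\<^sup>2" for i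
    proof (intro AE_I2)
      fix x
      have "norm (x - F i x) \<le> 3 * norm x" using norm_triangle_ineq4[of x "F i x"] F(3)[of i x] by linarith
      then have "(norm (x - F i x))\<^sup>2 \<le> (3 * norm x)\<^sup>2" by (intro power_mono) auto
      then show "norm ((norm (x - F i x))\<^sup>2) \<le> 9 * (norm x)\<^sup>2" by (simp add: power_mult_distrib)
    qed
  qed (use mom_\<sigma> in auto)
  moreover have "(\<integral>x. (norm (x - r i x))\<^sup>2 \<partial>\<sigma>) = (\<integral>x. (norm (x - F i x))\<^sup>2 \<partial>\<sigma>)" for i
    using rF[of i] by (intro integral_cong_AE) (auto elim!: eventually_mono)
  ultimately have lim: "(\<lambda>i. \<integral>x. (norm (x - r i x))\<^sup>2 \<partial>\<sigma>) \<longlonglongrightarrow> 0" by simp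
  show ?thesis using rm rX Xfin pos lim by (rule that)
qed

text \<open>The sum of the two defects tends to 0 in L1, hence almost everywhere along one common
  subsequence. There the step functions converge to T0 and T1 by \<open>supergradient_limit\<close>,
  and Fatou keeps the bound.\<close>

theorem talagrand_base:
  "integrable \<sigma> (\<lambda>x. (norm (T1 x - T0 x))\<^sup>2)" "\<kappa> / 2 * (\<integral>x. (norm (T1 x - T0 x))\<^sup>2 \<partial>\<sigma>) \<le> H"
proof -
  have [measurable_cong]: "sets \<sigma> = sets borel" by (rule sets_\<sigma>)
  have T[measurable]: "T0 \<in> borel_measurable borel" "T1 \<in> borel_measurable borel"
    and sg: "AE x in \<sigma>. supergradient_at U a0 x (T0 x)" "AE x in \<sigma>. supergradient_at U a1 x (T1 x)"
    using B0 B1 by (auto simp: brenier_pair_def elim!: eventually_mono)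
  obtain r X where r: "\<And>i. r i \<in> borel_measurable borel" "\<And>i x. r i x \<in> X i" "\<And>i. finite (X i)"
    "\<And>i z. z \<in> X i \<Longrightarrow> 0 < measure \<sigma> (r i -` {z})"
    and rlim: "(\<lambda>i. \<integral>x. (norm (x - r i x))\<^sup>2 \<partial>\<sigma>) \<longlonglongrightarrow> 0"
    by (rule simple_approximation) blast
  have "\<forall>i. \<exists>A B e0 e1. A \<in> borel_measurable borel \<and> B \<in> borel_measurable borel \<and>
    integrable \<sigma> (\<lambda>x. (norm (B x - A x))\<^sup>2) \<and> \<kappa> / 2 * (\<integral>x. (norm (B x - A x))\<^sup>2 \<partial>\<sigma>) \<le> H \<and>
    integrable \<sigma> e0 \<and> integrable \<sigma> e1 \<and>
    (AE x in \<sigma>. 0 \<le> e0 x \<and> (\<forall>x'\<in>U. a0 x + (x' - x) \<bullet> A x - e0 x \<le> a0 x')) \<and>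
    (AE x in \<sigma>. 0 \<le> e1 x \<and> (\<forall>x'\<in>U. a1 x + (x' - x) \<bullet> B x - e1 x \<le> a1 x')) \<and>
    (\<integral>x. e0 x + e1 x \<partial>\<sigma>) \<le> 2 * sqrt (\<integral>x. (norm (x - r i x))\<^sup>2 \<partial>\<sigma>) * (M0 + M1)"
    by (intro allI base_step[OF r(1,2,3,4)])
  then obtain A B e0 e1 where all: "\<forall>i. A i \<in> borel_measurable borel \<and> B i \<in> borel_measurable borel \<and>
    integrable \<sigma> (\<lambda>x. (norm (B i x - A i x))\<^sup>2) \<and> \<kappa> / 2 * (\<integral>x. (norm (B i x - A i x))\<^sup>2 \<partial>\<sigma>) \<le> H \<and>
    integrable \<sigma> (e0 i) \<and> integrable \<sigma> (e1 i) \<and>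
    (AE x in \<sigma>. 0 \<le> e0 i x \<and> (\<forall>x'\<in>U. a0 x + (x' - x) \<bullet> A i x - e0 i x \<le> a0 x')) \<and>
    (AE x in \<sigma>. 0 \<le> e1 i x \<and> (\<forall>x'\<in>U. a1 x + (x' - x) \<bullet> B i x - e1 i x \<le> a1 x')) \<and>
    (\<integral>x. e0 i x + e1 i x \<partial>\<sigma>) \<le> 2 * sqrt (\<integral>x. (norm (x - r i x))\<^sup>2 \<partial>\<sigma>) * (M0 + M1)"
    unfolding choice_iff by (elim exE)
  have m[measurable]: "\<And>i. A i \<in> borel_measurable borel" "\<And>i. B i \<in> borel_measurable borel"
    and iAB: "\<And>i. integrable \<sigma> (\<lambda>x. (norm (B i x - A i x))\<^sup>2)"
    and AB: "\<And>i. \<kappa> / 2 * (\<integral>x. (norm (B i x - A i x))\<^sup>2 \<partial>\<sigma>) \<le> H"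
    and ie: "\<And>i. integrable \<sigma> (e0 i)" "\<And>i. integrable \<sigma> (e1 i)"
    and e0: "\<And>i. AE x in \<sigma>. 0 \<le> e0 i x \<and> (\<forall>x'\<in>U. a0 x + (x' - x) \<bullet> A i x - e0 i x \<le> a0 x')"
    and e1: "\<And>i. AE x in \<sigma>. 0 \<le> e1 i x \<and> (\<forall>x'\<in>U. a1 x + (x' - x) \<bullet> B i x - e1 i x \<le> a1 x')"
    and Ie: "\<And>i. (\<integral>x. e0 i x + e1 i x \<partial>\<sigma>) \<le> 2 * sqrt (\<integral>x. (norm (x - r i x))\<^sup>2 \<partial>\<sigma>) * (M0 + M1)"
    using all by blast+
  have nn: "(\<integral>x. norm (e0 i x + e1 i x) \<partial>\<sigma>) = (\<integral>x. e0 i x + e1 i x \<partial>\<sigma>)" for i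
  proof (rule integral_cong_AE)
    show "AE x in \<sigma>. norm (e0 i x + e1 i x) = e0 i x + e1 i x"
      using e0[of i] e1[of i] by eventually_elim simp
  qed (use ie in auto)
  have "(\<lambda>i. \<integral>x. norm (e0 i x + e1 i x) \<partial>\<sigma>) \<longlonglongrightarrow> 0"
  proof (rule real_tendsto_sandwich)
    show "\<forall>\<^sub>F i in sequentially. 0 \<le> (\<integral>x. norm (e0 i x + e1 i x) \<partial>\<sigma>)" by simp
    show "\<forall>\<^sub>F i in sequentially. (\<integral>x. norm (e0 i x + e1 i x) \<partial>\<sigma>) \<le> 2 * sqrt (\<integral>x. (norm (x - r i x))\<^sup>2 \<partial>\<sigma>) * (M0 + M1)"
      unfolding nn using Ie by simp
    have "(\<lambda>i. 2 * sqrt (\<integral>x. (norm (x - r i x))\<^sup>2 \<partial>\<sigma>) * (M0 + M1)) \<longlonglongrightarrow> 2 * sqrt 0 * (M0 + M1)"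
      by (intro tendsto_intros rlim)
    then show "(\<lambda>i. 2 * sqrt (\<integral>x. (norm (x - r i x))\<^sup>2 \<partial>\<sigma>) * (M0 + M1)) \<longlonglongrightarrow> 0" by simp
  qed simp
  then obtain k where k: "strict_mono k" "AE x in \<sigma>. (\<lambda>n. e0 (k n) x + e1 (k n) x) \<longlonglongrightarrow> 0"
    using tendsto_L1_AE_subseq[of \<sigma> "\<lambda>i x. e0 i x + e1 i x"] ie by auto
  have "AE x in \<sigma>. \<forall>i. 0 \<le> e0 i x \<and> (\<forall>x'\<in>U. a0 x + (x' - x) \<bullet> A i x - e0 i x \<le> a0 x')"
    using e0 by (simp add: AE_all_countable)
  moreover have "AE x in \<sigma>. \<forall>i. 0 \<le> e1 i x \<and> (\<forall>x'\<in>U. a1 x + (x' - x) \<bullet> B i x - e1 i x \<le> a1 x')"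
    using e1 by (simp add: AE_all_countable)
  ultimately have lim: "AE x in \<sigma>. (\<lambda>n. (norm (B (k n) x - A (k n) x))\<^sup>2) \<longlonglongrightarrow> (norm (T1 x - T0 x))\<^sup>2"
    using k(2) sg
  proof eventually_elim
    case (elim x)
    have z0: "(\<lambda>n. e0 (k n) x) \<longlonglongrightarrow> 0"
      by (rule real_tendsto_sandwich[OF _ _ tendsto_const elim(3)]) (use elim in auto)
    have z1: "(\<lambda>n. e1 (k n) x) \<longlonglongrightarrow> 0"
      by (rule real_tendsto_sandwich[OF _ _ tendsto_const elim(3)]) (use elim in auto)
    have "(\<lambda>n. A (k n) x) \<longlonglongrightarrow> T0 x" by (rule supergradient_limit[OF elim(4) z0]) (use elim in auto)
    moreover have "(\<lambda>n. B (k n) x) \<longlonglongrightarrow> T1 x" by (rule supergradient_limit[OF elim(5) z1]) (use elim in auto)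
    ultimately show ?case by (intro tendsto_intros)
  qed
  have H0: "0 \<le> H"
  proof -
    have "0 \<le> \<kappa> / 2 * (\<integral>x. (norm (B 0 x - A 0 x))\<^sup>2 \<partial>\<sigma>)" using \<kappa> by simp
    then show ?thesis using AB[of 0] by linarith
  qed
  have "(\<integral>\<^sup>+x. ennreal ((norm (T1 x - T0 x))\<^sup>2) \<partial>\<sigma>) = (\<integral>\<^sup>+x. liminf (\<lambda>n. ennreal ((norm (B (k n) x - A (k n) x))\<^sup>2)) \<partial>\<sigma>)"
  proof (rule nn_integral_cong_AE)
    show "AE x in \<sigma>. ennreal ((norm (T1 x - T0 x))\<^sup>2) = liminf (\<lambda>n. ennreal ((norm (B (k n) x - A (k n) x))\<^sup>2))"
      using lim by eventually_elim (metis lim_imp_Liminf tendsto_ennrealI sequentially_bot)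
  qed
  also have "\<dots> \<le> liminf (\<lambda>n. \<integral>\<^sup>+x. ennreal ((norm (B (k n) x - A (k n) x))\<^sup>2) \<partial>\<sigma>)"
    by (rule nn_integral_liminf) measurable
  also have "\<dots> \<le> liminf (\<lambda>n. ennreal (2 * H / \<kappa>))"
  proof (intro Liminf_mono always_eventually allI)
    fix n
    have "(\<integral>x. (norm (B (k n) x - A (k n) x))\<^sup>2 \<partial>\<sigma>) \<le> 2 * H / \<kappa>"
      using AB[of "k n"] \<kappa> by (simp add: field_simps)
    then show "(\<integral>\<^sup>+x. ennreal ((norm (B (k n) x - A (k n) x))\<^sup>2) \<partial>\<sigma>) \<le> ennreal (2 * H / \<kappa>)"
      using iAB by (subst nn_integral_eq_integral) (auto intro: ennreal_leI)
  qed
  finally have le: "(\<integral>\<^sup>+x. ennreal ((norm (T1 x - T0 x))\<^sup>2) \<partial>\<sigma>) \<le> ennreal (2 * H / \<kappa>)"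
    by (simp add: Liminf_const)
  then show i: "integrable \<sigma> (\<lambda>x. (norm (T1 x - T0 x))\<^sup>2)"
    by (intro integrableI_nonneg) (auto intro: le_less_trans)
  then have "(\<integral>x. (norm (T1 x - T0 x))\<^sup>2 \<partial>\<sigma>) \<le> 2 * H / \<kappa>"
    using le H0 \<kappa> by (subst (asm) nn_integral_eq_integral) auto
  then show "\<kappa> / 2 * (\<integral>x. (norm (T1 x - T0 x))\<^sup>2 \<partial>\<sigma>) \<le> H" using \<kappa> by (simp add: field_simps)
qed

end

section \<open>Strongly log-concave measures\<close>

lemma integrable_exp_minus_norm_square:
  assumes a: "(a::real) > 0"
  shows "integrable (lborel :: 'a::euclidean_space measure) (\<lambda>x. exp (- (a * (norm x)\<^sup>2)))"
proof -
  interpret product_sigma_finite "\<lambda>_. lborel :: real measure" by standard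
  have 1: "integrable lborel (\<lambda>t::real. exp (- (a * t\<^sup>2)))"
  proof -
    define s where "s = sqrt (1 / (2 * a))"
    have s: "s > 0" "s\<^sup>2 = 1 / (2 * a)" using a by (auto simp: s_def)
    have "integrable lborel (normal_density 0 s)" using s(1) by (rule integrable_normal_density)
    then have "integrable lborel (\<lambda>t. sqrt (2 * pi * s\<^sup>2) * normal_density 0 s t)" by simp
    moreover have "sqrt (2 * pi * s\<^sup>2) * normal_density 0 s t = exp (- (a * t\<^sup>2))" for t
      using s a by (simp add: normal_density_def field_simps)
    ultimately show ?thesis by simp
  qed
  have "integrable (\<Pi>\<^sub>M b\<in>(Basis::'a set). lborel) (\<lambda>u. \<Prod>b\<in>(Basis::'a set). exp (- (a * (u b)\<^sup>2)))"
    by (rule product_integrable_prod) (use 1 in auto)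
  also have "(\<lambda>u. \<Prod>b\<in>(Basis::'a set). exp (- (a * (u b)\<^sup>2))) =
      (\<lambda>u. exp (- (a * (norm (\<Sum>b\<in>(Basis::'a set). u b *\<^sub>R b))\<^sup>2)))"
  proof
    fix u :: "'a \<Rightarrow> real"
    let ?y = "\<Sum>b\<in>(Basis::'a set). u b *\<^sub>R b"
    have "(norm ?y)\<^sup>2 = (\<Sum>b\<in>Basis. (?y \<bullet> b)\<^sup>2)"
      unfolding power2_norm_eq_inner by (subst euclidean_inner) (simp add: power2_eq_square)
    also have "\<dots> = (\<Sum>b\<in>Basis. (u b)\<^sup>2)" by (intro sum.cong refl) simp
    finally have "- (a * (norm ?y)\<^sup>2) = (\<Sum>b\<in>(Basis::'a set). - (a * (u b)\<^sup>2))"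
      by (simp add: sum_distrib_left sum_negf)
    then show "(\<Prod>b\<in>(Basis::'a set). exp (- (a * (u b)\<^sup>2))) = exp (- (a * (norm ?y)\<^sup>2))"
      by (simp add: exp_sum)
  qed
  finally show ?thesis
    unfolding lborel_eq[where 'a='a] by (subst integrable_distr_eq) auto
qed

lemma lower_semicontinuous_measurable:
  assumes "lower_semicontinuous V"
  shows "V \<in> borel_measurable borel"
proof (rule borel_measurableI_greater)
  fix c
  have "open {x. c < V x}"
  proof (subst open_subopen, clarify)
    fix x assume x: "c < V x"
    then have "c < Liminf (at x) V"
      using assms unfolding lower_semicontinuous_def by (blast intro: less_le_trans)
    then have "eventually (\<lambda>y. c < V y) (at x)" by (rule less_LiminfD)
    \<comment> \<open>\<open>Liminf (at x)\<close> ignores the point x itself, which is added back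
      by the assumption on \<open>V x\<close>.\<close>
    then have "eventually (\<lambda>y. c < V y) (nhds x)" using x by (auto simp: eventually_at_filter elim: eventually_mono)
    then show "\<exists>T. open T \<and> x \<in> T \<and> T \<subseteq> {x. c < V x}" by (auto simp: eventually_nhds)
  qed
  then show "{x \<in> space borel. c < V x} \<in> sets borel" by simp
qed

lemma exp_minus_measurable[measurable]: "exp_minus \<in> borel_measurable borel"
proof -
  have "exp_minus = (\<lambda>v. if v = \<infinity> then 0 else if v = -\<infinity> then \<infinity> else ennreal (exp (- real_of_ereal v)))"
    by (rule ext) (auto simp: exp_minus_def split: ereal.split)
  also have "\<dots> \<in> borel_measurable borel" by measurable
  finally show ?thesis .
qed

text \<open>Let y lie at distance r from x0 on the side opposite to x, where g is at most M. As x0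
  lies between x and y, convexity bounds g x from below, with slope (M - g x0) / r.\<close>

lemma convex_on_affine_lower_bound:
  fixes g :: "'a::euclidean_space \<Rightarrow> real"
  assumes g: "convex_on D g" and x0: "x0 \<in> interior D"
  shows "\<exists>c\<ge>0. \<forall>x\<in>D. g x0 - c * norm (x - x0) \<le> g x"
proof -
  have "continuous_on (interior D) g"
    using convex_on_subset[OF g interior_subset convex_interior] convex_on_imp_convex[OF g]
    by (intro convex_on_continuous) auto
  obtain r where r: "r > 0" "cball x0 r \<subseteq> interior D"
    using x0 open_contains_cball open_interior by blast
  have "compact (g ` cball x0 r)"
    using continuous_on_subset[OF \<open>continuous_on (interior D) g\<close> r(2)] compact_cball by (rule compact_continuous_image)
  then obtain M where M: "\<And>y. y \<in> cball x0 r \<Longrightarrow> \<bar>g y\<bar> \<le> M"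
    using compact_imp_bounded by (force simp: bounded_iff)
  define c where "c = (M - g x0) / r"
  have c0: "0 \<le> c" using M[of x0] r by (simp add: c_def)
  have "g x0 - c * norm (x - x0) \<le> g x" if x: "x \<in> D" for x
  proof (cases "x = x0")
    case False
    define s where "s = norm (x - x0)"
    have s: "s > 0" using False by (simp add: s_def)
    define y where "y = x0 - (r / s) *\<^sub>R (x - x0)"
    have y: "y \<in> cball x0 r" using s r by (simp add: y_def dist_norm s_def)
    have yD: "y \<in> D" using y r interior_subset by blast
    have e: "(1 - s / (r + s)) *\<^sub>R x + (s / (r + s)) *\<^sub>R y = x0"
    proof -
      have 1: "1 - s / (r + s) = r / (r + s)" "s / (r + s) * (r / s) = r / (r + s)"
        using r s by (simp_all add: field_simps)
      have "(1 - s / (r + s)) *\<^sub>R x + (s / (r + s)) *\<^sub>R y =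
          (r / (r + s)) *\<^sub>R x + (s / (r + s)) *\<^sub>R x0 - (r / (r + s)) *\<^sub>R (x - x0)"
        using s by (simp add: y_def scaleR_diff_right 1)
      also have "\<dots> = (r / (r + s) + s / (r + s)) *\<^sub>R x0" by (simp add: algebra_simps)
      also have "\<dots> = x0" using r s by (simp add: add_divide_distrib[symmetric])
      finally show ?thesis .
    qed
    have "g x0 \<le> (1 - s / (r + s)) * g x + (s / (r + s)) * g y"
      using convex_onD[OF g _ _ x yD, of "s / (r + s)"] r s unfolding e by simp
    also have "\<dots> \<le> (1 - s / (r + s)) * g x + (s / (r + s)) * M"
      using M[OF y] r s by (intro add_left_mono mult_left_mono) auto
    also have "1 - s / (r + s) = r / (r + s)" using r s by (simp add: field_simps)
    also have "r / (r + s) * g x + s / (r + s) * M = (r * g x + s * M) / (r + s)" by (simp add: add_divide_distrib)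
    finally have "g x0 * (r + s) \<le> r * g x + s * M" using r s by (simp add: pos_le_divide_eq)
    then have "g x0 - (M - g x0) * s / r \<le> g x" using r by (simp add: field_simps)
    then show ?thesis by (simp add: c_def s_def)
  qed simp
  with c0 show ?thesis by blast
qed

text \<open>The convex set where V is finite cannot be null, since \<open>\<mu>\<close> has mass
  one; so it has interior points, and its frontier is null. Hence \<open>\<mu>\<close> lives on the
  interior. Moments are finite because V grows at least like \<kappa> |x|^2 / 2 minus a linear
  term.\<close>

lemma strongly_log_concave_nice:
  fixes \<mu> :: "'a::euclidean_space measure"
  assumes "strongly_log_concave \<kappa> \<mu>"
  shows "\<exists>U d. nice_source \<mu> U \<and> \<mu> = density lborel d \<and> slc_density \<kappa> d \<and> (\<forall>L. integrable \<mu> (\<lambda>y. exp (L * norm y)))"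
proof -
  obtain V where \<kappa>: "\<kappa> > 0" and pm: "prob_space \<mu>" and V: "proper_ereal_fun V" "lower_semicontinuous V"
    "convex_ereal_fun (\<lambda>x. V x - ereal (\<kappa> * (norm x)\<^sup>2 / 2))" and \<mu>: "\<mu> = density lborel (\<lambda>x. exp_minus (V x))"
    using assms unfolding strongly_log_concave_def by blast
  have [measurable]: "V \<in> borel_measurable borel" by (rule lower_semicontinuous_measurable) fact
  define d where "d x = exp_minus (V x)" for x
  have \<mu>d: "\<mu> = density lborel d" by (simp add: \<mu> d_def[abs_def])
  have dm[measurable]: "d \<in> borel_measurable borel" unfolding d_def[abs_def] by measurable
  define D where "D = {x. V x \<noteq> \<infinity>}"
  have [measurable]: "D \<in> sets borel" unfolding D_def by measurable
  define v where "v x = real_of_ereal (V x)" for x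
  have Vv: "V x = ereal (v x)" if "x \<in> D" for x
    using that V(1) by (auto simp: D_def v_def proper_ereal_fun_def ereal_real)
  have dD: "d x = ennreal (exp (- v x))" if "x \<in> D" for x by (simp add: d_def Vv[OF that] exp_minus_def)
  have dnD: "d x = 0" if "x \<notin> D" for x using that by (simp add: d_def D_def exp_minus_def)
  define g where "g x = v x - \<kappa> * (norm x)\<^sup>2 / 2" for x
  have conv: "u *\<^sub>R x + w *\<^sub>R y \<in> D \<and> g (u *\<^sub>R x + w *\<^sub>R y) \<le> u * g x + w * g y"
    if "x \<in> D" "y \<in> D" "u > 0" "w > 0" "u + w = 1" for x y u w
  proof -
    let ?z = "u *\<^sub>R x + w *\<^sub>R y"
    have "V ?z - ereal (\<kappa> * (norm ?z)\<^sup>2 / 2) \<le>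
        ereal u * (V x - ereal (\<kappa> * (norm x)\<^sup>2 / 2)) + ereal w * (V y - ereal (\<kappa> * (norm y)\<^sup>2 / 2))"
      using V(3) that unfolding convex_ereal_fun_def by blast
    also have "\<dots> = ereal (u * g x + w * g y)" using that by (simp add: Vv g_def)
    finally have *: "V ?z - ereal (\<kappa> * (norm ?z)\<^sup>2 / 2) \<le> ereal (u * g x + w * g y)" .
    then have z: "?z \<in> D" by (auto simp: D_def)
    then show ?thesis using * by (simp add: Vv g_def)
  qed
  have cD: "convex D"
    unfolding convex_alt
  proof (intro ballI allI impI)
    fix x y u assume *: "x \<in> D" "y \<in> D" "0 \<le> u \<and> u \<le> (1::real)"
    then show "(1 - u) *\<^sub>R x + u *\<^sub>R y \<in> D"
      using conv[of x y "1 - u" u] by (cases "u = 0 \<or> u = 1") auto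
  qed
  have g: "convex_on D g"
  proof (rule convex_onI[OF _ cD])
    fix t x y assume "0 < t" "t < (1::real)" "x \<in> D" "y \<in> D"
    then show "g ((1 - t) *\<^sub>R x + t *\<^sub>R y) \<le> (1 - t) * g x + t * g y" using conv[of x y "1 - t" t] by simp
  qed
  define U where "U = interior D"
  have U: "open U" "convex U" using cD by (auto simp: U_def convex_interior)
  have "U \<noteq> {}"
  proof
    assume "U = {}"
    then have "negligible D" using negligible_convex_interior[OF cD] by (simp add: U_def)
    then have "D \<in> null_sets lborel" by (simp add: negligible_iff_null_sets null_sets_completion_iff)
    then have "AE x in lborel. x \<notin> D" by (rule AE_not_in)
    then have "AE x in lborel. d x = 0" by eventually_elim (rule dnD)
    then have "emeasure \<mu> (space \<mu>) = 0" by (simp add: \<mu>d emeasure_density nn_integral_0_iff_AE)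
    then show False using prob_space.emeasure_space_1[OF pm] by simp
  qed
  then obtain x0 where x0: "x0 \<in> U" by blast
  have "negligible (frontier D)" by (rule negligible_convex_frontier[OF cD])
  then have "frontier D \<in> null_sets lborel" by (simp add: negligible_iff_null_sets null_sets_completion_iff frontier_closed)
  then have "AE x in lborel. x \<notin> frontier D" by (rule AE_not_in)
  then have "AE x in lborel. 0 < d x \<longrightarrow> x \<in> U"
  proof eventually_elim
    case (elim x)
    then show ?case using closure_subset[of D] dnD[of x] by (cases "x \<in> D") (auto simp: frontier_def U_def)
  qed
  then have AEU: "AE x in \<mu>. x \<in> U" unfolding \<mu>d by (subst AE_density) auto
  obtain c1 where c1: "c1 \<ge> 0" "\<And>x. x \<in> D \<Longrightarrow> g x0 - c1 * norm (x - x0) \<le> g x"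
    using convex_on_affine_lower_bound[OF g x0[unfolded U_def]] by blast
  have slc: "slc_density \<kappa> d"
    unfolding slc_density_def
  proof (intro conjI allI dm)
    fix y z
    show "d y * d z * ennreal (exp (\<kappa> * (norm (y - z))\<^sup>2 / 4)) \<le> (d ((1 / 2) *\<^sub>R (y + z)))\<^sup>2"
    proof (cases "y \<in> D \<and> z \<in> D")
      case True
      let ?m = "(1 / 2) *\<^sub>R (y + z)"
      have m: "?m \<in> D" "g ?m \<le> 1/2 * g y + 1/2 * g z"
        using conv[of y z "1/2" "1/2"] True by (auto simp: scaleR_add_right)
      \<comment> \<open>The parallelogram identity, the source of the gain with constant \<kappa> /
        4.\<close>
      have nm: "(norm ?m)\<^sup>2 = (norm y)\<^sup>2 / 2 + (norm z)\<^sup>2 / 2 - (norm (y - z))\<^sup>2 / 4"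
        by (simp add: power2_norm_eq_inner inner_simps inner_commute field_simps)
      have "\<kappa> * (norm ?m)\<^sup>2 / 2 = \<kappa> * (norm y)\<^sup>2 / 4 + \<kappa> * (norm z)\<^sup>2 / 4 - \<kappa> * (norm (y - z))\<^sup>2 / 8"
        unfolding nm by (simp add: algebra_simps add_divide_distrib diff_divide_distrib)
      moreover have "2 * c \<le> a + b - r / 4"
        if "s / 2 = p / 4 + q / 4 - r / 8" "c - s / 2 \<le> 1/2 * (a - p / 2) + 1/2 * (b - q / 2)"
        for a b c p q r s :: real using that by (simp add: field_simps)
      ultimately have "2 * v ?m \<le> v y + v z - \<kappa> * (norm (y - z))\<^sup>2 / 4"
        using m(2) unfolding g_def by blast
      then have "exp (- v y + - v z + \<kappa> * (norm (y - z))\<^sup>2 / 4) \<le> exp (2 * - v ?m)" by simp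
      then have "exp (- v y) * exp (- v z) * exp (\<kappa> * (norm (y - z))\<^sup>2 / 4) \<le> (exp (- v ?m))\<^sup>2"
        unfolding exp_add exp_double .
      then have "ennreal (exp (- v y) * exp (- v z) * exp (\<kappa> * (norm (y - z))\<^sup>2 / 4)) \<le> ennreal ((exp (- v ?m))\<^sup>2)"
        by (rule ennreal_leI)
      then show ?thesis using True m by (simp add: dD ennreal_mult ennreal_power)
    qed (auto simp: dnD)
  qed
  have expm: "integrable \<mu> (\<lambda>y. exp (L * norm y))" for L
  proof -
    \<comment> \<open>c collects all linear growth. Half of the quadratic term absorbs c |x| at the
      price of c^2 / \<kappa>, and the other half stays as a Gaussian.\<close>
    define c where "c = c1 + \<bar>L\<bar>"
    define K where "K = exp (- g x0 + c1 * norm x0 + c\<^sup>2 / \<kappa>)"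
    have K0: "K \<ge> 0" by (simp add: K_def)
    have bd: "d x * ennreal (exp (L * norm x)) \<le> ennreal (K * exp (- (\<kappa> / 4 * (norm x)\<^sup>2)))" for x
    proof (cases "x \<in> D")
      case True
      have "c1 * norm (x - x0) \<le> c1 * (norm x + norm x0)"
        using c1(1) by (intro mult_left_mono norm_triangle_ineq4)
      moreover have "L * norm x \<le> \<bar>L\<bar> * norm x" by (intro mult_right_mono) auto
      moreover have "c * norm x \<le> \<kappa> / 4 * (norm x)\<^sup>2 + c\<^sup>2 / \<kappa>"
      proof -
        have "0 \<le> (\<kappa> * norm x / 2 - c)\<^sup>2 / \<kappa>" using \<kappa> by simp
        also have "\<dots> = \<kappa> / 4 * (norm x)\<^sup>2 + c\<^sup>2 / \<kappa> - c * norm x"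
          using \<kappa> by (simp add: power2_eq_square field_simps)
        finally show ?thesis by simp
      qed
      ultimately have "- v x + L * norm x \<le> (- g x0 + c1 * norm x0 + c\<^sup>2 / \<kappa>) + - (\<kappa> / 4 * (norm x)\<^sup>2)"
        using c1(2)[OF True] by (simp add: g_def c_def algebra_simps)
      then have "exp (- v x + L * norm x) \<le> exp ((- g x0 + c1 * norm x0 + c\<^sup>2 / \<kappa>) + - (\<kappa> / 4 * (norm x)\<^sup>2))" by simp
      then have "exp (- v x) * exp (L * norm x) \<le> K * exp (- (\<kappa> / 4 * (norm x)\<^sup>2))"
        unfolding K_def exp_add[symmetric] .
      then have "ennreal (exp (- v x) * exp (L * norm x)) \<le> ennreal (K * exp (- (\<kappa> / 4 * (norm x)\<^sup>2)))"
        by (rule ennreal_leI)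
      then show ?thesis by (simp add: dD[OF True] ennreal_mult)
    qed (simp add: dnD)
    have i: "integrable lborel (\<lambda>x::'a. K * exp (- (\<kappa> / 4 * (norm x)\<^sup>2)))"
      using integrable_exp_minus_norm_square[of "\<kappa> / 4", where 'a='a] \<kappa> by simp
    have "(\<integral>\<^sup>+y. ennreal (exp (L * norm y)) \<partial>\<mu>) = (\<integral>\<^sup>+x. d x * ennreal (exp (L * norm x)) \<partial>lborel)"
      unfolding \<mu>d by (subst nn_integral_density) auto
    also have "\<dots> \<le> (\<integral>\<^sup>+x. ennreal (K * exp (- (\<kappa> / 4 * (norm (x::'a))\<^sup>2))) \<partial>lborel)" by (intro nn_integral_mono bd)
    also have "\<dots> < \<infinity>" using i K0 by (subst nn_integral_eq_integral) auto
    finally show ?thesis unfolding integrable_iff_bounded by (auto simp: \<mu>d)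
  qed
  have mom: "integrable \<mu> (\<lambda>x. (norm x)\<^sup>2)"
  proof (rule Bochner_Integration.integrable_bound)
    show "integrable \<mu> (\<lambda>y. 2 * exp (1 * norm y))" using expm[of 1] by simp
    show "AE x in \<mu>. norm ((norm x)\<^sup>2) \<le> norm (2 * exp (1 * norm x))"
    proof (rule AE_I2)
      fix x :: 'a
      have "1 + norm x + (norm x)\<^sup>2 / 2 \<le> exp (norm x)" by (rule exp_lower_Taylor_quadratic) simp
      then have "(norm x)\<^sup>2 \<le> 2 * exp (norm x)" using norm_ge_zero[of x] by linarith
      then show "norm ((norm x)\<^sup>2) \<le> norm (2 * exp (1 * norm x))" by simp
    qed
  qed (auto simp: \<mu>d)
  have loc: "\<exists>r>0. \<exists>c>0. ball x r \<subseteq> U \<and> (\<forall>y\<in>ball x r. ennreal c \<le> d y)" if x: "x \<in> U" for x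
  proof -
    have "continuous_on U g"
      using convex_on_subset[OF g interior_subset convex_interior[OF cD]] U unfolding U_def
      by (intro convex_on_continuous) auto
    then have cv: "continuous_on U (\<lambda>x. g x + \<kappa> * (norm x)\<^sup>2 / 2)" by (intro continuous_intros) auto
    obtain r where r: "r > 0" "cball x r \<subseteq> U" using x U(1) open_contains_cball by blast
    have "compact ((\<lambda>x. g x + \<kappa> * (norm x)\<^sup>2 / 2) ` cball x r)"
      using continuous_on_subset[OF cv r(2)] compact_cball by (rule compact_continuous_image)
    then obtain M where M: "\<And>y. y \<in> cball x r \<Longrightarrow> \<bar>g y + \<kappa> * (norm y)\<^sup>2 / 2\<bar> \<le> M"
      using compact_imp_bounded by (force simp: bounded_iff)
    have "ennreal (exp (- M)) \<le> d y" if y: "y \<in> ball x r" for y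
    proof -
      have "y \<in> cball x r" using y by simp
      then have "y \<in> D" "v y \<le> M" using M[of y] r(2) interior_subset[of D] by (auto simp: g_def U_def)
      then show ?thesis by (simp add: dD ennreal_leI)
    qed
    moreover have "ball x r \<subseteq> U" using r(2) ball_subset_cball by blast
    ultimately show ?thesis using r(1) by (intro exI[of _ r] conjI exI[of _ "exp (- M)"] ballI) simp_all
  qed
  have "nice_source \<mu> U"
    unfolding nice_source_def by (intro conjI pm U \<open>U \<noteq> {}\<close> AEU mom bexI[OF _ dm] \<mu>d ballI loc)
  then show ?thesis by (intro exI[of _ U] exI[of _ d] conjI \<mu>d slc allI expm)
qed

section \<open>Uniqueness of optimal maps\<close>

lemma nice_source_density:
  assumes nice: "nice_source \<mu> U" and \<rho>[measurable]: "\<rho> \<in> borel_measurable borel"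
    and c: "0 < c" "\<And>x. c \<le> \<rho> x" "\<And>x. \<rho> x \<le> C" and one: "(\<integral>x. \<rho> x \<partial>\<mu>) = 1"
  shows "nice_source (density \<mu> (\<lambda>x. ennreal (\<rho> x))) U"
proof -
  obtain d where d[measurable]: "d \<in> borel_measurable borel" and \<mu>: "\<mu> = density lborel d"
    and loc: "\<And>x. x \<in> U \<Longrightarrow> \<exists>r>0. \<exists>k>0. ball x r \<subseteq> U \<and> (\<forall>y\<in>ball x r. ennreal k \<le> d y)"
    using nice unfolding nice_source_def by blast
  have n: "prob_space \<mu>" "open U" "convex U" "U \<noteq> {}" "AE x in \<mu>. x \<in> U" "integrable \<mu> (\<lambda>x. (norm x)\<^sup>2)"
    using nice by (auto simp: nice_source_def)
  have s[measurable_cong]: "sets \<mu> = sets borel" by (simp add: \<mu>)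
  have \<rho>0: "0 \<le> \<rho> x" for x using c(1) c(2)[of x] by linarith
  have C0: "0 \<le> C" using \<rho>0 c(3) order_trans by blast
  interpret prob_space \<mu> by (rule n)
  have i: "integrable \<mu> \<rho>" by (rule integrable_const_bound[of _ C]) (use c \<rho>0 in auto)
  have "prob_space (density \<mu> (\<lambda>x. ennreal (\<rho> x)))"
  proof
    have "(\<integral>\<^sup>+x. ennreal (\<rho> x) \<partial>\<mu>) = ennreal 1"
      unfolding one[symmetric] by (rule nn_integral_eq_integral[OF i]) (use \<rho>0 in auto)
    then show "emeasure (density \<mu> (\<lambda>x. ennreal (\<rho> x))) (space (density \<mu> (\<lambda>x. ennreal (\<rho> x)))) = 1"
      by (simp add: emeasure_density)
  qed
  moreover have "AE x in density \<mu> (\<lambda>x. ennreal (\<rho> x)). x \<in> U"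
    using n(5) by (subst AE_density) auto
  moreover have "integrable (density \<mu> (\<lambda>x. ennreal (\<rho> x))) (\<lambda>x. (norm x)\<^sup>2)"
  proof (subst integrable_density)
    show "integrable \<mu> (\<lambda>x. \<rho> x *\<^sub>R (norm x)\<^sup>2)"
      by (rule Bochner_Integration.integrable_bound[of _ "\<lambda>x. C * (norm x)\<^sup>2"])
         (use n(6) c(3) \<rho>0 C0 in \<open>auto simp: abs_mult intro!: mult_right_mono\<close>)
  qed (use \<rho>0 in auto)
  moreover have "density \<mu> (\<lambda>x. ennreal (\<rho> x)) = density lborel (\<lambda>x. d x * ennreal (\<rho> x))"
    unfolding \<mu> by (rule density_density_eq) auto
  moreover have "\<exists>r>0. \<exists>k>0. ball x r \<subseteq> U \<and> (\<forall>y\<in>ball x r. ennreal k \<le> d y * ennreal (\<rho> y))" if "x \<in> U" for x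
  proof -
    obtain r k where r: "r > 0" "k > 0" "ball x r \<subseteq> U" "\<And>y. y \<in> ball x r \<Longrightarrow> ennreal k \<le> d y"
      using loc[OF \<open>x \<in> U\<close>] by blast
    have "ennreal (k * c) \<le> d y * ennreal (\<rho> y)" if "y \<in> ball x r" for y
      using r(2) c(1) by (simp add: ennreal_mult mult_mono r(4)[OF that] ennreal_leI[OF c(2)])
    then show ?thesis using r c(1) by (intro exI[of _ r] conjI exI[of _ "k * c"]) auto
  qed
  ultimately show ?thesis
    unfolding nice_source_def using n(2,3,4)
    by (intro conjI bexI[of _ "\<lambda>x. d x * ennreal (\<rho> x)"]) simp_all
qed

text \<open>The gap g = a + b minus the inner product is nonnegative, and its integral is the
  difference of the two sides. If it vanishes, Y w is an exact subgradient of a at X w and so equals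
  T (X w). A coupling is given by two random variables on M, so that a map can enter from either
  end.\<close>

lemma brenier_pair_optimal:
  fixes \<sigma> \<tau> :: "'a::euclidean_space measure" and X Y :: "'m \<Rightarrow> 'a"
  assumes B: "brenier_pair \<sigma> \<tau> U a W b T" and M: "prob_space M"
    and X[measurable]: "X \<in> borel_measurable M" and dX: "distr M borel X = \<sigma>"
    and Y[measurable]: "Y \<in> borel_measurable M" and dY: "distr M borel Y = \<tau>"
    and mom: "integrable \<sigma> (\<lambda>x. (norm x)\<^sup>2)" "integrable \<tau> (\<lambda>x. (norm x)\<^sup>2)"
  shows "(\<integral>w. X w \<bullet> Y w \<partial>M) \<le> (\<integral>x. x \<bullet> T x \<partial>\<sigma>)"
    and "(\<integral>x. x \<bullet> T x \<partial>\<sigma>) \<le> (\<integral>w. X w \<bullet> Y w \<partial>M) \<Longrightarrow> AE w in M. Y w = T (X w)"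
proof -
  interpret prob_space M by (rule M)
  have W: "AE y in \<tau>. y \<in> W" and le: "\<And>x y. x \<in> U \<Longrightarrow> y \<in> W \<Longrightarrow> x \<bullet> y \<le> a x + b y"
    and i: "integrable \<sigma> a" "integrable \<tau> b" and T: "T \<in> borel_measurable borel" "distr \<sigma> borel T = \<tau>"
    and AE\<sigma>: "AE x in \<sigma>. x \<in> U \<and> T x \<in> W \<and> a x + b (T x) = x \<bullet> T x \<and> supergradient_at U a x (T x)"
    using B unfolding brenier_pair_def by blast+
  have s: "sets \<sigma> = sets borel" "sets \<tau> = sets borel" by (simp_all add: dX[symmetric] dY[symmetric])
  have [measurable]: "a \<in> borel_measurable borel" "b \<in> borel_measurable borel"
    using borel_measurable_integrable[OF i(1)] borel_measurable_integrable[OF i(2)] s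
    by (simp_all cong: measurable_cong_sets)
  have [measurable]: "T \<in> borel_measurable borel" "T \<in> borel_measurable \<sigma>"
    using T(1) s by (simp_all cong: measurable_cong_sets)
  have iM: "integrable M (\<lambda>w. a (X w))" "integrable M (\<lambda>w. b (Y w))"
    using i unfolding dX[symmetric] dY[symmetric] by (simp_all add: integrable_distr_eq)
  have i2: "integrable M (\<lambda>w. (norm (X w))\<^sup>2)" "integrable M (\<lambda>w. (norm (Y w))\<^sup>2)"
    using mom unfolding dX[symmetric] dY[symmetric] by (simp_all add: integrable_distr_eq)
  have iXY: "integrable M (\<lambda>w. X w \<bullet> Y w)"
    by (rule integral_inner_Cauchy_Schwarz[OF X Y i2])
  define g where "g w = a (X w) + b (Y w) - X w \<bullet> Y w" for w
  have ig: "integrable M g" unfolding g_def[abs_def] using iM iXY by simp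
  have AEX: "AE w in M. X w \<in> U \<and> supergradient_at U a (X w) (T (X w))"
  proof (rule AE_distrD[OF X])
    show "AE x in distr M borel X. x \<in> U \<and> supergradient_at U a x (T x)"
      unfolding dX using AE\<sigma> by eventually_elim blast
  qed
  have AEY: "AE w in M. Y w \<in> W" by (rule AE_distrD[OF Y]) (simp only: dY W)
  have g0: "AE w in M. 0 \<le> g w"
    using AEX AEY by eventually_elim (use le in \<open>auto simp: g_def\<close>)
  have "(\<integral>x. x \<bullet> T x \<partial>\<sigma>) = (\<integral>x. a x + b (T x) \<partial>\<sigma>)"
    by (rule integral_cong_AE) (use AE\<sigma> s in \<open>auto cong: measurable_cong_sets\<close>)
  also have "\<dots> = (\<integral>x. a x \<partial>\<sigma>) + (\<integral>x. b (T x) \<partial>\<sigma>)"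
    by (rule Bochner_Integration.integral_add[OF i(1)])
       (use i(2) in \<open>simp add: T(2)[symmetric] integrable_distr_eq\<close>)
  also have "(\<integral>x. b (T x) \<partial>\<sigma>) = (\<integral>y. b y \<partial>\<tau>)" by (simp add: T(2)[symmetric] integral_distr)
  also have "(\<integral>y. b y \<partial>\<tau>) = (\<integral>w. b (Y w) \<partial>M)" by (simp add: dY[symmetric] integral_distr)
  also have "(\<integral>x. a x \<partial>\<sigma>) = (\<integral>w. a (X w) \<partial>M)" by (simp add: dX[symmetric] integral_distr)
  finally have gap: "(\<integral>w. g w \<partial>M) = (\<integral>x. x \<bullet> T x \<partial>\<sigma>) - (\<integral>w. X w \<bullet> Y w \<partial>M)"
    unfolding g_def using iM iXY by simp
  have "0 \<le> (\<integral>w. g w \<partial>M)" by (rule integral_nonneg_AE[OF g0])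
  then show "(\<integral>w. X w \<bullet> Y w \<partial>M) \<le> (\<integral>x. x \<bullet> T x \<partial>\<sigma>)" using gap by simp
  assume "(\<integral>x. x \<bullet> T x \<partial>\<sigma>) \<le> (\<integral>w. X w \<bullet> Y w \<partial>M)"
  then have "(\<integral>w. g w \<partial>M) = 0" using gap \<open>0 \<le> (\<integral>w. g w \<partial>M)\<close> by simp
  then have "AE w in M. g w = 0" using integral_nonneg_eq_0_iff_AE[OF ig g0] by simp
  then show "AE w in M. Y w = T (X w)"
    using AEX AEY
  proof eventually_elim
    case (elim w)
    have "a (X w) + (x' - X w) \<bullet> Y w - 0 \<le> a x'" if "x' \<in> U" for x'
      using le[OF that, of "Y w"] elim by (simp add: g_def inner_diff_left)
    then have "(\<lambda>_::nat. Y w) \<longlonglongrightarrow> T (X w)"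
      using elim by (intro supergradient_limit[of U a "X w" "T (X w)" "\<lambda>_. 0"]) auto
    then show ?case by (simp add: LIMSEQ_const_iff)
  qed
qed

text \<open>Read backwards, T gives a coupling against which S is optimal. This is the inequality
  required by the uniqueness part for T, applied to the pair (S y, y).\<close>

lemma brenier_pair_inverse:
  fixes \<sigma> \<tau> :: "'a::euclidean_space measure"
  assumes B: "brenier_pair \<sigma> \<tau> U a W b T" and B': "brenier_pair \<tau> \<sigma> U' a' W' b' S"
    and p: "prob_space \<sigma>" "prob_space \<tau>" and s: "sets \<sigma> = sets borel" "sets \<tau> = sets borel"
    and mom: "integrable \<sigma> (\<lambda>x. (norm x)\<^sup>2)" "integrable \<tau> (\<lambda>x. (norm x)\<^sup>2)"
  shows "AE y in \<tau>. T (S y) = y"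
proof -
  have T: "T \<in> borel_measurable \<sigma>" "distr \<sigma> borel T = \<tau>" and S: "S \<in> borel_measurable \<tau>" "distr \<tau> borel S = \<sigma>"
    using B B' s by (simp_all add: brenier_pair_def cong: measurable_cong_sets)
  have id: "(\<lambda>x. x) \<in> borel_measurable \<sigma>" "(\<lambda>x. x) \<in> borel_measurable \<tau>" using s by (simp_all cong: measurable_cong_sets)
  have did: "distr \<sigma> borel (\<lambda>x. x) = \<sigma>" "distr \<tau> borel (\<lambda>x. x) = \<tau>" using s by (simp_all add: distr_id2)
  have "(\<integral>x. T x \<bullet> x \<partial>\<sigma>) \<le> (\<integral>y. y \<bullet> S y \<partial>\<tau>)"
    by (rule brenier_pair_optimal(1)[OF B' p(1) T id(1) did(1) mom(2,1)])
  then have "(\<integral>x. x \<bullet> T x \<partial>\<sigma>) \<le> (\<integral>y. S y \<bullet> y \<partial>\<tau>)" by (simp add: inner_commute)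
  then have "AE y in \<tau>. y = T (S y)"
    by (rule brenier_pair_optimal(2)[OF B p(2) S id(2) did(2) mom])
  then show ?thesis by eventually_elim simp
qed

text \<open>The contact condition is pointwise, and the composition of \<open>\<rho>\<close> with T
  is the same weight seen from the source, so the old potentials still certify T.\<close>

lemma brenier_pair_density:
  fixes \<sigma> \<tau> :: "'a::euclidean_space measure"
  assumes B: "brenier_pair \<sigma> \<tau> U a W b T" and s: "sets \<sigma> = sets borel" "sets \<tau> = sets borel"
    and \<rho>[measurable]: "\<rho> \<in> borel_measurable borel" and \<rho>0: "\<And>x. 0 \<le> \<rho> x" and C: "\<And>x. \<rho> x \<le> C"
  shows "brenier_pair (density \<sigma> (\<lambda>x. ennreal (\<rho> (T x)))) (density \<tau> (\<lambda>x. ennreal (\<rho> x))) U a W b T"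
proof -
  have W: "AE y in \<tau>. y \<in> W" and le: "\<forall>x\<in>U. \<forall>y\<in>W. x \<bullet> y \<le> a x + b y"
    and i: "integrable \<sigma> a" "integrable \<tau> b" and T[measurable]: "T \<in> borel_measurable borel" and dT: "distr \<sigma> borel T = \<tau>"
    and AE\<sigma>: "AE x in \<sigma>. x \<in> U \<and> T x \<in> W \<and> a x + b (T x) = x \<bullet> T x \<and> supergradient_at U a x (T x)"
    using B unfolding brenier_pair_def by blast+
  note [measurable_cong] = s
  have C0: "0 \<le> C" using \<rho>0 C order_trans by blast
  have bd: "integrable N (\<lambda>x. r x *\<^sub>R h x)"
    if "integrable N h" "r \<in> borel_measurable N" "\<And>x. 0 \<le> r x" "\<And>x. r x \<le> C" for N :: "'a measure" and h r :: "'a \<Rightarrow> real"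
    by (rule Bochner_Integration.integrable_bound[of _ "\<lambda>x. C * h x"])
       (use that C0 in \<open>auto simp: abs_mult intro!: mult_right_mono\<close>)
  show ?thesis
    unfolding brenier_pair_def
  proof (intro conjI le T)
    show "AE y in density \<tau> (\<lambda>x. ennreal (\<rho> x)). y \<in> W" using W by (subst AE_density) auto
    show "AE x in density \<sigma> (\<lambda>x. ennreal (\<rho> (T x))).
       x \<in> U \<and> T x \<in> W \<and> a x + b (T x) = x \<bullet> T x \<and> supergradient_at U a x (T x)"
      using AE\<sigma> by (subst AE_density) auto
    show "integrable (density \<sigma> (\<lambda>x. ennreal (\<rho> (T x)))) a"
      using i(1) \<rho>0 C bd[OF i(1), of "\<lambda>x. \<rho> (T x)"] by (subst integrable_density) auto
    show "integrable (density \<tau> (\<lambda>x. ennreal (\<rho> x))) b"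
      using i(2) \<rho>0 C bd[OF i(2), of \<rho>] by (subst integrable_density) auto
    show "distr (density \<sigma> (\<lambda>x. ennreal (\<rho> (T x)))) borel T = density \<tau> (\<lambda>x. ennreal (\<rho> x))"
      unfolding dT[symmetric] by (rule density_distr[symmetric]) auto
  qed
qed

section \<open>Test functions\<close>

lemma test_function_partial_vanishes:
  fixes f :: "'a::euclidean_space \<Rightarrow> real"
  assumes "x \<notin> closure {x. f x \<noteq> 0}"
  shows "frechet_derivative f (at x) b = 0"
proof -
  let ?S = "- closure {x. f x \<noteq> 0}"
  have S: "open ?S" "x \<in> ?S" using assms by auto
  have "((\<lambda>_. 0) has_derivative (\<lambda>_. 0)) (at x)" by simp
  then have "(f has_derivative (\<lambda>_. 0)) (at x)"
    by (rule has_derivative_transform_within_open[OF _ S]) (use closure_subset[of "{x. f x \<noteq> 0}"] in force)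
  then have "frechet_derivative f (at x) = (\<lambda>_. 0)" by (rule frechet_derivative_at[symmetric])
  then show ?thesis by simp
qed

lemma continuous_zero_outside_compact_bounded:
  fixes f :: "'a::metric_space \<Rightarrow> real"
  assumes c: "continuous_on UNIV f" and K: "compact K" and z: "\<And>x. x \<notin> K \<Longrightarrow> f x = 0"
  shows "\<exists>B>0. \<forall>x. \<bar>f x\<bar> \<le> B"
proof -
  have "compact (f ` K)" using c K by (intro compact_continuous_image) (auto intro: continuous_on_subset)
  then obtain B where B: "\<And>x. x \<in> K \<Longrightarrow> \<bar>f x\<bar> \<le> B"
    using compact_imp_bounded by (force simp: bounded_iff)
  have "\<bar>f x\<bar> \<le> \<bar>B\<bar> + 1" for x using B[of x] z[of x] by (cases "x \<in> K") auto
  then show ?thesis by (intro exI[of _ "\<bar>B\<bar> + 1"]) auto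
qed

text \<open>First and second partial derivatives are continuous and vanish off a compact set, hence
  are bounded; the bounds on the second ones add up to the Lipschitz constant of the
  gradient.\<close>

lemma test_function_regular:
  fixes f :: "'a::euclidean_space \<Rightarrow> real"
  assumes f: "f \<in> test_functions"
  obtains B G L where "\<And>x. \<bar>f x\<bar> \<le> B" "\<And>x. norm (grad f x) \<le> G" "L \<ge> 0"
    "continuous_on UNIV f" "continuous_on UNIV (grad f)"
    "\<And>x y. norm (grad f x - grad f y) \<le> L * norm (x - y)"
    "\<And>x. (f has_derivative (\<lambda>h. h \<bullet> grad f x)) (at x)"
proof -
  define K where "K = closure {x. f x \<noteq> 0}"
  have K: "compact K" and Ck: "\<And>k. Ck k f" using f by (auto simp: test_functions_def K_def)
  have cf: "continuous_on UNIV f" using Ck[of 0] by simp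
  have df: "f differentiable (at x)" for x using Ck[of 1] by simp
  define p where "p b x = frechet_derivative f (at x) b" for b x
  have pC: "Ck k (p b)" if "b \<in> Basis" for b k using Ck[of "Suc k"] that by (simp add: p_def[abs_def])
  have pc: "continuous_on UNIV (p b)" if "b \<in> Basis" for b using pC[OF that, of 0] by simp
  have dp: "p b differentiable (at x)" if "b \<in> Basis" for b x using pC[OF that, of 1] by simp
  define q where "q b c x = frechet_derivative (p b) (at x) c" for b c x
  have qc: "continuous_on UNIV (q b c)" if "b \<in> Basis" "c \<in> Basis" for b c
    using pC[OF that(1), of 1] that(2) by (simp add: q_def[abs_def])
  have p0: "p b x = 0" if "x \<notin> K" for b x
    unfolding p_def using that by (intro test_function_partial_vanishes) (simp add: K_def)
  have q0: "q b c x = 0" if "x \<notin> K" for b c x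
    unfolding q_def
  proof (rule test_function_partial_vanishes)
    have "{x. p b x \<noteq> 0} \<subseteq> K" using p0 by auto
    then have "closure {x. p b x \<noteq> 0} \<subseteq> K" using K by (intro closure_minimal compact_imp_closed)
    then show "x \<notin> closure {x. p b x \<noteq> 0}" using that by auto
  qed
  have f0: "f x = 0" if "x \<notin> K" for x
    using that closure_subset[of "{x. f x \<noteq> 0}"] unfolding K_def by blast
  obtain B where B: "\<And>x. \<bar>f x\<bar> \<le> B"
    using continuous_zero_outside_compact_bounded[OF cf K f0] by blast
  have fd: "(f has_derivative frechet_derivative f (at x)) (at x)" for x
    using df frechet_derivative_works by blast
  have gr: "grad f x = (\<Sum>b\<in>Basis. p b x *\<^sub>R b)" and gd: "(f has_derivative (\<lambda>h. h \<bullet> grad f x)) (at x)" for x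
  proof -
    let ?D = "\<Sum>b\<in>Basis. p b x *\<^sub>R b"
    have lin: "linear (frechet_derivative f (at x))" using fd has_derivative_linear by blast
    have "frechet_derivative f (at x) h = h \<bullet> ?D" for h
    proof -
      have "frechet_derivative f (at x) h = frechet_derivative f (at x) (\<Sum>b\<in>Basis. (h \<bullet> b) *\<^sub>R b)"
        by (simp add: euclidean_representation)
      also have "\<dots> = (\<Sum>b\<in>Basis. (h \<bullet> b) * p b x)"
        using lin by (simp add: linear_sum linear_cmul p_def)
      also have "\<dots> = h \<bullet> ?D" by (simp add: inner_sum_right mult.commute)
      finally show ?thesis .
    qed
    then have "frechet_derivative f (at x) = (\<lambda>h. h \<bullet> ?D)" by (rule ext)
    then have "(f has_derivative (\<lambda>h. h \<bullet> ?D)) (at x)" using fd[of x] by simp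
    then have gD: "GDERIV f x :> ?D" by (simp add: gderiv_def inner_commute)
    then show "grad f x = ?D" by (rule grad_eq)
    with \<open>(f has_derivative (\<lambda>h. h \<bullet> ?D)) (at x)\<close> show "(f has_derivative (\<lambda>h. h \<bullet> grad f x)) (at x)" by simp
  qed
  have gc: "continuous_on UNIV (grad f)"
    unfolding gr[abs_def] using pc by (intro continuous_intros) auto
  have "\<exists>P. \<forall>b\<in>Basis. \<forall>x. \<bar>p b x\<bar> \<le> P b"
  proof -
    have "\<forall>b\<in>Basis. \<exists>P. \<forall>x. \<bar>p b x\<bar> \<le> P"
      using continuous_zero_outside_compact_bounded[OF pc K p0] by blast
    then show ?thesis by metis
  qed
  then obtain P where P: "\<And>b x. b \<in> Basis \<Longrightarrow> \<bar>p b x\<bar> \<le> P b" by blast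
  have G: "norm (grad f x) \<le> (\<Sum>b\<in>Basis. P b)" for x
    unfolding gr
    by (rule order_trans[OF norm_sum], rule sum_mono) (use P in auto)
  have "\<exists>Q. \<forall>b\<in>Basis. \<forall>c\<in>Basis. \<forall>x. \<bar>q b c x\<bar> \<le> Q b c"
  proof -
    have "\<forall>b\<in>Basis. \<forall>c\<in>Basis. \<exists>P. \<forall>x. \<bar>q b c x\<bar> \<le> P"
      using continuous_zero_outside_compact_bounded[OF qc K q0] by blast
    then show ?thesis by metis
  qed
  then obtain Q where Q: "\<And>b c x. b \<in> Basis \<Longrightarrow> c \<in> Basis \<Longrightarrow> \<bar>q b c x\<bar> \<le> Q b c" by blast
  have plip: "\<bar>p b x - p b y\<bar> \<le> (\<Sum>c\<in>Basis. Q b c) * norm (x - y)" if b: "b \<in> Basis" for b x y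
  proof -
    have "norm (p b x - p b y) \<le> (\<Sum>c\<in>Basis. Q b c) * norm (x - y)"
    proof (rule differentiable_bound[of UNIV "p b" "\<lambda>x. frechet_derivative (p b) (at x)"])
      fix x :: 'a
      show hd: "(p b has_derivative frechet_derivative (p b) (at x)) (at x within UNIV)"
        using dp[OF b] frechet_derivative_works by auto
      have lin: "linear (frechet_derivative (p b) (at x))" using hd has_derivative_linear by auto
      show "onorm (frechet_derivative (p b) (at x)) \<le> (\<Sum>c\<in>Basis. Q b c)"
      proof (rule onorm_le)
        fix h
        have "frechet_derivative (p b) (at x) h = frechet_derivative (p b) (at x) (\<Sum>c\<in>Basis. (h \<bullet> c) *\<^sub>R c)"
          by (simp add: euclidean_representation)
        also have "\<dots> = (\<Sum>c\<in>Basis. (h \<bullet> c) * q b c x)"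
          using lin by (simp add: linear_sum linear_cmul q_def)
        also have "norm \<dots> \<le> (\<Sum>c\<in>Basis. Q b c * norm h)"
        proof (rule order_trans[OF norm_sum], rule sum_mono)
          fix c :: 'a assume c: "c \<in> Basis"
          have "\<bar>h \<bullet> c\<bar> * \<bar>q b c x\<bar> \<le> norm h * Q b c"
            using Basis_le_norm[OF c, of h] Q[OF b c, of x] by (intro mult_mono) auto
          then show "norm ((h \<bullet> c) * q b c x) \<le> Q b c * norm h" by (simp add: abs_mult mult.commute)
        qed
        finally show "norm (frechet_derivative (p b) (at x) h) \<le> (\<Sum>c\<in>Basis. Q b c) * norm h"
          by (simp add: sum_distrib_right)
      qed
    qed auto
    then show ?thesis by simp
  qed
  define L where "L = (\<Sum>b\<in>(Basis::'a set). \<Sum>c\<in>(Basis::'a set). Q b c)"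
  have L: "norm (grad f x - grad f y) \<le> L * norm (x - y)" for x y
  proof -
    have "grad f x - grad f y = (\<Sum>b\<in>Basis. (p b x - p b y) *\<^sub>R b)"
      by (simp add: gr sum_subtractf scaleR_diff_left)
    also have "norm \<dots> \<le> (\<Sum>b\<in>Basis. (\<Sum>c\<in>Basis. Q b c) * norm (x - y))"
      by (rule order_trans[OF norm_sum], rule sum_mono) (use plip in auto)
    finally show ?thesis by (simp add: L_def sum_distrib_right)
  qed
  have Q0: "0 \<le> Q b c" if "b \<in> Basis" "c \<in> Basis" for b c
    using Q[OF that, of 0] abs_ge_zero[of "q b c 0"] by linarith
  have L0: "0 \<le> L" unfolding L_def using Q0 by (intro sum_nonneg) auto
  show ?thesis by (rule that[OF B G L0 cf gc L gd])
qed

text \<open>Later one displacement starts at a point of the coupling given by T and the other ends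
  at one. The two versions allow the gradient to be evaluated at that point in both cases, where its
  L2 norm is controlled.\<close>

lemma lipschitz_gradient_taylor:
  fixes f :: "'a::euclidean_space \<Rightarrow> real"
  assumes d: "\<And>x. (f has_derivative (\<lambda>h. h \<bullet> g x)) (at x)"
    and L: "\<And>x y. norm (g x - g y) \<le> L * norm (x - y)" and L0: "0 \<le> L"
  shows "f y - f x \<le> g x \<bullet> (y - x) + L * (norm (y - x))\<^sup>2"
    and "f y - f x \<le> g y \<bullet> (y - x) + L * (norm (y - x))\<^sup>2"
proof -
  let ?p = "\<lambda>t. x + t *\<^sub>R (y - x)"
  have d': "((\<lambda>t. f (?p t)) has_derivative (\<lambda>s. (s *\<^sub>R (y - x)) \<bullet> g (?p t))) (at t within {0..1})" for t
  proof -
    have "(?p has_derivative (\<lambda>s. s *\<^sub>R (y - x))) (at t within {0..1})"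
      by (auto intro!: derivative_eq_intros)
    from has_derivative_compose[OF this d] show ?thesis by simp
  qed
  obtain t where t: "0 < t" "t < 1" "f y - f x = (y - x) \<bullet> g (?p t)"
    using mvt_simple[OF zero_less_one d'] by auto
  have n: "norm (g (?p t) - g z) \<le> L * norm (y - x)" if "norm (?p t - z) \<le> norm (y - x)" for z
    using L[of "?p t" z] mult_left_mono[OF that L0] by linarith
  have e: "f y - f x \<le> g z \<bullet> (y - x) + L * (norm (y - x))\<^sup>2" if z: "norm (?p t - z) \<le> norm (y - x)" for z
  proof -
    have "f y - f x = g z \<bullet> (y - x) + (y - x) \<bullet> (g (?p t) - g z)"
      using t(3) by (simp add: inner_diff_right inner_commute)
    also have "(y - x) \<bullet> (g (?p t) - g z) \<le> norm (y - x) * norm (g (?p t) - g z)"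
      by (rule norm_cauchy_schwarz)
    also have "\<dots> \<le> norm (y - x) * (L * norm (y - x))"
      by (rule mult_left_mono[OF n[OF z]]) simp
    also have "\<dots> = L * (norm (y - x))\<^sup>2" by (simp add: power2_eq_square)
    finally show ?thesis by simp
  qed
  have "t * norm (y - x) \<le> norm (y - x)" "(1 - t) * norm (y - x) \<le> norm (y - x)"
    using t by (auto intro: mult_left_le_one_le)
  moreover have "?p t - y = (t - 1) *\<^sub>R (y - x)" by (simp add: algebra_simps)
  ultimately have "norm (?p t - x) \<le> norm (y - x)" "norm (?p t - y) \<le> norm (y - x)"
    using t by simp_all
  then show "f y - f x \<le> g x \<bullet> (y - x) + L * (norm (y - x))\<^sup>2" "f y - f x \<le> g y \<bullet> (y - x) + L * (norm (y - x))\<^sup>2"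
    using e by blast+
qed

section \<open>Variance along the geodesic\<close>

text \<open>The difference of the two sides has derivative x / (1 - \<delta>) - ln (1 + x), which
  has the sign of x. The coefficient tends to 1/2 with \<delta>, as the sharp constant
  requires.\<close>

lemma xlogx_le_quadratic:
  fixes u \<delta> :: real
  assumes u: "\<bar>u\<bar> \<le> \<delta>" and \<delta>: "\<delta> < 1"
  shows "(1 + u) * ln (1 + u) \<le> u + u\<^sup>2 / (2 * (1 - \<delta>))"
proof -
  define h where "h x = x + x\<^sup>2 / (2 * (1 - \<delta>)) - (1 + x) * ln (1 + x)" for x
  have d: "(h has_real_derivative x / (1 - \<delta>) - ln (1 + x)) (at x)" if "\<bar>x\<bar> \<le> \<delta>" for x
  proof -
    have x: "0 < 1 + x" using that \<delta> by linarith
    have "(h has_real_derivative 1 + 2 * x / (2 * (1 - \<delta>)) - (ln (1 + x) + (1 + x) * (1 / (1 + x)))) (at x)"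
      unfolding h_def[abs_def] using x \<delta> by (auto intro!: derivative_eq_intros)
    moreover have "(1 + x) * (1 / (1 + x)) = 1" using x by simp
    moreover have "2 * x / (2 * (1 - \<delta>)) = x / (1 - \<delta>)" by (rule mult_divide_mult_cancel_left) simp
    ultimately show ?thesis by (simp only:) (simp add: algebra_simps)
  qed
  have \<delta>0: "0 \<le> \<delta>" using u by linarith
  have "h 0 \<le> h u"
  proof (cases "0 \<le> u")
    case True
    show ?thesis
    proof (rule DERIV_nonneg_imp_nondecreasing[OF True])
      fix x assume x: "0 \<le> x" "x \<le> u"
      have "ln (1 + x) \<le> x" using x by (intro ln_add_one_self_le_self) auto
      also have "x \<le> x / (1 - \<delta>)" using x \<delta> \<delta>0 mult_left_mono[of "1 - \<delta>" 1 x] by (simp add: pos_le_divide_eq)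
      finally show "\<exists>y. (h has_real_derivative y) (at x) \<and> 0 \<le> y"
        using d[of x] x u by (intro exI[of _ "x / (1 - \<delta>) - ln (1 + x)"]) auto
    qed
  next
    case False
    then have "u \<le> 0" by simp
    then show ?thesis
    proof (rule DERIV_nonpos_imp_nonincreasing)
      fix x assume x: "u \<le> x" "x \<le> 0"
      then have x\<delta>: "1 - \<delta> \<le> 1 + x" using u by linarith
      have "- ln (1 + x) = ln (1 / (1 + x))" using x\<delta> \<delta> by (simp add: ln_div)
      also have "\<dots> \<le> 1 / (1 + x) - 1" using x\<delta> \<delta> by (intro ln_le_minus_one) auto
      also have "\<dots> = - x / (1 + x)" using x\<delta> \<delta> by (simp add: field_simps)
      also have "\<dots> \<le> - x / (1 - \<delta>)" using x x\<delta> \<delta> by (intro divide_left_mono) auto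
      finally show "\<exists>y. (h has_real_derivative y) (at x) \<and> y \<le> 0"
        using d[of x] x u by (intro exI[of _ "x / (1 - \<delta>) - ln (1 + x)"]) auto
    qed
  qed
  then show ?thesis by (simp add: h_def)
qed

text \<open>s is the weight of the moving end point in the interpolation, and E will be of order
  \<epsilon>^2. Therefore s is kept in the first-order term, while its square is replaced by 1 in
  the remainder.\<close>

lemma first_order_bound:
  fixes A D :: "'m \<Rightarrow> 'a::euclidean_space"
  assumes A: "A \<in> borel_measurable M" "integrable M (\<lambda>x. (norm (A x))\<^sup>2)" "(\<integral>x. (norm (A x))\<^sup>2 \<partial>M) \<le> K"
    and D: "D \<in> borel_measurable M" "integrable M (\<lambda>x. (norm (D x))\<^sup>2)" "(\<integral>x. (norm (D x))\<^sup>2 \<partial>M) \<le> E"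
    and h: "integrable M h" "\<And>x. h x \<le> A x \<bullet> (s *\<^sub>R D x) + L * (norm (s *\<^sub>R D x))\<^sup>2"
    and s: "0 \<le> s" "s \<le> 1" and L: "0 \<le> L"
  shows "(\<integral>x. h x \<partial>M) \<le> s * sqrt K * sqrt E + L * E"
proof -
  note CS = integral_inner_Cauchy_Schwarz[OF A(1) D(1) A(2) D(2)]
  have i: "integrable M (\<lambda>x. s * (A x \<bullet> D x))" "integrable M (\<lambda>x. L * s\<^sup>2 * (norm (D x))\<^sup>2)"
    using CS(1) D(2) by simp_all
  have "(\<integral>x. h x \<partial>M) \<le> (\<integral>x. s * (A x \<bullet> D x) + L * s\<^sup>2 * (norm (D x))\<^sup>2 \<partial>M)"
    by (rule integral_mono[OF h(1)]) (use i h(2) in \<open>auto simp: power_mult_distrib algebra_simps\<close>)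
  also have "\<dots> = s * (\<integral>x. A x \<bullet> D x \<partial>M) + L * s\<^sup>2 * (\<integral>x. (norm (D x))\<^sup>2 \<partial>M)"
    using i by simp
  also have "\<dots> \<le> s * (sqrt K * sqrt E) + L * E"
  proof (rule add_mono)
    have "(\<integral>x. A x \<bullet> D x \<partial>M) \<le> sqrt (\<integral>x. (norm (A x))\<^sup>2 \<partial>M) * sqrt (\<integral>x. (norm (D x))\<^sup>2 \<partial>M)"
      using CS(2) by simp
    also have "\<dots> \<le> sqrt K * sqrt E"
    proof (rule mult_mono)
      have "0 \<le> K" by (rule order_trans[OF _ A(3)]) simp
      then show "0 \<le> sqrt K" by simp
    qed (use A(3) D(3) in auto)
    finally show "s * (\<integral>x. A x \<bullet> D x \<partial>M) \<le> s * (sqrt K * sqrt E)" using s(1) by (rule mult_left_mono)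
    have "s\<^sup>2 \<le> 1" using s by (simp add: power_le_one)
    then have "L * s\<^sup>2 * (\<integral>x. (norm (D x))\<^sup>2 \<partial>M) \<le> L * 1 * (\<integral>x. (norm (D x))\<^sup>2 \<partial>M)"
      using L by (intro mult_right_mono mult_left_mono) auto
    also have "\<dots> \<le> L * E" using D(3) L by (simp add: mult_left_mono)
    finally show "L * s\<^sup>2 * (\<integral>x. (norm (D x))\<^sup>2 \<partial>M) \<le> L * E" .
  qed
  finally show ?thesis by (simp add: mult.assoc)
qed

section \<open>Perturbing the optimal coupling\<close>

locale brenier_geodesic =
  fixes \<mu>0 \<mu>1 :: "'a::euclidean_space measure" and U0 U1 :: "'a set" and d0 d1 :: "'a \<Rightarrow> ennreal" and \<kappa>0 \<kappa>1 :: real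
    and a0 b0 a1 b1 :: "'a \<Rightarrow> real" and W0 W1 :: "'a set" and T S :: "'a \<Rightarrow> 'a"
    and f :: "'a \<Rightarrow> real" and g :: "'a \<Rightarrow> 'a" and B G L t :: real
  assumes nice0: "nice_source \<mu>0 U0" and nice1: "nice_source \<mu>1 U1"
    and \<mu>0: "\<mu>0 = density lborel d0" and \<mu>1: "\<mu>1 = density lborel d1"
    and slc0: "slc_density \<kappa>0 d0" and slc1: "slc_density \<kappa>1 d1"
    and exp0: "\<And>L. integrable \<mu>0 (\<lambda>y. exp (L * norm y))" and exp1: "\<And>L. integrable \<mu>1 (\<lambda>y. exp (L * norm y))"
    and \<kappa>0: "\<kappa>0 > 0" and \<kappa>1: "\<kappa>1 > 0"
    and BT: "brenier_pair \<mu>0 \<mu>1 U0 a0 W0 b0 T" and BS: "brenier_pair \<mu>1 \<mu>0 U1 a1 W1 b1 S"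
    and f_bound: "\<And>x. \<bar>f x\<bar> \<le> B" and g_bound: "\<And>x. norm (g x) \<le> G" and L0: "L \<ge> 0"
    and f_cont: "continuous_on UNIV f" and g_cont: "continuous_on UNIV g"
    and g_lip: "\<And>x y. norm (g x - g y) \<le> L * norm (x - y)"
    and f_deriv: "\<And>x. (f has_derivative (\<lambda>h. h \<bullet> g x)) (at x)"
    and t: "0 \<le> t" "t \<le> 1"
begin

definition Z :: "'a \<Rightarrow> 'a \<Rightarrow> 'a" where "Z x y = (1 - t) *\<^sub>R x + t *\<^sub>R y"
definition m :: real where "m = (\<integral>x. f (Z x (T x)) \<partial>\<mu>0)"
text \<open>As S inverts T, this is the centred test function at the interpolated point, read as a
  function of its end point in the target. So \<open>1 + \<epsilon> * k y\<close> reweights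
  \<open>\<mu>1\<close>, and its composition with T reweights \<open>\<mu>0\<close>.\<close>

definition k :: "'a \<Rightarrow> real" where "k y = f (Z (S y) y) - m"
definition var :: real where "var = (\<integral>x. (f (Z x (T x)) - m)\<^sup>2 \<partial>\<mu>0)"
definition N :: real where "N = sqrt (\<integral>x. (norm (g (Z x (T x))))\<^sup>2 \<partial>\<mu>0)"

lemma prob: "prob_space \<mu>0" "prob_space \<mu>1"
  using nice0 nice1 by (auto simp: nice_source_def)

lemma mom: "integrable \<mu>0 (\<lambda>x. (norm x)\<^sup>2)" "integrable \<mu>1 (\<lambda>x. (norm x)\<^sup>2)"
  using nice0 nice1 by (auto simp: nice_source_def)

lemma sets: "sets \<mu>0 = sets borel" "sets \<mu>1 = sets borel" by (simp_all add: \<mu>0 \<mu>1)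

lemmas [measurable_cong] = sets

lemma meas[measurable]: "T \<in> borel_measurable borel" "S \<in> borel_measurable borel"
    "f \<in> borel_measurable borel" "g \<in> borel_measurable borel"
  using BT BS by (auto simp: brenier_pair_def intro!: borel_measurable_continuous_onI f_cont g_cont)

lemma Z_comp_meas[measurable (raw)]:
  "h \<in> borel_measurable M \<Longrightarrow> h' \<in> borel_measurable M \<Longrightarrow> (\<lambda>x. Z (h x) (h' x)) \<in> borel_measurable M"
  unfolding Z_def by (intro borel_measurable_add borel_measurable_scaleR borel_measurable_const)

lemma k_meas[measurable]: "k \<in> borel_measurable borel" unfolding k_def[abs_def] by measurable

lemma distrT: "distr \<mu>0 borel T = \<mu>1" using BT by (simp add: brenier_pair_def)

lemma integral_T: "h \<in> borel_measurable borel \<Longrightarrow> (\<integral>y. h y \<partial>\<mu>1) = (\<integral>x. h (T x) \<partial>\<mu>0)" for h :: "'a \<Rightarrow> real"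
  unfolding distrT[symmetric] by (rule integral_distr) auto

lemma integrable_bounded:
  fixes h :: "'a \<Rightarrow> 'b::{banach, second_countable_topology}"
  assumes "prob_space M" "h \<in> borel_measurable M" "\<And>x. norm (h x) \<le> c"
  shows "integrable M h"
proof -
  interpret prob_space M by fact
  show ?thesis using assms by (intro integrable_const_bound[of _ c]) auto
qed

lemma f_int: "integrable \<mu>0 (\<lambda>x. f (Z x (T x)))"
  by (rule integrable_bounded[of _ _ B]) (use prob f_bound in auto)

lemma m_bound: "\<bar>m\<bar> \<le> B"
proof -
  interpret prob_space \<mu>0 by (rule prob)
  have "\<bar>m\<bar> \<le> (\<integral>x. \<bar>f (Z x (T x))\<bar> \<partial>\<mu>0)" unfolding m_def by (rule integral_abs_bound)
  also have "\<dots> \<le> (\<integral>x. B \<partial>\<mu>0)" by (rule integral_mono) (use f_int f_bound in auto)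
  finally show ?thesis by (simp add: prob_space)
qed

lemma B0: "0 \<le> B" using m_bound by linarith

lemma k_bound: "\<bar>k y\<bar> \<le> 2 * B" using f_bound[of "Z (S y) y"] m_bound by (simp add: k_def)

lemma ST: "AE x in \<mu>0. S (T x) = x"
  by (rule brenier_pair_inverse[OF BS BT]) (use prob sets mom in auto)

lemma kT: "AE x in \<mu>0. k (T x) = f (Z x (T x)) - m"
  using ST by eventually_elim (simp add: k_def)

lemma k_mean: "(\<integral>y. k y \<partial>\<mu>1) = 0"
proof -
  interpret prob_space \<mu>0 by (rule prob)
  have "(\<integral>y. k y \<partial>\<mu>1) = (\<integral>x. f (Z x (T x)) - m \<partial>\<mu>0)"
    unfolding integral_T[OF k_meas] by (rule integral_cong_AE) (use kT in auto)
  then show ?thesis using f_int by (simp add: m_def prob_space)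
qed

lemma k_var: "(\<integral>y. (k y)\<^sup>2 \<partial>\<mu>1) = var"
proof -
  have "(\<integral>y. (k y)\<^sup>2 \<partial>\<mu>1) = (\<integral>x. (k (T x))\<^sup>2 \<partial>\<mu>0)" by (rule integral_T) simp
  also have "\<dots> = var" unfolding var_def by (rule integral_cong_AE) (use kT in auto)
  finally show ?thesis .
qed

lemma k_int: "integrable \<mu>1 k" "integrable \<mu>1 (\<lambda>y. (k y)\<^sup>2)"
proof -
  show "integrable \<mu>1 k" by (rule integrable_bounded[of _ _ "2 * B"]) (use prob k_bound in auto)
  have "(k y)\<^sup>2 \<le> (2 * B)\<^sup>2" for y using power_mono[OF k_bound[of y], of 2] by simp
  then show "integrable \<mu>1 (\<lambda>y. (k y)\<^sup>2)" by (intro integrable_bounded[of _ _ "(2 * B)\<^sup>2"]) (use prob in auto)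
qed

lemma var_nonneg: "0 \<le> var" unfolding var_def by simp

lemma N_nonneg: "0 \<le> N" and N_square: "N\<^sup>2 = (\<integral>x. (norm (g (Z x (T x))))\<^sup>2 \<partial>\<mu>0)"
  unfolding N_def by simp_all

text \<open>k has mean zero, so the linear term of the expansion integrates to 0 and the quadratic
  one leaves the variance.\<close>

lemma entropy_bound:
  assumes \<epsilon>: "0 < \<epsilon>" "\<epsilon> * (2 * B) < 1"
  shows "(\<integral>y. (1 + \<epsilon> * k y) * ln (1 + \<epsilon> * k y) \<partial>\<mu>1) \<le> \<epsilon>\<^sup>2 * var / (2 * (1 - \<epsilon> * (2 * B)))"
proof -
  define c where "c = 1 - \<epsilon> * (2 * B)"
  have le: "(1 + \<epsilon> * k y) * ln (1 + \<epsilon> * k y) \<le> \<epsilon> * k y + \<epsilon>\<^sup>2 * (k y)\<^sup>2 / (2 * c)" for y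
  proof -
    have "\<bar>\<epsilon> * k y\<bar> \<le> \<epsilon> * (2 * B)" using k_bound[of y] \<epsilon> by (simp add: abs_mult)
    from xlogx_le_quadratic[OF this \<epsilon>(2)] show ?thesis by (simp add: c_def power_mult_distrib)
  qed
  have i: "integrable \<mu>1 (\<lambda>y. \<epsilon> * k y + \<epsilon>\<^sup>2 * (k y)\<^sup>2 / (2 * c))" using k_int by simp
  have "(\<integral>y. (1 + \<epsilon> * k y) * ln (1 + \<epsilon> * k y) \<partial>\<mu>1) \<le> (\<integral>y. \<epsilon> * k y + \<epsilon>\<^sup>2 * (k y)\<^sup>2 / (2 * c) \<partial>\<mu>1)"
  proof (cases "integrable \<mu>1 (\<lambda>y. (1 + \<epsilon> * k y) * ln (1 + \<epsilon> * k y))")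
    case True
    then show ?thesis by (intro integral_mono i le)
  next
    \<comment> \<open>A non-integrable integrand has integral 0 by convention, which the nonnegative
      right-hand side covers.\<close>
    case False
    have "0 < c" using \<epsilon> by (simp add: c_def)
    then have "0 \<le> \<epsilon>\<^sup>2 * var / (2 * c)" using var_nonneg by simp
    then show ?thesis using k_int k_mean k_var by (simp add: not_integrable_integral_eq[OF False])
  qed
  also have "\<dots> = \<epsilon>\<^sup>2 * var / (2 * c)" using k_int k_mean k_var by simp
  finally show ?thesis by (simp add: c_def)
qed

text \<open>From the coupling of \<open>\<mu>0\<close>, \<open>\<mu>1\<close> to the reweighted one
  of \<open>\<nu>0\<close>, \<open>\<nu>1\<close>, the mean of f changes by \<epsilon> var. The
  optimal coupling of \<open>\<mu>0\<close> and \<open>\<nu>1\<close> is inserted in between: seen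
  from \<open>\<mu>0\<close> through \<open>Te\<close> it shares its source with T, and seen from
  \<open>\<nu>1\<close> through \<open>S0\<close> it shares its source with
  \<open>S1\<close>.\<close>

lemma perturbation_bound:
  assumes \<epsilon>: "0 < \<epsilon>" "\<epsilon> * (2 * B) < 1" and q: "q = var / (1 - \<epsilon> * (2 * B))"
  shows "var \<le> (1 - t) * (sqrt (1 + \<epsilon> * (2 * B)) * N) * sqrt (q / \<kappa>0) + t * N * sqrt (q / \<kappa>1)
    + \<epsilon> * (L * q / \<kappa>0 + L * q / \<kappa>1)"
proof -
  define c C where "c = 1 - \<epsilon> * (2 * B)" and "C = 1 + \<epsilon> * (2 * B)"
  define \<rho> where "\<rho> y = 1 + \<epsilon> * k y" for y
  have c: "0 < c" using \<epsilon> by (simp add: c_def)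
  have \<rho>m[measurable]: "\<rho> \<in> borel_measurable borel" unfolding \<rho>_def[abs_def] by measurable
  have \<rho>b: "c \<le> \<rho> y" "\<rho> y \<le> C" for y
  proof -
    have "\<bar>\<epsilon> * k y\<bar> \<le> \<epsilon> * (2 * B)" using k_bound[of y] \<epsilon> by (simp add: abs_mult)
    then show "c \<le> \<rho> y" "\<rho> y \<le> C" by (auto simp: \<rho>_def c_def C_def)
  qed
  have \<rho>0: "0 \<le> \<rho> y" for y using c \<rho>b(1)[of y] by linarith
  have C0: "0 \<le> C" using order_trans[OF \<rho>0 \<rho>b(2)] by blast
  interpret p0: prob_space \<mu>0 by (rule prob)
  interpret p1: prob_space \<mu>1 by (rule prob)
  have one1: "(\<integral>y. \<rho> y \<partial>\<mu>1) = 1" using k_int k_mean by (simp add: \<rho>_def p1.prob_space)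
  have one0: "(\<integral>x. \<rho> (T x) \<partial>\<mu>0) = 1" using integral_T[OF \<rho>m] one1 by simp
  define \<nu>1 where "\<nu>1 = density \<mu>1 (\<lambda>y. ennreal (\<rho> y))"
  define \<nu>0 where "\<nu>0 = density \<mu>0 (\<lambda>x. ennreal (\<rho> (T x)))"
  have n1: "nice_source \<nu>1 U1" unfolding \<nu>1_def
    by (rule nice_source_density[OF nice1 \<rho>m c \<rho>b one1])
  have n0: "nice_source \<nu>0 U0" unfolding \<nu>0_def
    by (rule nice_source_density[OF nice0 _ c \<rho>b one0]) measurable
  have p\<nu>: "prob_space \<nu>0" "prob_space \<nu>1" and m\<nu>: "integrable \<nu>0 (\<lambda>x. (norm x)\<^sup>2)" "integrable \<nu>1 (\<lambda>x. (norm x)\<^sup>2)"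
    using n0 n1 by (simp_all add: nice_source_def)
  have s\<nu>: "sets \<nu>0 = sets borel" "sets \<nu>1 = sets borel" by (simp_all add: \<nu>0_def \<nu>1_def sets)
  note [measurable_cong] = s\<nu>
  obtain ae We be Te where Te: "brenier_pair \<mu>0 \<nu>1 U0 ae We be Te"
    using brenier_exists[OF nice0 p\<nu>(2) s\<nu>(2) m\<nu>(2)] by (elim exE)
  obtain as Ws bs S0 where S0: "brenier_pair \<nu>1 \<mu>0 U1 as Ws bs S0"
    using brenier_exists[OF n1 prob(1) sets(1) mom(1)] by (elim exE)
  obtain ar Wr br S1 where S1: "brenier_pair \<nu>1 \<nu>0 U1 ar Wr br S1"
    using brenier_exists[OF n1 p\<nu>(1) s\<nu>(1) m\<nu>(1)] by (elim exE)
  have T\<nu>: "brenier_pair \<nu>0 \<nu>1 U0 a0 W0 b0 T"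
    unfolding \<nu>0_def \<nu>1_def by (rule brenier_pair_density[OF BT sets \<rho>m \<rho>0 \<rho>b(2)])
  have me[measurable]: "Te \<in> borel_measurable borel" "S0 \<in> borel_measurable borel" "S1 \<in> borel_measurable borel"
    and dist: "distr \<mu>0 borel Te = \<nu>1" "distr \<nu>1 borel S0 = \<mu>0" "distr \<nu>1 borel S1 = \<nu>0"
    using Te S0 S1 by (simp_all add: brenier_pair_def)
  have inv0: "AE y in \<nu>1. Te (S0 y) = y"
    by (rule brenier_pair_inverse[OF Te S0 prob(1) p\<nu>(2) sets(1) s\<nu>(2) mom(1) m\<nu>(2)])
  have inv1: "AE y in \<nu>1. T (S1 y) = y"
    by (rule brenier_pair_inverse[OF T\<nu> S1 p\<nu> s\<nu> m\<nu>])
  have P1: "base_pair \<mu>0 \<mu>1 \<nu>1 U0 U1 d1 \<kappa>1 c C \<rho> a0 b0 ae be W0 We T Te"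
    by (rule base_pair.intro[OF prob(1) sets(1) mom(1) \<mu>1 slc1 \<kappa>1 exp1 \<rho>m c \<rho>b \<nu>1_def nice1 n1 BT Te])
  have P0: "base_pair \<nu>1 \<mu>0 \<nu>0 U1 U0 d0 \<kappa>0 c C (\<lambda>x. \<rho> (T x)) as bs ar br Ws Wr S0 S1"
    by (rule base_pair.intro[OF p\<nu>(2) s\<nu>(2) m\<nu>(2) \<mu>0 slc0 \<kappa>0 exp0 _ c \<rho>b \<nu>0_def nice0 n0 S0 S1]) measurable
  have q': "q = var / c" by (simp add: q c_def)
  have ent1: "(\<integral>y. \<rho> y * ln (\<rho> y) \<partial>\<mu>1) \<le> \<epsilon>\<^sup>2 * q / 2"
    using entropy_bound[OF \<epsilon>] unfolding \<rho>_def q' c_def by (simp add: field_simps)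
  \<comment> \<open>The weights on the two marginals correspond under T, so their entropies coincide
    and one estimate serves both displacements.\<close>
  have "(\<integral>y. \<rho> y * ln (\<rho> y) \<partial>\<mu>1) = (\<integral>x. \<rho> (T x) * ln (\<rho> (T x)) \<partial>\<mu>0)" by (rule integral_T) simp
  then have ent0: "(\<integral>x. \<rho> (T x) * ln (\<rho> (T x)) \<partial>\<mu>0) \<le> \<epsilon>\<^sup>2 * q / 2" using ent1 by simp
  have D0: "integrable \<mu>0 (\<lambda>x. (norm (Te x - T x))\<^sup>2)" "(\<integral>x. (norm (Te x - T x))\<^sup>2 \<partial>\<mu>0) \<le> \<epsilon>\<^sup>2 * (q / \<kappa>1)"
  proof -
    show "integrable \<mu>0 (\<lambda>x. (norm (Te x - T x))\<^sup>2)" by (rule base_pair.talagrand_base(1)[OF P1])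
    have "\<kappa>1 / 2 * (\<integral>x. (norm (Te x - T x))\<^sup>2 \<partial>\<mu>0) \<le> \<epsilon>\<^sup>2 * q / 2"
      using base_pair.talagrand_base(2)[OF P1] ent1 unfolding base_pair.H_def[OF P1] by (rule order_trans)
    then show "(\<integral>x. (norm (Te x - T x))\<^sup>2 \<partial>\<mu>0) \<le> \<epsilon>\<^sup>2 * (q / \<kappa>1)" using \<kappa>1 by (simp add: field_simps)
  qed
  have D1: "integrable \<nu>1 (\<lambda>y. (norm (S1 y - S0 y))\<^sup>2)" "(\<integral>y. (norm (S1 y - S0 y))\<^sup>2 \<partial>\<nu>1) \<le> \<epsilon>\<^sup>2 * (q / \<kappa>0)"
  proof -
    show "integrable \<nu>1 (\<lambda>y. (norm (S1 y - S0 y))\<^sup>2)" by (rule base_pair.talagrand_base(1)[OF P0])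
    have "\<kappa>0 / 2 * (\<integral>y. (norm (S1 y - S0 y))\<^sup>2 \<partial>\<nu>1) \<le> \<epsilon>\<^sup>2 * q / 2"
      using base_pair.talagrand_base(2)[OF P0] ent0 unfolding base_pair.H_def[OF P0] by (rule order_trans)
    then show "(\<integral>y. (norm (S1 y - S0 y))\<^sup>2 \<partial>\<nu>1) \<le> \<epsilon>\<^sup>2 * (q / \<kappa>0)" using \<kappa>0 by (simp add: field_simps)
  qed
  have dens0: "(\<integral>x. h x \<partial>\<nu>0) = (\<integral>x. \<rho> (T x) * h x \<partial>\<mu>0)" if "h \<in> borel_measurable borel" for h :: "'a \<Rightarrow> real"
    unfolding \<nu>0_def using that \<rho>0 by (subst integral_density) auto
  have g2: "(norm (g x))\<^sup>2 \<le> G\<^sup>2" for x using power_mono[OF g_bound[of x], of 2] by simp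
  have A0: "integrable \<mu>0 (\<lambda>x. (norm (g (Z x (T x))))\<^sup>2)"
    by (rule integrable_bounded[OF prob(1), of _ "G\<^sup>2"]) (use g2 in auto)
  have A1: "integrable \<nu>1 (\<lambda>y. (norm (g (Z (S1 y) y)))\<^sup>2)"
    by (rule integrable_bounded[OF p\<nu>(2), of _ "G\<^sup>2"]) (use g2 in auto)
  \<comment> \<open>T inverts \<open>S1\<close>, so the pair (S1 y, y) under \<open>\<nu>1\<close>
    has the law of (x, T x) under \<open>\<nu>0\<close>, which is the reweighted coupling.\<close>
  have push1: "(\<integral>y. h (Z (S1 y) y) \<partial>\<nu>1) = (\<integral>x. \<rho> (T x) * h (Z x (T x)) \<partial>\<mu>0)"
    if [measurable]: "h \<in> borel_measurable borel" for h :: "'a \<Rightarrow> real"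
  proof -
    have "(\<integral>y. h (Z (S1 y) y) \<partial>\<nu>1) = (\<integral>y. h (Z (S1 y) (T (S1 y))) \<partial>\<nu>1)"
      by (rule integral_cong_AE) (use inv1 in auto)
    also have "\<dots> = (\<integral>x. h (Z x (T x)) \<partial>\<nu>0)"
      unfolding dist(3)[symmetric] by (rule integral_distr[symmetric]) measurable
    also have "\<dots> = (\<integral>x. \<rho> (T x) * h (Z x (T x)) \<partial>\<mu>0)" by (rule dens0) measurable
    finally show ?thesis .
  qed
  have A1_le: "(\<integral>y. (norm (g (Z (S1 y) y)))\<^sup>2 \<partial>\<nu>1) \<le> C * N\<^sup>2"
  proof -
    have "(\<integral>y. (norm (g (Z (S1 y) y)))\<^sup>2 \<partial>\<nu>1) = (\<integral>x. \<rho> (T x) * (norm (g (Z x (T x))))\<^sup>2 \<partial>\<mu>0)"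
      by (rule push1) measurable
    also have "\<dots> \<le> (\<integral>x. C * (norm (g (Z x (T x))))\<^sup>2 \<partial>\<mu>0)"
    proof (rule integral_mono)
      have "\<rho> y * (norm (g x))\<^sup>2 \<le> C * G\<^sup>2" for x y
        by (rule mult_mono[OF \<rho>b(2) g2 C0]) simp
      then show "integrable \<mu>0 (\<lambda>x. \<rho> (T x) * (norm (g (Z x (T x))))\<^sup>2)"
        by (intro integrable_bounded[OF prob(1), of _ "C * G\<^sup>2"]) (use \<rho>0 in auto)
    qed (use A0 \<rho>b in \<open>auto intro: mult_right_mono\<close>)
    also have "\<dots> = C * N\<^sup>2" by (simp add: N_square)
    finally show ?thesis .
  qed
  have fi: "integrable \<mu>0 (\<lambda>x. f (Z x (Te x)))" "integrable \<nu>1 (\<lambda>y. f (Z (S1 y) y))" "integrable \<nu>1 (\<lambda>y. f (Z (S0 y) y))"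
    by (rule integrable_bounded[of _ _ B]; use prob p\<nu> f_bound in simp)+
  \<comment> \<open>With P = f - m the weighted integrand is (1 + \<epsilon> P) (m + P). The terms
    linear in P have mean zero, so the increment is exactly \<epsilon> var.\<close>
  have e1: "(\<integral>y. f (Z (S1 y) y) \<partial>\<nu>1) = m + \<epsilon> * var"
  proof -
    let ?P = "\<lambda>x. f (Z x (T x)) - m"
    have iP: "integrable \<mu>0 ?P" using f_int by simp
    have lin: "(\<integral>x. h x + c * h' x + e * h'' x \<partial>\<mu>0) = (\<integral>x. h x \<partial>\<mu>0) + c * (\<integral>x. h' x \<partial>\<mu>0) + e * (\<integral>x. h'' x \<partial>\<mu>0)"
      if "integrable \<mu>0 h" "integrable \<mu>0 h'" "integrable \<mu>0 h''" for h h' h'' :: "'a \<Rightarrow> real" and c e :: real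
      using that by simp
    have "(?P x)\<^sup>2 \<le> (2 * B)\<^sup>2" for x
    proof -
      have "\<bar>?P x\<bar> \<le> 2 * B" using f_bound[of "Z x (T x)"] m_bound by linarith
      then show ?thesis using power_mono[of "\<bar>?P x\<bar>" "2 * B" 2] by simp
    qed
    then have iP2: "integrable \<mu>0 (\<lambda>x. (?P x)\<^sup>2)" by (intro integrable_bounded[OF prob(1), of _ "(2 * B)\<^sup>2"]) auto
    have "(\<integral>y. f (Z (S1 y) y) \<partial>\<nu>1) = (\<integral>x. \<rho> (T x) * f (Z x (T x)) \<partial>\<mu>0)" by (rule push1) measurable
    also have "\<dots> = (\<integral>x. f (Z x (T x)) + (\<epsilon> * m) * ?P x + \<epsilon> * (?P x)\<^sup>2 \<partial>\<mu>0)"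
    proof (rule integral_cong_AE)
      show "AE x in \<mu>0. \<rho> (T x) * f (Z x (T x)) = f (Z x (T x)) + (\<epsilon> * m) * ?P x + \<epsilon> * (?P x)\<^sup>2"
        using kT
      proof eventually_elim
        case (elim x)
        have \<rho>P: "\<rho> (T x) = 1 + \<epsilon> * ?P x" by (simp only: \<rho>_def elim)
        show ?case unfolding \<rho>P by (simp add: power2_eq_square algebra_simps)
      qed
    qed measurable
    also have "\<dots> = (\<integral>x. f (Z x (T x)) \<partial>\<mu>0) + (\<epsilon> * m) * (\<integral>x. ?P x \<partial>\<mu>0) + \<epsilon> * (\<integral>x. (?P x)\<^sup>2 \<partial>\<mu>0)"
      by (rule lin[OF f_int iP iP2])
    also have "(\<integral>x. ?P x \<partial>\<mu>0) = 0" using f_int by (simp add: m_def p0.prob_space)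
    finally show ?thesis by (simp add: m_def[symmetric] var_def[symmetric])
  qed
  have e0: "(\<integral>y. f (Z (S0 y) y) \<partial>\<nu>1) = (\<integral>x. f (Z x (Te x)) \<partial>\<mu>0)"
  proof -
    have "(\<integral>y. f (Z (S0 y) y) \<partial>\<nu>1) = (\<integral>y. f (Z (S0 y) (Te (S0 y))) \<partial>\<nu>1)"
      by (rule integral_cong_AE) (use inv0 in auto)
    also have "\<dots> = (\<integral>x. f (Z x (Te x)) \<partial>\<mu>0)"
      unfolding dist(2)[symmetric] by (rule integral_distr[symmetric]) measurable
    finally show ?thesis .
  qed
  \<comment> \<open>Here the source point is fixed and the target end moves, which gives the factor
    t.\<close>
  have b0: "(\<integral>x. f (Z x (Te x)) - f (Z x (T x)) \<partial>\<mu>0) \<le> t * sqrt (N\<^sup>2) * sqrt (\<epsilon>\<^sup>2 * (q / \<kappa>1)) + L * (\<epsilon>\<^sup>2 * (q / \<kappa>1))"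
  proof (rule first_order_bound[OF _ A0 _ _ D0])
    show "f (Z x (Te x)) - f (Z x (T x)) \<le>
      g (Z x (T x)) \<bullet> (t *\<^sub>R (Te x - T x)) + L * (norm (t *\<^sub>R (Te x - T x)))\<^sup>2" for x
    proof -
      have "Z x (Te x) - Z x (T x) = t *\<^sub>R (Te x - T x)" by (simp add: Z_def algebra_simps)
      with lipschitz_gradient_taylor(1)[OF f_deriv g_lip L0, of "Z x (Te x)" "Z x (T x)"] show ?thesis by simp
    qed
  qed (use fi f_int t L0 N_square in auto)
  \<comment> \<open>Here the target point is fixed and the source end moves, which gives 1 - t. The
    gradient is taken on the reweighted coupling, at the cost of the factor C, which tends to 1 with
    \<epsilon>.\<close>
  have b1: "(\<integral>y. f (Z (S1 y) y) - f (Z (S0 y) y) \<partial>\<nu>1) \<le>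
    (1 - t) * sqrt (C * N\<^sup>2) * sqrt (\<epsilon>\<^sup>2 * (q / \<kappa>0)) + L * (\<epsilon>\<^sup>2 * (q / \<kappa>0))"
  proof (rule first_order_bound[OF _ A1 A1_le _ D1])
    show "f (Z (S1 y) y) - f (Z (S0 y) y) \<le>
      g (Z (S1 y) y) \<bullet> ((1 - t) *\<^sub>R (S1 y - S0 y)) + L * (norm ((1 - t) *\<^sub>R (S1 y - S0 y)))\<^sup>2" for y
    proof -
      have "Z (S1 y) y - Z (S0 y) y = (1 - t) *\<^sub>R (S1 y - S0 y)" by (simp add: Z_def algebra_simps)
      with lipschitz_gradient_taylor(2)[OF f_deriv g_lip L0, of "Z (S1 y) y" "Z (S0 y) y"] show ?thesis by simp
    qed
  qed (use fi t L0 in auto)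
  have "\<epsilon> * var = (\<integral>y. f (Z (S1 y) y) - f (Z (S0 y) y) \<partial>\<nu>1) + (\<integral>x. f (Z x (Te x)) - f (Z x (T x)) \<partial>\<mu>0)"
    using fi f_int e0 e1 by (simp add: m_def[symmetric])
  also have "\<dots> \<le> ((1 - t) * sqrt (C * N\<^sup>2) * sqrt (\<epsilon>\<^sup>2 * (q / \<kappa>0)) + L * (\<epsilon>\<^sup>2 * (q / \<kappa>0)))
      + (t * sqrt (N\<^sup>2) * sqrt (\<epsilon>\<^sup>2 * (q / \<kappa>1)) + L * (\<epsilon>\<^sup>2 * (q / \<kappa>1)))"
    by (rule add_mono[OF b1 b0])
  also have "\<dots> = \<epsilon> * ((1 - t) * (sqrt C * N) * sqrt (q / \<kappa>0) + t * N * sqrt (q / \<kappa>1) + \<epsilon> * (L * q / \<kappa>0 + L * q / \<kappa>1))"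
    using \<epsilon> N_nonneg unfolding real_sqrt_mult real_sqrt_abs
    by (simp add: algebra_simps power2_eq_square)
  finally show ?thesis using \<epsilon> by (simp add: C_def)
qed

text \<open>As \<epsilon> decreases to 0 the correction factors tend to 1 and the remainder
  vanishes. With v = sqrt var this leaves v^2 <= v M N, where v cancels unless it is 0.\<close>

theorem variance_bound: "var \<le> ((1 - t) / sqrt \<kappa>0 + t / sqrt \<kappa>1)\<^sup>2 * N\<^sup>2"
proof -
  let ?q = "\<lambda>\<epsilon>. var / (1 - \<epsilon> * (2 * B))"
  let ?R = "\<lambda>\<epsilon>. (1 - t) * (sqrt (1 + \<epsilon> * (2 * B)) * N) * sqrt (?q \<epsilon> / \<kappa>0) + t * N * sqrt (?q \<epsilon> / \<kappa>1)
    + \<epsilon> * (L * ?q \<epsilon> / \<kappa>0 + L * ?q \<epsilon> / \<kappa>1)"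
  have "(?R \<longlongrightarrow> ?R 0) (at_right 0)"
    by (intro tendsto_intros) (use \<kappa>0 \<kappa>1 in auto)
  moreover have "\<forall>\<^sub>F \<epsilon> in at_right 0. var \<le> ?R \<epsilon>"
  proof -
    have "((\<lambda>\<epsilon>. \<epsilon> * (2 * B)) \<longlongrightarrow> 0 * (2 * B)) (at_right 0)" by (intro tendsto_intros)
    then have "\<forall>\<^sub>F \<epsilon> in at_right 0. \<epsilon> * (2 * B) < 1" by (rule order_tendstoD(2)) simp
    then show ?thesis using eventually_at_right_less[of 0]
      by eventually_elim (rule perturbation_bound, simp_all)
  qed
  ultimately have "var \<le> ?R 0" by (rule tendsto_lowerbound) simp
  define v M where "v = sqrt var" and "M = (1 - t) / sqrt \<kappa>0 + t / sqrt \<kappa>1"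
  have v: "0 \<le> v" "var = v\<^sup>2" using var_nonneg by (simp_all add: v_def)
  have "v\<^sup>2 \<le> v * (M * N)"
    using \<open>var \<le> ?R 0\<close> v by (simp add: M_def real_sqrt_divide algebra_simps add_divide_distrib diff_divide_distrib)
  then have "v \<le> M * N \<or> v = 0" using v(1) by (auto simp: power2_eq_square)
  moreover have "0 \<le> M * N" using t \<kappa>0 \<kappa>1 N_nonneg by (simp add: M_def)
  ultimately have "v \<le> M * N" by auto
  then have "v\<^sup>2 \<le> (M * N)\<^sup>2" using v(1) by (rule power_mono)
  then show ?thesis by (simp add: v(2) M_def power_mult_distrib)
qed

end

text \<open>For fixed marginals the quadratic cost is a constant minus twice the correlation. The
  map T' gives a competing coupling, so T has at least its correlation, and the uniqueness part of
  \<open>brenier_pair_optimal\<close> applies.\<close>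

lemma optimal_transport_map_AE_unique:
  fixes \<sigma> \<tau> :: "'a::euclidean_space measure"
  assumes T: "optimal_transport_map \<sigma> \<tau> T" and B: "brenier_pair \<sigma> \<tau> U a W b T'"
    and p: "prob_space \<sigma>" and s[measurable_cong]: "sets \<sigma> = sets borel"
    and mom: "integrable \<sigma> (\<lambda>x. (norm x)\<^sup>2)" "integrable \<tau> (\<lambda>x. (norm x)\<^sup>2)"
  shows "AE x in \<sigma>. T x = T' x"
proof -
  interpret prob_space \<sigma> by (rule p)
  have [measurable]: "T \<in> borel_measurable borel" "T' \<in> borel_measurable borel"
    and dT: "distr \<sigma> borel T = \<tau>" "distr \<sigma> borel T' = \<tau>"
    and opt: "(\<integral>\<^sup>+x. ennreal ((norm (x - T x))\<^sup>2) \<partial>\<sigma>) = W2_squared \<sigma> \<tau>"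
    using T B by (simp_all add: optimal_transport_map_def brenier_pair_def)
  have cost: "integrable \<sigma> (\<lambda>x. (norm (x - Q x))\<^sup>2)" "(\<integral>x. (norm (x - Q x))\<^sup>2 \<partial>\<sigma>) =
      (\<integral>x. (norm x)\<^sup>2 \<partial>\<sigma>) + (\<integral>y. (norm y)\<^sup>2 \<partial>\<tau>) - 2 * (\<integral>x. x \<bullet> Q x \<partial>\<sigma>)"
    if Q[measurable]: "Q \<in> borel_measurable borel" and d: "distr \<sigma> borel Q = \<tau>" for Q
  proof -
    have i: "integrable \<sigma> (\<lambda>x. (norm (Q x))\<^sup>2)"
      using mom(2) unfolding d[symmetric] by (simp add: integrable_distr_eq)
    have i': "integrable \<sigma> (\<lambda>x. x \<bullet> Q x)"
      by (rule integral_inner_Cauchy_Schwarz(1)[OF _ _ mom(1) i]) measurable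
    have e: "(norm (x - Q x))\<^sup>2 = (norm x)\<^sup>2 + (norm (Q x))\<^sup>2 - 2 * (x \<bullet> Q x)" for x
      by (simp add: power2_norm_eq_inner inner_simps inner_commute)
    show "integrable \<sigma> (\<lambda>x. (norm (x - Q x))\<^sup>2)" unfolding e using mom(1) i i' by simp
    have "(\<integral>y. (norm y)\<^sup>2 \<partial>\<tau>) = (\<integral>x. (norm (Q x))\<^sup>2 \<partial>\<sigma>)"
      unfolding d[symmetric] by (rule integral_distr) measurable
    then show "(\<integral>x. (norm (x - Q x))\<^sup>2 \<partial>\<sigma>) =
        (\<integral>x. (norm x)\<^sup>2 \<partial>\<sigma>) + (\<integral>y. (norm y)\<^sup>2 \<partial>\<tau>) - 2 * (\<integral>x. x \<bullet> Q x \<partial>\<sigma>)"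
      unfolding e using mom(1) i i' by simp
  qed
  define \<pi> where "\<pi> = distr \<sigma> (borel \<Otimes>\<^sub>M borel) (\<lambda>x. (x, T' x))"
  have "\<pi> \<in> couplings \<sigma> \<tau>"
    unfolding couplings_def \<pi>_def using dT(2) s by (simp add: distr_distr comp_def distr_id2)
  then have "W2_squared \<sigma> \<tau> \<le> (\<integral>\<^sup>+(x, y). ennreal ((norm (x - y))\<^sup>2) \<partial>\<pi>)"
    unfolding W2_squared_def by (rule INF_lower)
  also have "\<dots> = (\<integral>\<^sup>+x. ennreal ((norm (x - T' x))\<^sup>2) \<partial>\<sigma>)"
    unfolding \<pi>_def by (subst nn_integral_distr) auto
  finally have "ennreal (\<integral>x. (norm (x - T x))\<^sup>2 \<partial>\<sigma>) \<le> ennreal (\<integral>x. (norm (x - T' x))\<^sup>2 \<partial>\<sigma>)"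
    using cost(1)[OF _ dT(1)] cost(1)[OF _ dT(2)]
    unfolding opt[symmetric] by (simp add: nn_integral_eq_integral)
  then have "(\<integral>x. (norm (x - T x))\<^sup>2 \<partial>\<sigma>) \<le> (\<integral>x. (norm (x - T' x))\<^sup>2 \<partial>\<sigma>)"
    by (simp add: ennreal_le_iff)
  then have le: "(\<integral>x. x \<bullet> T' x \<partial>\<sigma>) \<le> (\<integral>x. x \<bullet> T x \<partial>\<sigma>)"
    using cost(2)[OF _ dT(1)] cost(2)[OF _ dT(2)] by simp
  show ?thesis
    by (rule brenier_pair_optimal(2)[OF B p _ _ _ dT(1) mom le]) (use s in \<open>simp_all add: distr_id2\<close>)
qed

theorem theorem1p1:
  fixes \<mu>0 \<mu>1 :: "(real ^ 'n) measure" and \<mu> :: "real \<Rightarrow> (real ^ 'n) measure"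
    and \<kappa>0 \<kappa>1 t :: real
  assumes "\<kappa>0 > 0" and "\<kappa>1 > 0"
    and "strongly_log_concave \<kappa>0 \<mu>0" and "strongly_log_concave \<kappa>1 \<mu>1"
    and "wasserstein_geodesic \<mu>0 \<mu>1 \<mu>"
    and "t \<in> {0..1}"
  shows "(\<forall>f\<in>test_functions.
            prob_space.variance (\<mu> t) f
              \<le> ((1 - t) / sqrt \<kappa>0 + t / sqrt \<kappa>1)\<^sup>2 * (\<integral>x. (norm (grad f x))\<^sup>2 \<partial>(\<mu> t)))
       \<and> poincare_const (\<mu> t) < \<infinity>
       \<and> sqrt (enn2real (poincare_const (\<mu> t))) \<le> (1 - t) / sqrt \<kappa>0 + t / sqrt \<kappa>1"
proof -
  obtain U0 d0 where s0: "nice_source \<mu>0 U0" "\<mu>0 = density lborel d0" "slc_density \<kappa>0 d0"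
    "\<And>L. integrable \<mu>0 (\<lambda>y. exp (L * norm y))"
    using strongly_log_concave_nice[OF assms(3)] by blast
  obtain U1 d1 where s1: "nice_source \<mu>1 U1" "\<mu>1 = density lborel d1" "slc_density \<kappa>1 d1"
    "\<And>L. integrable \<mu>1 (\<lambda>y. exp (L * norm y))"
    using strongly_log_concave_nice[OF assms(4)] by blast
  have p: "prob_space \<mu>0" "prob_space \<mu>1" and mom: "integrable \<mu>0 (\<lambda>x. (norm x)\<^sup>2)" "integrable \<mu>1 (\<lambda>x. (norm x)\<^sup>2)"
    using s0(1) s1(1) by (simp_all add: nice_source_def)
  have s: "sets \<mu>0 = sets borel" "sets \<mu>1 = sets borel"
    using s0(1) s1(1) by (simp_all add: nice_source_sets)
  note [measurable_cong] = s
  obtain a0 W0 b0 T where BT: "brenier_pair \<mu>0 \<mu>1 U0 a0 W0 b0 T"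
    using brenier_exists[OF s0(1) p(2) s(2) mom(2)] by (elim exE)
  obtain a1 W1 b1 S where BS: "brenier_pair \<mu>1 \<mu>0 U1 a1 W1 b1 S"
    using brenier_exists[OF s1(1) p(1) s(1) mom(1)] by (elim exE)
  obtain T' where T': "optimal_transport_map \<mu>0 \<mu>1 T'"
    and \<mu>t: "\<mu> t = distr \<mu>0 borel (\<lambda>x. (1 - t) *\<^sub>R x + t *\<^sub>R T' x)"
    using assms(5,6) unfolding wasserstein_geodesic_def by blast
  have [measurable]: "T \<in> borel_measurable borel" "T' \<in> borel_measurable borel"
    using BT T' by (simp_all add: brenier_pair_def optimal_transport_map_def)
  let ?Z = "\<lambda>x. (1 - t) *\<^sub>R x + t *\<^sub>R T x"
  have Zm[measurable]: "?Z \<in> borel_measurable \<mu>0" by measurable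
  have AE: "AE x in \<mu>0. T' x = T x"
    by (rule optimal_transport_map_AE_unique[OF T' BT p(1) s(1) mom])
  \<comment> \<open>The push-forward sees its map only up to null sets, so the given optimal map may
    be exchanged for the one that comes with dual potentials.\<close>
  have \<mu>t: "\<mu> t = distr \<mu>0 borel ?Z"
    unfolding \<mu>t
  proof (rule distr_cong_AE)
    show "AE x in \<mu>0. (1 - t) *\<^sub>R x + t *\<^sub>R T' x = ?Z x" using AE by eventually_elim simp
  qed (simp_all)
  define M where "M = (1 - t) / sqrt \<kappa>0 + t / sqrt \<kappa>1"
  have M0: "0 \<le> M" using assms(1,2,6) by (simp add: M_def)
  have main: "prob_space.variance (\<mu> t) f \<le> M\<^sup>2 * (\<integral>x. (norm (grad f x))\<^sup>2 \<partial>(\<mu> t))"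
    if f: "f \<in> test_functions" for f
  proof -
    obtain B G L where reg: "\<And>x. \<bar>f x\<bar> \<le> B" "\<And>x. norm (grad f x) \<le> G" "L \<ge> 0"
      "continuous_on UNIV f" "continuous_on UNIV (grad f)"
      "\<And>x y. norm (grad f x - grad f y) \<le> L * norm (x - y)"
      "\<And>x. (f has_derivative (\<lambda>h. h \<bullet> grad f x)) (at x)"
      by (rule test_function_regular[OF f]) blast
    have t: "0 \<le> t" "t \<le> 1" using assms(6) by simp_all
    interpret brenier_geodesic \<mu>0 \<mu>1 U0 U1 d0 d1 \<kappa>0 \<kappa>1 a0 b0 a1 b1 W0 W1 T S f "grad f" B G L t
      by (rule brenier_geodesic.intro[OF s0(1) s1(1) s0(2) s1(2) s0(3) s1(3) s0(4) s1(4) assms(1,2) BT BS reg t])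
    have int: "(\<integral>x. h x \<partial>(\<mu> t)) = (\<integral>x. h (Z x (T x)) \<partial>\<mu>0)" if "h \<in> borel_measurable borel" for h :: "real ^ 'n \<Rightarrow> real"
      unfolding \<mu>t Z_def using Zm that by (rule integral_distr)
    have "(\<integral>x. f x \<partial>(\<mu> t)) = m" unfolding m_def by (rule int) measurable
    then have "prob_space.variance (\<mu> t) f = (\<integral>x. (f x - m)\<^sup>2 \<partial>(\<mu> t))" by simp
    also have "\<dots> = var" unfolding var_def by (rule int) measurable
    finally have v: "prob_space.variance (\<mu> t) f = var" .
    have "N\<^sup>2 = (\<integral>x. (norm (grad f x))\<^sup>2 \<partial>(\<mu> t))" unfolding N_square by (rule int[symmetric]) measurable
    then show ?thesis using variance_bound v by (simp add: M_def)
  qed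
  have le: "poincare_const (\<mu> t) \<le> ennreal (M\<^sup>2)"
    unfolding poincare_const_def
  proof (rule Inf_lower, rule CollectI, intro ballI)
    fix f :: "real ^ 'n \<Rightarrow> real" assume f: "f \<in> test_functions"
    show "ennreal (prob_space.variance (\<mu> t) f) \<le> ennreal (M\<^sup>2) * ennreal (\<integral>x. (norm (grad f x))\<^sup>2 \<partial>(\<mu> t))"
      using ennreal_leI[OF main[OF f]] by (simp add: ennreal_mult)
  qed
  then have "enn2real (poincare_const (\<mu> t)) \<le> M\<^sup>2" by (rule enn2real_leI[rotated]) simp
  then have "sqrt (enn2real (poincare_const (\<mu> t))) \<le> M" using M0 by (rule real_le_lsqrt[rotated])
  \<comment> \<open>\<open>enn2real\<close> sends infinity to 0, so the bound on the square root has
    content only together with finiteness.\<close>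
  moreover have "poincare_const (\<mu> t) < \<infinity>" using le by (simp add: le_less_trans[OF _ ennreal_less_top])
  ultimately show ?thesis using main by (simp add: M_def)
qed

end
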